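(* Let $M$ be a surface of genus $\geq 2$ equipped with a hyperbolic metric $\sigma$ of total area $A$. Then for every $\varepsilon>0$ there exists a Riemannian metric $g$ on $M$ of total area $A$ that is conformally equivalent to $\sigma$ and such that $\mathrm{sys}(g)\leq\varepsilon$ and $\mathrm{diam}(M,g)\leq 2\,\mathrm{diam}(M,\sigma)$.
   Context: $M$ is a smooth closed surface and metrics are smooth. A hyperbolic metric is a Riemannian metric of constant Gaussian curvature $-1$. $g$ is conformally equivalent to $\sigma$ if $g=e^{2u}\sigma$ for a smooth function $u\colon M\to\mathbb{R}$. $\mathrm{sys}(g)$ is the systole: the length of a shortest (noncontractible) closed geodesic of $g$. $\mathrm{diam}(M,g)$ is the diameter of $M$ for the distance induced by $g$. *)

theory Defs
  imports "HOL-Analysis.Analysis" "HOL-Homology.Homology"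
begin

section \<open>Smooth maps between Euclidean spaces\<close>

text \<open>\<open>C\<^sup>k\<close> and \<open>C\<^sup>\<infinity>\<close> regularity; only meant for open domains \<open>S\<close>.\<close>

primrec Ck_on :: "nat \<Rightarrow> ('a::euclidean_space \<Rightarrow> 'b::real_normed_vector) \<Rightarrow> 'a set \<Rightarrow> bool" where
  "Ck_on 0 f S \<longleftrightarrow> continuous_on S f"
| "Ck_on (Suc k) f S \<longleftrightarrow> f differentiable_on S \<and>
     (\<forall>b\<in>Basis. Ck_on k (\<lambda>x. frechet_derivative f (at x) b) S)"

definition smooth_on :: "('a::euclidean_space \<Rightarrow> 'b::real_normed_vector) \<Rightarrow> 'a set \<Rightarrow> bool" where
  "smooth_on f S \<longleftrightarrow> (\<forall>k. Ck_on k f S)"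

section \<open>Smooth closed surfaces\<close>

text \<open>A chart is a pair of a domain and a coordinate map; the values of the coordinate map
  outside the domain are irrelevant. A smooth structure on \<open>M\<close> is given by an atlas
  (not required to be maximal).\<close>

type_synonym 'a chart = "'a set \<times> ('a \<Rightarrow> real^2)"

abbreviation cdom :: "'a chart \<Rightarrow> 'a set" where
  "cdom c \<equiv> fst c"

abbreviation coord :: "'a chart \<Rightarrow> 'a \<Rightarrow> real^2" where
  "coord c \<equiv> snd c"

definition point :: "'a chart \<Rightarrow> real^2 \<Rightarrow> 'a" where
  "point c = inv_into (cdom c) (coord c)"

definition transition :: "'a chart \<Rightarrow> 'a chart \<Rightarrow> real^2 \<Rightarrow> real^2" where
  "transition c d = coord d \<circ> point c"

definition is_chart :: "'a::topological_space set \<Rightarrow> 'a chart \<Rightarrow> bool" where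
  "is_chart M c \<longleftrightarrow>
     openin (top_of_set M) (cdom c) \<and> open (coord c ` cdom c) \<and>
     homeomorphism (cdom c) (coord c ` cdom c) (coord c) (point c)"

definition smooth_atlas :: "'a::topological_space set \<Rightarrow> 'a chart set \<Rightarrow> bool" where
  "smooth_atlas M \<A> \<longleftrightarrow>
     (\<forall>c\<in>\<A>. is_chart M c) \<and> (\<Union>c\<in>\<A>. cdom c) = M \<and>
     (\<forall>c\<in>\<A>. \<forall>d\<in>\<A>. smooth_on (transition c d) (coord c ` (cdom c \<inter> cdom d)))"

text \<open>The Hausdorff property comes from the sort of \<open>'a\<close>; second countability follows from
  compactness.\<close>

definition smooth_closed_surface :: "'a::t2_space set \<Rightarrow> 'a chart set \<Rightarrow> bool" where
  "smooth_closed_surface M \<A> \<longleftrightarrow>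
     M \<noteq> {} \<and> compact M \<and> connected M \<and> smooth_atlas M \<A>"

definition oriented_atlas :: "'a chart set \<Rightarrow> bool" where
  "oriented_atlas \<B> \<longleftrightarrow>
     (\<forall>c\<in>\<B>. \<forall>d\<in>\<B>. \<forall>p\<in>cdom c \<inter> cdom d.
        det (jacobian (transition c d) (at (coord c p))) > 0)"

definition orientable :: "'a::topological_space set \<Rightarrow> 'a chart set \<Rightarrow> bool" where
  "orientable M \<A> \<longleftrightarrow>
     (\<exists>\<B>. smooth_atlas M \<B> \<and> smooth_atlas M (\<A> \<union> \<B>) \<and> oriented_atlas \<B>)"

text \<open>The genus of a closed connected orientable surface is half the rank of its first
  integral homology group.\<close>

definition has_genus :: "'a::topological_space set \<Rightarrow> 'a chart set \<Rightarrow> nat \<Rightarrow> bool" where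
  "has_genus M \<A> n \<longleftrightarrow>
     orientable M \<A> \<and> homology_group 1 (top_of_set M) \<cong> free_Abelian_group {..<2 * n}"

definition smooth_function :: "'a chart set \<Rightarrow> ('a \<Rightarrow> real) \<Rightarrow> bool" where
  "smooth_function \<A> u \<longleftrightarrow> (\<forall>c\<in>\<A>. smooth_on (u \<circ> point c) (coord c ` cdom c))"

section \<open>Riemannian metrics\<close>

text \<open>A metric is represented by its Gram matrices: \<open>g c p\<close> is the matrix of the inner product
  on the tangent space at \<open>p\<close> in the coordinate basis of the chart \<open>c\<close>
  (relevant only for \<open>p\<close> in the domain of \<open>c\<close>). The last condition is the transformation law
  of a covariant 2-tensor.\<close>

type_synonym 'a metric_field = "'a chart \<Rightarrow> 'a \<Rightarrow> real^2^2"

definition riemannian_metric :: "'a chart set \<Rightarrow> 'a metric_field \<Rightarrow> bool" where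
  "riemannian_metric \<A> g \<longleftrightarrow>
     (\<forall>c\<in>\<A>. smooth_on (g c \<circ> point c) (coord c ` cdom c)) \<and>
     (\<forall>c\<in>\<A>. \<forall>p\<in>cdom c. transpose (g c p) = g c p \<and> (\<forall>v. v \<noteq> 0 \<longrightarrow> v \<bullet> (g c p *v v) > 0)) \<and>
     (\<forall>c\<in>\<A>. \<forall>d\<in>\<A>. \<forall>p\<in>cdom c \<inter> cdom d.
        let J = jacobian (transition c d) (at (coord c p))
        in g c p = transpose J ** g d p ** J)"

definition conformally_equivalent ::
    "'a chart set \<Rightarrow> 'a metric_field \<Rightarrow> 'a metric_field \<Rightarrow> bool" where
  "conformally_equivalent \<A> g \<sigma> \<longleftrightarrow>
     (\<exists>u. smooth_function \<A> u \<and> (\<forall>c\<in>\<A>. \<forall>p\<in>cdom c. g c p = exp (2 * u p) *\<^sub>R \<sigma> c p))"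

subsection \<open>Curvature\<close>

definition partial :: "2 \<Rightarrow> (real^2 \<Rightarrow> real) \<Rightarrow> real^2 \<Rightarrow> real" where
  "partial i f x = frechet_derivative f (at x) (axis i 1)"

text \<open>\<open>christoffel G k i j\<close> is \<open>\<Gamma>\<^sup>k\<^sub>i\<^sub>j\<close> for the coordinate expression \<open>G\<close> of a metric.\<close>

definition christoffel :: "(real^2 \<Rightarrow> real^2^2) \<Rightarrow> 2 \<Rightarrow> 2 \<Rightarrow> 2 \<Rightarrow> real^2 \<Rightarrow> real" where
  "christoffel G k i j x =
     (1/2) * (\<Sum>l\<in>UNIV. matrix_inv (G x) $ k $ l *
        (partial i (\<lambda>y. G y $ j $ l) x + partial j (\<lambda>y. G y $ i $ l) x
          - partial l (\<lambda>y. G y $ i $ j) x))"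

text \<open>\<open>curvature_coeff G l k i j\<close> is the \<open>\<partial>\<^sub>l\<close>-component of
  \<open>R(\<partial>\<^sub>i, \<partial>\<^sub>j) \<partial>\<^sub>k\<close> with \<open>R(X, Y) = [\<nabla>\<^sub>X, \<nabla>\<^sub>Y] - \<nabla>\<^bsub>[X, Y]\<^esub>\<close>.\<close>

definition curvature_coeff ::
    "(real^2 \<Rightarrow> real^2^2) \<Rightarrow> 2 \<Rightarrow> 2 \<Rightarrow> 2 \<Rightarrow> 2 \<Rightarrow> real^2 \<Rightarrow> real" where
  "curvature_coeff G l k i j x =
     partial i (christoffel G l j k) x - partial j (christoffel G l i k) x
     + (\<Sum>m\<in>UNIV. christoffel G m j k x * christoffel G l i m x
                 - christoffel G m i k x * christoffel G l j m x)"

text \<open>\<open>K = \<langle>R(\<partial>\<^sub>1, \<partial>\<^sub>2) \<partial>\<^sub>2, \<partial>\<^sub>1\<rangle> / det G\<close>.\<close>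

definition gauss_curvature :: "'a metric_field \<Rightarrow> 'a chart \<Rightarrow> 'a \<Rightarrow> real" where
  "gauss_curvature g c p =
     (let G = g c \<circ> point c; x = coord c p
      in (\<Sum>l\<in>UNIV. G x $ 1 $ l * curvature_coeff G l 2 1 2 x) / det (G x))"

definition hyperbolic_metric :: "'a chart set \<Rightarrow> 'a metric_field \<Rightarrow> bool" where
  "hyperbolic_metric \<A> \<sigma> \<longleftrightarrow>
     riemannian_metric \<A> \<sigma> \<and> (\<forall>c\<in>\<A>. \<forall>p\<in>cdom c. gauss_curvature \<sigma> c p = -1)"

subsection \<open>Area\<close>

text \<open>The Riemannian area measure is the unique Borel measure on \<open>M\<close> that is
  \<open>sqrt (det G) dx\<close> in every chart.\<close>

definition area_measure ::
    "'a::topological_space set \<Rightarrow> 'a chart set \<Rightarrow> 'a metric_field \<Rightarrow> 'a measure" where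
  "area_measure M \<A> g =
     (THE \<mu>. sets \<mu> = sets (restrict_space borel M) \<and>
        (\<forall>c\<in>\<A>. \<forall>B\<in>sets \<mu>. B \<subseteq> cdom c \<longrightarrow>
           emeasure \<mu> B =
             (\<integral>\<^sup>+x\<in>coord c ` B. ennreal (sqrt (det (g c (point c x)))) \<partial>lborel)))"

definition total_area ::
    "'a::topological_space set \<Rightarrow> 'a chart set \<Rightarrow> 'a metric_field \<Rightarrow> real" where
  "total_area M \<A> g = measure (area_measure M \<A> g) M"

subsection \<open>Length, distance and diameter\<close>

definition C1_curve_on :: "'a chart set \<Rightarrow> (real \<Rightarrow> 'a) \<Rightarrow> real \<Rightarrow> real \<Rightarrow> bool" where
  "C1_curve_on \<A> \<gamma> a b \<longleftrightarrow>
     (\<forall>c\<in>\<A>. \<exists>D. continuous_on {t\<in>{a..b}. \<gamma> t \<in> cdom c} D \<and>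
        (\<forall>t\<in>{a..b}. \<gamma> t \<in> cdom c \<longrightarrow>
           ((coord c \<circ> \<gamma>) has_vector_derivative D t) (at t within {a..b})))"

text \<open>\<open>T\<close> is the set of break points: the curve is \<open>C\<^sup>1\<close>, up to the end points, on each closed
  interval with no break point in its interior.\<close>

definition piecewise_C1_curve ::
    "'a::topological_space set \<Rightarrow> 'a chart set \<Rightarrow> (real \<Rightarrow> 'a) \<Rightarrow> bool" where
  "piecewise_C1_curve M \<A> \<gamma> \<longleftrightarrow>
     path \<gamma> \<and> path_image \<gamma> \<subseteq> M \<and>
     (\<exists>T. finite T \<and>
        (\<forall>a b. 0 \<le> a \<and> a < b \<and> b \<le> 1 \<and> {a<..<b} \<inter> T = {} \<longrightarrow> C1_curve_on \<A> \<gamma> a b))"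

text \<open>The speed is the common value computed in all charts around \<open>\<gamma> t\<close>; it is well defined
  wherever \<open>\<gamma>\<close> is differentiable, hence outside finitely many \<open>t\<close> for piecewise \<open>C\<^sup>1\<close> curves.\<close>

definition speed :: "'a chart set \<Rightarrow> 'a metric_field \<Rightarrow> (real \<Rightarrow> 'a) \<Rightarrow> real \<Rightarrow> real" where
  "speed \<A> g \<gamma> t =
     (THE s. \<forall>c\<in>\<A>. \<gamma> t \<in> cdom c \<longrightarrow>
        (let v = vector_derivative (coord c \<circ> \<gamma>) (at t)
         in s = sqrt (v \<bullet> (g c (\<gamma> t) *v v))))"

definition curve_length :: "'a chart set \<Rightarrow> 'a metric_field \<Rightarrow> (real \<Rightarrow> 'a) \<Rightarrow> real" where
  "curve_length \<A> g \<gamma> = integral {0..1} (speed \<A> g \<gamma>)"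

definition riemannian_dist ::
    "'a::topological_space set \<Rightarrow> 'a chart set \<Rightarrow> 'a metric_field \<Rightarrow> 'a \<Rightarrow> 'a \<Rightarrow> real" where
  "riemannian_dist M \<A> g p q =
     Inf {curve_length \<A> g \<gamma> | \<gamma>.
            piecewise_C1_curve M \<A> \<gamma> \<and> pathstart \<gamma> = p \<and> pathfinish \<gamma> = q}"

definition diam ::
    "'a::topological_space set \<Rightarrow> 'a chart set \<Rightarrow> 'a metric_field \<Rightarrow> real" where
  "diam M \<A> g = Sup {riemannian_dist M \<A> g p q | p q. p \<in> M \<and> q \<in> M}"

subsection \<open>Closed geodesics and the systole\<close>

definition geodesic ::
    "'a::topological_space set \<Rightarrow> 'a chart set \<Rightarrow> 'a metric_field \<Rightarrow> (real \<Rightarrow> 'a) \<Rightarrow> bool" where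
  "geodesic M \<A> g \<gamma> \<longleftrightarrow>
     continuous_on UNIV \<gamma> \<and> range \<gamma> \<subseteq> M \<and>
     (\<forall>c\<in>\<A>. \<forall>t. \<gamma> t \<in> cdom c \<longrightarrow>
        (let x = coord c \<circ> \<gamma>; v = (\<lambda>s. vector_derivative x (at s)) in
           (x has_vector_derivative v t) (at t) \<and>
           (v has_vector_derivative
              (\<chi> k. - (\<Sum>i\<in>UNIV. \<Sum>j\<in>UNIV.
                 christoffel (g c \<circ> point c) k i j (x t) * v t $ i * v t $ j))) (at t)))"

text \<open>Closed geodesics are parametrized with period 1.\<close>

definition closed_geodesic ::
    "'a::topological_space set \<Rightarrow> 'a chart set \<Rightarrow> 'a metric_field \<Rightarrow> (real \<Rightarrow> 'a) \<Rightarrow> bool" where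
  "closed_geodesic M \<A> g \<gamma> \<longleftrightarrow> geodesic M \<A> g \<gamma> \<and> (\<forall>t. \<gamma> (t + 1) = \<gamma> t)"

definition contractible_loop :: "'a::topological_space set \<Rightarrow> (real \<Rightarrow> 'a) \<Rightarrow> bool" where
  "contractible_loop M \<gamma> \<longleftrightarrow> (\<exists>p\<in>M. homotopic_loops M \<gamma> (\<lambda>t. p))"

text \<open>On a closed surface that is not simply connected the infimum is attained.\<close>

definition systole ::
    "'a::topological_space set \<Rightarrow> 'a chart set \<Rightarrow> 'a metric_field \<Rightarrow> real" where
  "systole M \<A> g =
     Inf {curve_length \<A> g \<gamma> | \<gamma>. closed_geodesic M \<A> g \<gamma> \<and> \<not> contractible_loop M \<gamma>}"

end

theory Submission
  imports Defs
begin

text \<open>Since the first homology group is a nonzero free group, some loop is not contractible; a polygon of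
  minimal length among the noncontractible ones has no self-intersection, and rounding its corners
  gives a smooth simple closed curve \<open>\<gamma>\<close> that is not contractible. Along \<open>\<gamma>\<close> one prescribes the 1-jet of
  the conformal factor \<open>u\<close>: the value \<open>- K - ln |\<gamma>'|\<close> makes the speed of \<open>\<gamma>\<close> for \<open>exp (2 u) \<sigma>\<close> constant
  and equal to \<open>exp (- K)\<close>, and the normal derivative makes \<open>\<gamma>\<close> a geodesic. For \<open>K\<close> large, \<open>u\<close> can be
  extended with \<open>u \<le> ln 2\<close> everywhere, which at most doubles distances, and \<open>u = ln 2\<close> off a small
  neighbourhood of \<open>\<gamma>\<close>, so that the area does not decrease. Subtracting a constant from \<open>u\<close> then
  restores the area and only shortens curves.\<close>

section \<open>Calculus of smooth maps\<close>

text \<open>The systole is an infimum over closed geodesics, so a short noncontractible loop is not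
  enough: the loop itself has to become a geodesic. The geodesic equation contains only first
  derivatives of the metric, which is why a 1-jet of the conformal factor along the curve suffices,
  and why the curve has to be simple: at a self-intersection two different 1-jets could be demanded.
  In the choice of the polygon, length is the number of edges and not a metric length; the existence
  of a minimum is then a matter of natural numbers, and no minimising geodesic of
  \<open>\<sigma>\<close> is constructed. The jets are patched together in coordinate discs without
  a tubular neighbourhood, since a blend of two functions with the same 1-jet along the curve has
  that 1-jet too. The constant \<open>ln 2\<close> is the factor 2 of the diameter; on areas it
  becomes 4. It therefore suffices that the region where \<open>u = ln 2\<close> carries more than a
  quarter of the area of \<open>\<sigma>\<close>, which is possible because the curve has area
  zero.\<close>

abbreviation Df :: "('a::real_normed_vector \<Rightarrow> 'b::real_normed_vector) \<Rightarrow> 'a \<Rightarrow> 'a \<Rightarrow> 'b" where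
  "Df f x \<equiv> frechet_derivative f (at x)"

lemma Df_eqI: "(f has_derivative f') (at x) \<Longrightarrow> Df f x = f'"
  using frechet_derivative_at by metis

text \<open>The definition speaks of \<open>frechet_derivative\<close>, whereas proofs produce some
  \<open>f'\<close>; passing from one to the other needs congruence at level \<open>k\<close>. It is
  a hypothesis here because \<open>Ck_on_cong\<close> is proved by induction through this very rule,
  with its induction hypothesis in that place; \<open>Ck_on_derivI\<close> is the version with it
  discharged.\<close>

lemma Ck_on_SucI:
  fixes f :: "'a::euclidean_space \<Rightarrow> 'b::real_normed_vector"
  assumes "open S" "\<And>x. x \<in> S \<Longrightarrow> (f has_derivative f' x) (at x)"
    and "\<And>b. b \<in> Basis \<Longrightarrow> Ck_on k (\<lambda>x. f' x b) S"
    and cong: "\<And>g h :: 'a::euclidean_space \<Rightarrow> 'b::real_normed_vector.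
        \<lbrakk>\<And>x. x \<in> S \<Longrightarrow> g x = h x; Ck_on k g S\<rbrakk> \<Longrightarrow> Ck_on k h S"
  shows "Ck_on (Suc k) f S"
proof -
  have "f differentiable_on S"
    using assms(2) by (meson differentiable_at_imp_differentiable_on differentiableI)
  moreover have "Ck_on k (\<lambda>x. Df f x b) S" if "b \<in> Basis" for b
    by (rule cong[OF _ assms(3)[OF that]]) (simp add: Df_eqI[OF assms(2)])
  ultimately show ?thesis by simp
qed

lemma Ck_on_Suc_derivative:
  assumes "Ck_on (Suc k) f S" "open S" "x \<in> S"
  shows "(f has_derivative Df f x) (at x)"
  using assms by (simp add: differentiable_on_eq_differentiable_at frechet_derivative_works)

lemma Ck_on_cong:
  fixes f g :: "'a::euclidean_space \<Rightarrow> 'b::real_normed_vector"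
  assumes "open S" "\<And>x. x \<in> S \<Longrightarrow> f x = g x" "Ck_on k f S"
  shows "Ck_on k g S"
  using assms(2,3)
proof (induction k arbitrary: f g)
  case 0
  then show ?case by (metis Ck_on.simps(1) continuous_on_cong)
next
  case (Suc k)
  show ?case
  proof (rule Ck_on_SucI[OF \<open>open S\<close>, where f' = "Df f"])
    show "(g has_derivative Df f x) (at x)" if "x \<in> S" for x
      using Ck_on_Suc_derivative[OF Suc.prems(2) assms(1) that] Suc.prems(1) that assms(1)
      by (metis has_derivative_transform_within_open)
    show "Ck_on k (\<lambda>x. Df f x b) S" if "b \<in> Basis" for b
      using Suc.prems(2) that by simp
  qed (rule Suc.IH; assumption)
qed

lemma Ck_on_derivI:
  fixes f :: "'a::euclidean_space \<Rightarrow> 'b::real_normed_vector"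
  assumes "open S" "\<And>x. x \<in> S \<Longrightarrow> (f has_derivative f' x) (at x)"
    and "\<And>b. b \<in> Basis \<Longrightarrow> Ck_on k (\<lambda>x. f' x b) S"
  shows "Ck_on (Suc k) f S"
  by (rule Ck_on_SucI[OF assms Ck_on_cong[OF assms(1)]])

lemma Ck_on_continuous: "Ck_on k f S \<Longrightarrow> continuous_on S f"
  using differentiable_imp_continuous_on by (cases k) force+

lemma Ck_on_Suc_weaken: "Ck_on (Suc k) f S \<Longrightarrow> Ck_on k f S"
proof (induction k arbitrary: f)
  case 0
  then show ?case by (simp add: differentiable_imp_continuous_on)
next
  case (Suc k)
  then have "f differentiable_on S" "\<forall>b\<in>Basis. Ck_on (Suc k) (\<lambda>x. Df f x b) S"
    by simp_all
  then show ?case using Suc.IH by simp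
qed

lemma Ck_on_subset: "Ck_on k f S \<Longrightarrow> T \<subseteq> S \<Longrightarrow> Ck_on k f T"
  by (induction k arbitrary: f) (auto intro: continuous_on_subset differentiable_on_subset)

lemma Ck_on_local:
  assumes "open S" "\<And>x. x \<in> S \<Longrightarrow> \<exists>T. open T \<and> x \<in> T \<and> Ck_on k f T"
  shows "Ck_on k f S"
  using assms(2)
proof (induction k arbitrary: f)
  case 0
  then show ?case
    using assms(1) by (auto simp: continuous_on_eq_continuous_at) (metis continuous_on_eq_continuous_at)
next
  case (Suc k)
  have "f differentiable_on S"
    unfolding differentiable_on_eq_differentiable_at[OF assms(1)]
    using Suc.prems by (metis Ck_on.simps(2) differentiable_on_eq_differentiable_at)
  moreover have "Ck_on k (\<lambda>x. Df f x b) S" if "b \<in> Basis" for b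
    using Suc.prems that by (intro Suc.IH) force
  ultimately show ?case by simp
qed

lemma Ck_on_const [intro]: "open S \<Longrightarrow> Ck_on k (\<lambda>x. c) S"
  by (induction k arbitrary: c) auto

lemma Ck_on_linear:
  assumes "bounded_linear L" "open S"
  shows "Ck_on k L S"
proof (cases k)
  case 0
  then show ?thesis using assms(1) by (simp add: linear_continuous_on)
next
  case (Suc m)
  show ?thesis unfolding Suc
    by (rule Ck_on_derivI[where f' = "\<lambda>x. L"])
       (use assms bounded_linear_imp_has_derivative in auto)
qed

lemma Ck_on_linear_compose:
  assumes "bounded_linear L" "open S" "Ck_on k f S"
  shows "Ck_on k (\<lambda>x. L (f x)) S"
  using assms(3)
proof (induction k arbitrary: f)
  case 0
  then show ?case
    using assms(1) bounded_linear.continuous_on by auto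
next
  case (Suc k)
  show ?case
  proof (rule Ck_on_derivI[OF assms(2), where f' = "\<lambda>x b. L (Df f x b)"])
    show "((\<lambda>x. L (f x)) has_derivative (\<lambda>b. L (Df f x b))) (at x)" if "x \<in> S" for x
      using bounded_linear.has_derivative[OF assms(1) Ck_on_Suc_derivative[OF Suc.prems assms(2) that]] .
  qed (use Suc in auto)
qed

lemma Ck_on_add:
  assumes "open S" "Ck_on k f S" "Ck_on k g S"
  shows "Ck_on k (\<lambda>x. f x + g x) S"
  using assms(2,3)
proof (induction k arbitrary: f g)
  case 0
  then show ?case by (auto intro: continuous_on_add)
next
  case (Suc k)
  show ?case
  proof (rule Ck_on_derivI[OF assms(1), where f' = "\<lambda>x b. Df f x b + Df g x b"])
    show "((\<lambda>x. f x + g x) has_derivative (\<lambda>b. Df f x b + Df g x b)) (at x)" if "x \<in> S" for x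
      using Ck_on_Suc_derivative[OF Suc.prems(1) assms(1) that]
        Ck_on_Suc_derivative[OF Suc.prems(2) assms(1) that] by (rule has_derivative_add)
  qed (use Suc in auto)
qed

lemma Ck_on_sum:
  assumes "open S" "\<And>i. i \<in> I \<Longrightarrow> Ck_on k (f i) S"
  shows "Ck_on k (\<lambda>x. \<Sum>i\<in>I. f i x) S"
  using assms(2)
  by (induction I rule: infinite_finite_induct) (auto intro: Ck_on_add assms(1))

lemma Ck_on_bilinear:
  assumes "bounded_bilinear m" "open S" "Ck_on k f S" "Ck_on k g S"
  shows "Ck_on k (\<lambda>x. m (f x) (g x)) S"
  using assms(3,4)
proof (induction k arbitrary: f g)
  case 0
  then show ?case using bounded_bilinear.continuous_on[OF assms(1)] by auto
next
  case (Suc k)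
  show ?case
  proof (rule Ck_on_derivI[OF assms(2), where f' = "\<lambda>x b. m (f x) (Df g x b) + m (Df f x b) (g x)"])
    show "((\<lambda>x. m (f x) (g x)) has_derivative
        (\<lambda>b. m (f x) (Df g x b) + m (Df f x b) (g x))) (at x)" if "x \<in> S" for x
      using bounded_bilinear.FDERIV[OF assms(1) Ck_on_Suc_derivative[OF Suc.prems(1) assms(2) that]
        Ck_on_Suc_derivative[OF Suc.prems(2) assms(2) that]] .
    show "Ck_on k (\<lambda>x. m (f x) (Df g x b) + m (Df f x b) (g x)) S" if "b \<in> Basis" for b
      using Suc that by (intro Ck_on_add[OF assms(2)]) (auto simp: Ck_on_Suc_weaken)
  qed
qed

lemma linear_eq_sum_Basis:
  fixes L :: "'a::euclidean_space \<Rightarrow> 'b::real_vector"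
  assumes "linear L"
  shows "L v = (\<Sum>b\<in>Basis. (v \<bullet> b) *\<^sub>R L b)"
  by (subst euclidean_representation[symmetric, of v])
     (simp only: linear_sum[OF assms] linear_scale[OF assms])

text \<open>Only derivatives along basis vectors are controlled by the definition, so
  \<open>Df g (f x) (Df f x b)\<close> is expanded over the basis of the intermediate space. Each
  summand is a scalar component of \<open>Df f x b\<close> times \<open>Df g (f x) i\<close>, and
  the induction hypothesis applies to the latter with the partial derivative in place of
  \<open>g\<close>.\<close>

lemma Ck_on_compose:
  fixes f :: "'a::euclidean_space \<Rightarrow> 'b::euclidean_space" and g :: "'b \<Rightarrow> 'c::real_normed_vector"
  assumes "open S" "open T" "Ck_on k f S" "Ck_on k g T" "f ` S \<subseteq> T"
  shows "Ck_on k (\<lambda>x. g (f x)) S"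
  using assms(3-)
proof (induction k arbitrary: f g)
  case 0
  then show ?case by (auto intro: continuous_on_compose2)
next
  case (Suc k)
  show ?case
  proof (rule Ck_on_derivI[OF assms(1),
        where f' = "\<lambda>x b. \<Sum>i\<in>Basis. (Df f x b \<bullet> i) *\<^sub>R Df g (f x) i"])
    fix x assume "x \<in> S"
    have f: "(f has_derivative Df f x) (at x)"
      using Ck_on_Suc_derivative[OF Suc.prems(1) assms(1) \<open>x \<in> S\<close>] .
    have g: "(g has_derivative Df g (f x)) (at (f x))"
      using Ck_on_Suc_derivative[OF Suc.prems(2) assms(2)] Suc.prems(3) \<open>x \<in> S\<close> by blast
    have "((\<lambda>x. g (f x)) has_derivative (\<lambda>b. Df g (f x) (Df f x b))) (at x)"
      using has_derivative_compose[OF f g] .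
    moreover have "(\<lambda>b. Df g (f x) (Df f x b)) = (\<lambda>b. \<Sum>i\<in>Basis. (Df f x b \<bullet> i) *\<^sub>R Df g (f x) i)"
      by (rule ext) (rule linear_eq_sum_Basis[OF has_derivative_linear[OF g]])
    ultimately show "((\<lambda>x. g (f x)) has_derivative
       (\<lambda>b. \<Sum>i\<in>Basis. (Df f x b \<bullet> i) *\<^sub>R Df g (f x) i)) (at x)"
      by (rule subst[rotated])
  next
    fix b :: 'a assume b: "b \<in> Basis"
    show "Ck_on k (\<lambda>x. \<Sum>i\<in>Basis. (Df f x b \<bullet> i) *\<^sub>R Df g (f x) i) S"
    proof (intro Ck_on_sum[OF assms(1)] Ck_on_bilinear[OF bounded_bilinear_scaleR assms(1)])
      fix i :: 'b assume "i \<in> Basis"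
      show "Ck_on k (\<lambda>x. Df f x b \<bullet> i) S"
        using Suc.prems b by (intro Ck_on_linear_compose[OF bounded_linear_inner_left assms(1)]) auto
      show "Ck_on k (\<lambda>x. Df g (f x) i) S"
        using Suc.prems \<open>i \<in> Basis\<close> by (intro Suc.IH) (auto simp: Ck_on_Suc_weaken)
    qed
  qed
qed

section \<open>Closure properties of infinitely differentiable maps\<close>

lemma smooth_on_cong: "smooth_on f S \<Longrightarrow> open S \<Longrightarrow> (\<And>x. x \<in> S \<Longrightarrow> f x = g x) \<Longrightarrow> smooth_on g S"
  unfolding smooth_on_def using Ck_on_cong by metis

lemma smooth_on_continuous: "smooth_on f S \<Longrightarrow> continuous_on S f"
  unfolding smooth_on_def using Ck_on_continuous by blast

lemma smooth_on_subset: "smooth_on f S \<Longrightarrow> T \<subseteq> S \<Longrightarrow> smooth_on f T"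
  unfolding smooth_on_def using Ck_on_subset by blast

lemma smooth_on_local:
  assumes "open S" "\<And>x. x \<in> S \<Longrightarrow> \<exists>T. open T \<and> x \<in> T \<and> smooth_on f T"
  shows "smooth_on f S"
  unfolding smooth_on_def using Ck_on_local[OF assms(1)] assms(2) by (metis smooth_on_def)

lemma smooth_on_const: "open S \<Longrightarrow> smooth_on (\<lambda>x. c) S"
  unfolding smooth_on_def by auto

lemma smooth_on_linear: "bounded_linear L \<Longrightarrow> open S \<Longrightarrow> smooth_on L S"
  unfolding smooth_on_def by (auto intro: Ck_on_linear)

lemma smooth_on_ident: "open S \<Longrightarrow> smooth_on (\<lambda>x. x) S"
  by (rule smooth_on_linear[OF bounded_linear_ident])

lemma smooth_on_linear_compose:
  "bounded_linear L \<Longrightarrow> smooth_on f S \<Longrightarrow> open S \<Longrightarrow> smooth_on (\<lambda>x. L (f x)) S"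
  unfolding smooth_on_def by (auto intro: Ck_on_linear_compose)

lemma smooth_on_add:
  "smooth_on f S \<Longrightarrow> smooth_on g S \<Longrightarrow> open S \<Longrightarrow> smooth_on (\<lambda>x. f x + g x) S"
  unfolding smooth_on_def by (auto intro: Ck_on_add)

lemma smooth_on_sum:
  "(\<And>i. i \<in> I \<Longrightarrow> smooth_on (f i) S) \<Longrightarrow> open S \<Longrightarrow> smooth_on (\<lambda>x. \<Sum>i\<in>I. f i x) S"
  unfolding smooth_on_def by (auto intro: Ck_on_sum)

lemma smooth_on_bilinear:
  "bounded_bilinear m \<Longrightarrow> smooth_on f S \<Longrightarrow> smooth_on g S \<Longrightarrow> open S \<Longrightarrow>
    smooth_on (\<lambda>x. m (f x) (g x)) S"
  unfolding smooth_on_def by (auto intro: Ck_on_bilinear)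

lemmas smooth_on_scaleR = smooth_on_bilinear[OF bounded_bilinear_scaleR]
lemmas smooth_on_inner = smooth_on_bilinear[OF bounded_bilinear_inner]
lemmas smooth_on_mult = smooth_on_bilinear[OF bounded_bilinear_mult]

lemma smooth_on_minus: "smooth_on f S \<Longrightarrow> open S \<Longrightarrow> smooth_on (\<lambda>x. - f x) S"
  by (rule smooth_on_linear_compose[OF bounded_linear_minus[OF bounded_linear_ident]])

lemma smooth_on_diff:
  "smooth_on f S \<Longrightarrow> smooth_on g S \<Longrightarrow> open S \<Longrightarrow> smooth_on (\<lambda>x. f x - g x) S"
  using smooth_on_add[OF _ smooth_on_minus] by fastforce

lemma smooth_on_compose:
  fixes f :: "'a::euclidean_space \<Rightarrow> 'b::euclidean_space" and g :: "'b \<Rightarrow> 'c::real_normed_vector"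
  shows "smooth_on f S \<Longrightarrow> smooth_on g T \<Longrightarrow> open S \<Longrightarrow> open T \<Longrightarrow> f ` S \<subseteq> T \<Longrightarrow> smooth_on (\<lambda>x. g (f x)) S"
  unfolding smooth_on_def by (auto intro: Ck_on_compose)

lemma smooth_on_has_derivative:
  "smooth_on f S \<Longrightarrow> open S \<Longrightarrow> x \<in> S \<Longrightarrow> (f has_derivative Df f x) (at x)"
  unfolding smooth_on_def using Ck_on_Suc_derivative by blast

lemma smooth_on_Df:
  assumes "smooth_on f S" "open S"
  shows "smooth_on (\<lambda>x. Df f x v) S"
proof (rule smooth_on_cong)
  show "smooth_on (\<lambda>x. \<Sum>b\<in>Basis. (v \<bullet> b) *\<^sub>R Df f x b) S"
  proof (intro smooth_on_sum smooth_on_scaleR smooth_on_const assms(2))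
    fix b :: 'a assume "b \<in> Basis"
    then show "smooth_on (\<lambda>x. Df f x b) S"
      using assms(1) unfolding smooth_on_def by (metis Ck_on.simps(2))
  qed
  show "(\<Sum>b\<in>Basis. (v \<bullet> b) *\<^sub>R Df f x b) = Df f x v" if "x \<in> S" for x
    by (rule linear_eq_sum_Basis[OF has_derivative_linear[OF smooth_on_has_derivative[OF assms that]], symmetric])
qed (rule assms(2))

text \<open>Lets the direction of differentiation move with the point, as when the Gram matrix is
  differentiated along a velocity.\<close>

lemma smooth_on_Df2:
  assumes "smooth_on f S" "open S" "smooth_on c T" "smooth_on v T" "open T" "c ` T \<subseteq> S"
  shows "smooth_on (\<lambda>t. Df f (c t) (v t)) T"
proof (rule smooth_on_cong)
  show "smooth_on (\<lambda>t. \<Sum>b\<in>Basis. (v t \<bullet> b) *\<^sub>R Df f (c t) b) T"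
    by (intro smooth_on_sum smooth_on_scaleR smooth_on_inner smooth_on_const
        smooth_on_compose[OF assms(3) smooth_on_Df[OF assms(1,2)]] assms)
  show "(\<Sum>b\<in>Basis. (v t \<bullet> b) *\<^sub>R Df f (c t) b) = Df f (c t) (v t)" if "t \<in> T" for t
    by (rule linear_eq_sum_Basis[OF has_derivative_linear[OF smooth_on_has_derivative[OF assms(1,2)]], symmetric])
       (use that assms(6) in blast)
qed (rule assms(5))

abbreviation vd :: "(real \<Rightarrow> 'b::real_normed_vector) \<Rightarrow> real \<Rightarrow> 'b" where
  "vd f t \<equiv> vector_derivative f (at t)"

lemma smooth_on_vd:
  fixes f :: "real \<Rightarrow> 'b::real_normed_vector"
  assumes "smooth_on f S" "open S" "t \<in> S"
  shows "(f has_vector_derivative vd f t) (at t)" "Df f t = (\<lambda>h. h *\<^sub>R vd f t)"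
proof -
  have "f differentiable at t"
    using smooth_on_has_derivative[OF assms] differentiable_def by blast
  then show "(f has_vector_derivative vd f t) (at t)"
    using vector_derivative_works by blast
  then show "Df f t = (\<lambda>h. h *\<^sub>R vd f t)"
    using Df_eqI has_vector_derivative_def by blast
qed

lemma smooth_on_vector_derivative:
  fixes f :: "real \<Rightarrow> 'b::real_normed_vector"
  assumes "smooth_on f S" "open S"
  shows "smooth_on (\<lambda>t. vd f t) S"
  by (rule smooth_on_cong[OF smooth_on_Df[OF assms, of 1] assms(2)])
     (simp add: smooth_on_vd(2)[OF assms])

lemma has_vector_derivative_compose_Df:
  assumes "(f has_derivative f') (at (c t))" "(c has_vector_derivative v) (at t within I)"
  shows "((\<lambda>s. f (c s)) has_vector_derivative f' v) (at t within I)"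
proof -
  have "((\<lambda>s. f (c s)) has_derivative (\<lambda>h. f' (h *\<^sub>R v))) (at t within I)"
    using has_derivative_compose[OF assms(2)[unfolded has_vector_derivative_def] assms(1)] .
  moreover have "f' (h *\<^sub>R v) = h *\<^sub>R f' v" for h
    using has_derivative_linear[OF assms(1)] by (simp add: linear_scale)
  ultimately show ?thesis by (simp add: has_vector_derivative_def)
qed

lemma Ck_on_real_derivI:
  fixes f :: "real \<Rightarrow> 'b::real_normed_vector"
  assumes "open S" "\<And>x. x \<in> S \<Longrightarrow> (f has_vector_derivative f' x) (at x)" "Ck_on k f' S"
  shows "Ck_on (Suc k) f S"
  by (rule Ck_on_derivI[OF assms(1), where f' = "\<lambda>x h. h *\<^sub>R f' x"])
     (use assms in \<open>auto simp: has_vector_derivative_def\<close>)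

lemma smooth_on_exp: "smooth_on (exp :: real \<Rightarrow> real) UNIV"
proof -
  have "Ck_on k (exp :: real \<Rightarrow> real) UNIV" for k
  proof (induction k)
    case 0
    then show ?case by (simp add: continuous_on_exp)
  next
    case (Suc k)
    show ?case
      by (rule Ck_on_real_derivI[OF _ _ Suc])
         (auto simp: has_real_derivative_iff_has_vector_derivative[symmetric] intro!: DERIV_exp)
  qed
  then show ?thesis by (simp add: smooth_on_def)
qed

lemma smooth_on_inverse: "smooth_on (inverse :: real \<Rightarrow> real) (- {0})"
proof -
  have "Ck_on k (inverse :: real \<Rightarrow> real) (- {0})" for k
  proof (induction k)
    case 0
    then show ?case by (auto intro!: continuous_intros)
  next
    case (Suc k)
    show ?case
    proof (rule Ck_on_real_derivI)
      show "(inverse has_vector_derivative - (inverse x * inverse x)) (at x)" if "x \<in> - {0}" for x :: real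
        using that unfolding has_real_derivative_iff_has_vector_derivative[symmetric]
        by (auto intro!: derivative_eq_intros simp: power2_eq_square)
      show "Ck_on k (\<lambda>x::real. - (inverse x * inverse x)) (- {0})"
        by (intro Ck_on_linear_compose[OF bounded_linear_minus[OF bounded_linear_ident]]
            Ck_on_bilinear[OF bounded_bilinear_mult] Suc) auto
    qed auto
  qed
  then show ?thesis by (simp add: smooth_on_def)
qed

lemma smooth_on_ln: "smooth_on (ln :: real \<Rightarrow> real) {0<..}"
proof -
  have "Ck_on k (ln :: real \<Rightarrow> real) {0<..}" for k
  proof (cases k)
    case 0
    then show ?thesis by (auto intro!: continuous_intros)
  next
    case (Suc m)
    show ?thesis unfolding Suc
    proof (rule Ck_on_real_derivI)
      show "(ln has_vector_derivative inverse x) (at x)" if "x \<in> {0<..}" for x :: real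
        using that unfolding has_real_derivative_iff_has_vector_derivative[symmetric]
        by (auto intro!: derivative_eq_intros simp: divide_inverse)
      show "Ck_on m (inverse :: real \<Rightarrow> real) {0<..}"
        using smooth_on_inverse Ck_on_subset unfolding smooth_on_def by blast
    qed auto
  qed
  then show ?thesis by (simp add: smooth_on_def)
qed

lemma smooth_on_divide:
  fixes f g :: "'a::euclidean_space \<Rightarrow> real"
  assumes "smooth_on f S" "smooth_on g S" "open S" "\<And>x. x \<in> S \<Longrightarrow> g x \<noteq> 0"
  shows "smooth_on (\<lambda>x. f x / g x) S"
  unfolding divide_inverse
  by (intro smooth_on_mult smooth_on_compose[OF assms(2) smooth_on_inverse] assms) (use assms(4) in auto)

subsection \<open>Inverse functions of one variable\<close>

text \<open>The derivative of \<theta> is \<open>1 / X'(\<theta>)\<close>, so \<theta> of class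
  \<open>C^k\<close> has a derivative of class \<open>C^k\<close>, and the regularity climbs by
  induction. Openness of the image comes from invariance of domain.\<close>

lemma smooth_on_inverse_function:
  fixes X :: "real \<Rightarrow> real"
  assumes X: "smooth_on X {a<..<b}" and pos: "\<And>t. t \<in> {a<..<b} \<Longrightarrow> vd X t > 0" and "a < b"
  obtains \<theta> where "open (X ` {a<..<b})" "smooth_on \<theta> (X ` {a<..<b})"
    "\<And>t. t \<in> {a<..<b} \<Longrightarrow> \<theta> (X t) = t" "inj_on X {a<..<b}"
proof -
  let ?I = "{a<..<b}"
  have der: "(X has_real_derivative vd X t) (at t)" if "t \<in> ?I" for t
    using smooth_on_vd(1)[OF X _ that] by (simp add: has_real_derivative_iff_has_vector_derivative)
  have mono: "X s < X t" if "s \<in> ?I" "t \<in> ?I" "s < t" for s t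
  proof (rule DERIV_pos_imp_increasing[OF that(3)])
    fix x assume "s \<le> x" "x \<le> t"
    then have "x \<in> ?I" using that by auto
    then show "\<exists>y. (X has_real_derivative y) (at x) \<and> 0 < y" using der pos by blast
  qed
  have inj: "inj_on X ?I"
    by (rule linorder_inj_onI) (use mono in force)+
  have cont: "continuous_on ?I X" using smooth_on_continuous[OF X] .
  have op: "open (X ` ?I)"
    using invariance_of_domain[OF cont _ inj] by simp
  define \<theta> where "\<theta> = the_inv_into ?I X"
  have \<theta>: "\<theta> (X t) = t" if "t \<in> ?I" for t
    using that the_inv_into_f_f[OF inj] by (simp add: \<theta>_def)
  have d\<theta>: "(\<theta> has_vector_derivative inverse (vd X (\<theta> y))) (at y)" if "y \<in> X ` ?I" for y
  proof -
    obtain t where t: "t \<in> ?I" "y = X t" using \<open>y \<in> X ` ?I\<close> by blast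
    have "(\<theta> has_derivative (\<lambda>h. inverse (vd X t) * h)) (at (X t))"
    proof (rule has_derivative_inverse_strong[where f = X and S = ?I and f' = "\<lambda>h. vd X t * h"])
      show "(X has_derivative (*) (vd X t)) (at t)" using der[OF t(1)] by (simp add: has_field_derivative_def)
      show "(*) (vd X t) \<circ> (*) (inverse (vd X t)) = id" using pos[OF t(1)] by (auto simp: fun_eq_iff)
    qed (use t cont \<theta> in auto)
    then show ?thesis
      using t \<theta>[OF t(1)] by (simp add: has_vector_derivative_def mult.commute)
  qed
  have "Ck_on k \<theta> (X ` ?I)" for k
  proof (induction k)
    case 0
    have "isCont \<theta> y" if "y \<in> X ` ?I" for y
      using has_vector_derivative_continuous[OF d\<theta>[OF that]] .
    then show ?case by (simp add: continuous_at_imp_continuous_on)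
  next
    case (Suc k)
    show ?case
    proof (rule Ck_on_real_derivI[OF op d\<theta>])
      have "smooth_on (\<lambda>t. inverse (vd X t)) ?I"
        by (rule smooth_on_compose[OF smooth_on_vector_derivative[OF X] smooth_on_inverse])
           (use pos in \<open>force\<close>)+
      then show "Ck_on k (\<lambda>y. inverse (vd X (\<theta> y))) (X ` ?I)"
        unfolding smooth_on_def
        by (intro Ck_on_compose[OF op open_greaterThanLessThan[of a b] Suc]) (use \<theta> in auto)
    qed
  qed
  then show ?thesis using that[OF op _ \<theta> inj] by (simp add: smooth_on_def)
qed

subsection \<open>Smooth steps\<close>

text \<open>The family is closed under differentiation: \<open>h\<^sub>n' = h\<^bsub>n+2\<^esub> - n h\<^bsub>n+1\<^esub>\<close>.\<close>

definition flat :: "nat \<Rightarrow> real \<Rightarrow> real" where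
  "flat n t = (if t > 0 then exp (- (1 / t)) / t ^ n else 0)"

lemma flat_tendsto_0: "(flat n \<longlongrightarrow> 0) (at 0)"
proof -
  have "((\<lambda>s. s ^ n / exp s) \<longlongrightarrow> 0) (at_top :: real filter)"
    by (rule tendsto_power_div_exp_0)
  then have "((\<lambda>t::real. inverse t ^ n / exp (inverse t)) \<longlongrightarrow> 0) (at_right 0)"
    using filterlim_compose filterlim_inverse_at_top_right by blast
  then have "(flat n \<longlongrightarrow> 0) (at_right 0)"
    by (rule Lim_transform_eventually)
       (auto simp: flat_def eventually_at_filter field_simps exp_minus)
  moreover have "(flat n \<longlongrightarrow> 0) (at_left 0)"
    by (rule Lim_transform_eventually[OF tendsto_const]) (auto simp: flat_def eventually_at_filter)
  ultimately show ?thesis using filterlim_split_at by blast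
qed

lemma flat_derivative:
  "(flat n has_vector_derivative flat (n+2) t - real n * flat (n+1) t) (at t)"
proof -
  consider "t > 0" | "t < 0" | "t = 0" by linarith
  then have "(flat n has_real_derivative flat (n+2) t - real n * flat (n+1) t) (at t)"
  proof cases
    case 1
    let ?E = "exp (- inverse t)"
    have pos: "flat m r = exp (- inverse r) * inverse r ^ m" if "r > 0" for m r
      using that by (simp add: flat_def divide_inverse power_inverse)
    have inv: "(inverse has_real_derivative - (inverse t * inverse t)) (at t)"
      using DERIV_inverse[of t] 1 by (simp add: power2_eq_square)
    have d1: "((\<lambda>r. exp (- inverse r)) has_real_derivative ?E * (inverse t * inverse t)) (at t)"
      using DERIV_chain2[OF DERIV_exp DERIV_minus[OF inv]] by simp
    have d2: "((\<lambda>r. inverse r ^ n) has_real_derivative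
        real n * inverse t ^ (n - 1) * - (inverse t * inverse t)) (at t)"
      using DERIV_power[OF inv, of n] by (simp add: mult_ac)
    have "?E * (inverse t * inverse t) * inverse t ^ n
        + real n * inverse t ^ (n - 1) * - (inverse t * inverse t) * ?E
      = flat (n+2) t - real n * flat (n+1) t"
      using 1 by (cases n) (simp_all add: pos algebra_simps)
    then have "((\<lambda>r. exp (- inverse r) * inverse r ^ n) has_real_derivative
        flat (n+2) t - real n * flat (n+1) t) (at t)"
      using DERIV_cong[OF DERIV_mult[OF d1 d2]] by blast
    then show ?thesis
      by (rule has_field_derivative_transform_within_open[where S = "{0<..}"])
         (use 1 pos in auto)
  next
    case 2
    have "((\<lambda>t. 0) has_real_derivative flat (n+2) t - real n * flat (n+1) t) (at t)"
      using 2 by (simp add: flat_def)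
    then show ?thesis
      by (rule has_field_derivative_transform_within_open[where S = "{..<0}"])
         (use 2 in \<open>auto simp: flat_def\<close>)
  next
    case 3
    \<comment> \<open>At 0 the difference quotient of \<open>flat n\<close> is
      \<open>flat (n+1)\<close>, so differentiability there is the vanishing limit of the next
      member of the family.\<close>
    have "((\<lambda>y. (flat n y - flat n 0) / (y - 0)) \<longlongrightarrow> 0) (at 0)"
      by (rule Lim_transform_eventually[OF flat_tendsto_0[of "n+1"]])
         (auto simp: flat_def eventually_at_filter)
    then show ?thesis
      unfolding has_field_derivative_iff using 3 by (simp add: flat_def)
  qed
  then show ?thesis by (simp add: has_real_derivative_iff_has_vector_derivative)
qed

lemma smooth_on_flat: "smooth_on (flat n) UNIV"
proof -
  have "Ck_on k (flat n) UNIV" for k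
  proof (induction k arbitrary: n)
    case 0
    have "isCont (flat n) t" for t
      using has_vector_derivative_continuous[OF flat_derivative] .
    then show ?case by (simp add: continuous_at_imp_continuous_on)
  next
    case (Suc k)
    have "Ck_on k (\<lambda>t. flat (n+2) t + (- real n) * flat (n+1) t) UNIV"
      by (intro Ck_on_add Ck_on_bilinear[OF bounded_bilinear_mult] Suc) auto
    then show ?case
      by (intro Ck_on_real_derivI[OF _ flat_derivative]) auto
  qed
  then show ?thesis by (simp add: smooth_on_def)
qed

lemma flat_0_mono: "s \<le> t \<Longrightarrow> flat 0 s \<le> flat 0 t"
  by (auto simp: flat_def frac_le)

lemma flat_0_nonneg: "flat 0 t \<ge> 0"
  by (simp add: flat_def)

definition smooth_step :: "real \<Rightarrow> real" where
  "smooth_step t = flat 0 t / (flat 0 t + flat 0 (1 - t))"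

lemma flat_denominator_pos: "flat 0 t + flat 0 (1 - t) > 0"
  by (auto simp: flat_def add_pos_nonneg)

lemma smooth_on_smooth_step: "smooth_on smooth_step UNIV"
proof -
  have 1: "smooth_on (\<lambda>t. flat 0 (1 - t)) UNIV"
    by (rule smooth_on_compose[OF smooth_on_diff[OF smooth_on_const smooth_on_ident] smooth_on_flat]) auto
  show ?thesis
    unfolding smooth_step_def
    by (intro smooth_on_divide smooth_on_add 1 smooth_on_flat)
       (simp_all add: less_imp_neq[OF flat_denominator_pos, symmetric])
qed

lemma smooth_step_0: "t \<le> 0 \<Longrightarrow> smooth_step t = 0"
  by (simp add: smooth_step_def flat_def)

lemma smooth_step_1: "t \<ge> 1 \<Longrightarrow> smooth_step t = 1"
  by (simp add: smooth_step_def flat_def)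

lemma smooth_step_bounds: "0 \<le> smooth_step t" "smooth_step t \<le> 1"
  using flat_denominator_pos[of t] flat_0_nonneg[of t] flat_0_nonneg[of "1 - t"]
  by (auto simp: smooth_step_def)

lemma mono_smooth_step: "mono smooth_step"
proof
  fix s t :: real assume "s \<le> t"
  then have "flat 0 s * flat 0 (1 - t) \<le> flat 0 t * flat 0 (1 - s)"
    by (intro mult_mono flat_0_mono flat_0_nonneg) auto
  then show "smooth_step s \<le> smooth_step t"
    using flat_denominator_pos[of s] flat_denominator_pos[of t]
    by (simp add: smooth_step_def divide_simps mult_ac) (simp add: algebra_simps)
qed

subsection \<open>Symmetry of second derivatives\<close>

text \<open>The mean value theorem, along \<open>a\<close> and then along \<open>b\<close>. The
  second difference on the left is symmetric in \<open>a\<close> and \<open>b\<close>, and this is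
  what the lemma is used for.\<close>

lemma second_difference_mvt:
  fixes f :: "'a::euclidean_space \<Rightarrow> real"
  assumes f: "smooth_on f S" and S: "open S" and h: "h > 0"
    and sub: "\<And>s t. \<lbrakk>0 \<le> s; s \<le> h; 0 \<le> t; t \<le> h\<rbrakk> \<Longrightarrow> x + s *\<^sub>R a + t *\<^sub>R b \<in> S"
  obtains s t where "0 \<le> s" "s \<le> h" "0 \<le> t" "t \<le> h"
    "f (x + h *\<^sub>R a + h *\<^sub>R b) - f (x + h *\<^sub>R a) - f (x + h *\<^sub>R b) + f x
      = h * h * Df (\<lambda>y. Df f y a) (x + s *\<^sub>R a + t *\<^sub>R b) b"
proof -
  define \<phi> where "\<phi> = (\<lambda>s. f (x + s *\<^sub>R a + h *\<^sub>R b) - f (x + s *\<^sub>R a))"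
  have d1: "((\<lambda>s. f (x + s *\<^sub>R a + t *\<^sub>R b)) has_real_derivative Df f (x + s *\<^sub>R a + t *\<^sub>R b) a) (at s)"
    if "0 \<le> s" "s \<le> h" "0 \<le> t" "t \<le> h" for s t
    unfolding has_real_derivative_iff_has_vector_derivative
    by (rule has_vector_derivative_compose_Df[where c = "\<lambda>s. x + s *\<^sub>R a + t *\<^sub>R b",
          OF smooth_on_has_derivative[OF f S sub[OF that]]])
       (auto intro!: derivative_eq_intros)
  have d2: "((\<lambda>t. Df f (x + s *\<^sub>R a + t *\<^sub>R b) a) has_real_derivative
      Df (\<lambda>y. Df f y a) (x + s *\<^sub>R a + t *\<^sub>R b) b) (at t)"
    if "0 \<le> s" "s \<le> h" "0 \<le> t" "t \<le> h" for s t
    unfolding has_real_derivative_iff_has_vector_derivative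
    by (rule has_vector_derivative_compose_Df[where f = "\<lambda>y. Df f y a" and c = "\<lambda>t. x + s *\<^sub>R a + t *\<^sub>R b",
          OF smooth_on_has_derivative[OF smooth_on_Df[OF f S] S sub[OF that]]])
       (auto intro!: derivative_eq_intros)
  have d\<phi>: "(\<phi> has_real_derivative Df f (x + s *\<^sub>R a + h *\<^sub>R b) a - Df f (x + s *\<^sub>R a) a) (at s)"
    if "0 \<le> s" "s \<le> h" for s
    unfolding \<phi>_def using d1[OF that, of h] d1[OF that, of 0] h by (auto intro!: derivative_eq_intros)
  obtain s where s: "0 < s" "s < h" and 1: "\<phi> h - \<phi> 0 = (h - 0) *
      (Df f (x + s *\<^sub>R a + h *\<^sub>R b) a - Df f (x + s *\<^sub>R a) a)"
    using MVT2[OF h, of \<phi> "\<lambda>s. Df f (x + s *\<^sub>R a + h *\<^sub>R b) a - Df f (x + s *\<^sub>R a) a"] d\<phi> by auto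
  obtain t where t: "0 < t" "t < h" and 2: "Df f (x + s *\<^sub>R a + h *\<^sub>R b) a - Df f (x + s *\<^sub>R a + 0 *\<^sub>R b) a
      = (h - 0) * Df (\<lambda>y. Df f y a) (x + s *\<^sub>R a + t *\<^sub>R b) b"
    using MVT2[OF h, of "\<lambda>t. Df f (x + s *\<^sub>R a + t *\<^sub>R b) a"
        "\<lambda>t. Df (\<lambda>y. Df f y a) (x + s *\<^sub>R a + t *\<^sub>R b) b"] d2[of s] s by auto
  show ?thesis
  proof (rule that[of s t])
    show "f (x + h *\<^sub>R a + h *\<^sub>R b) - f (x + h *\<^sub>R a) - f (x + h *\<^sub>R b) + f x
      = h * h * Df (\<lambda>y. Df f y a) (x + s *\<^sub>R a + t *\<^sub>R b) b"
      using 1 2 by (simp add: \<phi>_def)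
  qed (use s t in auto)
qed

text \<open>Both mixed derivatives, taken at two possibly different points of a small parallelogram,
  equal the same second difference divided by \<open>h * h\<close>; continuity brings the two points
  to \<open>x\<close>.\<close>

lemma Df_symmetric_real:
  fixes f :: "'a::euclidean_space \<Rightarrow> real"
  assumes f: "smooth_on f S" and S: "open S" and x: "x \<in> S"
  shows "Df (\<lambda>y. Df f y a) x b = Df (\<lambda>y. Df f y b) x a"
proof -
  let ?F = "\<lambda>y. Df (\<lambda>y. Df f y a) y b" and ?G = "\<lambda>y. Df (\<lambda>y. Df f y b) y a"
  have cF: "isCont ?F x" and cG: "isCont ?G x"
    using smooth_on_continuous[OF smooth_on_Df[OF smooth_on_Df[OF f S] S]] S x
    by (auto simp: continuous_on_eq_continuous_at)
  have "dist (?F x) (?G x) < e" if "e > 0" for e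
  proof -
    obtain d1 where d1: "d1 > 0" "\<And>y. dist y x < d1 \<Longrightarrow> dist (?F y) (?F x) < e / 2"
      using cF \<open>e > 0\<close> unfolding continuous_at_eps_delta by (meson half_gt_zero)
    obtain d2 where d2: "d2 > 0" "\<And>y. dist y x < d2 \<Longrightarrow> dist (?G y) (?G x) < e / 2"
      using cG \<open>e > 0\<close> unfolding continuous_at_eps_delta by (meson half_gt_zero)
    obtain d3 where d3: "d3 > 0" "ball x d3 \<subseteq> S" using S x open_contains_ball by blast
    define d where "d = min d1 (min d2 d3)"
    \<comment> \<open>Puts the whole parallelogram spanned by \<open>h *\<^sub>R a\<close> and
      \<open>h *\<^sub>R b\<close> within \<open>d / 2\<close> of \<open>x\<close>; the summand 1
      keeps the denominator positive for \<open>a = b = 0\<close>.\<close>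
    define h where "h = d / (2 * (norm a + norm b + 1))"
    have "d > 0" and h: "h > 0" using d1 d2 d3 by (auto simp: d_def h_def add_nonneg_pos)
    have near: "dist (x + s *\<^sub>R a + t *\<^sub>R b) x < d" if "0 \<le> s" "s \<le> h" "0 \<le> t" "t \<le> h" for s t
    proof -
      have "norm (s *\<^sub>R a + t *\<^sub>R b) \<le> s * norm a + t * norm b"
        using norm_triangle_ineq[of "s *\<^sub>R a" "t *\<^sub>R b"] that by simp
      also have "\<dots> \<le> h * norm a + h * norm b" using that by (intro add_mono mult_right_mono) auto
      also have "\<dots> \<le> h * (norm a + norm b + 1)" using h by (simp add: algebra_simps)
      also have "\<dots> = d / 2"
        using norm_ge_zero[of a] norm_ge_zero[of b] unfolding h_def by (simp add: field_simps add_nonneg_eq_0_iff)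
      finally show ?thesis using \<open>d > 0\<close> by (simp add: dist_norm algebra_simps)
    qed
    then have sub: "x + s *\<^sub>R a + t *\<^sub>R b \<in> S" if "0 \<le> s" "s \<le> h" "0 \<le> t" "t \<le> h" for s t
      using d3 that by (force simp: d_def dist_commute)
    then have sub': "x + s *\<^sub>R b + t *\<^sub>R a \<in> S" if "0 \<le> s" "s \<le> h" "0 \<le> t" "t \<le> h" for s t
      using that sub[of t s] by (simp add: algebra_simps)
    obtain s t where st: "0 \<le> s" "s \<le> h" "0 \<le> t" "t \<le> h"
      "f (x + h *\<^sub>R a + h *\<^sub>R b) - f (x + h *\<^sub>R a) - f (x + h *\<^sub>R b) + f x
      = h * h * ?F (x + s *\<^sub>R a + t *\<^sub>R b)"
      by (rule second_difference_mvt[OF f S h sub])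
    obtain s' t' where st': "0 \<le> s'" "s' \<le> h" "0 \<le> t'" "t' \<le> h"
      "f (x + h *\<^sub>R b + h *\<^sub>R a) - f (x + h *\<^sub>R b) - f (x + h *\<^sub>R a) + f x
      = h * h * ?G (x + s' *\<^sub>R b + t' *\<^sub>R a)"
      by (rule second_difference_mvt[OF f S h sub'])
    have comm: "x + p *\<^sub>R b + q *\<^sub>R a = x + q *\<^sub>R a + p *\<^sub>R b" for p q by simp
    have "h * h * ?F (x + s *\<^sub>R a + t *\<^sub>R b) = h * h * ?G (x + s' *\<^sub>R b + t' *\<^sub>R a)"
      using st(5) st'(5) unfolding comm by linarith
    then have eq: "?F (x + s *\<^sub>R a + t *\<^sub>R b) = ?G (x + t' *\<^sub>R a + s' *\<^sub>R b)"
      using h by (simp add: comm[of s' t'])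
    have "dist (?F (x + s *\<^sub>R a + t *\<^sub>R b)) (?F x) < e / 2"
      using near[OF st(1-4)] d1(2) by (simp add: d_def)
    moreover have "dist (?G (x + t' *\<^sub>R a + s' *\<^sub>R b)) (?G x) < e / 2"
      using near[OF st'(3,4,1,2)] d2(2) by (simp add: d_def)
    ultimately show ?thesis using eq by (metis dist_commute dist_triangle_half_l)
  qed
  then show ?thesis by (metis dist_self less_irrefl zero_less_dist_iff)
qed

lemma Df_linear_compose:
  assumes "bounded_linear L" "f differentiable (at x)"
  shows "Df (\<lambda>y. L (f y)) x a = L (Df f x a)"
  using Df_eqI[OF bounded_linear.has_derivative[OF assms(1)]] assms(2) frechet_derivative_works by metis

lemma Df_symmetric:
  fixes f :: "'a::euclidean_space \<Rightarrow> 'b::euclidean_space"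
  assumes f: "smooth_on f S" and S: "open S" and x: "x \<in> S"
  shows "Df (\<lambda>y. Df f y a) x b = Df (\<lambda>y. Df f y b) x a"
proof (rule euclidean_eqI)
  fix i :: 'b assume "i \<in> Basis"
  let ?g = "\<lambda>y. f y \<bullet> i"
  have g: "smooth_on ?g S" by (intro smooth_on_inner f smooth_on_const S)
  have eq: "Df (\<lambda>y. Df ?g y c) x d = Df (\<lambda>y. Df f y c) x d \<bullet> i" for c d
  proof -
    have 1: "Df ?g y c = Df f y c \<bullet> i" if "y \<in> S" for y
      by (rule Df_linear_compose[OF bounded_linear_inner_left])
         (use smooth_on_has_derivative[OF f S that] differentiable_def in blast)
    have dd: "(\<lambda>y. Df f y c) differentiable (at x)"
      using smooth_on_has_derivative[OF smooth_on_Df[OF f S] S x] differentiable_def by blast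
    have "Df (\<lambda>y. Df ?g y c) x = Df (\<lambda>y. Df f y c \<bullet> i) x"
    proof (rule Df_eqI, rule has_derivative_transform_within_open[OF _ S x])
      show "((\<lambda>y. Df f y c \<bullet> i) has_derivative Df (\<lambda>y. Df f y c \<bullet> i) x) (at x)"
        using dd by (simp add: frechet_derivative_works[symmetric])
    qed (simp add: 1)
    then show ?thesis
      by (simp add: Df_linear_compose[OF bounded_linear_inner_left dd])
  qed
  show "Df (\<lambda>y. Df f y a) x b \<bullet> i = Df (\<lambda>y. Df f y b) x a \<bullet> i"
    using Df_symmetric_real[OF g S x, of a b] eq by simp
qed

section \<open>Charts, curves and functions on a surface\<close>

abbreviation img :: "'a chart \<Rightarrow> (real^2) set" where
  "img c \<equiv> coord c ` cdom c"

locale surface =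
  fixes M :: "'a::t2_space set" and \<A> :: "'a chart set"
  assumes surf: "smooth_closed_surface M \<A>"
begin

lemma compact_M: "compact M" and connected_M: "connected M" and M_ne: "M \<noteq> {}"
  and atlas: "smooth_atlas M \<A>"
  using surf by (auto simp: smooth_closed_surface_def)

lemma ex_chart: "p \<in> M \<Longrightarrow> \<exists>c\<in>\<A>. p \<in> cdom c"
  using atlas unfolding smooth_atlas_def by blast

context
  fixes c assumes c: "c \<in> \<A>"
begin

lemma openin_cdom: "openin (top_of_set M) (cdom c)"
  and open_img: "open (img c)"
  and homeo: "homeomorphism (cdom c) (img c) (coord c) (point c)"
  using atlas c unfolding smooth_atlas_def is_chart_def by auto

lemma cdom_sub: "cdom c \<subseteq> M"
  using openin_cdom openin_imp_subset by blast

lemma point_coord: "p \<in> cdom c \<Longrightarrow> point c (coord c p) = p"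
  and coord_point: "y \<in> img c \<Longrightarrow> coord c (point c y) = y"
  and point_in: "y \<in> img c \<Longrightarrow> point c y \<in> cdom c"
  and cont_coord: "continuous_on (cdom c) (coord c)"
  and cont_point: "continuous_on (img c) (point c)"
  using homeo unfolding homeomorphism_def by auto

lemma inj_on_point: "inj_on (point c) (img c)"
  by (metis inj_onI coord_point)

lemma point_image_eq: "V \<subseteq> img c \<Longrightarrow> point c ` V = cdom c \<inter> coord c -` V"
  using point_coord coord_point point_in by (auto simp: image_iff) metis

lemma openin_point_image:
  assumes "open V" "V \<subseteq> img c"
  shows "openin (top_of_set M) (point c ` V)"
proof -
  have "openin (top_of_set (cdom c)) (cdom c \<inter> coord c -` V)"
    using cont_coord assms(1) continuous_openin_preimage_gen by blast
  then show ?thesis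
    using point_image_eq[OF assms(2)] openin_cdom openin_trans by metis
qed

lemma open_coord_image:
  assumes "openin (top_of_set M) U"
  shows "open (coord c ` (cdom c \<inter> U))"
proof -
  obtain O' where "open O'" "U = M \<inter> O'" using assms by (auto simp: openin_open)
  moreover have "openin (top_of_set (img c)) (img c \<inter> point c -` O')"
    using cont_point \<open>open O'\<close> continuous_openin_preimage_gen by blast
  moreover have "coord c ` (cdom c \<inter> U) = img c \<inter> point c -` O'"
    using \<open>U = M \<inter> O'\<close> cdom_sub by (auto simp: point_coord)
  ultimately show ?thesis using open_img openin_open_trans by metis
qed

lemma compact_point_image: "compact K \<Longrightarrow> K \<subseteq> img c \<Longrightarrow> compact (point c ` K)"
  using cont_point compact_continuous_image continuous_on_subset by blast

end

lemma open_overlap: "c \<in> \<A> \<Longrightarrow> d \<in> \<A> \<Longrightarrow> open (coord c ` (cdom c \<inter> cdom d))"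
  by (simp add: open_coord_image openin_cdom)

lemma smooth_transition:
  "c \<in> \<A> \<Longrightarrow> d \<in> \<A> \<Longrightarrow> smooth_on (transition c d) (coord c ` (cdom c \<inter> cdom d))"
  using atlas unfolding smooth_atlas_def by blast

lemma transition_coord:
  "c \<in> \<A> \<Longrightarrow> p \<in> cdom c \<Longrightarrow> transition c d (coord c p) = coord d p"
  by (simp add: transition_def point_coord)

lemma transition_has_derivative:
  assumes "c \<in> \<A>" "d \<in> \<A>" "p \<in> cdom c" "p \<in> cdom d"
  shows "(transition c d has_derivative Df (transition c d) (coord c p)) (at (coord c p))"
  using smooth_on_has_derivative[OF smooth_transition[OF assms(1,2)] open_overlap[OF assms(1,2)]] assms by blast

text \<open>The derivative is taken within \<open>I\<close> so that one-sided derivatives at the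
  ends of an interval transform as well. Continuity keeps the curve in \<open>cdom c\<close> near
  \<open>t\<close>, where the transition map expresses the coordinates in \<open>d\<close>.\<close>

lemma coord_curve_derivative:
  assumes "c \<in> \<A>" "d \<in> \<A>" "\<gamma> t \<in> cdom c" "\<gamma> t \<in> cdom d"
    and cont: "continuous_on I \<gamma>" "\<gamma> ` I \<subseteq> M" "t \<in> I"
    and v: "((coord c \<circ> \<gamma>) has_vector_derivative v) (at t within I)"
  shows "((coord d \<circ> \<gamma>) has_vector_derivative Df (transition c d) (coord c (\<gamma> t)) v) (at t within I)"
proof -
  have 1: "((\<lambda>s. transition c d ((coord c \<circ> \<gamma>) s)) has_vector_derivative Df (transition c d) (coord c (\<gamma> t)) v)
      (at t within I)"
    by (rule has_vector_derivative_compose_Df[OF _ v])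
       (use transition_has_derivative[OF assms(1-4)] in simp)
  obtain O' where "open O'" "cdom c = M \<inter> O'"
    using openin_cdom[OF assms(1)] by (auto simp: openin_open)
  have "(\<gamma> \<longlongrightarrow> \<gamma> t) (at t within I)" using cont by (simp add: continuous_on)
  then have "\<forall>\<^sub>F s in at t within I. \<gamma> s \<in> O'"
    using \<open>open O'\<close> assms(3) \<open>cdom c = M \<inter> O'\<close> topological_tendstoD by blast
  then have "\<forall>\<^sub>F s in at t within I. \<gamma> s \<in> cdom c"
    using \<open>cdom c = M \<inter> O'\<close> cont(2)
    by (auto simp: eventually_at_filter elim!: eventually_mono)
  then have "\<forall>\<^sub>F s in at t within I. transition c d ((coord c \<circ> \<gamma>) s) = (coord d \<circ> \<gamma>) s"
    by eventually_elim (simp add: transition_coord[OF assms(1)])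
  then show ?thesis
    unfolding has_vector_derivative_def
    by (rule has_derivative_transform_eventually[OF 1[unfolded has_vector_derivative_def] _ _ \<open>t \<in> I\<close>])
       (simp add: transition_coord[OF assms(1,3)])
qed

lemma smooth_curve_transition:
  assumes "c \<in> \<A>" "d \<in> \<A>" "open I" "\<gamma> ` I \<subseteq> cdom c \<inter> cdom d" "smooth_on (coord c \<circ> \<gamma>) I"
  shows "smooth_on (coord d \<circ> \<gamma>) I"
proof (rule smooth_on_cong[OF _ assms(3)])
  show "smooth_on (\<lambda>t. transition c d ((coord c \<circ> \<gamma>) t)) I"
    by (rule smooth_on_compose[OF assms(5) smooth_transition[OF assms(1,2)] assms(3) open_overlap[OF assms(1,2)]])
       (use assms(4) in auto)
  show "transition c d ((coord c \<circ> \<gamma>) t) = (coord d \<circ> \<gamma>) t" if "t \<in> I" for t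
    using that assms(4) by (auto simp: transition_coord[OF assms(1)])
qed

lemma continuous_curve:
  assumes "c \<in> \<A>" "\<gamma> ` I \<subseteq> cdom c" "continuous_on I (coord c \<circ> \<gamma>)"
  shows "continuous_on I \<gamma>"
proof -
  have "continuous_on I (\<lambda>t. point c ((coord c \<circ> \<gamma>) t))"
    by (rule continuous_on_compose2[OF cont_point[OF assms(1)] assms(3)]) (use assms(2) in auto)
  then show ?thesis
    by (rule continuous_on_eq) (use assms(2) point_coord[OF assms(1)] in auto)
qed

lemma open_preimage_cdom:
  assumes "c \<in> \<A>" "open I" "continuous_on I \<gamma>" "\<gamma> ` I \<subseteq> M"
  shows "open {t\<in>I. \<gamma> t \<in> cdom c}"
proof -
  obtain O' where "open O'" "cdom c = M \<inter> O'"
    using openin_cdom[OF assms(1)] by (auto simp: openin_open)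
  then have "{t\<in>I. \<gamma> t \<in> cdom c} = I \<inter> \<gamma> -` O'" using assms(4) by auto
  moreover have "open (I \<inter> \<gamma> -` O')"
    using continuous_on_open_vimage[OF assms(2), of \<gamma>] assms(3) \<open>open O'\<close> by (metis Int_commute)
  ultimately show ?thesis by simp
qed

text \<open>Being a smooth immersion is asked in one chart around each time;
  \<open>reg_chart\<close> carries it to all the others. Since each \<open>J\<close> lies inside
  \<open>I\<close>, openness of \<open>I\<close> is built in, and the notion is local
  (\<open>reg_local\<close>).\<close>

definition reg :: "(real \<Rightarrow> 'a) \<Rightarrow> real set \<Rightarrow> bool" where
  "reg \<gamma> I \<longleftrightarrow> (\<forall>t\<in>I. \<exists>c\<in>\<A>. \<exists>J. open J \<and> t \<in> J \<and> J \<subseteq> I \<and> \<gamma> ` J \<subseteq> cdom c \<and>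
     smooth_on (coord c \<circ> \<gamma>) J \<and> vd (coord c \<circ> \<gamma>) t \<noteq> 0)"

lemma reg_open: "reg \<gamma> I \<Longrightarrow> open I"
  unfolding reg_def by (metis open_subopen)

lemma reg_sub: "reg \<gamma> I \<Longrightarrow> \<gamma> ` I \<subseteq> M"
  unfolding reg_def using cdom_sub by blast

lemma reg_continuous: "reg \<gamma> I \<Longrightarrow> continuous_on I \<gamma>"
proof -
  assume r: "reg \<gamma> I"
  have "isCont \<gamma> t" if "t \<in> I" for t
  proof -
    obtain c J where "c \<in> \<A>" "open J" "t \<in> J" "\<gamma> ` J \<subseteq> cdom c" "smooth_on (coord c \<circ> \<gamma>) J"
      using r \<open>t \<in> I\<close> unfolding reg_def by metis
    then show ?thesis
      using continuous_curve smooth_on_continuous by (metis continuous_on_eq_continuous_at)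
  qed
  then show ?thesis by (simp add: continuous_at_imp_continuous_on)
qed

lemma reg_open_cdom: "reg \<gamma> I \<Longrightarrow> c \<in> \<A> \<Longrightarrow> open {t\<in>I. \<gamma> t \<in> cdom c}"
  by (rule open_preimage_cdom[OF _ reg_open reg_continuous reg_sub])

text \<open>Smoothness passes through the transition maps. A velocity vanishing in \<open>c\<close>
  would be sent to 0 by the differential of the transition map, against its being nonzero in the
  chart that \<open>reg\<close> provides.\<close>

lemma reg_chart:
  assumes "reg \<gamma> I" "c \<in> \<A>"
  shows "smooth_on (coord c \<circ> \<gamma>) {t\<in>I. \<gamma> t \<in> cdom c}" (is ?A)
    and "t \<in> I \<Longrightarrow> \<gamma> t \<in> cdom c \<Longrightarrow> vd (coord c \<circ> \<gamma>) t \<noteq> 0"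
proof -
  let ?I = "{t\<in>I. \<gamma> t \<in> cdom c}"
  have op: "open ?I" using reg_open_cdom[OF assms] .
  have *: "\<exists>J. open J \<and> t \<in> J \<and> smooth_on (coord c \<circ> \<gamma>) J \<and> vd (coord c \<circ> \<gamma>) t \<noteq> 0" if "t \<in> ?I" for t
  proof -
    obtain d J where d: "d \<in> \<A>" "open J" "t \<in> J" "J \<subseteq> I" "\<gamma> ` J \<subseteq> cdom d"
        "smooth_on (coord d \<circ> \<gamma>) J" "vd (coord d \<circ> \<gamma>) t \<noteq> 0"
      using assms(1) \<open>t \<in> ?I\<close> unfolding reg_def by blast
    let ?J = "J \<inter> ?I"
    have oJ: "open ?J" "?J \<subseteq> J" using d op by auto
    have s: "smooth_on (coord c \<circ> \<gamma>) ?J"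
      by (rule smooth_curve_transition[OF d(1) assms(2) oJ(1) _ smooth_on_subset[OF d(6) oJ(2)]])
         (use d in auto)
    have tJ: "t \<in> ?J" using that d by auto
    have "((coord d \<circ> \<gamma>) has_vector_derivative Df (transition c d) (coord c (\<gamma> t)) (vd (coord c \<circ> \<gamma>) t)) (at t)"
    proof -
      have "continuous_on I \<gamma>" "\<gamma> ` I \<subseteq> M" "t \<in> I"
        using reg_continuous[OF assms(1)] reg_sub[OF assms(1)] \<open>t \<in> ?I\<close> by auto
      moreover have "at t within I = at t"
        using reg_open[OF assms(1)] \<open>t \<in> I\<close> at_within_open by blast
      ultimately show ?thesis
        using coord_curve_derivative[of c d \<gamma> t I "vd (coord c \<circ> \<gamma>) t"] smooth_on_vd(1)[OF s oJ(1) tJ]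
          assms(2) d(1,3,5) \<open>t \<in> ?I\<close> by auto
    qed
    then have eq: "vd (coord d \<circ> \<gamma>) t = Df (transition c d) (coord c (\<gamma> t)) (vd (coord c \<circ> \<gamma>) t)"
      by (rule vector_derivative_at)
    have lin: "linear (Df (transition c d) (coord c (\<gamma> t)))"
      by (rule has_derivative_linear[OF transition_has_derivative[OF assms(2) d(1)]]) (use that d in auto)
    have "vd (coord c \<circ> \<gamma>) t \<noteq> 0"
      using eq d(7) linear_0[OF lin] by auto
    then show ?thesis using s oJ tJ by blast
  qed
  show ?A by (rule smooth_on_local[OF op]) (use * in blast)
  show "t \<in> I \<Longrightarrow> \<gamma> t \<in> cdom c \<Longrightarrow> vd (coord c \<circ> \<gamma>) t \<noteq> 0" using * by blast
qed

lemma reg_subset: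
  assumes "reg \<gamma> I" "J \<subseteq> I" "open J"
  shows "reg \<gamma> J"
  unfolding reg_def
proof
  fix t assume "t \<in> J"
  then obtain c where c: "c \<in> \<A>" "\<gamma> t \<in> cdom c" using assms reg_sub ex_chart by blast
  let ?K = "{t\<in>I. \<gamma> t \<in> cdom c} \<inter> J"
  have "open ?K \<and> t \<in> ?K \<and> ?K \<subseteq> J \<and> \<gamma> ` ?K \<subseteq> cdom c \<and> smooth_on (coord c \<circ> \<gamma>) ?K \<and> vd (coord c \<circ> \<gamma>) t \<noteq> 0"
    using reg_open_cdom[OF assms(1) c(1)] reg_chart[OF assms(1) c(1)] assms(2,3) \<open>t \<in> J\<close> c(2)
    by (auto intro: smooth_on_subset)
  then show "\<exists>c\<in>\<A>. \<exists>K. open K \<and> t \<in> K \<and> K \<subseteq> J \<and> \<gamma> ` K \<subseteq> cdom c \<and>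
     smooth_on (coord c \<circ> \<gamma>) K \<and> vd (coord c \<circ> \<gamma>) t \<noteq> 0" using c(1) by blast
qed

lemma reg_local:
  assumes "\<And>t. t \<in> I \<Longrightarrow> \<exists>J. t \<in> J \<and> J \<subseteq> I \<and> reg \<gamma> J"
  shows "reg \<gamma> I"
  using assms unfolding reg_def by (meson order_trans)

lemma reg_chartI:
  assumes "c \<in> \<A>" "open J" "x ` J \<subseteq> img c" "smooth_on x J" "\<And>t. t \<in> J \<Longrightarrow> vd x t \<noteq> 0"
    and eq: "\<And>t. t \<in> J \<Longrightarrow> \<gamma> t = point c (x t)"
  shows "reg \<gamma> J"
proof -
  have g: "\<gamma> ` J \<subseteq> cdom c" using assms(3) eq point_in[OF assms(1)] by auto
  have e: "x t = (coord c \<circ> \<gamma>) t" if "t \<in> J" for t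
    using that assms(3) eq[OF that] coord_point[OF assms(1)] by auto
  have s: "smooth_on (coord c \<circ> \<gamma>) J" by (rule smooth_on_cong[OF assms(4,2) e])
  have "vd (coord c \<circ> \<gamma>) t \<noteq> 0" if "t \<in> J" for t
  proof -
    have "((coord c \<circ> \<gamma>) has_vector_derivative vd x t) (at t)"
      by (rule has_vector_derivative_transform_within_open[OF smooth_on_vd(1)[OF assms(4,2) that] assms(2) that e])
    then show ?thesis using assms(5)[OF that] vector_derivative_at by metis
  qed
  then show ?thesis unfolding reg_def using assms(1,2) g s by blast
qed

subsection \<open>Smooth functions\<close>

text \<open>One chart around each point is enough because the transition maps are smooth, whereas
  \<open>smooth_function\<close> quantifies over all charts of the atlas.\<close>

lemma smooth_function_local:
  assumes "\<And>p. p \<in> M \<Longrightarrow> \<exists>d\<in>\<A>. p \<in> cdom d \<and> (\<exists>V. open V \<and> coord d p \<in> V \<and> V \<subseteq> img d \<and> smooth_on (u \<circ> point d) V)"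
  shows "smooth_function \<A> u"
  unfolding smooth_function_def
proof
  fix c assume c: "c \<in> \<A>"
  show "smooth_on (u \<circ> point c) (img c)"
  proof (rule smooth_on_local[OF open_img[OF c]])
    fix y assume y: "y \<in> img c"
    let ?p = "point c y"
    obtain d V where d: "d \<in> \<A>" "?p \<in> cdom d" "open V" "coord d ?p \<in> V" "V \<subseteq> img d" "smooth_on (u \<circ> point d) V"
      using assms point_in[OF c y] cdom_sub[OF c] by blast
    let ?O = "coord c ` (cdom c \<inter> cdom d)"
    define W where "W = ?O \<inter> transition c d -` V"
    have op: "open ?O" using open_overlap[OF c d(1)] .
    have W: "open W" unfolding W_def
      using continuous_open_preimage[OF smooth_on_continuous[OF smooth_transition[OF c d(1)]] op d(3)] .
    have "y \<in> ?O" using d(2) point_in[OF c y] coord_point[OF c y] by (metis IntI imageI)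
    then have yW: "y \<in> W" using d(4) by (simp add: W_def transition_def)
    have "smooth_on (\<lambda>z. (u \<circ> point d) (transition c d z)) W"
      by (rule smooth_on_compose[OF smooth_on_subset[OF smooth_transition[OF c d(1)]] d(6) W d(3)])
         (auto simp: W_def)
    then have "smooth_on (u \<circ> point c) W"
      by (rule smooth_on_cong[OF _ W])
         (auto simp: W_def transition_coord[OF c] point_coord[OF d(1)] point_coord[OF c])
    then show "\<exists>T. open T \<and> y \<in> T \<and> smooth_on (u \<circ> point c) T" using W yW by blast
  qed
qed

lemma smooth_function_chart: "smooth_function \<A> u \<Longrightarrow> c \<in> \<A> \<Longrightarrow> smooth_on (u \<circ> point c) (img c)"
  by (simp add: smooth_function_def)

lemma smooth_function_continuous:
  assumes "smooth_function \<A> u"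
  shows "continuous_on M u"
proof -
  have "continuous (at p within M) u" if "p \<in> M" for p
  proof -
    obtain c where c: "c \<in> \<A>" "p \<in> cdom c" using ex_chart \<open>p \<in> M\<close> by blast
    have "continuous_on (cdom c) (\<lambda>q. (u \<circ> point c) (coord c q))"
      by (rule continuous_on_compose2[OF smooth_on_continuous[OF smooth_function_chart[OF assms c(1)]] cont_coord[OF c(1)]]) auto
    then have "continuous_on (cdom c) u"
      by (rule continuous_on_eq) (simp add: point_coord[OF c(1)])
    then have "continuous (at p within cdom c) u"
      using c(2) continuous_on_eq_continuous_within by blast
    moreover obtain O' where "open O'" "cdom c = M \<inter> O'"
      using openin_cdom[OF c(1)] by (auto simp: openin_open)
    then have "at p within cdom c = at p within M"
      using c(2) by (intro at_within_nhd[of p O']) auto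
    ultimately show ?thesis by simp
  qed
  then show ?thesis by (simp add: continuous_on_eq_continuous_within)
qed

lemma smooth_function_const: "smooth_function \<A> (\<lambda>p. k)"
  unfolding smooth_function_def by (auto simp: o_def intro!: smooth_on_const open_img)

lemma smooth_function_add: "smooth_function \<A> u \<Longrightarrow> smooth_function \<A> v \<Longrightarrow> smooth_function \<A> (\<lambda>p. u p + v p)"
  unfolding smooth_function_def o_def by (auto intro!: smooth_on_add open_img)

lemma smooth_function_mult: "smooth_function \<A> u \<Longrightarrow> smooth_function \<A> v \<Longrightarrow> smooth_function \<A> (\<lambda>p. u p * v p)"
  unfolding smooth_function_def o_def by (auto intro!: smooth_on_mult open_img)

lemma smooth_function_diff: "smooth_function \<A> u \<Longrightarrow> smooth_function \<A> v \<Longrightarrow> smooth_function \<A> (\<lambda>p. u p - v p)"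
  unfolding smooth_function_def o_def by (auto intro!: smooth_on_diff open_img)

text \<open>The last property is the purpose of the bump: a function \<open>U\<close> that is smooth
  only around the closed disc becomes globally smooth after multiplication by \<beta>, whatever its
  values elsewhere.\<close>

lemma smooth_bump:
  assumes c: "c \<in> \<A>" and r: "r > 0" "cball x r \<subseteq> img c"
  obtains \<beta> where "\<And>p. 0 \<le> \<beta> p" "\<And>p. \<beta> p \<le> (1::real)"
    "\<And>p. p \<in> cdom c \<Longrightarrow> dist x (coord c p) \<le> r / 2 \<Longrightarrow> \<beta> p = 1"
    "\<And>p. p \<notin> point c ` cball x r \<Longrightarrow> \<beta> p = 0" "smooth_function \<A> \<beta>"
    "\<And>U. (\<And>y. y \<in> cball x r \<Longrightarrow> \<exists>V. open V \<and> y \<in> V \<and> V \<subseteq> img c \<and> smooth_on (U \<circ> point c) V) \<Longrightarrow>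
       smooth_function \<A> (\<lambda>p. \<beta> p * U p)"
proof -
  \<comment> \<open>The squared distance keeps the function smooth at the centre. The argument of
    the step is at least 1 for distance at most \<open>r / 2\<close>, and at most 0 once the squared
    distance reaches half of \<open>r^2\<close>, in particular off the disc.\<close>
  define \<psi> where "\<psi> = (\<lambda>y. smooth_step (2 - 4 * ((y - x) \<bullet> (y - x)) / r\<^sup>2))"
  define \<beta> where "\<beta> p = (if p \<in> cdom c then \<psi> (coord c p) else 0)" for p
  let ?K = "point c ` cball x r"
  have K: "compact ?K" "?K \<subseteq> cdom c" using compact_point_image[OF c _ r(2)] point_in[OF c] r(2) by auto
  have \<psi>: "smooth_on \<psi> UNIV" unfolding \<psi>_def
    by (rule smooth_on_compose[OF _ smooth_on_smooth_step])
       (auto intro!: smooth_on_diff smooth_on_const smooth_on_divide smooth_on_mult smooth_on_inner smooth_on_ident r(1)[THEN less_imp_neq, symmetric] simp: r(1)[THEN less_imp_neq, symmetric])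
  have \<psi>0: "\<psi> y = 0" if "y \<notin> cball x r" for y
  proof -
    have "r\<^sup>2 < (norm (y - x))\<^sup>2" using that r(1) by (intro power_strict_mono) (auto simp: dist_norm norm_minus_commute)
    then have "r\<^sup>2 < (y - x) \<bullet> (y - x)" by (simp add: power2_norm_eq_inner)
    moreover have "0 < r\<^sup>2" using r(1) by simp
    ultimately have "2 * r\<^sup>2 \<le> 4 * ((y - x) \<bullet> (y - x))" by linarith
    then have "4 * ((y - x) \<bullet> (y - x)) / r\<^sup>2 \<ge> 2"
      using \<open>0 < r\<^sup>2\<close> by (simp add: pos_le_divide_eq)
    then show ?thesis unfolding \<psi>_def by (intro smooth_step_0) simp
  qed
  have \<psi>1: "\<psi> y = 1" if "dist x y \<le> r / 2" for y
  proof -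
    have "(norm (y - x))\<^sup>2 \<le> (r / 2)\<^sup>2" using that by (intro power_mono) (auto simp: dist_norm norm_minus_commute)
    then have "4 * ((y - x) \<bullet> (y - x)) / r\<^sup>2 \<le> 1" using r(1) by (simp add: power2_norm_eq_inner power_divide pos_divide_le_eq)
    then show ?thesis unfolding \<psi>_def by (intro smooth_step_1) simp
  qed
  have 0: "\<beta> p = 0" if "p \<notin> ?K" for p
  proof (cases "p \<in> cdom c")
    case True
    then have "coord c p \<notin> cball x r"
      using that point_coord[OF c True] by (metis imageI)
    then show ?thesis by (simp add: \<beta>_def \<psi>0)
  qed (simp add: \<beta>_def)
  have main: "smooth_function \<A> (\<lambda>p. \<beta> p * U p)"
    if U: "\<And>y. y \<in> cball x r \<Longrightarrow> \<exists>V. open V \<and> y \<in> V \<and> V \<subseteq> img c \<and> smooth_on (U \<circ> point c) V" for U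
  proof (rule smooth_function_local)
    fix p assume "p \<in> M"
    show "\<exists>d\<in>\<A>. p \<in> cdom d \<and> (\<exists>V. open V \<and> coord d p \<in> V \<and> V \<subseteq> img d \<and> smooth_on ((\<lambda>p. \<beta> p * U p) \<circ> point d) V)"
    proof (cases "p \<in> ?K")
      case True
      then have p: "p \<in> cdom c" "coord c p \<in> cball x r" using K coord_point[OF c] r(2) by auto
      then obtain V where V: "open V" "coord c p \<in> V" "V \<subseteq> img c" "smooth_on (U \<circ> point c) V" using U by blast
      have "smooth_on (\<lambda>y. \<psi> y * (U \<circ> point c) y) V"
        by (intro smooth_on_mult V smooth_on_subset[OF \<psi>]) auto
      then have "smooth_on ((\<lambda>p. \<beta> p * U p) \<circ> point c) V"
        by (rule smooth_on_cong[OF _ V(1)])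
           (use V(3) in \<open>auto simp: \<beta>_def point_in[OF c] coord_point[OF c] subset_iff\<close>)
      then show ?thesis using p c V by blast
    next
      case False
      obtain d where d: "d \<in> \<A>" "p \<in> cdom d" using \<open>p \<in> M\<close> ex_chart by blast
      define V where "V = coord d ` (cdom d \<inter> (M - ?K))"
      \<comment> \<open>Compact sets are closed in a Hausdorff space, so the complement of the
        support disc is open and the product is 0 near \<open>p\<close>.\<close>
      have "openin (top_of_set M) (M - ?K)"
        using compact_imp_closed[OF K(1)] by (simp add: Diff_eq openin_open_Int open_Compl)
      then have V: "open V" "coord d p \<in> V" "V \<subseteq> img d"
        using open_coord_image[OF d(1)] False d \<open>p \<in> M\<close> by (auto simp: V_def)
      have "smooth_on ((\<lambda>p. \<beta> p * U p) \<circ> point d) V"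
        by (rule smooth_on_cong[OF smooth_on_const[OF V(1), of 0] V(1)])
           (auto simp: V_def point_coord[OF d(1)] 0)
      then show ?thesis using V d by blast
    qed
  qed
  have "smooth_function \<A> \<beta>"
  proof -
    have "smooth_function \<A> (\<lambda>p. \<beta> p * 1)"
      by (rule main, rule exI[of _ "img c"])
         (use r(2) open_img[OF c] smooth_on_const[OF open_img[OF c]] in \<open>auto simp: o_def\<close>)
    then show ?thesis by simp
  qed
  with that[of \<beta>] main 0 \<psi>1 smooth_step_bounds show ?thesis
    by (auto simp: \<beta>_def \<psi>_def)
qed

end

section \<open>Homotopies of paths\<close>

definition pth :: "'a::topological_space set \<Rightarrow> 'a \<Rightarrow> 'a \<Rightarrow> (real \<Rightarrow> 'a) \<Rightarrow> bool" where
  "pth M p q f \<longleftrightarrow> path f \<and> path_image f \<subseteq> M \<and> pathstart f = p \<and> pathfinish f = q"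

lemma pth_join: "pth M p q f \<Longrightarrow> pth M q r g \<Longrightarrow> pth M p r (f +++ g)"
  by (auto simp: pth_def subset_path_image_join)

lemma pth_reverse: "pth M p q f \<Longrightarrow> pth M q p (reversepath f)"
  by (auto simp: pth_def)

lemma pth_const: "p \<in> M \<Longrightarrow> pth M p p (\<lambda>_. p)"
  by (auto simp: pth_def path_def path_image_def pathstart_def pathfinish_def)

lemma pth_ends: "pth M p q f \<Longrightarrow> p \<in> M \<and> q \<in> M"
  unfolding pth_def using pathstart_in_path_image pathfinish_in_path_image by blast

lemma hp_refl: "pth M p q f \<Longrightarrow> homotopic_paths M f f"
  by (simp add: pth_def)

lemma hp_join:
  "pth M p q f \<Longrightarrow> pth M q r g \<Longrightarrow> homotopic_paths M f f' \<Longrightarrow> homotopic_paths M g g' \<Longrightarrow>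
    homotopic_paths M (f +++ g) (f' +++ g')"
  by (rule homotopic_paths_join) (auto simp: pth_def)

lemma hp_joinL: "pth M p q f \<Longrightarrow> pth M q r g \<Longrightarrow> homotopic_paths M f f' \<Longrightarrow> homotopic_paths M (f +++ g) (f' +++ g)"
  by (rule hp_join[OF _ _ _ hp_refl])

lemma hp_joinR: "pth M p q f \<Longrightarrow> pth M q r g \<Longrightarrow> homotopic_paths M g g' \<Longrightarrow> homotopic_paths M (f +++ g) (f +++ g')"
  by (rule hp_join[OF _ _ hp_refl])

lemma hp_assoc: "pth M p q f \<Longrightarrow> pth M q r g \<Longrightarrow> pth M r s h \<Longrightarrow>
    homotopic_paths M (f +++ (g +++ h)) ((f +++ g) +++ h)"
  by (rule homotopic_paths_assoc) (auto simp: pth_def)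

lemmas hp_sym = homotopic_paths_sym
lemmas hp_trans [trans] = homotopic_paths_trans

text \<open>Two paths in a convex set are homotopic along straight lines, and \<open>f\<close>
  carries the homotopy to \<open>M\<close>. With an interval for \<open>S\<close> and polygons of
  line segments for the paths, the reparametrisation identities below become instances.\<close>

lemma homotopic_paths_pullback:
  fixes f :: "'b::real_normed_vector \<Rightarrow> 'a::topological_space"
  assumes "continuous_on S f" "convex S" "f ` S \<subseteq> M" "pth S x y a" "pth S x y b"
  shows "homotopic_paths M (f \<circ> a) (f \<circ> b)"
proof (rule homotopic_paths_continuous_image)
  show "homotopic_paths S a b"
  proof (rule homotopic_paths_linear)
    fix t :: real assume "t \<in> {0..1}"
    then have "a t \<in> S" "b t \<in> S" using assms(4,5) by (auto simp: pth_def path_image_def)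
    then show "closed_segment (a t) (b t) \<subseteq> S" using assms(2) closed_segment_subset by blast
  qed (use assms(4,5) in \<open>auto simp: pth_def\<close>)
qed (use assms in auto)

lemma pth_linepath: "closed_segment x y \<subseteq> S \<Longrightarrow> pth S x y (linepath x y)"
  by (simp add: pth_def)

lemma hp_const_right:
  assumes f: "pth M p q f" shows "homotopic_paths M (f +++ (\<lambda>_. q)) f"
proof -
  have "homotopic_paths M (f \<circ> (linepath 0 1 +++ linepath 1 1)) (f \<circ> linepath 0 1)"
    by (rule homotopic_paths_pullback[OF _ _ _ pth_join[OF pth_linepath pth_linepath] pth_linepath, where S = "{0..1}"])
       (use f in \<open>auto simp: pth_def path_def path_image_def closed_segment_eq_real_ivl\<close>)
  moreover have "f \<circ> linepath 0 1 = f" by (auto simp: linepath_def)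
  moreover have "f \<circ> linepath 1 1 = (\<lambda>_. q)" using f by (auto simp: linepath_def pth_def pathfinish_def)
  ultimately show ?thesis by (simp add: path_compose_join)
qed

lemma hp_reverse_right:
  assumes f: "pth M p q f" shows "homotopic_paths M (f +++ reversepath f) (\<lambda>_. p)"
proof -
  have "homotopic_paths M (f \<circ> (linepath 0 1 +++ linepath 1 0)) (f \<circ> linepath 0 0)"
    by (rule homotopic_paths_pullback[OF _ _ _ pth_join[OF pth_linepath pth_linepath] pth_linepath, where S = "{0..1}"])
       (use f in \<open>auto simp: pth_def path_def path_image_def closed_segment_eq_real_ivl\<close>)
  moreover have "f \<circ> linepath 0 1 = f" by (auto simp: linepath_def)
  moreover have "f \<circ> linepath 1 0 = reversepath f" by (auto simp: linepath_def reversepath_def)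
  moreover have "f \<circ> linepath 0 0 = (\<lambda>_. p)" using f by (auto simp: linepath_def pth_def pathstart_def)
  ultimately show ?thesis by (simp add: path_compose_join)
qed

lemma hp_reverse_left:
  assumes f: "pth M p q f" shows "homotopic_paths M (reversepath f +++ f) (\<lambda>_. q)"
  using hp_reverse_right[OF pth_reverse[OF f]] by simp

lemma hp_const_left:
  assumes f: "pth M p q f" shows "homotopic_paths M ((\<lambda>_. p) +++ f) f"
proof -
  have "homotopic_paths M (f \<circ> (linepath 0 0 +++ linepath 0 1)) (f \<circ> linepath 0 1)"
    by (rule homotopic_paths_pullback[OF _ _ _ pth_join[OF pth_linepath pth_linepath] pth_linepath, where S = "{0..1}"])
       (use f in \<open>auto simp: pth_def path_def path_image_def closed_segment_eq_real_ivl\<close>)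
  moreover have "f \<circ> linepath 0 1 = f" by (auto simp: linepath_def)
  moreover have "f \<circ> linepath 0 0 = (\<lambda>_. p)" using f by (auto simp: linepath_def pth_def pathstart_def)
  ultimately show ?thesis by (simp add: path_compose_join)
qed

definition piece :: "real \<Rightarrow> real \<Rightarrow> (real \<Rightarrow> 'a) \<Rightarrow> real \<Rightarrow> 'a" where
  "piece u v f = f \<circ> linepath u v"

lemma pth_piece:
  fixes f :: "real \<Rightarrow> 'a::topological_space"
  assumes "continuous_on S f" "f ` S \<subseteq> M" "closed_segment u v \<subseteq> S"
  shows "pth M (f u) (f v) (piece u v f)"
proof -
  have "linepath u v ` {0..1} \<subseteq> S" using assms(3) by (auto simp: linepath_image_01)
  then have "continuous_on {0..1} (f \<circ> linepath u v)" "(f \<circ> linepath u v) ` {0..1} \<subseteq> M"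
    using continuous_on_compose[OF continuous_on_linepath continuous_on_subset[OF assms(1)]] assms(2)
    by (simp, metis image_comp image_mono order_trans)
  then show ?thesis
    by (simp add: pth_def path_def path_image_def piece_def pathstart_def pathfinish_def
        linepath_0' linepath_1')
qed

lemma hp_join_pieces:
  fixes f :: "real \<Rightarrow> 'a::topological_space"
  assumes "continuous_on S f" "convex S" "f ` S \<subseteq> M" "u \<in> S" "v \<in> S" "w \<in> S"
  shows "homotopic_paths M (piece u v f +++ piece v w f) (piece u w f)"
proof -
  have seg: "closed_segment x y \<subseteq> S" if "x \<in> S" "y \<in> S" for x y
    using that assms(2) closed_segment_subset by blast
  have "homotopic_paths M (f \<circ> (linepath u v +++ linepath v w)) (f \<circ> linepath u w)"
    by (rule homotopic_paths_pullback[where S = S and x = u and y = w, OF assms(1-3)])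
       (use seg assms in \<open>auto simp: pth_def path_image_join\<close>)
  then show ?thesis by (simp add: path_compose_join piece_def)
qed

text \<open>The boundary of the square, traversed the long way, shows that the free homotopy \<open>h\<close> gives
  a homotopy of \<open>p\<close> with \<open>l * const * l\<^sup>-\<^sup>1\<close>, where \<open>l\<close> is the track of the base point.\<close>

lemma null_homotopic_loop_based:
  fixes p :: "real \<Rightarrow> 'a::topological_space"
  assumes "homotopic_loops M p (\<lambda>_. a)"
  shows "homotopic_paths M p (\<lambda>_. pathstart p)"
proof -
  obtain h where h: "continuous_on ({0..1::real} \<times> {0..1::real}) h" "h \<in> ({0..1} \<times> {0..1}) \<rightarrow> M"
     "\<forall>x\<in>{0..1}. h(0,x) = p x" "\<forall>x\<in>{0..1}. h(1,x) = a"
     "\<forall>t\<in>{0..1}. pathfinish(h \<circ> Pair t) = pathstart(h \<circ> Pair t)"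
    using assms unfolding homotopic_loops by blast
  let ?S = "{0..1::real} \<times> {0..1::real}"
  have conv: "convex ?S" by (intro convex_Times) auto
  have seg: "closed_segment x y \<subseteq> ?S" if "x \<in> ?S" "y \<in> ?S" for x y
    by (rule closed_segment_subset[OF that conv])
  define l where "l = h \<circ> linepath (0,0) (1,0)"
  have line: "pth M (h x) (h y) (h \<circ> linepath x y)" if "x \<in> ?S" "y \<in> ?S" for x y
  proof -
    have "linepath x y ` {0..1} \<subseteq> ?S" using seg[OF that] by (auto simp: linepath_image_01)
    have c1: "continuous_on {0..1} (h \<circ> linepath x y)"
      by (rule continuous_on_compose[OF continuous_on_linepath continuous_on_subset[OF h(1)]]) fact
    have c2: "(h \<circ> linepath x y) ` {0..1} \<subseteq> M"
    proof (rule image_subsetI)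
      fix t :: real assume "t \<in> {0..1}"
      then have "linepath x y t \<in> ?S" using \<open>linepath x y ` {0..1} \<subseteq> ?S\<close> by (rule image_subset_iff[THEN iffD1, rule_format, rotated])
      from funcset_mem[OF h(2) this] show "(h \<circ> linepath x y) t \<in> M" by simp
    qed
    from c1 c2 show ?thesis
      by (simp add: pth_def path_def path_image_def pathstart_def pathfinish_def linepath_0' linepath_1')
  qed
  have "homotopic_paths M (h \<circ> linepath (0,0) (0,1))
     (h \<circ> (linepath (0,0) (1,0) +++ (linepath (1,0) (1,1) +++ linepath (1,1) (0,1))))"
    by (rule homotopic_paths_pullback[where S = ?S and x = "(0,0)" and y = "(0,1)", OF h(1) conv])
       (use h(2) seg in \<open>auto simp: pth_def path_image_join\<close>)
  moreover have "homotopic_paths M p (h \<circ> linepath (0,0) (0,1))"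
  proof (rule hp_sym, rule homotopic_paths_eq)
    show "path (h \<circ> linepath (0,0) (0,1))" "path_image (h \<circ> linepath (0,0) (0,1)) \<subseteq> M"
      using line[of "(0,0)" "(0,1)"] by (auto simp: pth_def)
    show "\<And>t. t \<in> {0..1} \<Longrightarrow> (h \<circ> linepath (0,0) (0,1)) t = p t"
      using h(3) by (auto simp: linepath_def)
  qed
  ultimately have 1: "homotopic_paths M p (l +++ ((h \<circ> linepath (1,0) (1,1)) +++ (h \<circ> linepath (1,1) (0,1))))"
    by (simp add: path_compose_join l_def hp_trans)
  have ll: "pth M (h (0,0)) (h (1,0)) l" unfolding l_def by (rule line) auto
  have m: "pth M (h (1,0)) (h (1,1)) (h \<circ> linepath (1,0) (1,1))" by (rule line) auto
  have r: "pth M (h (1,1)) (h (0,1)) (h \<circ> linepath (1,1) (0,1))" by (rule line) auto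
  have e: "h (1,0) = a" "h (1,1) = a" "h (0,1) = h (0,0)" "h (0,0) = p 0"
    using h(3-5) by (auto simp: pathstart_def pathfinish_def)
  have m': "homotopic_paths M (h \<circ> linepath (1,0) (1,1)) (\<lambda>_. a)"
    by (rule homotopic_paths_eq) (use m h(4) in \<open>auto simp: pth_def linepath_def\<close>)
  have r': "homotopic_paths M (h \<circ> linepath (1,1) (0,1)) (reversepath l)"
  proof (rule homotopic_paths_eq)
    fix t :: real assume "t \<in> {0..1}"
    then have "h (1 - t, 1) = h (1 - t, 0)"
      using h(5)[rule_format, of "1 - t"] by (simp add: pathstart_def pathfinish_def)
    then show "(h \<circ> linepath (1,1) (0,1)) t = reversepath l t"
      by (simp add: l_def linepath_def reversepath_def)
  qed (use r in \<open>auto simp: pth_def\<close>)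
  have "homotopic_paths M ((h \<circ> linepath (1,0) (1,1)) +++ (h \<circ> linepath (1,1) (0,1))) ((\<lambda>_. a) +++ reversepath l)"
    using hp_join[OF m r m' r'] .
  also have "homotopic_paths M \<dots> (reversepath l)"
    using hp_const_left[OF pth_reverse[OF ll]] e by simp
  finally have "homotopic_paths M (l +++ ((h \<circ> linepath (1,0) (1,1)) +++ (h \<circ> linepath (1,1) (0,1)))) (l +++ reversepath l)"
    using hp_joinR[OF ll] pth_join[OF m r] by blast
  also have "homotopic_paths M \<dots> (\<lambda>_. pathstart p)"
    using hp_reverse_right[OF ll] e by (simp add: pathstart_def)
  finally show ?thesis using 1 hp_trans by blast
qed

text \<open>A null-homotopic product makes \<open>g\<close> homotopic to the inverse of
  \<open>f\<close>. The lemma moves the base point of a closed curve from one of its points to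
  another.\<close>

lemma null_homotopic_swap:
  assumes f: "pth M p q f" and g: "pth M q p g" and "homotopic_paths M (f +++ g) (\<lambda>_. p)"
  shows "homotopic_paths M (g +++ f) (\<lambda>_. q)"
proof -
  note rf = pth_reverse[OF f] and fg = pth_join[OF f g]
  have "homotopic_paths M g ((\<lambda>_. q) +++ g)" using hp_sym hp_const_left[OF g] by blast
  also have "homotopic_paths M \<dots> ((reversepath f +++ f) +++ g)"
    by (rule hp_joinL[OF pth_const g hp_sym[OF hp_reverse_left[OF f]]]) (use pth_ends[OF f] in simp)
  also have "homotopic_paths M \<dots> (reversepath f +++ (f +++ g))"
    by (rule hp_sym[OF hp_assoc[OF rf f g]])
  also have "homotopic_paths M \<dots> (reversepath f +++ (\<lambda>_. p))"
    by (rule hp_joinR[OF rf fg assms(3)])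
  also have "homotopic_paths M \<dots> (reversepath f)" by (rule hp_const_right[OF rf])
  finally have "homotopic_paths M (g +++ f) (reversepath f +++ f)" by (rule hp_joinL[OF g f])
  also have "homotopic_paths M \<dots> (\<lambda>_. q)" by (rule hp_reverse_left[OF f])
  finally show ?thesis .
qed

lemma hp_remove_null_loop:
  assumes f: "pth M p q f" and h: "pth M q q h" and k: "pth M q r k" and "homotopic_paths M h (\<lambda>_. q)"
  shows "homotopic_paths M (f +++ (h +++ k)) (f +++ k)"
proof -
  have "homotopic_paths M (h +++ k) ((\<lambda>_. q) +++ k)" by (rule hp_joinL[OF h k assms(4)])
  also have "homotopic_paths M \<dots> k" by (rule hp_const_left[OF k])
  finally show ?thesis by (rule hp_joinR[OF f pth_join[OF h k]])
qed

section \<open>The first homology group of a simply connected space\<close>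

text \<open>The second barycentric coordinate serves as the parameter of the path;
  \<open>edge_point\<close> parametrises the edge in return.\<close>

definition path_simplex :: "(real \<Rightarrow> 'a) \<Rightarrow> (nat \<Rightarrow> real) \<Rightarrow> 'a" where
  "path_simplex a = restrict (\<lambda>x. a (x 1)) (standard_simplex 1)"

definition edge_point :: "real \<Rightarrow> nat \<Rightarrow> real" where
  "edge_point t = (\<lambda>i. if i = 0 then 1 - t else if i = 1 then t else 0)"

lemma simplex1: "x \<in> standard_simplex 1 \<Longrightarrow> x 0 = 1 - x 1 \<and> 0 \<le> x 1 \<and> x 1 \<le> 1 \<and> x = edge_point (x 1)"
  by (auto simp: standard_simplex_def edge_point_def fun_eq_iff)

lemma simplex2: "x \<in> standard_simplex 2 \<longleftrightarrow>
    0 \<le> x 0 \<and> 0 \<le> x 1 \<and> 0 \<le> x 2 \<and> x 0 + x 1 + x 2 = 1 \<and> (\<forall>i>2. x i = 0)"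
proof
  assume "x \<in> standard_simplex 2"
  then show "0 \<le> x 0 \<and> 0 \<le> x 1 \<and> 0 \<le> x 2 \<and> x 0 + x 1 + x 2 = 1 \<and> (\<forall>i>2. x i = 0)"
    by (auto simp: standard_simplex_def numeral_2_eq_2)
next
  assume x: "0 \<le> x 0 \<and> 0 \<le> x 1 \<and> 0 \<le> x 2 \<and> x 0 + x 1 + x 2 = 1 \<and> (\<forall>i>2. x i = 0)"
  have "0 \<le> x i \<and> x i \<le> 1" for i
  proof -
    consider "i = 0" | "i = 1" | "i = 2" | "i > 2" by linarith
    then show ?thesis using x by cases auto
  qed
  then show "x \<in> standard_simplex 2" using x by (auto simp: standard_simplex_def numeral_2_eq_2)
qed

lemma edge_point_in: "0 \<le> t \<Longrightarrow> t \<le> 1 \<Longrightarrow> edge_point t \<in> standard_simplex 1"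
  by (auto simp: standard_simplex_def edge_point_def)

lemma continuous_edge_point: "continuous_on S edge_point"
proof (rule continuous_on_coordinatewise_then_product)
  show "continuous_on S (\<lambda>t. edge_point t i)" for i
    unfolding edge_point_def by (cases "i = 0"; cases "i = 1") (auto intro!: continuous_intros)
qed

lemma singular_simplex_iff:
  "singular_simplex p (top_of_set M) f \<longleftrightarrow>
     continuous_on (standard_simplex p) f \<and> f ` standard_simplex p \<subseteq> M \<and> f \<in> extensional (standard_simplex p)"
  unfolding singular_simplex_def euclidean_product_topology
  by (auto simp: continuous_map_in_subtopology)

text \<open>A homotopy with fixed end points from \<open>a +++ b\<close> to \<open>c\<close> is a
  map on a square that is constant on two opposite sides. Collapsing these sides to vertices turns
  the square into the triangle; the collapse \<open>Q\<close> is a quotient map, being continuous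
  from a compact space onto a Hausdorff one, so the homotopy descends.\<close>

lemma triangle_filling:
  fixes M :: "'a::topological_space set"
  assumes a: "pth M p q a" and b: "pth M q r b" and c: "pth M p r c" and hom: "homotopic_paths M (a +++ b) c"
  obtains T where "singular_simplex 2 (top_of_set M) T"
    "singular_face 2 0 T = path_simplex b" "singular_face 2 1 T = path_simplex c" "singular_face 2 2 T = path_simplex a"
proof -
  let ?I = "{0..1::real} \<times> {0..1::real}"
  obtain H where H: "continuous_on ?I H" "H ` ?I \<subseteq> M" "\<And>t. t \<in> {0..1} \<Longrightarrow> H (0,t) = (a +++ b) t"
     "\<And>t. t \<in> {0..1} \<Longrightarrow> H (1,t) = c t" "\<And>u. u \<in> {0..1} \<Longrightarrow> H (u,0) = p" "\<And>u. u \<in> {0..1} \<Longrightarrow> H (u,1) = r"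
    using hom a b c unfolding homotopic_paths pth_def
    by (auto simp: pathstart_def pathfinish_def image_subset_iff_funcset joinpaths_def)
  \<comment> \<open>The tent with \<open>m 0 = m 1 = 0\<close> and \<open>m (1/2) = 1\<close>. In
    barycentric coordinates \<open>Q\<close> sends the side \<open>u = 0\<close> to the two edges
    through vertex 1 and the side \<open>u = 1\<close> to the edge opposite to it. The functions
    \<tau> and \<upsilon> recover \<open>t\<close> and, where the tent is positive,
    \<open>u\<close>.\<close>
  define m where "m t = min (2 * t) (2 - 2 * t)" for t :: real
  define Q :: "real \<times> real \<Rightarrow> nat \<Rightarrow> real" where
    "Q z = (\<lambda>i. if i = 0 then 1 - snd z - (1 - fst z) * m (snd z) / 2 else if i = 1 then (1 - fst z) * m (snd z)
       else if i = 2 then snd z - (1 - fst z) * m (snd z) / 2 else 0)" for z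
  define \<tau> where "\<tau> x = x 2 + x 1 / 2" for x :: "nat \<Rightarrow> real"
  define \<upsilon> where "\<upsilon> x = 1 - x 1 / m (\<tau> x)" for x :: "nat \<Rightarrow> real"
  have m0: "m t = 0 \<longleftrightarrow> t = 0 \<or> t = 1" "0 \<le> m t" "m t \<le> 2 * t" "m t \<le> 2 - 2 * t" if "t \<in> {0..1}" for t
    using that by (auto simp: m_def min_def)
  have QI: "Q ` ?I = standard_simplex 2"
  proof (rule equalityI; rule subsetI)
    fix x assume "x \<in> Q ` ?I"
    then obtain u t where ut: "u \<in> {0..1}" "t \<in> {0..1}" "x = Q (u,t)" by auto
    have "0 \<le> (1 - u) * m t" "(1 - u) * m t \<le> m t"
      using ut m0[OF ut(2)] by (auto simp: mult_left_le_one_le)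
    then show "x \<in> standard_simplex 2"
      unfolding simplex2 ut(3) using m0(3,4)[OF ut(2)] by (auto simp: Q_def)
  next
    fix x assume x: "x \<in> standard_simplex 2"
    have \<tau>: "\<tau> x \<in> {0..1}" "x 1 \<le> m (\<tau> x)" using x by (auto simp: simplex2 \<tau>_def m_def)
    have u: "\<upsilon> x \<in> {0..1}"
      using \<tau> m0(1,2)[OF \<tau>(1)] x by (cases "m (\<tau> x) = 0") (auto simp: \<upsilon>_def simplex2 divide_le_eq_1)
    have "(1 - \<upsilon> x) * m (\<tau> x) = x 1"
      using \<tau> x m0[OF \<tau>(1)] by (cases "m (\<tau> x) = 0") (auto simp: \<upsilon>_def simplex2)
    moreover have "x i = Q (\<upsilon> x, \<tau> x) i" if "(1 - \<upsilon> x) * m (\<tau> x) = x 1" for i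
    proof -
      consider "i = 0" | "i = 1" | "i = 2" | "i > 2" by linarith
      then show ?thesis using x that unfolding simplex2 Q_def by cases (auto simp: \<tau>_def)
    qed
    ultimately have "x = Q (\<upsilon> x, \<tau> x)" by blast
    then show "x \<in> Q ` ?I" using u \<tau> by (metis image_eqI SigmaI)
  qed
  define T0 where "T0 x = H (\<upsilon> x, \<tau> x)" for x
  have T0Q: "T0 (Q z) = H z" if "z \<in> ?I" for z
  proof -
    obtain u t where z: "z = (u,t)" "u \<in> {0..1}" "t \<in> {0..1}" using \<open>z \<in> ?I\<close> by auto
    have \<tau>: "\<tau> (Q z) = t" by (simp add: \<tau>_def Q_def z)
    show ?thesis
    proof (cases "t = 0 \<or> t = 1")
      case True
      \<comment> \<open>Division by 0 gives 0, hence the value 1. It may differ from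
        \<open>u\<close>, which does no harm because the homotopy does not depend on
        \<open>u\<close> on these two sides.\<close>
      then have "\<upsilon> (Q z) = 1" using m0(1)[OF z(3)] \<tau> by (simp add: \<upsilon>_def)
      then show ?thesis unfolding T0_def \<tau> using True H(5,6)[of 1] H(5,6)[of u] z by auto
    next
      case False
      then have "m t \<noteq> 0" using m0(1)[OF z(3)] by simp
      then have "\<upsilon> (Q z) = u" unfolding \<upsilon>_def \<tau> by (simp add: Q_def z)
      then show ?thesis unfolding T0_def using \<tau> z(1) by simp
    qed
  qed
  have contQ: "continuous_on ?I Q"
  proof (rule continuous_on_coordinatewise_then_product)
    fix i :: nat
    consider "i = 0" | "i = 1" | "i = 2" | "i > 2" by linarith
    then show "continuous_on ?I (\<lambda>z. Q z i)"
      by cases (auto simp: Q_def m_def intro!: continuous_intros)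
  qed
  have "quotient_map (top_of_set ?I) (top_of_set (standard_simplex 2)) Q"
    by (rule T1_Spaces.continuous_imp_quotient_map)
       (use contQ QI in \<open>auto simp: compact_space_subtopology compact_Times Hausdorff_space_subtopology\<close>)
  moreover have "continuous_map (top_of_set ?I) (top_of_set M) (T0 \<circ> Q)"
    using H(1,2) T0Q by (auto simp: image_subset_iff cong: continuous_on_cong)
  ultimately have "continuous_map (top_of_set (standard_simplex 2)) (top_of_set M) T0"
    using continuous_compose_quotient_map by blast
  then have T0: "continuous_on (standard_simplex 2) T0" "T0 ` standard_simplex 2 \<subseteq> M"
    by (auto simp: continuous_map_in_subtopology)
  define T where "T = restrict T0 (standard_simplex 2)"
  have T: "singular_simplex 2 (top_of_set M) T"
    using T0 unfolding singular_simplex_iff T_def by (auto cong: continuous_on_cong_simp)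
  have face: "singular_face 2 k T = path_simplex f"
    if "k \<le> 2" and f: "\<And>t. t \<in> {0..1} \<Longrightarrow> T0 (simplical_face k (edge_point t)) = f t" for k f
  proof -
    have "T (simplical_face k x) = f (x 1)" if x: "x \<in> standard_simplex 1" for x
    proof -
      have "simplical_face k x \<in> standard_simplex 2"
        using simplical_face_in_standard_simplex[of 2 k x] x \<open>k \<le> 2\<close> by simp
      then show ?thesis using f[of "x 1"] simplex1[OF x] by (auto simp: T_def)
    qed
    then show ?thesis by (auto simp: singular_face_def path_simplex_def)
  qed
  have ends: "a 0 = p" "a 1 = q" "b 0 = q" "b 1 = r" using a b by (auto simp: pth_def pathstart_def pathfinish_def)
  have "singular_face 2 0 T = path_simplex b"
  proof (rule face)
    fix t :: real assume t: "t \<in> {0..1}"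
    let ?x = "simplical_face 0 (edge_point t)"
    have \<tau>: "\<tau> ?x = (1 + t) / 2" and "m (\<tau> ?x) = 1 - t" "?x 1 = 1 - t"
      using t by (auto simp: \<tau>_def simplical_face_def edge_point_def m_def field_simps)
    then have "\<upsilon> ?x = (if t = 1 then 1 else 0)" by (simp add: \<upsilon>_def)
    then show "T0 ?x = b t"
      using t ends H(3)[of "(1 + t)/2"] H(6)[of 1] unfolding T0_def \<tau> by (auto simp: joinpaths_def field_simps)
  qed simp
  moreover have "singular_face 2 1 T = path_simplex c"
  proof (rule face)
    fix t :: real assume t: "t \<in> {0..1}"
    let ?x = "simplical_face 1 (edge_point t)"
    have "\<tau> ?x = t" "\<upsilon> ?x = 1" by (auto simp: \<tau>_def \<upsilon>_def simplical_face_def edge_point_def)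
    then show "T0 ?x = c t" using H(4)[OF t] by (simp add: T0_def)
  qed simp
  moreover have "singular_face 2 2 T = path_simplex a"
  proof (rule face)
    fix t :: real assume t: "t \<in> {0..1}"
    let ?x = "simplical_face 2 (edge_point t)"
    have \<tau>: "\<tau> ?x = t / 2" and "m (\<tau> ?x) = t" "?x 1 = t"
      using t by (auto simp: \<tau>_def simplical_face_def edge_point_def m_def field_simps)
    then have "\<upsilon> ?x = (if t = 0 then 1 else 0)" by (simp add: \<upsilon>_def)
    then show "T0 ?x = a t"
      using t ends H(3)[of "t/2"] H(5)[of 1] unfolding T0_def \<tau> by (auto simp: joinpaths_def field_simps)
  qed simp
  ultimately show ?thesis using that T by blast
qed

text \<open>Coning from \<open>x0\<close>: a path \<open>P y\<close> is chosen to every point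
  \<open>y\<close>. For a 1-simplex \<open>s\<close>, the path to its start followed by
  \<open>s\<close> is homotopic to the path to its end, so a 2-simplex fills the triangle with these
  sides. Extended linearly, the fillings satisfy
  \<open>\<partial> F c = c - G (\<partial> c)\<close>, where \<open>G\<close> puts the chosen path
  in place of each vertex; a cycle \<open>z\<close> is thus the boundary of
  \<open>F z\<close>.\<close>

lemma simply_connected_boundary:
  fixes M :: "'a::topological_space set"
  assumes conn: "\<And>x y. x \<in> M \<Longrightarrow> y \<in> M \<Longrightarrow> \<exists>f. pth M x y f"
    and null: "\<And>x f. pth M x x f \<Longrightarrow> homotopic_paths M f (\<lambda>_. x)"
    and "M \<noteq> {}" and z: "singular_chain 1 (top_of_set M) z" "chain_boundary 1 z = 0"
  shows "singular_relboundary 1 (top_of_set M) {} z"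
proof -
  let ?X = "top_of_set M"
  obtain x0 where x0: "x0 \<in> M" using \<open>M \<noteq> {}\<close> by blast
  obtain P where P: "\<And>y. y \<in> M \<Longrightarrow> pth M x0 y (P y)" using conn[OF x0] by metis
  have path_of: "pth M (s (edge_point 0)) (s (edge_point 1)) (s \<circ> edge_point) \<and> path_simplex (s \<circ> edge_point) = s"
    if s: "singular_simplex 1 ?X s" for s
  proof
    have "edge_point ` {0..1} \<subseteq> standard_simplex 1" using edge_point_in by auto
    then have "continuous_on {0..1} (s \<circ> edge_point)" "(s \<circ> edge_point) ` {0..1} \<subseteq> M"
      using s continuous_on_compose[OF continuous_edge_point continuous_on_subset]
      unfolding singular_simplex_iff by fastforce+
    then show "pth M (s (edge_point 0)) (s (edge_point 1)) (s \<circ> edge_point)"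
      by (simp add: pth_def path_def path_image_def pathstart_def pathfinish_def)
    show "path_simplex (s \<circ> edge_point) = s"
      using s simplex1 unfolding singular_simplex_iff path_simplex_def
      by (auto simp: fun_eq_iff restrict_def extensional_def) metis
  qed
  have "\<exists>T. singular_simplex 2 ?X T \<and> singular_face 2 0 T = s \<and>
      singular_face 2 1 T = path_simplex (P (s (edge_point 1))) \<and>
      singular_face 2 2 T = path_simplex (P (s (edge_point 0)))"
    if s: "singular_simplex 1 ?X s" for s
  proof -
    let ?s = "s \<circ> edge_point"
    note ps = path_of[OF s, THEN conjunct1]
    have pq: "s (edge_point 0) \<in> M" "s (edge_point 1) \<in> M" using pth_ends[OF ps] by auto
    note a = P[OF pq(1)] and c = P[OF pq(2)]
    note ab = pth_join[OF a ps]
    have "homotopic_paths M ((P (s (edge_point 0)) +++ ?s) +++ reversepath (P (s (edge_point 1)))) (\<lambda>_. x0)"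
      by (rule null[OF pth_join[OF ab pth_reverse[OF c]]])
    from hp_joinL[OF pth_join[OF ab pth_reverse[OF c]] c this]
    have 1: "homotopic_paths M (((P (s (edge_point 0)) +++ ?s) +++ reversepath (P (s (edge_point 1)))) +++ P (s (edge_point 1)))
        (P (s (edge_point 1)))"
      using hp_const_left[OF c] hp_trans by blast
    have "homotopic_paths M (P (s (edge_point 0)) +++ ?s) ((P (s (edge_point 0)) +++ ?s) +++ (\<lambda>_. s (edge_point 1)))"
      by (rule hp_sym[OF hp_const_right[OF ab]])
    also have "homotopic_paths M \<dots> ((P (s (edge_point 0)) +++ ?s) +++ (reversepath (P (s (edge_point 1))) +++ P (s (edge_point 1))))"
      by (rule hp_joinR[OF ab pth_const[OF pq(2)] hp_sym[OF hp_reverse_left[OF c]]])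
    also have "homotopic_paths M \<dots> (((P (s (edge_point 0)) +++ ?s) +++ reversepath (P (s (edge_point 1)))) +++ P (s (edge_point 1)))"
      by (rule hp_assoc[OF ab pth_reverse[OF c] c])
    also note 1
    finally show ?thesis
      using triangle_filling[OF a ps c] path_of[OF s] by metis
  qed
  then obtain T where T: "\<And>s. singular_simplex 1 ?X s \<Longrightarrow> singular_simplex 2 ?X (T s) \<and> singular_face 2 0 (T s) = s \<and>
      singular_face 2 1 (T s) = path_simplex (P (s (edge_point 1))) \<and>
      singular_face 2 2 (T s) = path_simplex (P (s (edge_point 0)))" by metis
  define F where "F = frag_extend (\<lambda>s. frag_of (T s))"
  define v :: "nat \<Rightarrow> real" where "v = (\<lambda>j. if j = 0 then 1 else 0)"
  define G :: "'a chain \<Rightarrow> 'a chain" where "G = frag_extend (\<lambda>s. frag_of (path_simplex (P (s v))))"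
  have v: "simplical_face 0 v = edge_point 1" "simplical_face (Suc 0) v = edge_point 0" "v \<in> standard_simplex 0"
    by (auto simp: v_def simplical_face_def edge_point_def fun_eq_iff standard_simplex_0)
  have key: "chain_boundary 2 (F c) = c - G (chain_boundary 1 c)"
    if "Poly_Mapping.keys c \<subseteq> singular_simplex_set 1 ?X" for c
    using that
  proof (induction c rule: frag_induction)
    case zero
    then show ?case by (simp add: F_def G_def)
  next
    case (one s)
    then have s: "singular_simplex 1 ?X s" by simp
    have "chain_boundary 2 (frag_of (T s)) =
        frag_of s - frag_of (path_simplex (P (s (edge_point 1)))) + frag_of (path_simplex (P (s (edge_point 0))))"
      using T[OF s] by (simp add: chain_boundary_of numeral_2_eq_2)
    moreover have "G (chain_boundary 1 (frag_of s)) =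
        frag_of (path_simplex (P (s (edge_point 1)))) - frag_of (path_simplex (P (s (edge_point 0))))"
      by (simp add: chain_boundary_of G_def frag_extend_diff singular_face_def v)
    ultimately show ?case by (simp add: F_def)
  next
    case (diff a b)
    then show ?case
      by (simp add: F_def G_def frag_extend_diff chain_boundary_diff)
  qed
  have "chain_boundary (Suc 1) (F z) = z"
    using key z by (simp add: singular_chain_def G_def numeral_2_eq_2)
  moreover have "singular_chain (Suc 1) ?X (F z)"
    unfolding F_def using z(1) T
    by (intro singular_chain_extend) (auto simp: singular_chain_of singular_chain_def numeral_2_eq_2 subset_iff)
  ultimately show ?thesis unfolding singular_boundary by blast
qed

text \<open>If every loop were null-homotopic, all 1-cycles would be homologous and the group would
  have a single element, whereas a free abelian group on a nonempty set contains both 0 and a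
  generator different from it.\<close>

lemma free_first_homology_noncontractible:
  fixes M :: "'a::topological_space set"
  assumes iso: "homology_group 1 (top_of_set M) \<cong> free_Abelian_group {..<k::nat}" and "k > 0"
    and conn: "\<And>x y. x \<in> M \<Longrightarrow> y \<in> M \<Longrightarrow> \<exists>f. pth M x y f" and "M \<noteq> {}"
  obtains (noncon) x f where "pth M x x f" "\<not> homotopic_paths M f (\<lambda>_. x)"
proof (rule ccontr)
  assume no: "\<not> thesis"
  have null: "homotopic_paths M f (\<lambda>_. x)" if "pth M x x f" for x f using noncon[OF that] no by blast
  let ?X = "top_of_set M"
  have hom: "homologous_rel 1 ?X {} a b" if "singular_relcycle 1 ?X {} a" "singular_relcycle 1 ?X {} b" for a b
  proof -
    have "singular_relcycle 1 ?X {} (a - b)" using that singular_relcycle_diff by blast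
    then have "singular_chain 1 ?X (a - b)" "chain_boundary 1 (a - b) = 0"
      unfolding singular_cycle by auto
    then show ?thesis unfolding homologous_rel_def
      by (intro simply_connected_boundary) (assumption | rule conn null \<open>M \<noteq> {}\<close>)+
  qed
  define R where "R = homologous_rel_set 1 ?X {} 0"
  have R: "carrier (homology_group 1 ?X) \<subseteq> {R}"
  proof
    fix x assume "x \<in> carrier (homology_group 1 ?X)"
    then obtain a where a: "singular_relcycle 1 ?X {} a" "x = homologous_rel_set 1 ?X {} a"
      using carrier_relative_homology_group[of 1 ?X "{}"] by auto
    have "homologous_rel_set 1 ?X {} a = R"
      unfolding R_def by (rule homologous_rel_set_eq[THEN iffD2, OF hom[OF a(1) singular_relcycle_0]])
    then show "x \<in> {R}" using a(2) by simp
  qed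
  obtain h where "bij_betw h (carrier (homology_group 1 ?X)) (carrier (free_Abelian_group {..<k}))"
    using iso by (auto simp: is_iso_def iso_def)
  then have sub: "carrier (free_Abelian_group {..<k}) \<subseteq> {h R}"
    using R unfolding bij_betw_def by blast
  have "0 \<in> carrier (free_Abelian_group {..<k})" "frag_of 0 \<in> carrier (free_Abelian_group {..<k})"
    using \<open>k > 0\<close> by auto
  from this[THEN subsetD[OF sub]] have "frag_of (0::nat) = 0" by simp
  then show False by (simp add: frag_of_nonzero)
qed

section \<open>Minimal polygons\<close>

lemma open_thicken_interval:
  fixes a b :: real
  assumes "open S" "{a..b} \<subseteq> S" "a \<le> b"
  obtains \<eta> where "\<eta> > 0" "{a-\<eta><..<b+\<eta>} \<subseteq> S"
proof -
  have "a \<in> S" "b \<in> S" using assms by auto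
  then obtain e1 e2 where e: "e1 > 0" "ball a e1 \<subseteq> S" "e2 > 0" "ball b e2 \<subseteq> S"
    using assms(1) open_contains_ball by metis
  have "{a - min e1 e2<..<b + min e1 e2} \<subseteq> S"
  proof
    fix t assume t: "t \<in> {a - min e1 e2<..<b + min e1 e2}"
    consider "t < a" | "t > b" | "t \<in> {a..b}" by fastforce
    then show "t \<in> S"
    proof cases
      case 1
      then have "t \<in> ball a e1" using t by (auto simp: dist_real_def)
      then show ?thesis using e by blast
    next
      case 2
      then have "t \<in> ball b e2" using t by (auto simp: dist_real_def)
      then show ?thesis using e by blast
    qed (use assms in auto)
  qed
  then show ?thesis using that[of "min e1 e2"] e by simp
qed

lemma first_hit:
  fixes A :: "real \<Rightarrow> 'a::t2_space"
  assumes "continuous_on {a..b} A" "a \<le> b" "compact K" "A b \<in> K"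
  obtains u where "a \<le> u" "u \<le> b" "A u \<in> K" "\<And>s. a \<le> s \<Longrightarrow> s \<le> u \<Longrightarrow> A s \<in> K \<Longrightarrow> s = u"
proof -
  let ?H = "{a..b} \<inter> A -` K"
  have "closed ?H" by (rule continuous_closed_preimage[OF assms(1) _ compact_imp_closed[OF assms(3)]]) simp
  then have "compact ?H" by (simp add: compact_Int_closed bounded_closed_imp_seq_compact compact_eq_bounded_closed bounded_Int)
  moreover have "b \<in> ?H" using assms by simp
  ultimately obtain u where u: "u \<in> ?H" "\<forall>s\<in>?H. u \<le> s"
    using compact_attains_inf[of ?H] by blast
  show ?thesis by (rule that[of u]) (use u in \<open>force+\<close>)
qed

text \<open>An arc together with the part of its parameter interval in use. Subdividing or
  shortening an edge changes only the two bounds, so no reparametrisation is involved and the map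
  stays regular across the new ends.\<close>

type_synonym 'a edge = "(real \<Rightarrow> 'a) \<times> real \<times> real"

fun im :: "'a edge \<Rightarrow> 'a set" where "im (A,a,b) = A ` {a..b}"
fun src :: "'a edge \<Rightarrow> 'a" where "src (A,a,b) = A a"
fun tgt :: "'a edge \<Rightarrow> 'a" where "tgt (A,a,b) = A b"
fun ep :: "'a edge \<Rightarrow> real \<Rightarrow> 'a" where "ep (A,a,b) = piece a b A"

text \<open>Right-nested, with a constant path at the end: a single edge gives
  \<open>ep e +++ (\<lambda>_. tgt e)\<close>, which accounts for the later appeals to
  \<open>hp_const_right\<close>. The argument \<open>p\<close> supplies the value for the empty
  list.\<close>

primrec cpath :: "'a::topological_space \<Rightarrow> 'a edge list \<Rightarrow> real \<Rightarrow> 'a" where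
  "cpath p [] = (\<lambda>_. p)"
| "cpath p (e # es) = ep e +++ cpath (tgt e) es"

lemma split_list_nth2:
  assumes "i < j" "j < length es" "es!i = s" "es!j = t"
  obtains xs ys zs where "es = xs @ s # ys @ t # zs" "length xs = i"
    "length ys = j - i - 1" "length zs = length es - j - 1"
proof -
  have 1: "es = take j es @ es!j # drop (Suc j) es" using id_take_nth_drop[OF assms(2)] .
  have "i < length (take j es)" using assms by simp
  from id_take_nth_drop[OF this]
  have "take j es = take i (take j es) @ (take j es)!i # drop (Suc i) (take j es)" .
  then have "take j es = take i es @ es!i # drop (Suc i) (take j es)"
    using assms by (simp add: min_def)
  then have "es = take i es @ es!i # drop (Suc i) (take j es) @ es!j # drop (Suc j) es"
    using 1 by (metis append.assoc append_Cons)
  then show ?thesis unfolding assms(3,4) by (rule that) (use assms(1,2) in auto)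
qed

section \<open>Coordinate discs, small sets and closed polygons\<close>

context surface
begin

definition disc :: "'a set \<Rightarrow> bool" where
  "disc U \<longleftrightarrow> (\<exists>c\<in>\<A>. \<exists>x r. ball x r \<subseteq> img c \<and> U = point c ` ball x r)"

text \<open>In its coordinates a disc is a convex ball, so straight-line homotopies are
  available.\<close>

lemma disc_homotopic:
  assumes "disc U" "pth U p q f" "pth U p q g"
  shows "homotopic_paths M f g"
proof -
  obtain c x r where c: "c \<in> \<A>" and b: "ball x r \<subseteq> img c" and U: "U = point c ` ball x r"
    using assms(1) unfolding disc_def by blast
  have U_sub: "U \<subseteq> cdom c" using b point_in[OF c] U by blast
  have cU: "coord c u \<in> ball x r" if "u \<in> U" for u
    using that b coord_point[OF c] unfolding U by auto
  have *: "pth (ball x r) (coord c p) (coord c q) (coord c \<circ> h) \<and> homotopic_paths M h (point c \<circ> (coord c \<circ> h))"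
    if h: "pth U p q h" for h
  proof
    have hU: "h t \<in> U" if "t \<in> {0..1}" for t using h that by (auto simp: pth_def path_image_def)
    have "continuous_on {0..1} h" using h by (simp add: pth_def path_def)
    then have "continuous_on {0..1} (coord c \<circ> h)"
      by (rule continuous_on_compose[OF _ continuous_on_subset[OF cont_coord[OF c]]]) (use hU U_sub in auto)
    then show "pth (ball x r) (coord c p) (coord c q) (coord c \<circ> h)"
      using h hU cU by (auto simp: pth_def path_def path_image_def pathstart_def pathfinish_def simp del: mem_ball)
    show "homotopic_paths M h (point c \<circ> (coord c \<circ> h))"
    proof (rule homotopic_paths_eq)
      show "path h" using h by (simp add: pth_def)
      show "path_image h \<subseteq> M" using h U_sub cdom_sub[OF c] by (auto simp: pth_def)
      show "h t = (point c \<circ> (coord c \<circ> h)) t" if "t \<in> {0..1}" for t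
        using hU[OF that] U_sub point_coord[OF c] by auto
    qed
  qed
  have "homotopic_paths M (point c \<circ> (coord c \<circ> f)) (point c \<circ> (coord c \<circ> g))"
    by (rule homotopic_paths_pullback[OF continuous_on_subset[OF cont_point[OF c] b] convex_ball _
        *[OF assms(2), THEN conjunct1] *[OF assms(3), THEN conjunct1]])
       (use U U_sub cdom_sub[OF c] in auto)
  then show ?thesis
    using *[OF assms(2), THEN conjunct2] hp_sym[OF *[OF assms(3), THEN conjunct2]] hp_trans by blast
qed

lemma finite_subcover_M:
  assumes "\<And>p. p \<in> M \<Longrightarrow> openin (top_of_set M) (D p) \<and> p \<in> D p"
  obtains F where "finite F" "F \<subseteq> M" "M = (\<Union>p\<in>F. D p)"
proof -
  have "\<forall>C. (\<forall>c\<in>C. openin (top_of_set M) c) \<and> M \<subseteq> \<Union>C \<longrightarrow> (\<exists>D\<subseteq>C. finite D \<and> M \<subseteq> \<Union>D)"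
    using compact_M compact_eq_openin_cover by metis
  moreover have "(\<forall>c\<in>D ` M. openin (top_of_set M) c) \<and> M \<subseteq> \<Union>(D ` M)" using assms by blast
  ultimately obtain E where E: "E \<subseteq> D ` M" "finite E" "M \<subseteq> \<Union>E" by meson
  then obtain F where F: "F \<subseteq> M" "finite F" "E = D ` F" by (meson finite_subset_image)
  have "(\<Union>p\<in>F. D p) \<subseteq> M" using F(1) assms openin_imp_subset by (metis UN_least subsetD)
  then show ?thesis using that[OF F(2,1)] E(3) F(3) by auto
qed

lemma disc_nbhd:
  assumes "p \<in> U" "openin (top_of_set M) U"
  obtains c r where "c \<in> \<A>" "p \<in> cdom c" "r > 0" "cball (coord c p) r \<subseteq> img c" "point c ` cball (coord c p) r \<subseteq> U"
proof -
  have "p \<in> M" using assms openin_imp_subset by blast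
  then obtain c where c: "c \<in> \<A>" "p \<in> cdom c" using ex_chart by blast
  have "open (coord c ` (cdom c \<inter> U))" using open_coord_image[OF c(1) assms(2)] .
  then obtain r where r: "r > 0" "cball (coord c p) r \<subseteq> coord c ` (cdom c \<inter> U)"
    using c(2) assms(1) open_contains_cball by (metis IntI imageI)
  have "point c ` cball (coord c p) r \<subseteq> point c ` (coord c ` (cdom c \<inter> U))" using r(2) by blast
  also have "\<dots> \<subseteq> U" using point_coord[OF c(1)] by auto
  finally show ?thesis using that[OF c r(1)] r(2) by blast
qed

text \<open>A set is small if it lies in a member of a fixed open cover that star-refines the cover of
  \<open>M\<close> by coordinate discs.\<close>

definition small_system :: "('a set \<Rightarrow> bool) \<Rightarrow> bool" where
  "small_system sm \<longleftrightarrow> (\<forall>S T. sm S \<longrightarrow> T \<subseteq> S \<longrightarrow> sm T) \<and>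
     (\<forall>p\<in>M. \<exists>U. openin (top_of_set M) U \<and> p \<in> U \<and> sm U) \<and>
     (\<forall>S T. sm S \<longrightarrow> sm T \<longrightarrow> S \<inter> T \<noteq> {} \<longrightarrow> (\<exists>U. disc U \<and> S \<union> T \<subseteq> U))"

text \<open>\<open>M\<close> is covered by finitely many discs \<open>D p\<close>, each inside a
  compact \<open>K p\<close> inside an open disc \<open>U p\<close>. The cover member
  \<open>W q\<close> is the intersection of the \<open>U p\<close> with \<open>q\<close> in
  \<open>K p\<close> and of the complements of the other \<open>K p\<close>. If it contains a point
  of \<open>K p\<close>, then \<open>q\<close> is in \<open>K p\<close> and \<open>W q\<close> lies
  in \<open>U p\<close>. Hence two members meeting at \<open>x\<close> both lie in
  \<open>U p\<close> for any \<open>p\<close> of the finite set with \<open>x\<close> in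
  \<open>D p\<close>.\<close>

lemma ex_small_system: "\<exists>sm. small_system sm"
proof -
  have "\<exists>c r. c \<in> \<A> \<and> p \<in> cdom c \<and> r > 0 \<and> cball (coord c p) r \<subseteq> img c" if "p \<in> M" for p
    using disc_nbhd[of p M] that by (metis openin_subtopology_self topspace_euclidean_subtopology openin_topspace)
  then obtain c r where cr: "\<And>p. p \<in> M \<Longrightarrow> c p \<in> \<A> \<and> p \<in> cdom (c p) \<and> r p > 0 \<and> cball (coord (c p) p) (r p) \<subseteq> img (c p)"
    by metis
  define U where "U p = point (c p) ` ball (coord (c p) p) (r p)" for p
  define K where "K p = point (c p) ` cball (coord (c p) p) (r p / 2)" for p
  define D where "D p = point (c p) ` ball (coord (c p) p) (r p / 2)" for p
  have sub: "ball (coord (c p) p) (r p) \<subseteq> img (c p)" "ball (coord (c p) p) (r p / 2) \<subseteq> img (c p)"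
    "cball (coord (c p) p) (r p / 2) \<subseteq> img (c p)" "D p \<subseteq> K p" if "p \<in> M" for p
  proof -
    show "ball (coord (c p) p) (r p) \<subseteq> img (c p)"
      using cr[OF that] ball_subset_cball by (meson order_trans)
    have "cball (coord (c p) p) (r p / 2) \<subseteq> cball (coord (c p) p) (r p)"
      using cr[OF that] by (intro subset_cball) simp
    then show "cball (coord (c p) p) (r p / 2) \<subseteq> img (c p)" using cr[OF that] by blast
    then show "ball (coord (c p) p) (r p / 2) \<subseteq> img (c p)" using ball_subset_cball by (meson order_trans)
    show "D p \<subseteq> K p" unfolding D_def K_def using ball_subset_cball by (rule image_mono)
  qed
  have oU: "openin (top_of_set M) (U p)" and discU: "disc (U p)" and cK: "compact (K p)"
    and oD: "openin (top_of_set M) (D p)" if "p \<in> M" for p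
  proof -
    have c: "c p \<in> \<A>" using cr[OF that] by blast
    show "openin (top_of_set M) (U p)" unfolding U_def by (rule openin_point_image[OF c open_ball sub(1)[OF that]])
    show "openin (top_of_set M) (D p)" unfolding D_def by (rule openin_point_image[OF c open_ball sub(2)[OF that]])
    show "compact (K p)" unfolding K_def by (rule compact_point_image[OF c compact_cball sub(3)[OF that]])
    show "disc (U p)" unfolding disc_def U_def using c sub(1)[OF that] by blast
  qed
  have pD: "p \<in> D p" if "p \<in> M" for p
  proof -
    have "coord (c p) p \<in> ball (coord (c p) p) (r p / 2)" using cr[OF that] by simp
    then have "point (c p) (coord (c p) p) \<in> D p" unfolding D_def by (rule imageI)
    then show ?thesis using point_coord cr[OF that] by metis
  qed
  obtain F where F: "finite F" "F \<subseteq> M" "M = (\<Union>p\<in>F. D p)"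
    by (rule finite_subcover_M[of D]) (rule conjI, erule oD, erule pD)
  define W where "W q = M \<inter> (\<Inter>p\<in>F. if q \<in> K p then U p else M - K p)" for q
  have W: "openin (top_of_set M) (W q)" for q
  proof -
    have "openin (top_of_set M) (if q \<in> K p then U p else M - K p)" if "p \<in> F" for p
    proof -
      have p: "p \<in> M" using F(2) that by blast
      have "openin (top_of_set M) (M \<inter> - K p)"
        by (rule openin_open_Int) (use compact_imp_closed[OF cK[OF p]] in blast)
      then show ?thesis using oU[OF p] by (simp add: Diff_eq)
    qed
    note g = this
    have "openin (top_of_set M) (\<Inter>p\<in>F. if q \<in> K p then U p else M - K p)" if "F \<noteq> {}"
    proof (rule openin_Inter)
      fix X assume "X \<in> (\<lambda>p. if q \<in> K p then U p else M - K p) ` F"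
      then show "openin (top_of_set M) X" using g by blast
    qed (use F(1) that in blast)+
    then show ?thesis unfolding W_def by (cases "F = {}") (simp_all add: openin_Int)
  qed
  have KU: "K p \<subseteq> U p" if "p \<in> M" for p
    unfolding K_def U_def using cr[OF that] by (intro image_mono cball_subset_ball_iff[THEN iffD2]) auto
  have qW: "q \<in> W q" if "q \<in> M" for q
    unfolding W_def
  proof (intro IntI INT_I that)
    fix p assume "p \<in> F"
    then have "K p \<subseteq> U p" using F(2) KU[of p] by blast
    then show "q \<in> (if q \<in> K p then U p else M - K p)" using that by (cases "q \<in> K p") auto
  qed
  have WU: "W q \<subseteq> U p" if "p \<in> F" "x \<in> W q" "x \<in> K p" for p q x
  proof -
    have "x \<in> (if q \<in> K p then U p else M - K p)" using that(1,2) unfolding W_def by blast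
    then have "q \<in> K p" using that(3) by (cases "q \<in> K p") auto
    then show ?thesis using that(1) unfolding W_def by auto
  qed
  define sm where "sm S \<longleftrightarrow> (\<exists>q\<in>M. S \<subseteq> W q)" for S
  have "small_system sm"
    unfolding small_system_def
  proof (intro conjI allI impI ballI)
    show "sm T" if "sm S" "T \<subseteq> S" for S T using that unfolding sm_def by blast
    show "\<exists>U. openin (top_of_set M) U \<and> p \<in> U \<and> sm U" if "p \<in> M" for p
      using W qW that unfolding sm_def by blast
    show "\<exists>U. disc U \<and> S \<union> T \<subseteq> U" if S: "sm S" and T: "sm T" and ne: "S \<inter> T \<noteq> {}" for S T
    proof -
      obtain x q q' where x: "x \<in> S" "x \<in> T" "S \<subseteq> W q" "T \<subseteq> W q'" using S T ne unfolding sm_def by blast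
      then have "x \<in> M" unfolding W_def by blast
      then obtain p where p: "p \<in> F" "x \<in> D p" using F(3) by blast
      then have "x \<in> K p" "p \<in> M" using sub(4) F(2) by blast+
      then have "W q \<subseteq> U p" "W q' \<subseteq> U p" using WU p(1) x by blast+
      then show ?thesis using discU[OF \<open>p \<in> M\<close>] x by blast
    qed
  qed
  then show ?thesis by blast
qed

text \<open>One system is fixed by choice, so that edges can refer to it without carrying a
  parameter.\<close>

definition small :: "'a set \<Rightarrow> bool" where "small = (SOME sm. small_system sm)"

lemma small_system_small: "small_system small"
  unfolding small_def using ex_small_system by (rule someI_ex)

lemma small_subset: "small S \<Longrightarrow> T \<subseteq> S \<Longrightarrow> small T"
  and small_nbhd: "p \<in> M \<Longrightarrow> \<exists>U. openin (top_of_set M) U \<and> p \<in> U \<and> small U"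
  and small_union_disc: "small S \<Longrightarrow> small T \<Longrightarrow> S \<inter> T \<noteq> {} \<Longrightarrow> \<exists>U. disc U \<and> S \<union> T \<subseteq> U"
  using small_system_small unfolding small_system_def by blast+

fun edge :: "'a edge \<Rightarrow> bool" where
  "edge (A,a,b) \<longleftrightarrow> a \<le> b \<and> (\<exists>\<eta>>0. reg A {a-\<eta><..<b+\<eta>}) \<and> inj_on A {a..b} \<and> small (A ` {a..b})"

lemma edge_facts:
  assumes "edge (A,a,b)"
  shows "a \<le> b" "continuous_on {a..b} A" "A ` {a..b} \<subseteq> M" "compact (A ` {a..b})"
    "inj_on A {a..b}" "small (A ` {a..b})"
proof -
  obtain \<eta> where "\<eta> > 0" and r: "reg A {a-\<eta><..<b+\<eta>}" using assms by auto
  then have sub: "{a..b} \<subseteq> {a-\<eta><..<b+\<eta>}" by auto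
  show c: "continuous_on {a..b} A" using continuous_on_subset[OF reg_continuous[OF r] sub] .
  then show "compact (A ` {a..b})" by (rule compact_continuous_image) simp
  show "A ` {a..b} \<subseteq> M" using reg_sub[OF r] sub by blast
qed (use assms in auto)

declare edge.simps [simp del]

lemma edge_sub:
  assumes "edge (A,a,b)" "a \<le> u" "u \<le> v" "v \<le> b"
  shows "edge (A,u,v)"
proof -
  obtain \<eta> where \<eta>: "\<eta> > 0" "reg A {a-\<eta><..<b+\<eta>}" using assms by (auto simp: edge.simps)
  have "reg A {u-\<eta><..<v+\<eta>}" by (rule reg_subset[OF \<eta>(2)]) (use assms in auto)
  moreover have "{u..v} \<subseteq> {a..b}" using assms by auto
  then have "inj_on A {u..v}" "small (A ` {u..v})"
    using edge_facts(5,6)[OF assms(1)] inj_on_subset small_subset image_mono by metis+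
  ultimately show ?thesis using \<eta>(1) assms(3) by (auto simp: edge.simps)
qed

lemma edge_pth: "edge e \<Longrightarrow> im e \<subseteq> S \<Longrightarrow> pth S (src e) (tgt e) (ep e)"
proof (cases e)
  fix A a b assume e: "edge e" "im e \<subseteq> S" "e = (A,a,b)"
  have "pth S (A a) (A b) (piece a b A)"
    by (rule pth_piece[OF edge_facts(2)]) (use e edge_facts(1)[of A a b] in \<open>auto simp: closed_segment_eq_real_ivl\<close>)
  then show ?thesis using e by simp
qed

lemma edge_im: "edge e \<Longrightarrow> im e \<subseteq> M" by (cases e) (use edge_facts(3) in auto)

primrec chain :: "'a \<Rightarrow> 'a edge list \<Rightarrow> 'a \<Rightarrow> bool" where
  "chain p [] q \<longleftrightarrow> p = q \<and> p \<in> M"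
| "chain p (e # es) q \<longleftrightarrow> edge e \<and> src e = p \<and> chain (tgt e) es q"

lemma chain_append: "chain p (xs @ ys) q \<longleftrightarrow> (\<exists>m. chain p xs m \<and> chain m ys q)"
proof (induction xs arbitrary: p)
  case Nil
  show ?case
  proof (cases ys)
    case (Cons e es)
    have "edge e \<Longrightarrow> src e \<in> M" using edge_pth[OF _ order_refl] pth_ends edge_im by blast
    then show ?thesis using Cons by auto
  qed auto
qed auto

lemma chain_pth_in:
  assumes "chain p es q" "\<And>e. e \<in> set es \<Longrightarrow> im e \<subseteq> S" "p \<in> S"
  shows "pth S p q (cpath p es)"
  using assms
proof (induction es arbitrary: p)
  case Nil
  then show ?case using pth_const by auto
next
  case (Cons e es)
  have 1: "pth S p (tgt e) (ep e)" using edge_pth[of e S] Cons.prems by auto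
  have "tgt e \<in> S" using pth_ends[OF 1] by blast
  then have 2: "pth S (tgt e) q (cpath (tgt e) es)" using Cons by simp
  show ?case using pth_join[OF 1 2] by simp
qed

lemma chain_ends: "chain p es q \<Longrightarrow> p \<in> M \<and> q \<in> M"
proof (induction es arbitrary: p)
  case (Cons e es)
  then have "edge e" "src e = p" "q \<in> M" by auto
  then show ?case using edge_pth[OF _ order_refl, of e] pth_ends edge_im by blast
qed auto

lemma chain_edges: "chain p es q \<Longrightarrow> e \<in> set es \<Longrightarrow> edge e"
  by (induction es arbitrary: p) auto

lemma chain_pth: "chain p es q \<Longrightarrow> pth M p q (cpath p es)"
  by (rule chain_pth_in) (auto dest: chain_edges chain_ends edge_im)

lemma cpath_append:
  assumes "chain p xs m" "chain m ys q"
  shows "homotopic_paths M (cpath p (xs @ ys)) (cpath p xs +++ cpath m ys)"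
  using assms(1)
proof (induction xs arbitrary: p)
  case Nil
  then show ?case using hp_sym[OF hp_const_left[OF chain_pth[OF assms(2)]]] by simp
next
  case (Cons e xs)
  then have e: "edge e" "src e = p" "chain (tgt e) xs m" by auto
  have 1: "pth M p (tgt e) (ep e)" using edge_pth[OF e(1) edge_im[OF e(1)]] e(2) by simp
  have 2: "pth M (tgt e) q (cpath (tgt e) (xs @ ys))"
    by (rule chain_pth) (use e(3) assms(2) chain_append in blast)
  have "homotopic_paths M (ep e +++ cpath (tgt e) (xs @ ys)) (ep e +++ (cpath (tgt e) xs +++ cpath m ys))"
    by (rule hp_joinR[OF 1 2 Cons.IH[OF e(3)]])
  also have "homotopic_paths M \<dots> ((ep e +++ cpath (tgt e) xs) +++ cpath m ys)"
    by (rule hp_assoc[OF 1 chain_pth[OF e(3)] chain_pth[OF assms(2)]])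
  finally show ?case by simp
qed

lemma chain_refine:
  assumes "chain p (xs @ (A,a,b) # zs) q" "a \<le> u" "u \<le> b"
  shows "chain p (xs @ (A,a,u) # (A,u,b) # zs) q"
    "homotopic_paths M (cpath p (xs @ (A,a,b) # zs)) (cpath p (xs @ (A,a,u) # (A,u,b) # zs))"
proof -
  have e: "edge (A,a,b)" by (rule chain_edges[OF assms(1)]) simp
  have e1: "edge (A,a,u)" and e2: "edge (A,u,b)" using edge_sub[OF e] assms(2,3) by auto
  obtain m where m: "chain p xs m" "chain m ((A,a,b) # zs) q" using assms(1) chain_append by blast
  then have c2: "chain m ((A,a,u) # (A,u,b) # zs) q" using e1 e2 by simp
  show c: "chain p (xs @ (A,a,u) # (A,u,b) # zs) q" using m(1) c2 chain_append by blast
  have z: "pth M (A b) q (cpath (A b) zs)" using chain_pth m(2) by auto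
  have p1: "pth M (A a) (A u) (piece a u A)" using edge_pth[OF e1 edge_im[OF e1]] by simp
  have p2: "pth M (A u) (A b) (piece u b A)" using edge_pth[OF e2 edge_im[OF e2]] by simp
  have p: "pth M (A a) (A b) (piece a b A)" using edge_pth[OF e edge_im[OF e]] by simp
  have "homotopic_paths M (piece a b A) (piece a u A +++ piece u b A)"
    by (rule hp_sym[OF hp_join_pieces[OF edge_facts(2)[OF e] _ edge_facts(3)[OF e]]]) (use assms in auto)
  then have "homotopic_paths M (piece a b A +++ cpath (A b) zs) ((piece a u A +++ piece u b A) +++ cpath (A b) zs)"
    by (rule hp_joinL[OF p z])
  also have "homotopic_paths M \<dots> (piece a u A +++ (piece u b A +++ cpath (A b) zs))"
    by (rule hp_sym[OF hp_assoc[OF p1 p2 z]])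
  finally have 1: "homotopic_paths M (cpath m ((A,a,b) # zs)) (cpath m ((A,a,u) # (A,u,b) # zs))" by simp
  have "homotopic_paths M (cpath p (xs @ (A,a,b) # zs)) (cpath p xs +++ cpath m ((A,a,b) # zs))"
    by (rule cpath_append[OF m])
  also have "homotopic_paths M \<dots> (cpath p xs +++ cpath m ((A,a,u) # (A,u,b) # zs))"
    by (rule hp_joinR[OF chain_pth[OF m(1)] chain_pth[OF m(2)] 1])
  also have "homotopic_paths M \<dots> (cpath p (xs @ (A,a,u) # (A,u,b) # zs))"
    by (rule hp_sym[OF cpath_append[OF m(1) c2]])
  finally show "homotopic_paths M (cpath p (xs @ (A,a,b) # zs)) (cpath p (xs @ (A,a,u) # (A,u,b) # zs))" .
qed

lemma chain_remove_loop:
  assumes "chain p xs m" "chain m ls m" "chain m zs q" "homotopic_paths M (cpath m ls) (\<lambda>_. m)"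
  shows "homotopic_paths M (cpath p (xs @ ls @ zs)) (cpath p (xs @ zs))"
proof -
  have lz: "chain m (ls @ zs) q" using assms chain_append by blast
  have "homotopic_paths M (cpath p (xs @ ls @ zs)) (cpath p xs +++ cpath m (ls @ zs))"
    by (rule cpath_append[OF assms(1) lz])
  also have "homotopic_paths M \<dots> (cpath p xs +++ (cpath m ls +++ cpath m zs))"
    by (rule hp_joinR[OF chain_pth[OF assms(1)] chain_pth[OF lz] cpath_append[OF assms(2,3)]])
  also have "homotopic_paths M \<dots> (cpath p xs +++ cpath m zs)"
    by (rule hp_remove_null_loop[OF chain_pth[OF assms(1)] chain_pth[OF assms(2)] chain_pth[OF assms(3)] assms(4)])
  also have "homotopic_paths M \<dots> (cpath p (xs @ zs))"
    by (rule hp_sym[OF cpath_append[OF assms(1,3)]])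
  finally show ?thesis .
qed

text \<open>Noncontractibility is stated for homotopies that fix the base point, the form compatible
  with concatenation; free homotopies are reduced to it by
  \<open>null_homotopic_loop_based\<close>.\<close>

definition ncl :: "'a \<Rightarrow> 'a edge list \<Rightarrow> bool" where
  "ncl p es \<longleftrightarrow> chain p es p \<and> \<not> homotopic_paths M (cpath p es) (\<lambda>_. p)"

text \<open>At a common point of two edges the polygon decomposes into an inner loop and the polygon
  that short-cuts it. If both were null-homotopic the whole would be, so one of them inherits
  noncontractibility. The removal of self-intersections below rests on this alternative.\<close>

lemma ncl_split:
  assumes "ncl p (xs @ (A,a,b) # ys @ (B,c,d) # zs)" "a \<le> u" "u \<le> b" "c \<le> v" "v \<le> d" "A u = B v"
  shows "ncl (A u) ((A,u,b) # ys @ [(B,c,v)]) \<or> ncl p (xs @ (A,a,u) # (B,v,d) # zs)"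
proof (rule ccontr)
  assume no: "\<not> ?thesis"
  let ?L = "(A,u,b) # ys @ [(B,c,v)]" and ?X = "xs @ [(A,a,u)]" and ?Z = "(B,v,d) # zs"
  have c0: "chain p (xs @ (A,a,b) # (ys @ (B,c,d) # zs)) p" using assms(1) by (simp add: ncl_def)
  note r1 = chain_refine[OF c0 assms(2,3)]
  have c1: "chain p ((xs @ (A,a,u) # (A,u,b) # ys) @ (B,c,d) # zs) p" using r1(1) by simp
  note r2 = chain_refine[OF c1 assms(4,5)]
  have eq: "(xs @ (A,a,u) # (A,u,b) # ys) @ (B,c,v) # (B,v,d) # zs = ?X @ ?L @ ?Z" by simp
  have c2: "chain p (?X @ ?L @ ?Z) p" using r2(1) unfolding eq .
  have hom: "homotopic_paths M (cpath p (xs @ (A,a,b) # ys @ (B,c,d) # zs)) (cpath p (?X @ ?L @ ?Z))"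
    using r1(2) r2(2) unfolding eq by (simp add: hp_trans)
  obtain m m' where m: "chain p ?X m" "chain m ?L m'" "chain m' ?Z p" using c2 chain_append by meson
  have "m = A u" using m(2) by auto
  moreover have "m' = B v" using m(3) by auto
  ultimately have m: "chain p ?X (A u)" "chain (A u) ?L (A u)" "chain (A u) ?Z p" using m assms(6) by auto
  have XZ: "chain p (?X @ ?Z) p" using m chain_append by blast
  have "homotopic_paths M (cpath (A u) ?L) (\<lambda>_. A u)" using no m(2) by (auto simp: ncl_def)
  from chain_remove_loop[OF m this]
  have "homotopic_paths M (cpath p (?X @ ?L @ ?Z)) (cpath p (?X @ ?Z))" .
  moreover have "homotopic_paths M (cpath p (?X @ ?Z)) (\<lambda>_. p)" using no XZ by (auto simp: ncl_def)
  ultimately have "homotopic_paths M (cpath p (xs @ (A,a,b) # ys @ (B,c,d) # zs)) (\<lambda>_. p)"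
    using hom hp_trans by blast
  then show False using assms(1) by (simp add: ncl_def)
qed

lemma ncl_remove_degenerate:
  assumes "ncl p (xs @ (A,a,a) # zs)" shows "ncl p (xs @ zs)"
proof -
  have c: "chain p (xs @ [(A,a,a)] @ zs) p" using assms by (simp add: ncl_def)
  then obtain m m' where m: "chain p xs m" "chain m [(A,a,a)] m'" "chain m' zs p" using chain_append by meson
  then have e: "m = A a" "m' = A a" and M: "A a \<in> M" using chain_ends[OF m(1)] by auto
  have "piece a a A = (\<lambda>_. A a)" by (auto simp: piece_def linepath_def algebra_simps)
  then have "homotopic_paths M (cpath m [(A,a,a)]) (\<lambda>_. m)"
    using hp_const_left[OF pth_const[OF M]] e by simp
  then have h: "homotopic_paths M (cpath p (xs @ [(A,a,a)] @ zs)) (cpath p (xs @ zs))"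
    by (intro chain_remove_loop[of p xs m _ zs p]) (use m e in auto)
  have "chain p (xs @ zs) p" using m e chain_append by blast
  moreover have "\<not> homotopic_paths M (cpath p (xs @ zs)) (\<lambda>_. p)"
    using hp_trans[OF h] assms by (auto simp: ncl_def)
  ultimately show ?thesis by (simp add: ncl_def)
qed

text \<open>At most two edges are small sets with a common vertex; star refinement puts them into
  one coordinate disc, where every loop is null-homotopic.\<close>

lemma ncl_length: assumes "ncl p es" shows "length es \<ge> 3"
proof (rule ccontr)
  assume "\<not> 3 \<le> length es"
  have c: "chain p es p" using assms by (simp add: ncl_def)
  have "\<exists>U. disc U \<and> p \<in> U \<and> (\<forall>e\<in>set es. im e \<subseteq> U)" if ne: "es \<noteq> []"
  proof -
    obtain e es' where es: "es = e # es'" using ne by (cases es) auto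
    have ends: "src f \<in> im f" "tgt f \<in> im f" if "edge f" for f
      using that edge_facts(1) by (cases f; auto)+
    have e: "edge e" using c es by simp
    then have p: "p \<in> im e" "tgt e \<in> im e" using c es ends[OF e] by auto
    have sm: "small (im f)" if "edge f" for f using that by (cases f) (auto simp: edge.simps)
    show ?thesis
    proof (cases es')
      case Nil
      obtain U where "disc U" "im e \<union> im e \<subseteq> U" using small_union_disc[OF sm[OF e] sm[OF e]] p by blast
      then show ?thesis using Nil es p by auto
    next
      case (Cons f fs)
      then have "fs = []" using \<open>\<not> 3 \<le> length es\<close> es by (cases fs) auto
      have f: "edge f" "tgt e \<in> im f" using c es Cons ends[of f] by auto
      obtain U where "disc U" "im e \<union> im f \<subseteq> U" using small_union_disc[OF sm[OF e] sm[OF f(1)]] p f by blast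
      then show ?thesis using Cons es p \<open>fs = []\<close> by auto
    qed
  qed
  moreover have "es \<noteq> []"
  proof
    assume "es = []"
    then have "homotopic_paths M (cpath p es) (\<lambda>_. p)" using hp_refl[OF chain_pth[OF c]] by simp
    then show False using assms by (simp add: ncl_def)
  qed
  ultimately obtain U where U: "disc U" "p \<in> U" "\<forall>e\<in>set es. im e \<subseteq> U" by blast
  have "pth U p p (cpath p es)" by (rule chain_pth_in[OF c]) (use U in auto)
  then have "homotopic_paths M (cpath p es) (\<lambda>_. p)" using disc_homotopic[OF U(1) _ pth_const[OF U(2)]] by blast
  then show False using assms by (simp add: ncl_def)
qed

lemma segment_arc:
  assumes c: "c \<in> \<A>" and V: "open V" "convex V" "V \<subseteq> img c" and y: "y0 \<in> V" "y1 \<in> V" "y0 \<noteq> y1"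
  defines "A \<equiv> \<lambda>t. point c (y0 + t *\<^sub>R (y1 - y0))"
  shows "\<exists>\<eta>>0. reg A {0-\<eta><..<1+\<eta>} \<and> A ` {0-\<eta><..<1+\<eta>} \<subseteq> point c ` V" "inj_on A {0..1}" "A ` {0..1} \<subseteq> point c ` V"
    "A 0 = point c y0" "A 1 = point c y1"
    "\<And>t. t \<in> {0..1} \<Longrightarrow> y0 + t *\<^sub>R (y1 - y0) \<in> V"
proof -
  let ?x = "\<lambda>t. y0 + t *\<^sub>R (y1 - y0)"
  have op: "open (?x -` V)" by (intro open_vimage V continuous_intros)
  have mem: "?x t \<in> V" if "t \<in> {0..1}" for t
  proof -
    have "?x t = (1 - t) *\<^sub>R y0 + t *\<^sub>R y1" by (simp add: algebra_simps)
    then show ?thesis using convexD_alt[OF V(2) y(1,2), of t] that by simp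
  qed
  then show "\<And>t. t \<in> {0..1} \<Longrightarrow> y0 + t *\<^sub>R (y1 - y0) \<in> V" by blast
  have "{0..1} \<subseteq> ?x -` V" using mem by blast
  then obtain \<eta> where \<eta>: "\<eta> > 0" "{0-\<eta><..<1+\<eta>} \<subseteq> ?x -` V" using open_thicken_interval[OF op _ zero_le_one] by blast
  have d: "(?x has_vector_derivative (y1 - y0)) (at t)" for t
    by (auto intro!: derivative_eq_intros)
  have "reg A {0-\<eta><..<1+\<eta>}"
  proof (rule reg_chartI[OF c, where x = ?x])
    show "?x ` {0-\<eta><..<1+\<eta>} \<subseteq> img c" using \<eta>(2) V(3) by blast
    show "smooth_on ?x {0-\<eta><..<1+\<eta>}"
      by (intro smooth_on_add smooth_on_scaleR smooth_on_const smooth_on_ident) auto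
    show "vd ?x t \<noteq> 0" for t using vector_derivative_at[OF d] y(3) by simp
  qed (simp_all add: A_def)
  moreover have "A ` {0-\<eta><..<1+\<eta>} \<subseteq> point c ` V" unfolding A_def using \<eta>(2) by blast
  ultimately show "\<exists>\<eta>>0. reg A {0-\<eta><..<1+\<eta>} \<and> A ` {0-\<eta><..<1+\<eta>} \<subseteq> point c ` V" using \<eta>(1) by blast
  show "inj_on A {0..1}"
  proof (rule inj_onI)
    fix s t :: real assume st: "s \<in> {0..1}" "t \<in> {0..1}" "A s = A t"
    have m: "?x s \<in> img c" "?x t \<in> img c" using mem[OF st(1)] mem[OF st(2)] V(3) by blast+
    have "?x s = ?x t" by (rule inj_onD[OF inj_on_point[OF c] st(3)[unfolded A_def] m])
    then show "s = t" using y(3) by simp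
  qed
  show "A ` {0..1} \<subseteq> point c ` V" unfolding A_def using mem by blast
qed (simp_all add: A_def)

text \<open>The bisection principle \<open>Bolzano\<close> is applied to the property that the
  portion of \<open>f\<close> between two parameters is homotopic to a polygon. The property is
  additive by concatenation, and near a parameter the portion lies in a coordinate disc contained in
  a small set, where one segment straight in coordinates replaces it.\<close>

lemma ncl_exists:
  assumes f: "pth M p p f" and "\<not> homotopic_paths M f (\<lambda>_. p)"
  obtains es where "ncl p es"
proof -
  have cf: "continuous_on {0..1} f" and fM: "f ` {0..1} \<subseteq> M" and f01: "f 0 = p" "f 1 = p"
    using f by (auto simp: pth_def path_def path_image_def pathstart_def pathfinish_def)
  define P where "P a b \<longleftrightarrow> (0 \<le> a \<and> b \<le> 1 \<longrightarrow> (\<exists>es. chain (f a) es (f b) \<and> homotopic_paths M (cpath (f a) es) (piece a b f)))"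
    for a b
  have "0 \<le> (1::real)" by simp
  then have "P 0 1"
  proof (induction rule: Bolzano)
    case (trans a b c)
    show ?case unfolding P_def
    proof
      assume ac: "0 \<le> a \<and> c \<le> 1"
      then obtain es where es: "chain (f a) es (f b)" "homotopic_paths M (cpath (f a) es) (piece a b f)"
        using trans unfolding P_def by auto
      obtain es' where es': "chain (f b) es' (f c)" "homotopic_paths M (cpath (f b) es') (piece b c f)"
        using trans ac unfolding P_def by auto
      have "homotopic_paths M (cpath (f a) (es @ es')) (cpath (f a) es +++ cpath (f b) es')"
        by (rule cpath_append[OF es(1) es'(1)])
      also have "homotopic_paths M \<dots> (piece a b f +++ piece b c f)"
        by (rule hp_join[OF chain_pth[OF es(1)] chain_pth[OF es'(1)] es(2) es'(2)])
      also have "homotopic_paths M \<dots> (piece a c f)"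
        by (rule hp_join_pieces[OF cf _ fM]) (use trans ac in auto)
      finally show "\<exists>es. chain (f a) es (f c) \<and> homotopic_paths M (cpath (f a) es) (piece a c f)"
        using es(1) es'(1) chain_append by blast
    qed
  next
    case (local x)
    then have x: "x \<in> {0..1}" by simp
    then have "f x \<in> M" using fM by blast
    then obtain U where U: "openin (top_of_set M) U" "f x \<in> U" "small U" using small_nbhd by blast
    obtain c r where c: "c \<in> \<A>" "f x \<in> cdom c" "r > 0" "cball (coord c (f x)) r \<subseteq> img c"
        "point c ` cball (coord c (f x)) r \<subseteq> U" using disc_nbhd[OF U(2,1)] by blast
    let ?V = "ball (coord c (f x)) r" and ?B = "point c ` ball (coord c (f x)) r"
    have V: "?V \<subseteq> img c" using c(4) ball_subset_cball by (meson order_trans)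
    have BU: "?B \<subseteq> U" using c(5) ball_subset_cball by (meson order_trans image_mono)
    have B: "openin (top_of_set M) ?B" "disc ?B" "f x \<in> ?B"
    proof -
      show "openin (top_of_set M) ?B" by (rule openin_point_image[OF c(1) open_ball V])
      show "disc ?B" unfolding disc_def using c(1) V by blast
      have "point c (coord c (f x)) \<in> ?B" by (rule imageI) (use c(3) in simp)
      then show "f x \<in> ?B" using point_coord[OF c(1,2)] by simp
    qed
    have BM: "?B \<subseteq> M" using B(1) openin_imp_subset by blast
    obtain O' where O': "open O'" "?B = M \<inter> O'" using B(1) by (auto simp: openin_open)
    have "\<exists>d>0. \<forall>t\<in>{0..1}. dist t x < d \<longrightarrow> f t \<in> O'"
      using cf O'(1) B(3) O'(2) x unfolding continuous_on_topological
      by (metis Int_iff open_dist)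
    then obtain d where d: "d > 0" "\<And>t. t \<in> {0..1} \<Longrightarrow> dist t x < d \<Longrightarrow> f t \<in> O'" by blast
    have "P a b" if ab: "a \<le> x" "x \<le> b" "b - a < d" for a b
      unfolding P_def
    proof
      assume ab1: "0 \<le> a \<and> b \<le> 1"
      have fB: "f t \<in> ?B" if "t \<in> {a..b}" for t
        using d(2)[of t] that ab ab1 fM O'(2) by (auto simp: dist_real_def)
      have pp: "pth ?B (f a) (f b) (piece a b f)"
        by (rule pth_piece[where S = "{a..b}", OF continuous_on_subset[OF cf]])
           (use fB ab ab1 in \<open>auto simp: closed_segment_eq_real_ivl image_subset_iff simp del: mem_ball\<close>)
      have inV: "coord c (f t) \<in> ?V" "f t = point c (coord c (f t))" if t: "t \<in> {a..b}" for t
      proof -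
        obtain y where "y \<in> ?V" "f t = point c y" using fB[OF t] by blast
        then show "coord c (f t) \<in> ?V" "f t = point c (coord c (f t))"
          using coord_point[OF c(1)] V by auto
      qed
      have a: "a \<in> {a..b}" and b: "b \<in> {a..b}" using ab by auto
      show "\<exists>es. chain (f a) es (f b) \<and> homotopic_paths M (cpath (f a) es) (piece a b f)"
      \<comment> \<open>Equal end points are represented by the empty polygon, since a segment from
        a point to itself has zero velocity and is not an edge.\<close>
      proof (cases "f a = f b")
        case True
        have "homotopic_paths M (\<lambda>_. f a) (piece a b f)"
          by (rule disc_homotopic[OF B(2) _ pp]) (use pth_const[OF fB[OF a]] True in simp)
        then have "chain (f a) [] (f b) \<and> homotopic_paths M (cpath (f a) []) (piece a b f)"
          using True fB[OF a] BM by auto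
        then show ?thesis by blast
      next
        case False
        have ne: "coord c (f a) \<noteq> coord c (f b)" using False inV(2)[OF a] inV(2)[OF b] by metis
        define A where "A = (\<lambda>t. point c (coord c (f a) + t *\<^sub>R (coord c (f b) - coord c (f a))))"
        note sa = segment_arc[OF c(1) open_ball convex_ball V inV(1)[OF a] inV(1)[OF b] ne, folded A_def]
        have "small (A ` {0..1})" using small_subset[OF U(3)] sa(3) BU by blast
        then have e: "edge (A,0,1)" using sa(1,2) by (auto simp: edge.simps)
        have "A 0 = point c (coord c (f a))" "A 1 = point c (coord c (f b))" by (simp_all add: A_def)
        then have A01: "A 0 = f a" "A 1 = f b" by (simp_all only: inV(2)[OF a, symmetric] inV(2)[OF b, symmetric])
        have ch: "chain (f a) [(A,0,1)] (f b)" using e A01 fB[OF b] BM by auto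
        have "pth ?B (f a) (f b) (cpath (f a) [(A,0,1)])"
          by (rule chain_pth_in[OF ch]) (use sa(3) fB[OF a] in auto)
        then have "homotopic_paths M (cpath (f a) [(A,0,1)]) (piece a b f)"
          by (rule disc_homotopic[OF B(2) _ pp])
        then show ?thesis using ch by blast
      qed
    qed
    then show ?case using d(1) by blast
  qed
  then obtain es where es: "chain p es p" "homotopic_paths M (cpath p es) (piece 0 1 f)"
    unfolding P_def using f01 by auto
  have "piece 0 1 f = f" by (auto simp: piece_def linepath_def)
  then have "ncl p es" using es assms(2) hp_trans[OF hp_sym[OF es(2)]] by (auto simp: ncl_def)
  then show ?thesis by (rule that)
qed

section \<open>Polygons with the fewest edges\<close>

definition min_ncl :: "'a \<Rightarrow> 'a edge list \<Rightarrow> bool" where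
  "min_ncl p es \<longleftrightarrow> ncl p es \<and> (\<forall>q fs. ncl q fs \<longrightarrow> length es \<le> length fs)"

lemma min_ncl_nondegenerate:
  assumes "min_ncl p es" "(A,a,b) \<in> set es" shows "a < b"
proof (rule ccontr)
  assume "\<not> a < b"
  have n: "ncl p es" using assms(1) by (simp add: min_ncl_def)
  then have "edge (A,a,b)" using chain_edges assms(2) by (auto simp: ncl_def)
  then have "b = a" using \<open>\<not> a < b\<close> edge_facts(1) by force
  obtain xs zs where es: "es = xs @ (A,a,a) # zs" using split_list[OF assms(2)] \<open>b = a\<close> by blast
  then have "ncl p (xs @ zs)" using n ncl_remove_degenerate by blast
  then have "length es \<le> length (xs @ zs)" using assms(1) unfolding min_ncl_def by blast
  then show False using es by simp
qed

text \<open>Cutting at a common point of edges \<open>i\<close> and \<open>j\<close> yields an inner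
  polygon with \<open>j - i + 1\<close> edges and an outer one with
  \<open>length es - (j - i) + 1\<close>. Both numbers are below \<open>length es\<close> unless the
  edges are consecutive or are the first and the last, which are adjacent around the base
  point.\<close>

lemma min_ncl_nonadjacent:
  assumes "min_ncl p es" "i + 1 < j" "j < length es" "i \<noteq> 0 \<or> j \<noteq> length es - 1"
  shows "im (es!i) \<inter> im (es!j) = {}"
proof (rule ccontr)
  assume ne: "im (es!i) \<inter> im (es!j) \<noteq> {}"
  obtain A a b B c d where e: "es!i = (A,a,b)" "es!j = (B,c,d)" by (metis prod_cases3)
  obtain xs ys zs where es: "es = xs @ (A,a,b) # ys @ (B,c,d) # zs" "length xs = i"
    "length ys = j - i - 1" "length zs = length es - j - 1"
    by (rule split_list_nth2[OF add_lessD1[OF assms(2)] assms(3) e])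
  obtain u v where uv: "a \<le> u" "u \<le> b" "c \<le> v" "v \<le> d" "A u = B v" using ne e by auto
  have "ncl p (xs @ (A,a,b) # ys @ (B,c,d) # zs)" using assms(1) es(1) by (simp add: min_ncl_def)
  note n = this
  have len: "length es = length xs + length ys + length zs + 2" using arg_cong[OF es(1), of length] by simp
  from ncl_split[OF n uv] show False
  proof
    assume "ncl (A u) ((A,u,b) # ys @ [(B,c,v)])"
    then have "length es \<le> length ((A,u,b) # ys @ [(B,c,v)])" using assms(1) unfolding min_ncl_def by blast
    then have "length es \<le> length ys + 2" by simp
    then show False using len es(2-4) assms(2-4) by linarith
  next
    assume "ncl p (xs @ (A,a,u) # (B,v,d) # zs)"
    then have "length es \<le> length (xs @ (A,a,u) # (B,v,d) # zs)" using assms(1) unfolding min_ncl_def by blast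
    then have "length es \<le> length xs + length zs + 2" by simp
    then show False using len es(2-4) assms(2-4) by linarith
  qed
qed

text \<open>Adjacent edges can meet outside their common vertex. Stopping edge \<open>m\<close>
  where it meets the next edge for the first time, and continuing along the latter, cuts off a loop
  of two edges, which is contractible by \<open>ncl_length\<close>; the number of edges is
  unchanged, so minimality persists. Going from left to right, the corners already treated are
  affected only through a shrinking of edge \<open>m\<close>.\<close>

lemma min_ncl_clean:
  assumes "min_ncl p0 es0" "m + 1 \<le> length es0"
  shows "\<exists>p es. min_ncl p es \<and> length es = length es0 \<and> (\<forall>i<m. im (es!i) \<inter> im (es!(i+1)) \<subseteq> {tgt (es!i)})"
  using assms(2)
proof (induction m)
  case 0
  then show ?case using assms(1) by blast
next
  case (Suc m)
  then obtain p es where es: "min_ncl p es" "length es = length es0" "\<And>i. i < m \<Longrightarrow> im (es!i) \<inter> im (es!(i+1)) \<subseteq> {tgt (es!i)}"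
    by auto
  obtain A a b B c d where e: "es!m = (A,a,b)" "es!(m+1) = (B,c,d)" by (metis prod_cases3)
  have m1: "m < m + 1" "m + 1 < length es" using Suc.prems es(2) by auto
  obtain xs ys zs where d0: "es = xs @ (A,a,b) # ys @ (B,c,d) # zs" "length xs = m" "length ys = m + 1 - m - 1"
    by (rule split_list_nth2[OF m1 e])
  have "ys = []" using d0(3) by simp
  then have d: "es = xs @ (A,a,b) # (B,c,d) # zs" "length xs = m" using d0(1,2) by simp_all
  have "ncl p es" using es(1) by (simp add: min_ncl_def)
  then have n: "ncl p (xs @ (A,a,b) # [] @ (B,c,d) # zs)" using d(1) by (metis append_Nil)
  then have ch: "chain p (xs @ (A,a,b) # (B,c,d) # zs) p" by (simp add: ncl_def)
  then have eA: "edge (A,a,b)" and eB: "edge (B,c,d)" using chain_edges by (metis in_set_conv_decomp append_Cons append_assoc append_Nil)+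
  have AB: "A b = B c" using ch chain_append by auto
  obtain u where u: "a \<le> u" "u \<le> b" "A u \<in> B ` {c..d}" "\<And>s. a \<le> s \<Longrightarrow> s \<le> u \<Longrightarrow> A s \<in> B ` {c..d} \<Longrightarrow> s = u"
    using first_hit[OF edge_facts(2)[OF eA] edge_facts(1)[OF eA] edge_facts(4)[OF eB]] AB edge_facts(1)[OF eB]
    by (metis atLeastAtMost_iff imageI order_refl)
  then obtain v where v: "c \<le> v" "v \<le> d" "A u = B v" by auto
  let ?es = "xs @ (A,a,u) # (B,v,d) # zs"
  have "ncl p ?es"
    using ncl_split[OF n u(1,2) v] ncl_length[of "A u" "[(A,u,b),(B,c,v)]"] by auto
  moreover have len: "length ?es = length es" using arg_cong[OF d(1), of length] by simp
  ultimately have "min_ncl p ?es" using es(1) unfolding min_ncl_def by simp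
  moreover have "im (?es!i) \<inter> im (?es!(i+1)) \<subseteq> {tgt (?es!i)}" if "i < Suc m" for i
  proof (cases "i = m")
    case True
    then have "?es!i = (A,a,u)" "?es!(i+1) = (B,v,d)" using d(2) by (auto simp: nth_append)
    moreover have "A ` {a..u} \<inter> B ` {v..d} \<subseteq> {A u}"
    proof
      fix z assume "z \<in> A ` {a..u} \<inter> B ` {v..d}"
      then obtain s where s: "a \<le> s" "s \<le> u" "z = A s" "z \<in> B ` {v..d}" by auto
      then have "A s \<in> B ` {c..d}" using v(1) by auto
      then show "z \<in> {A u}" using u(4)[OF s(1,2)] s(3) by simp
    qed
    ultimately show ?thesis by simp
  next
    case False
    then have i: "i < m" using that by simp
    then have 1: "?es!i = es!i" using d(2) unfolding d(1) by (simp add: nth_append)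
    have "im (?es!(i+1)) \<subseteq> im (es!(i+1))"
    proof (cases "i + 1 = m")
      case True
      then have "?es!(i+1) = (A,a,u)" "es!(i+1) = (A,a,b)" using d(2) e by (auto simp: nth_append)
      then show ?thesis using u(2) by auto
    next
      case False
      then have "?es!(i+1) = es!(i+1)" using d(2) i unfolding d(1) by (simp add: nth_append)
      then show ?thesis by simp
    qed
    then show ?thesis using es(3)[OF i] 1 by auto
  qed
  ultimately show ?case using len es(2)
    by (intro exI[of _ p] exI[of _ ?es]) (simp del: append_Cons)
qed

text \<open>After \<open>min_ncl_clean\<close> the remaining pair is the first and the last edge,
  which meet at the base point. The last edge is stopped at its first hit of the first one, and the
  base point moves to the point of contact. The two shortened edges only lose points and the others
  are untouched, so the corners already treated stay clean.\<close>

theorem simple_polygon: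
  assumes f: "pth M p0 p0 f" and "\<not> homotopic_paths M f (\<lambda>_. p0)"
  obtains p es where "ncl p es" "length es \<ge> 3" "\<And>A a b. (A,a,b) \<in> set es \<Longrightarrow> a < b"
    "\<And>i j z. i < j \<Longrightarrow> j < length es \<Longrightarrow> z \<in> im (es!i) \<Longrightarrow> z \<in> im (es!j) \<Longrightarrow>
       (j = i + 1 \<and> z = tgt (es!i)) \<or> (i = 0 \<and> j = length es - 1 \<and> z = p)"
proof -
  obtain es1 where "ncl p0 es1" using ncl_exists[OF assms] by blast
  then have ex: "\<exists>k p es. ncl p es \<and> length es = k" by blast
  define k where "k = (LEAST k. \<exists>p es. ncl p es \<and> length es = k)"
  have "\<exists>p es. ncl p es \<and> length es = k" unfolding k_def using LeastI_ex[OF ex] .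
  then obtain p2 es2 where es2: "ncl p2 es2" "length es2 = k" by blast
  have kle: "k \<le> length fs" if "ncl q fs" for q fs unfolding k_def by (rule Least_le) (use that in blast)
  have m2: "min_ncl p2 es2" using es2 kle by (simp add: min_ncl_def)
  have k3: "k \<ge> 3" using ncl_length[OF es2(1)] es2(2) by simp
  obtain p es where es: "min_ncl p es" "length es = k" "\<And>i. i < k - 1 \<Longrightarrow> im (es!i) \<inter> im (es!(i+1)) \<subseteq> {tgt (es!i)}"
    using min_ncl_clean[OF m2, of "k - 1"] k3 es2(2) by auto
  obtain A a b B c d where e: "es!0 = (A,a,b)" "es!(k-1) = (B,c,d)" by (metis prod_cases3)
  have k1: "0 < k - 1" "k - 1 < length es" using k3 es(2) by auto
  obtain xs ys zs where d0: "es = xs @ (A,a,b) # ys @ (B,c,d) # zs" "length xs = 0"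
    "length ys = k - 1 - 0 - 1" "length zs = length es - (k - 1) - 1"
    by (rule split_list_nth2[OF k1 e])
  have "xs = []" "zs = []" "length ys = k - 2" using d0(2-4) es(2) k3 by simp_all
  then have d: "es = [] @ (A,a,b) # ys @ (B,c,d) # []" "length ys = k - 2" using d0(1) by simp_all
  have "ncl p es" using es(1) by (simp add: min_ncl_def)
  then have n: "ncl p ([] @ (A,a,b) # ys @ (B,c,d) # [])" using d(1) by metis
  then have ch: "chain p ((A,a,b) # ys @ [(B,c,d)]) p" by (simp add: ncl_def)
  have eA: "edge (A,a,b)" and eB: "edge (B,c,d)" using chain_edges[OF ch] by auto
  have "A a = p" "B d = p" using ch chain_append by auto
  obtain v where v: "c \<le> v" "v \<le> d" "B v \<in> A ` {a..b}" "\<And>s. c \<le> s \<Longrightarrow> s \<le> v \<Longrightarrow> B s \<in> A ` {a..b} \<Longrightarrow> s = v"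
    using first_hit[OF edge_facts(2)[OF eB] edge_facts(1)[OF eB] edge_facts(4)[OF eA]]
      \<open>A a = p\<close> \<open>B d = p\<close> edge_facts(1)[OF eA] by (metis atLeastAtMost_iff imageI order_refl)
  then obtain u where u: "a \<le> u" "u \<le> b" "A u = B v" by auto
  let ?es = "(A,u,b) # ys @ [(B,c,v)]"
  \<comment> \<open>The other polygon offered by \<open>ncl_split\<close> has two edges and is
    excluded by \<open>ncl_length\<close>.\<close>
  have n': "ncl (A u) ?es"
    using ncl_split[OF n u(1,2) v(1,2) u(3)] ncl_length[of p "[(A,a,u),(B,v,d)]"] by auto
  have len: "length ?es = k" using d(2) k3 by simp
  have m: "min_ncl (A u) ?es" using n' kle unfolding min_ncl_def len by blast
  have last: "?es!(k-1) = (B,c,v)" proof -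
    have "k - 1 = Suc (length ys)" using d(2) k3 by simp
    then show ?thesis by simp
  qed
  have mid: "?es!i = es!i" if ik: "0 < i" "i < k - 1" for i
  proof -
    obtain i' where i: "i = Suc i'" "i' < length ys" using ik d(2) by (cases i) auto
    then show ?thesis unfolding d(1) by (simp add: nth_append)
  qed
  show ?thesis
  proof (rule that[OF n'])
    show "3 \<le> length ?es" using len k3 by simp
    show "\<And>A' a' b'. (A',a',b') \<in> set ?es \<Longrightarrow> a' < b'" using min_ncl_nondegenerate[OF m] by blast
    fix i j z assume ij: "i < j" "j < length ?es" and z: "z \<in> im (?es!i)" "z \<in> im (?es!j)"
    consider "j = i + 1" | "i + 1 < j" "i \<noteq> 0 \<or> j \<noteq> k - 1" | "i = 0" "j = k - 1" "i + 1 < j" using ij by linarith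
    then show "(j = i + 1 \<and> z = tgt (?es!i)) \<or> (i = 0 \<and> j = length ?es - 1 \<and> z = A u)"
    proof cases
      case 1
      have ik: "i < k - 1" using 1 ij len by simp
      have 2: "im (?es!i) \<subseteq> im (es!i)" "tgt (?es!i) = tgt (es!i)"
        using mid[of i] ik e(1) u(1) by (cases "i = 0"; auto)+
      have "im (?es!j) \<subseteq> im (es!j)"
        using mid[of j] last e(2) v(2) 1 ij len by (cases "j = k - 1") auto
      then show ?thesis using es(3)[OF ik] z 1 2 by auto
    next
      case 2
      then show ?thesis using min_ncl_nonadjacent[OF m, of i j] ij z len by auto
    next
      case 3
      then have "z \<in> A ` {u..b}" "z \<in> B ` {c..v}" using z last by auto
      moreover have "A ` {u..b} \<subseteq> A ` {a..b}" using u(1) by (intro image_mono) auto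
      ultimately have zz: "z \<in> A ` {a..b}" "z \<in> B ` {c..v}" by blast+
      obtain s where s0: "z = B s" "s \<in> {c..v}" using zz(2) by (rule imageE)
      then have s: "c \<le> s" "s \<le> v" "z = B s" "B s \<in> A ` {a..b}" using zz(1) by simp_all
      then have "z = A u" using v(4)[OF s(1,2)] u(3) by simp
      then show ?thesis using 3 len by simp
    qed
  qed
qed

end

section \<open>Smoothing the corners\<close>

text \<open>The vector \<open>norm w *\<^sub>R v + norm v *\<^sub>R w\<close> bisects the angle
  between \<open>v\<close> and \<open>w\<close> and has a positive product with both, unless
  Cauchy-Schwarz holds with equality and negative sign. This separates cusps from all other
  corners.\<close>

lemma opposite_directions:
  fixes v w :: "'a::real_inner"
  assumes "v \<noteq> 0" "w \<noteq> 0" and no: "\<nexists>e. e \<bullet> v > 0 \<and> e \<bullet> w > 0"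
  obtains \<kappa> where "\<kappa> > 0" "w = - \<kappa> *\<^sub>R v"
proof -
  define e where "e = norm w *\<^sub>R v + norm v *\<^sub>R w"
  have pos: "norm v > 0" "norm w > 0" using assms by auto
  have 1: "e \<bullet> v = norm v * (norm v * norm w + v \<bullet> w)" "e \<bullet> w = norm w * (norm v * norm w + v \<bullet> w)"
    by (simp_all add: e_def inner_add_left inner_commute algebra_simps flip: power2_norm_eq_inner)
       (simp_all add: power2_eq_square)
  have "\<not> (norm v * norm w + v \<bullet> w > 0)" using no 1 pos by (metis mult_pos_pos)
  moreover have "- (v \<bullet> w) \<le> norm v * norm w" using norm_cauchy_schwarz[of v "- w"] by simp
  ultimately have "v \<bullet> (- w) = norm v * norm (- w)" by simp
  then have eq: "norm v *\<^sub>R (- w) = norm (- w) *\<^sub>R v" by (simp only: norm_cauchy_schwarz_eq)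
  have "norm v *\<^sub>R w = - (norm v *\<^sub>R (- w))" by simp
  also have "\<dots> = - (norm w *\<^sub>R v)" unfolding eq by simp
  finally have eq2: "norm v *\<^sub>R w = - (norm w *\<^sub>R v)" .
  have "w = inverse (norm v) *\<^sub>R (norm v *\<^sub>R w)" using pos by simp
  also have "\<dots> = - (inverse (norm v) * norm w) *\<^sub>R v" unfolding eq2 by simp
  finally have "w = - (inverse (norm v) * norm w) *\<^sub>R v" .
  then show ?thesis using pos that[of "inverse (norm v) * norm w"] by simp
qed

lemma piece_shift: "piece u v (\<lambda>t. f (t + sh)) = piece (u + sh) (v + sh) f"
  by (auto simp: piece_def linepath_def fun_eq_iff algebra_simps)

lemma piece_cong:
  assumes "pth M x y (piece u v f)" "\<And>t. t \<in> closed_segment u v \<Longrightarrow> f t = g t"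
  shows "homotopic_paths M (piece u v f) (piece u v g)"
proof (rule homotopic_paths_eq)
  fix t :: real assume "t \<in> {0..1}"
  then have "linepath u v t \<in> closed_segment u v" by (metis imageI linepath_image_01)
  then show "piece u v f t = piece u v g t" using assms(2) by (simp add: piece_def)
qed (use assms(1) in \<open>auto simp: pth_def\<close>)

lemma hp_regroup:
  assumes "pth M p q f" "pth M q r g" "pth M r s h" "pth M s z k"
  shows "homotopic_paths M (f +++ ((g +++ h) +++ k)) ((f +++ g) +++ (h +++ k))"
proof -
  have "homotopic_paths M ((g +++ h) +++ k) (g +++ (h +++ k))"
    by (rule hp_sym[OF hp_assoc[OF assms(2-4)]])
  from hp_joinR[OF assms(1) pth_join[OF pth_join[OF assms(2,3)] assms(4)] this]
  have "homotopic_paths M (f +++ ((g +++ h) +++ k)) (f +++ (g +++ (h +++ k)))" .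
  also have "homotopic_paths M \<dots> ((f +++ g) +++ (h +++ k))"
    by (rule hp_assoc[OF assms(1,2) pth_join[OF assms(3,4)]])
  finally show ?thesis .
qed

section \<open>Rounding a single corner\<close>

context surface
begin

lemma reg_affine:
  assumes r: "reg \<gamma> I" and "l \<noteq> 0" and eq: "\<And>t. t \<in> J \<Longrightarrow> \<delta> t = \<gamma> (l * t + a)"
    and J: "open J" "\<And>t. t \<in> J \<Longrightarrow> l * t + a \<in> I"
  shows "reg \<delta> J"
  unfolding reg_def
proof
  fix t assume t: "t \<in> J"
  then obtain c where c: "c \<in> \<A>" "\<gamma> (l * t + a) \<in> cdom c" using J(2) r reg_sub ex_chart by blast
  define K0 where "K0 = {t\<in>I. \<gamma> t \<in> cdom c}"
  define K where "K = J \<inter> (\<lambda>t. l * t + a) -` K0"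
  have K0: "open K0" "smooth_on (coord c \<circ> \<gamma>) K0"
    using reg_open_cdom[OF r c(1)] reg_chart(1)[OF r c(1)] by (auto simp: K0_def)
  have K: "open K" unfolding K_def
    by (intro open_Int J(1) open_vimage K0 continuous_intros)
  have tK: "t \<in> K" using t c J(2) by (simp add: K_def K0_def)
  have lin: "smooth_on (\<lambda>t. l * t + a) K"
    by (intro smooth_on_add smooth_on_mult smooth_on_const smooth_on_ident K)
  have 1: "smooth_on (\<lambda>t. (coord c \<circ> \<gamma>) (l * t + a)) K"
    by (rule smooth_on_compose[OF lin K0(2) K K0(1)]) (auto simp: K_def)
  have eqK: "(coord c \<circ> \<gamma>) (l * s + a) = (coord c \<circ> \<delta>) s" if "s \<in> K" for s
    using that eq by (simp add: K_def)
  have s: "smooth_on (coord c \<circ> \<delta>) K" by (rule smooth_on_cong[OF 1 K eqK])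
  have "((\<lambda>s. (coord c \<circ> \<gamma>) (l * s + a)) has_vector_derivative l *\<^sub>R vd (coord c \<circ> \<gamma>) (l * t + a)) (at t)"
  proof -
    have g: "((coord c \<circ> \<gamma>) has_vector_derivative vd (coord c \<circ> \<gamma>) (l * t + a)) (at (l * t + a))"
      by (rule smooth_on_vd(1)[OF K0(2,1)]) (use tK in \<open>simp add: K_def\<close>)
    have "((\<lambda>s. l * s + a) has_vector_derivative l) (at t)" by (auto intro!: derivative_eq_intros)
    from vector_diff_chain_at[OF this] g show ?thesis by (simp add: o_def)
  qed
  then have "((coord c \<circ> \<delta>) has_vector_derivative l *\<^sub>R vd (coord c \<circ> \<gamma>) (l * t + a)) (at t)"
    by (rule has_vector_derivative_transform_within_open[OF _ K tK eqK])
  then have "vd (coord c \<circ> \<delta>) t = l *\<^sub>R vd (coord c \<circ> \<gamma>) (l * t + a)"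
    by (rule vector_derivative_at)
  then have "vd (coord c \<circ> \<delta>) t \<noteq> 0"
    using reg_chart(2)[OF r c(1) J(2)[OF t] c(2)] \<open>l \<noteq> 0\<close> by simp
  moreover have "\<delta> ` K \<subseteq> cdom c" using eq by (auto simp: K_def K0_def)
  moreover have "K \<subseteq> J" by (simp add: K_def)
  ultimately show "\<exists>c\<in>\<A>. \<exists>K. open K \<and> t \<in> K \<and> K \<subseteq> J \<and> \<delta> ` K \<subseteq> cdom c \<and>
     smooth_on (coord c \<circ> \<delta>) K \<and> vd (coord c \<circ> \<delta>) t \<noteq> 0" using c(1) s K tK by blast
qed

definition regnb :: "(real \<Rightarrow> 'a) \<Rightarrow> real \<Rightarrow> real \<Rightarrow> bool" where
  "regnb A a b \<longleftrightarrow> (\<exists>\<eta>>0. reg A {a-\<eta><..<b+\<eta>})"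

text \<open>The two ends of the arc are allowed to coincide, as they do once the last edge closes
  the polygon.\<close>

definition simple_on :: "(real \<Rightarrow> 'a) \<Rightarrow> real \<Rightarrow> real \<Rightarrow> bool" where
  "simple_on A a b \<longleftrightarrow> (\<forall>s t. a \<le> s \<longrightarrow> s < t \<longrightarrow> t \<le> b \<longrightarrow> A s = A t \<longrightarrow> s = a \<and> t = b)"

lemma regnb_facts:
  assumes "regnb A a b"
  shows "continuous_on {a..b} A" "A ` {a..b} \<subseteq> M" "compact (A ` {a..b})"
    "\<And>u v. a \<le> u \<Longrightarrow> u \<le> b \<Longrightarrow> a \<le> v \<Longrightarrow> v \<le> b \<Longrightarrow> pth M (A u) (A v) (piece u v A)"
    "\<And>u v w. a \<le> u \<Longrightarrow> u \<le> b \<Longrightarrow> a \<le> v \<Longrightarrow> v \<le> b \<Longrightarrow> a \<le> w \<Longrightarrow> w \<le> b \<Longrightarrow>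
      homotopic_paths M (piece u v A +++ piece v w A) (piece u w A)"
proof -
  obtain \<eta> where "\<eta> > 0" and r: "reg A {a-\<eta><..<b+\<eta>}" using assms by (auto simp: regnb_def)
  then have sub: "{a..b} \<subseteq> {a-\<eta><..<b+\<eta>}" by auto
  show c: "continuous_on {a..b} A" using continuous_on_subset[OF reg_continuous[OF r] sub] .
  then show "compact (A ` {a..b})" by (rule compact_continuous_image) simp
  show m: "A ` {a..b} \<subseteq> M" using reg_sub[OF r] sub by blast
  show "pth M (A u) (A v) (piece u v A)" if "a \<le> u" "u \<le> b" "a \<le> v" "v \<le> b" for u v
    by (rule pth_piece[OF c m]) (use that in \<open>auto simp: closed_segment_eq_real_ivl\<close>)
  show "homotopic_paths M (piece u v A +++ piece v w A) (piece u w A)"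
    if "a \<le> u" "u \<le> b" "a \<le> v" "v \<le> b" "a \<le> w" "w \<le> b" for u v w
    by (rule hp_join_pieces[OF c _ m]) (use that in auto)
qed

lemma regnb_sub:
  assumes "regnb A a b" "a \<le> u" "v \<le> b"
  shows "regnb A u v"
proof -
  obtain \<eta> where \<eta>: "\<eta> > 0" "reg A {a-\<eta><..<b+\<eta>}" using assms by (auto simp: regnb_def)
  have "reg A {u-\<eta><..<v+\<eta>}" by (rule reg_subset[OF \<eta>(2)]) (use assms in auto)
  then show ?thesis using \<eta>(1) by (auto simp: regnb_def)
qed

text \<open>Near an end point, an arc is strictly monotone in a direction in which its velocity has a
  positive component.\<close>

lemma end_nbhd:
  assumes A: "regnb A a b" and x: "a \<le> x" "x \<le> b" and k: "k \<in> \<A>" "A x \<in> cdom k"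
    and e: "e \<bullet> vd (coord k \<circ> A) x > 0" and "m > 0"
  obtains r where "r > 0" "r < m" "\<And>t. \<bar>t - x\<bar> < r \<Longrightarrow> A t \<in> cdom k"
    "smooth_on (coord k \<circ> A) {x-r<..<x+r}" "\<And>t. \<bar>t - x\<bar> < r \<Longrightarrow> e \<bullet> vd (coord k \<circ> A) t > 0"
    "\<And>s t. x - r < s \<Longrightarrow> s < t \<Longrightarrow> t < x + r \<Longrightarrow> e \<bullet> coord k (A s) < e \<bullet> coord k (A t)"
proof -
  obtain \<eta> where \<eta>: "\<eta> > 0" "reg A {a-\<eta><..<b+\<eta>}" using A by (auto simp: regnb_def)
  let ?I = "{t\<in>{a-\<eta><..<b+\<eta>}. A t \<in> cdom k}"
  have I: "open ?I" "smooth_on (coord k \<circ> A) ?I" "x \<in> ?I"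
    using reg_open_cdom[OF \<eta>(2) k(1)] reg_chart(1)[OF \<eta>(2) k(1)] x k(2) \<eta>(1) by auto
  have "continuous_on ?I (\<lambda>t. e \<bullet> vd (coord k \<circ> A) t)"
    by (intro continuous_intros smooth_on_continuous smooth_on_vector_derivative I)
  then have "open (?I \<inter> (\<lambda>t. e \<bullet> vd (coord k \<circ> A) t) -` {0<..})"
    by (rule continuous_open_preimage[OF _ I(1)]) simp
  moreover have "x \<in> ?I \<inter> (\<lambda>t. e \<bullet> vd (coord k \<circ> A) t) -` {0<..}" using I(3) e by simp
  ultimately obtain r0 where r0: "r0 > 0" "ball x r0 \<subseteq> ?I \<inter> (\<lambda>t. e \<bullet> vd (coord k \<circ> A) t) -` {0<..}"
    using open_contains_ball by meson
  define r where "r = min r0 (m / 2)"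
  have r: "r > 0" "r < m" "r \<le> r0" using r0(1) \<open>m > 0\<close> by (auto simp: r_def)
  have in_r: "t \<in> ?I \<and> e \<bullet> vd (coord k \<circ> A) t > 0" if "\<bar>t - x\<bar> < r" for t
  proof -
    have "t \<in> ball x r0" using that r(3) by (simp add: dist_real_def)
    then have "t \<in> ?I \<inter> (\<lambda>t. e \<bullet> vd (coord k \<circ> A) t) -` {0<..}" using r0(2) by blast
    then show ?thesis by simp
  qed
  have sm: "smooth_on (coord k \<circ> A) {x-r<..<x+r}"
    by (rule smooth_on_subset[OF I(2)]) (rule subsetI, rule in_r[THEN conjunct1], auto)
  show ?thesis
  proof (rule that[OF r(1,2) _ sm])
    show "A t \<in> cdom k" if "\<bar>t - x\<bar> < r" for t using in_r[OF that] by simp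
    show "e \<bullet> vd (coord k \<circ> A) t > 0" if "\<bar>t - x\<bar> < r" for t using in_r[OF that] by simp
    fix s t assume st: "x - r < s" "s < t" "t < x + r"
    show "e \<bullet> coord k (A s) < e \<bullet> coord k (A t)"
    proof (rule DERIV_pos_imp_increasing[OF st(2)])
      fix z assume z: "s \<le> z" "z \<le> t"
      then have zr: "\<bar>z - x\<bar> < r" using st by auto
      have "((coord k \<circ> A) has_vector_derivative vd (coord k \<circ> A) z) (at z)"
        by (rule smooth_on_vd(1)[OF sm]) (use z st in auto)
      then have "((\<lambda>t. e \<bullet> (coord k \<circ> A) t) has_vector_derivative e \<bullet> vd (coord k \<circ> A) z) (at z)"
        by (rule bounded_linear.has_vector_derivative[OF bounded_linear_inner_right])
      then have "((\<lambda>t. e \<bullet> coord k (A t)) has_real_derivative e \<bullet> vd (coord k \<circ> A) z) (at z)"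
        by (simp add: has_real_derivative_iff_has_vector_derivative)
      then show "\<exists>y. ((\<lambda>t. e \<bullet> coord k (A t)) has_real_derivative y) (at z) \<and> 0 < y"
        using in_r[OF zr] by blast
    qed
  qed
qed

text \<open>The alternative \<open>s = a\<close> and \<open>t = d\<close> admits arcs that also meet
  at their far ends. It occurs when the last edge is attached and again when the corner at the base
  point is rounded.\<close>

definition joinable :: "(real \<Rightarrow> 'a) \<Rightarrow> real \<Rightarrow> real \<Rightarrow> (real \<Rightarrow> 'a) \<Rightarrow> real \<Rightarrow> real \<Rightarrow> bool" where
  "joinable A a b B c d \<longleftrightarrow> a < b \<and> c < d \<and> regnb A a b \<and> regnb B c d \<and> inj_on A {a..b} \<and> inj_on B {c..d} \<and>
     A b = B c \<and> (\<forall>s t. a \<le> s \<longrightarrow> s \<le> b \<longrightarrow> c \<le> t \<longrightarrow> t \<le> d \<longrightarrow> A s = B t \<longrightarrow> (s = b \<and> t = c) \<or> (s = a \<and> t = d))"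

text \<open>\<open>C\<close> is a smooth arc on \<open>[a, d - sh]\<close> that follows \<open>A\<close>, rounds the corner inside \<open>N\<close> and then
  follows \<open>B\<close> with the parameter shifted by \<open>sh\<close>.\<close>

definition joins :: "(real \<Rightarrow> 'a) \<Rightarrow> real \<Rightarrow> real \<Rightarrow> (real \<Rightarrow> 'a) \<Rightarrow> real \<Rightarrow> real \<Rightarrow> 'a set \<Rightarrow>
    (real \<Rightarrow> 'a) \<Rightarrow> real \<Rightarrow> bool" where
  "joins A a b B c d N C sh \<longleftrightarrow> a < d - sh \<and> regnb C a (d - sh) \<and> simple_on C a (d - sh) \<and>
     (\<exists>l>a. \<forall>t\<le>l. C t = A t) \<and> (\<exists>m<d - sh. \<forall>t\<ge>m. C t = B (t + sh)) \<and>
     C ` {a..d - sh} \<subseteq> A ` {a..b} \<union> B ` {c..d} \<union> N \<and>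
     homotopic_paths M (piece a (d - sh) C) (piece a b A +++ piece c d B)"

text \<open>The set \<open>V\<close> around the corner misses both arcs except for short end pieces
  on which each arc is monotone in its own direction. Whatever is changed inside \<open>V\<close>
  can therefore meet the arcs only in pieces that are ordered by a linear functional. Two directions
  are allowed because at a cusp the arcs are monotone in opposite ones.\<close>

lemma corner_nbhd:
  assumes j: "joinable A a b B c d" and N: "openin (top_of_set M) N" "A b \<in> N"
    and k: "k \<in> \<A>" "A b \<in> cdom k" and e1: "e1 \<bullet> vd (coord k \<circ> A) b > 0" and e2: "e2 \<bullet> vd (coord k \<circ> B) c > 0"
  obtains r \<rho> V where "r > 0" "r < b - a" "r < d - c" "0 < \<rho>" "\<rho> \<le> r"
    "\<And>t. \<bar>t - b\<bar> < r \<Longrightarrow> A t \<in> cdom k" "smooth_on (coord k \<circ> A) {b-r<..<b+r}"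
    "\<And>t. \<bar>t - b\<bar> < r \<Longrightarrow> e1 \<bullet> vd (coord k \<circ> A) t > 0"
    "\<And>s t. b - r < s \<Longrightarrow> s < t \<Longrightarrow> t < b + r \<Longrightarrow> e1 \<bullet> coord k (A s) < e1 \<bullet> coord k (A t)"
    "\<And>t. \<bar>t - c\<bar> < r \<Longrightarrow> B t \<in> cdom k" "smooth_on (coord k \<circ> B) {c-r<..<c+r}"
    "\<And>t. \<bar>t - c\<bar> < r \<Longrightarrow> e2 \<bullet> vd (coord k \<circ> B) t > 0"
    "\<And>s t. c - r < s \<Longrightarrow> s < t \<Longrightarrow> t < c + r \<Longrightarrow> e2 \<bullet> coord k (B s) < e2 \<bullet> coord k (B t)"
    "open V" "convex V" "V \<subseteq> img k" "disc (point k ` V)" "point k ` V \<subseteq> N"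
    "point k ` V \<inter> (A ` {a..b-r} \<union> B ` {c+r..d}) = {}"
    "\<And>t. \<bar>t - b\<bar> < \<rho> \<Longrightarrow> coord k (A t) \<in> V" "\<And>t. \<bar>t - c\<bar> < \<rho> \<Longrightarrow> coord k (B t) \<in> V"
proof -
  have ab: "a < b" "c < d" and A: "regnb A a b" and B: "regnb B c d" and AB: "A b = B c"
    and iA: "inj_on A {a..b}" and iB: "inj_on B {c..d}" using j by (auto simp: joinable_def)
  define m where "m = min (b - a) (d - c)"
  have m: "m > 0" using ab by (simp add: m_def)
  obtain r1 where r1: "r1 > 0" "r1 < m" "\<And>t. \<bar>t - b\<bar> < r1 \<Longrightarrow> A t \<in> cdom k"
    "smooth_on (coord k \<circ> A) {b-r1<..<b+r1}" "\<And>t. \<bar>t - b\<bar> < r1 \<Longrightarrow> e1 \<bullet> vd (coord k \<circ> A) t > 0"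
    "\<And>s t. b - r1 < s \<Longrightarrow> s < t \<Longrightarrow> t < b + r1 \<Longrightarrow> e1 \<bullet> coord k (A s) < e1 \<bullet> coord k (A t)"
    by (rule end_nbhd[OF A less_imp_le[OF ab(1)] order_refl k e1 m]) blast
  have kB: "B c \<in> cdom k" using k(2) AB by simp
  obtain r2 where r2: "r2 > 0" "r2 < m" "\<And>t. \<bar>t - c\<bar> < r2 \<Longrightarrow> B t \<in> cdom k"
    "smooth_on (coord k \<circ> B) {c-r2<..<c+r2}" "\<And>t. \<bar>t - c\<bar> < r2 \<Longrightarrow> e2 \<bullet> vd (coord k \<circ> B) t > 0"
    "\<And>s t. c - r2 < s \<Longrightarrow> s < t \<Longrightarrow> t < c + r2 \<Longrightarrow> e2 \<bullet> coord k (B s) < e2 \<bullet> coord k (B t)"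
    by (rule end_nbhd[OF B order_refl less_imp_le[OF ab(2)] k(1) kB e2 m]) blast
  define r where "r = min r1 r2"
  have r: "r > 0" "r < b - a" "r < d - c" "r \<le> r1" "r \<le> r2"
    using r1(1,2) r2(1,2) by (auto simp: r_def m_def)
  let ?K = "A ` {a..b-r} \<union> B ` {c+r..d}"
  have "compact (A ` {a..b-r})" "compact (B ` {c+r..d})"
    using regnb_facts(3)[OF regnb_sub[OF A, of a "b-r"]] regnb_facts(3)[OF regnb_sub[OF B, of "c+r" d]] r by auto
  then have "compact ?K" by (rule compact_Un)
  then have "openin (top_of_set M) (M \<inter> - ?K)" by (intro openin_open_Int open_Compl compact_imp_closed)
  then have oU: "openin (top_of_set M) (N \<inter> (M \<inter> - ?K))" using N(1) by (rule openin_Int[rotated])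
  have "A b \<notin> A ` {a..b-r}"
  proof
    assume "A b \<in> A ` {a..b-r}"
    then obtain s where s: "A b = A s" "s \<in> {a..b-r}" by (rule imageE)
    have "b = s" by (rule inj_onD[OF iA s(1)]) (use s(2) r ab in auto)
    then show False using s(2) r(1) by simp
  qed
  moreover have "A b \<notin> B ` {c+r..d}"
  proof
    assume "A b \<in> B ` {c+r..d}"
    then obtain s where s: "A b = B s" "s \<in> {c+r..d}" by (rule imageE)
    have "c = s" by (rule inj_onD[OF iB]) (use s AB r ab in auto)
    then show False using s(2) r(1) by simp
  qed
  ultimately have pU: "A b \<in> N \<inter> (M \<inter> - ?K)" using N(2) k cdom_sub by blast
  have "open (coord k ` (cdom k \<inter> (N \<inter> (M \<inter> - ?K))))" by (rule open_coord_image[OF k(1) oU])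
  moreover have "coord k (A b) \<in> coord k ` (cdom k \<inter> (N \<inter> (M \<inter> - ?K)))" using pU k(2) by blast
  ultimately obtain q where q: "q > 0" "ball (coord k (A b)) q \<subseteq> coord k ` (cdom k \<inter> (N \<inter> (M \<inter> - ?K)))"
    by (rule openE)
  let ?V = "ball (coord k (A b)) q"
  have V: "?V \<subseteq> img k" using q(2) by blast
  have pV: "point k ` ?V \<subseteq> N \<inter> (M \<inter> - ?K)"
  proof
    fix z assume "z \<in> point k ` ?V"
    then obtain y where "z = point k y" "y \<in> coord k ` (cdom k \<inter> (N \<inter> (M \<inter> - ?K)))" using q(2) by blast
    then show "z \<in> N \<inter> (M \<inter> - ?K)" using point_coord[OF k(1)] by auto
  qed
  have near: "\<exists>\<rho>>0. \<rho> \<le> r \<and> (\<forall>t. \<bar>t - x\<bar> < \<rho> \<longrightarrow> coord k (F t) \<in> ?V)"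
    if sm: "smooth_on (coord k \<circ> F) {x-r'<..<x+r'}" and "r' > 0" "F x = A b" for F x r'
  proof -
    have "open ({x-r'<..<x+r'} \<inter> (coord k \<circ> F) -` ?V)"
      by (rule continuous_open_preimage[OF smooth_on_continuous[OF sm]]) auto
    moreover have "x \<in> {x-r'<..<x+r'} \<inter> (coord k \<circ> F) -` ?V" using that q(1) by simp
    ultimately obtain \<rho> where \<rho>: "\<rho> > 0" "ball x \<rho> \<subseteq> {x-r'<..<x+r'} \<inter> (coord k \<circ> F) -` ?V" by (rule openE)
    have "coord k (F t) \<in> ?V" if "\<bar>t - x\<bar> < min \<rho> r" for t
    proof -
      have "t \<in> ball x \<rho>" using that by (simp add: dist_real_def abs_minus_commute)
      then have "t \<in> (coord k \<circ> F) -` ?V" using \<rho>(2) by blast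
      then show ?thesis by simp
    qed
    then show ?thesis using \<rho>(1) r(1) by (intro exI[of _ "min \<rho> r"]) auto
  qed
  obtain \<rho>1 where \<rho>1: "\<rho>1 > 0" "\<rho>1 \<le> r" "\<And>t. \<bar>t - b\<bar> < \<rho>1 \<Longrightarrow> coord k (A t) \<in> ?V" using near[OF r1(4,1)] by blast
  obtain \<rho>2 where \<rho>2: "\<rho>2 > 0" "\<rho>2 \<le> r" "\<And>t. \<bar>t - c\<bar> < \<rho>2 \<Longrightarrow> coord k (B t) \<in> ?V" using near[OF r2(4,1)] AB by metis
  show ?thesis
  proof (rule that[of r "min \<rho>1 \<rho>2" ?V])
    show "smooth_on (coord k \<circ> A) {b-r<..<b+r}" by (rule smooth_on_subset[OF r1(4)]) (use r(4) in auto)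
    show "smooth_on (coord k \<circ> B) {c-r<..<c+r}" by (rule smooth_on_subset[OF r2(4)]) (use r(5) in auto)
    show "e1 \<bullet> coord k (A s) < e1 \<bullet> coord k (A t)" if "b - r < s" "s < t" "t < b + r" for s t
      by (rule r1(6)) (use that r(4) in auto)
    show "e2 \<bullet> coord k (B s) < e2 \<bullet> coord k (B t)" if "c - r < s" "s < t" "t < c + r" for s t
      by (rule r2(6)) (use that r(5) in auto)
    show "disc (point k ` ?V)" unfolding disc_def using k(1) V by blast
    show "point k ` ?V \<subseteq> N" using pV by blast
    show "point k ` ?V \<inter> ?K = {}" using pV by blast
  qed (use r r1(3,5) r2(3,5) \<rho>1 \<rho>2 V in \<open>simp_all\<close>)
qed

text \<open>In the chart, \<open>A\<close> is blended into a time-shifted \<open>B\<close> by a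
  smooth cut-off \<mu>. The functional \<open>e\<close> increases strictly along the end of
  \<open>A\<close>, along the beginning of \<open>B\<close> and along the blend, so the blended
  piece is embedded and stays clear of the pieces next to it.\<close>

lemma join_noncusp:
  assumes j: "joinable A a b B c d" and N: "openin (top_of_set M) N" "A b \<in> N"
    and k: "k \<in> \<A>" "A b \<in> cdom k" and e1: "e \<bullet> vd (coord k \<circ> A) b > 0" and e2: "e \<bullet> vd (coord k \<circ> B) c > 0"
  obtains C sh where "joins A a b B c d N C sh"
proof -
  have ab: "a < b" "c < d" and A: "regnb A a b" and B: "regnb B c d" and AB: "A b = B c"
    and iA: "inj_on A {a..b}" and iB: "inj_on B {c..d}"
    and int: "\<And>s t. a \<le> s \<Longrightarrow> s \<le> b \<Longrightarrow> c \<le> t \<Longrightarrow> t \<le> d \<Longrightarrow> A s = B t \<Longrightarrow> (s = b \<and> t = c) \<or> (s = a \<and> t = d)"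
    using j unfolding joinable_def by blast+
  obtain r \<rho> V where r: "r > 0" "r < b - a" "r < d - c" "0 < \<rho>" "\<rho> \<le> r"
    and cA: "\<And>t. \<bar>t - b\<bar> < r \<Longrightarrow> A t \<in> cdom k" and sA: "smooth_on (coord k \<circ> A) {b-r<..<b+r}"
    and dA: "\<And>t. \<bar>t - b\<bar> < r \<Longrightarrow> e \<bullet> vd (coord k \<circ> A) t > 0"
    and mA: "\<And>s t. b - r < s \<Longrightarrow> s < t \<Longrightarrow> t < b + r \<Longrightarrow> e \<bullet> coord k (A s) < e \<bullet> coord k (A t)"
    and cB: "\<And>t. \<bar>t - c\<bar> < r \<Longrightarrow> B t \<in> cdom k" and sB: "smooth_on (coord k \<circ> B) {c-r<..<c+r}"
    and dB: "\<And>t. \<bar>t - c\<bar> < r \<Longrightarrow> e \<bullet> vd (coord k \<circ> B) t > 0"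
    and mB: "\<And>s t. c - r < s \<Longrightarrow> s < t \<Longrightarrow> t < c + r \<Longrightarrow> e \<bullet> coord k (B s) < e \<bullet> coord k (B t)"
    and V: "open V" "convex V" "V \<subseteq> img k" "disc (point k ` V)" "point k ` V \<subseteq> N"
    "point k ` V \<inter> (A ` {a..b-r} \<union> B ` {c+r..d}) = {}"
    and VA: "\<And>t. \<bar>t - b\<bar> < \<rho> \<Longrightarrow> coord k (A t) \<in> V" and VB: "\<And>t. \<bar>t - c\<bar> < \<rho> \<Longrightarrow> coord k (B t) \<in> V"
    by (rule corner_nbhd[OF j N k e1 e2]) blast
  define \<tau> where "\<tau> = \<rho> / 3"
  have \<tau>: "\<tau> > 0" "2 * \<tau> < \<rho>" "2 * \<tau> < r" using r by (auto simp: \<tau>_def)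
  \<comment> \<open>The time shift \<open>\<tau>\<close> puts \<open>B\<close> ahead of \<open>A\<close> in the direction \<open>e\<close> during the blending, so that the
    derivative of the cut-off contributes with the right sign.\<close>
  have "e \<bullet> coord k (A b) < e \<bullet> coord k (B (c + \<tau>/2))"
    using mB[of c "c + \<tau>/2"] r \<tau> AB by simp
  moreover have "isCont (\<lambda>t. e \<bullet> (coord k \<circ> A) t) b"
  proof -
    have "continuous_on {b-r<..<b+r} (\<lambda>t. e \<bullet> (coord k \<circ> A) t)"
      by (intro continuous_intros smooth_on_continuous[OF sA])
    from this[unfolded continuous_on_eq_continuous_at[OF open_greaterThanLessThan]] show ?thesis
      by (rule bspec) (use r(1) in simp)
  qed
  ultimately have "\<forall>\<^sub>F t in at b. e \<bullet> (coord k \<circ> A) t < e \<bullet> coord k (B (c + \<tau>/2))"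
    unfolding isCont_def by (intro order_tendstoD(2)) auto
  then obtain z where z: "z > 0" "\<And>t. t \<noteq> b \<Longrightarrow> dist t b < z \<Longrightarrow> e \<bullet> coord k (A t) < e \<bullet> coord k (B (c + \<tau>/2))"
    unfolding eventually_at by auto
  \<comment> \<open>Blending takes place between \<open>b - \<delta>\<close> and
    \<open>b + \<delta>\<close>. On twice that window the value of \<open>e\<close> along
    \<open>A\<close> must stay below its value at \<open>B (c + \<tau>/2)\<close>, a point that the
    shifted \<open>B\<close> has already passed there.\<close>
  define \<delta> where "\<delta> = min (z / 4) (\<tau> / 8)"
  have \<delta>: "\<delta> > 0" "2 * \<delta> < \<tau> / 2" "2 * \<delta> < r" "e \<bullet> coord k (A (b + 2 * \<delta>)) < e \<bullet> coord k (B (c + \<tau>/2))"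
    using z \<tau> by (auto simp: \<delta>_def dist_real_def intro!: z(2))
  \<comment> \<open>At time \<open>b\<close> the shifted arc is at parameter
    \<open>c + \<tau>\<close> of \<open>B\<close>; the very beginning of \<open>B\<close> is
    skipped.\<close>
  define sh where "sh = c + \<tau> - b"
  define x1 where "x1 = coord k \<circ> A"
  define x2 where "x2 = (\<lambda>t. (coord k \<circ> B) (t + sh))"
  let ?W = "{b-2*\<delta><..<b+2*\<delta>}"
  define \<mu> where "\<mu> t = smooth_step ((t - b + \<delta>) / (2 * \<delta>))" for t
  define y where "y t = x1 t + \<mu> t *\<^sub>R (x2 t - x1 t)" for t
  define C where "C t = (if t \<le> b - \<delta> then A t else if t < b + \<delta> then point k (y t) else B (t + sh))" for t
  have W: "\<bar>t - b\<bar> < r \<and> \<bar>t - b\<bar> < \<rho> \<and> \<bar>t + sh - c\<bar> < r \<and> \<bar>t + sh - c\<bar> < \<rho> \<and> c + \<tau>/2 < t + sh" if "t \<in> ?W" for t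
    using that \<delta> \<tau> r(5) by (auto simp: sh_def abs_if)
  have \<mu>: "0 \<le> \<mu> t" "\<mu> t \<le> 1" for t using smooth_step_bounds by (auto simp: \<mu>_def)
  have \<mu>0: "\<mu> t = 0" if "t \<le> b - \<delta>" for t
    unfolding \<mu>_def by (rule smooth_step_0) (use that \<delta>(1) in \<open>simp add: divide_le_0_iff\<close>)
  have \<mu>1: "\<mu> t = 1" if "b + \<delta> \<le> t" for t
    unfolding \<mu>_def by (rule smooth_step_1) (use that \<delta>(1) in \<open>simp add: pos_le_divide_eq\<close>)
  have s\<mu>: "smooth_on \<mu> UNIV"
  proof -
    have "smooth_on (\<lambda>t. (t - b + \<delta>) / (2 * \<delta>)) UNIV"
      by (intro smooth_on_divide smooth_on_add smooth_on_diff smooth_on_const smooth_on_ident) (use \<delta>(1) in auto)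
    then have "smooth_on (\<lambda>t. smooth_step ((t - b + \<delta>) / (2 * \<delta>))) UNIV"
      by (rule smooth_on_compose[OF _ smooth_on_smooth_step]) auto
    then show ?thesis by (simp add: \<mu>_def[abs_def])
  qed
  have mono\<mu>: "mono \<mu>"
    by (intro monoI) (use \<delta>(1) in \<open>auto simp: \<mu>_def divide_right_mono intro!: monoD[OF mono_smooth_step]\<close>)
  have d\<mu>: "(\<mu> has_vector_derivative vd \<mu> t) (at t)" "vd \<mu> t \<ge> 0" for t
  proof -
    show 1: "(\<mu> has_vector_derivative vd \<mu> t) (at t)" by (rule smooth_on_vd(1)[OF s\<mu>]) auto
    show "vd \<mu> t \<ge> 0"
      by (rule mono_on_imp_deriv_nonneg[of UNIV \<mu> _ t])
         (use 1 mono\<mu> in \<open>auto simp: has_real_derivative_iff_has_vector_derivative\<close>)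
  qed
  have sx1: "smooth_on x1 ?W" unfolding x1_def
    by (rule smooth_on_subset[OF sA]) (use \<delta>(3) in auto)
  have sx2: "smooth_on x2 ?W" unfolding x2_def
    by (rule smooth_on_compose[OF smooth_on_add[OF smooth_on_ident smooth_on_const] sB])
       (use W in \<open>force simp: abs_less_iff\<close>)+
  have sy: "smooth_on y ?W" unfolding y_def
    by (intro smooth_on_add smooth_on_scaleR smooth_on_diff sx1 sx2 smooth_on_subset[OF s\<mu>]) auto
  have ahead: "e \<bullet> x1 t < e \<bullet> x2 t" if t: "t \<in> ?W" for t
  proof -
    have "e \<bullet> x1 t < e \<bullet> coord k (A (b + 2 * \<delta>))"
      unfolding x1_def o_def by (rule mA) (use t \<delta> in auto)
    also have "\<dots> < e \<bullet> coord k (B (c + \<tau>/2))" by (rule \<delta>(4))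
    also have "\<dots> < e \<bullet> x2 t"
      unfolding x2_def o_def by (rule mB) (use W[OF t] \<tau> r in auto)
    finally show ?thesis .
  qed
  have dx2: "(x2 has_vector_derivative vd (coord k \<circ> B) (t + sh)) (at t)" if t: "t \<in> ?W" for t
  proof -
    have g: "((coord k \<circ> B) has_vector_derivative vd (coord k \<circ> B) (t + sh)) (at (t + sh))"
      by (rule smooth_on_vd(1)[OF sB]) (use W[OF t] in \<open>auto simp: abs_less_iff\<close>)
    have "((\<lambda>s. s + sh) has_vector_derivative 1) (at t)" by (auto intro!: derivative_eq_intros)
    from vector_diff_chain_at[OF this] g show ?thesis by (simp add: o_def x2_def)
  qed
  have dx1: "(x1 has_vector_derivative vd (coord k \<circ> A) t) (at t)" if t: "t \<in> ?W" for t
    unfolding x1_def by (rule smooth_on_vd(1)[OF sA]) (use W[OF t] in \<open>auto simp: abs_less_iff\<close>)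
  have ey: "e \<bullet> vd y t > 0" if t: "t \<in> ?W" for t
  proof -
    let ?D = "vd (coord k \<circ> A) t + (\<mu> t *\<^sub>R (vd (coord k \<circ> B) (t + sh) - vd (coord k \<circ> A) t) + vd \<mu> t *\<^sub>R (x2 t - x1 t))"
    have "(y has_vector_derivative ?D) (at t)"
      unfolding y_def
      by (intro has_vector_derivative_add has_vector_derivative_diff dx1[OF t] dx2[OF t]
          has_vector_derivative_scaleR)
         (use d\<mu>(1)[of t] in \<open>simp_all add: has_real_derivative_iff_has_vector_derivative\<close>)
    then have vdy: "vd y t = ?D" by (rule vector_derivative_at)
    \<comment> \<open>A convex combination of two positive components, plus the contribution of the
      cut-off, which is nonnegative because \<mu> increases and the shifted \<open>B\<close> is
      ahead of \<open>A\<close>.\<close>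
    have eq: "e \<bullet> vd y t = (1 - \<mu> t) * (e \<bullet> vd (coord k \<circ> A) t) + \<mu> t * (e \<bullet> vd (coord k \<circ> B) (t + sh))
        + vd \<mu> t * (e \<bullet> x2 t - e \<bullet> x1 t)"
      unfolding vdy by (simp add: inner_add_right inner_diff_right algebra_simps)
    have 1: "vd \<mu> t * (e \<bullet> x2 t - e \<bullet> x1 t) \<ge> 0" using d\<mu>(2) ahead[OF t] by simp
    have p1: "e \<bullet> vd (coord k \<circ> A) t > 0" using dA W[OF t] by blast
    have p2: "e \<bullet> vd (coord k \<circ> B) (t + sh) > 0" using dB W[OF t] by blast
    have 2: "(1 - \<mu> t) * (e \<bullet> vd (coord k \<circ> A) t) + \<mu> t * (e \<bullet> vd (coord k \<circ> B) (t + sh)) > 0"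
    proof (cases "\<mu> t = 0")
      case True then show ?thesis using p1 by simp
    next
      case False
      then have "\<mu> t * (e \<bullet> vd (coord k \<circ> B) (t + sh)) > 0" using p2 \<mu>(1)[of t] by simp
      moreover have "(1 - \<mu> t) * (e \<bullet> vd (coord k \<circ> A) t) \<ge> 0" using p1 \<mu>(2)[of t] by simp
      ultimately show ?thesis by linarith
    qed
    show ?thesis using eq 1 2 by linarith
  qed
  have yV: "y t \<in> V" if t: "t \<in> ?W" for t
  proof -
    have "x1 t \<in> V" "x2 t \<in> V" using VA VB W[OF t] by (auto simp: x1_def x2_def)
    moreover have "y t = (1 - \<mu> t) *\<^sub>R x1 t + \<mu> t *\<^sub>R x2 t" by (simp add: y_def algebra_simps)
    ultimately show ?thesis using convexD_alt[OF V(2)] \<mu> by auto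
  qed
  have CA: "C t = A t" if "t \<le> b - \<delta>" for t using that by (simp add: C_def)
  have CB: "C t = B (t + sh)" if "b + \<delta> \<le> t" for t using that \<delta>(1) by (simp add: C_def)
  have CW: "C t = point k (y t)" if t: "t \<in> ?W" for t
  proof -
    consider "t \<le> b - \<delta>" | "b - \<delta> < t" "t < b + \<delta>" | "b + \<delta> \<le> t" by linarith
    then show ?thesis
    proof cases
      case 1
      then have "y t = coord k (A t)" by (simp add: y_def \<mu>0 x1_def)
      then show ?thesis using CA[OF 1] point_coord[OF k(1)] cA W[OF t] by simp
    next
      case 2 then show ?thesis by (simp add: C_def)
    next
      case 3
      then have "y t = coord k (B (t + sh))" by (simp add: y_def \<mu>1 x2_def)
      then show ?thesis using CB[OF 3] point_coord[OF k(1)] cB W[OF t] by simp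
    qed
  qed
  define E where "E = d - sh"
  have Eb: "b + \<delta> < E" "a < b - \<delta>" "c + r - sh < E" using r \<delta> \<tau> by (auto simp: E_def sh_def)
  obtain \<eta>1 where \<eta>1: "\<eta>1 > 0" "reg A {a-\<eta>1<..<b+\<eta>1}" using A by (auto simp: regnb_def)
  obtain \<eta>2 where \<eta>2: "\<eta>2 > 0" "reg B {c-\<eta>2<..<d+\<eta>2}" using B by (auto simp: regnb_def)
  define \<eta> where "\<eta> = min \<eta>1 \<eta>2"
  have \<eta>: "\<eta> > 0" "\<eta> \<le> \<eta>1" "\<eta> \<le> \<eta>2" using \<eta>1 \<eta>2 by (auto simp: \<eta>_def)
  have regC: "reg C {a-\<eta><..<E+\<eta>}"
  proof (rule reg_local)
    fix t assume t: "t \<in> {a-\<eta><..<E+\<eta>}"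
    consider "t < b - \<delta>" | "t \<in> ?W" | "t > b + \<delta>" using \<delta>(1) by fastforce
    then show "\<exists>J. t \<in> J \<and> J \<subseteq> {a-\<eta><..<E+\<eta>} \<and> reg C J"
    proof cases
      case 1
      have "reg C {a-\<eta><..<b-\<delta>}"
        by (rule reg_affine[OF \<eta>1(2), of 1 _ _ 0]) (use CA \<eta> \<delta>(1) \<eta>1(1) in auto)
      then show ?thesis using 1 t Eb \<delta>(1) \<eta>(1) by (intro exI[of _ "{a-\<eta><..<b-\<delta>}"]) auto
    next
      case 2
      have 0: "vd y t \<noteq> 0" if "t \<in> ?W" for t using ey[OF that] by auto
      have "reg C ?W" by (rule reg_chartI[OF k(1) _ _ sy 0 CW]) (use yV V(3) in auto)
      then have "reg C (?W \<inter> {a-\<eta><..<E+\<eta>})" by (rule reg_subset) auto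
      then show ?thesis using 2 t by (intro exI[of _ "?W \<inter> {a-\<eta><..<E+\<eta>}"]) auto
    next
      case 3
      have "reg C {b+\<delta><..<E+\<eta>}"
        by (rule reg_affine[OF \<eta>2(2), of 1 _ _ sh]) (use CB \<eta> \<delta> \<tau> \<eta>2(1) in \<open>auto simp: E_def sh_def\<close>)
      then show ?thesis using 3 t Eb \<delta>(1) \<eta>(1) by (intro exI[of _ "{b+\<delta><..<E+\<eta>}"]) auto
    qed
  qed
  then have rC: "regnb C a E" using \<eta>(1) by (auto simp: regnb_def)
  have incW: "e \<bullet> y s < e \<bullet> y t" if st: "s \<in> ?W" "t \<in> ?W" "s < t" for s t
  proof (rule DERIV_pos_imp_increasing[OF st(3)])
    fix z assume "s \<le> z" "z \<le> t"
    then have z: "z \<in> ?W" using st by auto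
    have "(y has_vector_derivative vd y z) (at z)" by (rule smooth_on_vd(1)[OF sy _ z]) simp
    then have "((\<lambda>t. e \<bullet> y t) has_vector_derivative e \<bullet> vd y z) (at z)"
      by (rule bounded_linear.has_vector_derivative[OF bounded_linear_inner_right])
    then show "\<exists>D. ((\<lambda>t. e \<bullet> y t) has_real_derivative D) (at z) \<and> 0 < D"
      using ey[OF z] by (auto simp: has_real_derivative_iff_has_vector_derivative)
  qed
  have ymid: "y t \<in> img k" "C t \<notin> A ` {a..b-r}" "C t \<notin> B ` {c+r..d}" if "t \<in> ?W" for t
    using yV[OF that] V(3,6) CW[OF that] by auto
  \<comment> \<open>Points of the blend lie in \<open>V\<close>, so only the end piece of
    \<open>A\<close> after \<open>b - r\<close> could meet it; there \<open>e\<close> is at most its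
    value at \<open>b - \<delta>\<close>, which the blend exceeds. The argument for \<open>B\<close>
    is the mirror image.\<close>
  have AW: "A s \<noteq> C t" if s: "a \<le> s" "s \<le> b - \<delta>" and t: "b - \<delta> < t" "t < b + \<delta>" for s t
  proof
    assume eq: "A s = C t"
    have tW: "t \<in> ?W" using t \<delta>(1) by auto
    have "s \<notin> {a..b-r}" using eq ymid(2)[OF tW] by (metis imageI)
    then have s': "b - r < s" using s by auto
    have "coord k (A s) = y t" using eq CW[OF tW] coord_point[OF k(1) ymid(1)[OF tW]] by simp
    moreover have "e \<bullet> coord k (A s) \<le> e \<bullet> coord k (A (b - \<delta>))"
      using mA[of s "b - \<delta>"] s s' \<delta> r(1) by (cases "s = b - \<delta>") auto
    moreover have "coord k (A (b - \<delta>)) = y (b - \<delta>)" by (simp add: y_def \<mu>0 x1_def)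
    moreover have "e \<bullet> y (b - \<delta>) < e \<bullet> y t" by (rule incW) (use tW t \<delta>(1) in auto)
    ultimately show False by simp
  qed
  have BW: "C s \<noteq> B (t + sh)" if t: "b + \<delta> \<le> t" "t \<le> E" and s: "b - \<delta> < s" "s < b + \<delta>" for s t
  proof
    assume eq: "C s = B (t + sh)"
    have sW: "s \<in> ?W" using s \<delta>(1) by auto
    have "t + sh \<notin> {c+r..d}" using eq ymid(3)[OF sW] by (metis imageI)
    then have t': "t + sh < c + r" using t by (auto simp: E_def)
    have "coord k (B (t + sh)) = y s" using eq CW[OF sW] coord_point[OF k(1) ymid(1)[OF sW]] by simp
    moreover have "e \<bullet> coord k (B (b + \<delta> + sh)) \<le> e \<bullet> coord k (B (t + sh))"
      using mB[of "b + \<delta> + sh" "t + sh"] t t' \<delta> \<tau> r(1) by (cases "t = b + \<delta>") (auto simp: sh_def)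
    moreover have "coord k (B (b + \<delta> + sh)) = y (b + \<delta>)" by (simp add: y_def \<mu>1 x2_def)
    moreover have "e \<bullet> y s < e \<bullet> y (b + \<delta>)" by (rule incW) (use sW s \<delta>(1) in auto)
    ultimately show False by simp
  qed
  have simple: "simple_on C a E"
    unfolding simple_on_def
  proof (intro allI impI)
    fix s t assume st: "a \<le> s" "s < t" "t \<le> E" and eq: "C s = C t"
    consider (AA) "t \<le> b - \<delta>" | (AM) "s \<le> b - \<delta>" "b - \<delta> < t" "t < b + \<delta>" | (AB) "s \<le> b - \<delta>" "b + \<delta> \<le> t"
      | (MM) "b - \<delta> < s" "t < b + \<delta>" | (MB) "b - \<delta> < s" "s < b + \<delta>" "b + \<delta> \<le> t" | (BB) "b + \<delta> \<le> s"
      using st(2) by linarith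
    then show "s = a \<and> t = E"
    proof cases
      case AA
      have "s = t" by (rule inj_onD[OF iA]) (use AA st eq CA \<delta>(1) in auto)
      then show ?thesis using st(2) by simp
    next
      case AM then show ?thesis using AW[OF st(1) AM] CA[OF AM(1)] eq by simp
    next
      case AB
      have "A s = B (t + sh)" using CA[OF AB(1)] CB[OF AB(2)] eq by simp
      from int[OF st(1) _ _ _ this] have "s = b \<and> t + sh = c \<or> s = a \<and> t + sh = d"
        using AB st \<delta> \<tau> by (auto simp: E_def sh_def)
      then show ?thesis using AB \<delta>(1) by (auto simp: E_def)
    next
      case MM
      have sW: "s \<in> ?W" "t \<in> ?W" using MM st \<delta>(1) by auto
      have "y s = y t" using eq CW sW coord_point[OF k(1) ymid(1)[OF sW(1)]] coord_point[OF k(1) ymid(1)[OF sW(2)]] by metis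
      then show ?thesis using incW[OF sW st(2)] by simp
    next
      case MB then show ?thesis using BW[OF MB(3) st(3) MB(1,2)] CB[OF MB(3)] eq by simp
    next
      case BB
      have "s + sh = t + sh"
        by (rule inj_onD[OF iB]) (use BB st eq CB \<delta> \<tau> in \<open>auto simp: E_def sh_def\<close>)
      then show ?thesis using st(2) by simp
    qed
  qed
  have img: "C ` {a..E} \<subseteq> A ` {a..b} \<union> B ` {c..d} \<union> N"
  proof (rule image_subsetI)
    fix t assume t: "t \<in> {a..E}"
    consider "t \<le> b - \<delta>" | "t \<in> ?W" | "b + \<delta> \<le> t" using \<delta>(1) by fastforce
    then show "C t \<in> A ` {a..b} \<union> B ` {c..d} \<union> N"
    proof cases
      case 1 then show ?thesis using CA[OF 1] t \<delta>(1) by auto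
    next
      case 2 then show ?thesis using CW[OF 2] yV[OF 2] V(5) by auto
    next
      case 3
      have "t + sh \<in> {c..d}" using t 3 \<delta> \<tau> by (auto simp: E_def sh_def)
      then show ?thesis using CB[OF 3] by auto
    qed
  qed
  define c' where "c' = b + \<delta> + sh"
  have c': "c \<le> c'" "c' \<le> d" "c' = c + \<tau> + \<delta>" using \<delta> \<tau> r by (auto simp: c'_def sh_def)
  have hom: "homotopic_paths M (piece a E C) (piece a b A +++ piece c d B)"
  proof -
    have ra: "a \<le> b - \<delta>" "b - \<delta> \<le> b + \<delta>" "b + \<delta> \<le> E" "b - \<delta> \<le> b" "a \<le> b" using Eb \<delta>(1) ab by auto
    have pA1: "pth M (A a) (A (b-\<delta>)) (piece a (b-\<delta>) A)" and pA2: "pth M (A (b-\<delta>)) (A b) (piece (b-\<delta>) b A)"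
      and pA: "pth M (A a) (A b) (piece a b A)"
      using regnb_facts(4)[OF A] ra by auto
    have pB1: "pth M (B c) (B c') (piece c c' B)" and pB2: "pth M (B c') (B d) (piece c' d B)"
      and pB: "pth M (B c) (B d) (piece c d B)"
      using regnb_facts(4)[OF B] c' ab by auto
    have pC1: "pth M (C a) (C (b-\<delta>)) (piece a (b-\<delta>) C)" and pC2: "pth M (C (b-\<delta>)) (C (b+\<delta>)) (piece (b-\<delta>) (b+\<delta>) C)"
      and pC3: "pth M (C (b+\<delta>)) (C E) (piece (b+\<delta>) E C)" and pC23: "pth M (C (b-\<delta>)) (C E) (piece (b-\<delta>) E C)"
      using regnb_facts(4)[OF rC] ra by auto
    have VAp: "pth (point k ` V) (A (b-\<delta>)) (A b) (piece (b-\<delta>) b A)"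
    proof (rule pth_piece[OF continuous_on_subset[OF regnb_facts(1)[OF A]]])
      show "closed_segment (b-\<delta>) b \<subseteq> {b-\<delta>..b}" using ra by (simp add: closed_segment_eq_real_ivl)
      show "A ` {b-\<delta>..b} \<subseteq> point k ` V"
      proof (rule image_subsetI)
        fix t assume t: "t \<in> {b-\<delta>..b}"
        then have "t \<in> ?W" using \<delta>(1) by auto
        then have "coord k (A t) \<in> V" "A t \<in> cdom k" using VA cA W by auto
        then show "A t \<in> point k ` V" using point_coord[OF k(1)] by (metis imageI)
      qed
    qed (use ra in auto)
    have VBp: "pth (point k ` V) (B c) (B c') (piece c c' B)"
    proof (rule pth_piece[OF continuous_on_subset[OF regnb_facts(1)[OF B]]])
      show "closed_segment c c' \<subseteq> {c..c'}" using c' by (simp add: closed_segment_eq_real_ivl)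
      show "B ` {c..c'} \<subseteq> point k ` V"
      proof (rule image_subsetI)
        fix t assume t: "t \<in> {c..c'}"
        then have "\<bar>t - c\<bar> < \<rho>" "\<bar>t - c\<bar> < r" using c'(3) \<delta> \<tau> by auto
        then have "coord k (B t) \<in> V" "B t \<in> cdom k" using VB cB by auto
        then show "B t \<in> point k ` V" using point_coord[OF k(1)] by (metis imageI)
      qed
    qed (use c' in auto)
    have VCp: "pth (point k ` V) (C (b-\<delta>)) (C (b+\<delta>)) (piece (b-\<delta>) (b+\<delta>) C)"
    proof (rule pth_piece[OF continuous_on_subset[OF regnb_facts(1)[OF rC]]])
      show "closed_segment (b-\<delta>) (b+\<delta>) \<subseteq> {b-\<delta>..b+\<delta>}" using ra by (simp add: closed_segment_eq_real_ivl)
      show "C ` {b-\<delta>..b+\<delta>} \<subseteq> point k ` V"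
      proof (rule image_subsetI)
        fix t assume t: "t \<in> {b-\<delta>..b+\<delta>}"
        then have "t \<in> ?W" using \<delta>(1) by auto
        then show "C t \<in> point k ` V" using CW yV by auto
      qed
    qed (use ra in auto)
    have ends: "C (b-\<delta>) = A (b-\<delta>)" "C (b+\<delta>) = B c'" using CA[of "b-\<delta>"] CB[of "b+\<delta>"] by (auto simp: c'_def)
    have VBp': "pth (point k ` V) (A b) (B c') (piece c c' B)" using VBp AB by simp
    have mid: "homotopic_paths M (piece (b-\<delta>) (b+\<delta>) C) (piece (b-\<delta>) b A +++ piece c c' B)"
      by (rule disc_homotopic[OF V(4) VCp]) (use pth_join[OF VAp VBp'] ends in simp)
    have first: "homotopic_paths M (piece a (b-\<delta>) C) (piece a (b-\<delta>) A)"
      by (rule piece_cong[OF pC1 CA]) (use ra in \<open>auto simp: closed_segment_eq_real_ivl\<close>)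
    have last: "homotopic_paths M (piece (b+\<delta>) E C) (piece c' d B)"
    proof -
      have "homotopic_paths M (piece (b+\<delta>) E C) (piece (b+\<delta>) E (\<lambda>t. B (t + sh)))"
        by (rule piece_cong[OF pC3 CB]) (use ra in \<open>auto simp: closed_segment_eq_real_ivl\<close>)
      also have "piece (b+\<delta>) E (\<lambda>t. B (t + sh)) = piece c' d B" unfolding piece_shift by (simp add: c'_def E_def)
      finally show ?thesis .
    qed
    note pB1' = pB1[folded AB]
    have "homotopic_paths M (piece a E C) (piece a (b-\<delta>) C +++ piece (b-\<delta>) E C)"
      by (rule hp_sym[OF regnb_facts(5)[OF rC]]) (use ra in auto)
    also have "homotopic_paths M \<dots> (piece a (b-\<delta>) C +++ (piece (b-\<delta>) (b+\<delta>) C +++ piece (b+\<delta>) E C))"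
      by (rule hp_joinR[OF pC1 pC23 hp_sym[OF regnb_facts(5)[OF rC]]]) (use ra in auto)
    also have "homotopic_paths M \<dots> (piece a (b-\<delta>) A +++ ((piece (b-\<delta>) b A +++ piece c c' B) +++ piece c' d B))"
      by (rule hp_join[OF pC1 pth_join[OF pC2 pC3] first hp_join[OF pC2 pC3 mid last]])
    also have "homotopic_paths M \<dots> ((piece a (b-\<delta>) A +++ piece (b-\<delta>) b A) +++ (piece c c' B +++ piece c' d B))"
      by (rule hp_regroup[OF pA1 pA2 pB1' pB2])
    also have "homotopic_paths M \<dots> (piece a b A +++ piece c d B)"
    proof (rule hp_join[OF pth_join[OF pA1 pA2] pth_join[OF pB1' pB2]])
      show "homotopic_paths M (piece a (b-\<delta>) A +++ piece (b-\<delta>) b A) (piece a b A)"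
        by (rule regnb_facts(5)[OF A]) (use ra in auto)
      show "homotopic_paths M (piece c c' B +++ piece c' d B) (piece c d B)"
        by (rule regnb_facts(5)[OF B]) (use c' ab in auto)
    qed
    finally show ?thesis .
  qed
  have "joins A a b B c d N C sh"
    unfolding joins_def E_def[symmetric]
  proof (intro conjI)
    show "a < E" using Eb \<delta>(1) by linarith
    show "\<exists>l>a. \<forall>t\<le>l. C t = A t" using CA Eb(2) by blast
    show "\<exists>m<E. \<forall>t\<ge>m. C t = B (t + sh)" using CB Eb(1) by blast
  qed (use rC simple img hom in auto)
  then show ?thesis by (rule that)
qed

end

text \<open>A large multiple of \<open>w\<close> makes the product with \<open>v\<close> positive
  and, \<open>w\<close> being orthogonal to \<open>n\<close>, leaves the product with
  \<open>n\<close> alone. At a cusp \<open>v\<close> is the velocity of an arc and \<open>n\<close>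
  the direction of the inserted segment; the functional certifies that the corner between them is
  not a cusp.\<close>

lemma tilted_functional:
  fixes v n w :: "'a::real_inner"
  assumes "w \<bullet> v > 0" "w \<bullet> n = 0" "n \<noteq> 0"
  obtains e where "e \<bullet> v > 0" "e \<bullet> n > 0"
proof
  let ?e = "n + ((\<bar>n \<bullet> v\<bar> + 1) / (w \<bullet> v)) *\<^sub>R w"
  have "?e \<bullet> v = n \<bullet> v + (\<bar>n \<bullet> v\<bar> + 1)" using assms(1) by (simp add: inner_add_left)
  then show "?e \<bullet> v > 0" by linarith
  show "?e \<bullet> n > 0" using assms(2,3) by (simp add: inner_add_left)
qed

section \<open>Cusps, and the passage from polygons to smooth closed curves\<close>

context surface
begin

lemma simple_on_inj: "simple_on C a e \<Longrightarrow> C a \<noteq> C e \<Longrightarrow> inj_on C {a..e}"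
proof (rule linorder_inj_onI)
  fix x y assume s: "simple_on C a e" "C a \<noteq> C e" and xy: "x < y" "x \<in> {a..e}" "y \<in> {a..e}"
  show "C x \<noteq> C y"
  proof
    assume "C x = C y"
    then have "x = a \<and> y = e" using s(1) xy unfolding simple_on_def by simp
    then show False using s(2) \<open>C x = C y\<close> by simp
  qed
qed auto

lemma joinsD:
  assumes "joins A a b B c d N C sh"
  shows "a < d - sh" "regnb C a (d - sh)" "simple_on C a (d - sh)"
    "\<exists>l>a. \<forall>t\<le>l. C t = A t" "\<exists>m<d - sh. \<forall>t\<ge>m. C t = B (t + sh)"
    "C ` {a..d - sh} \<subseteq> A ` {a..b} \<union> B ` {c..d} \<union> N"
    "homotopic_paths M (piece a (d - sh) C) (piece a b A +++ piece c d B)"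
    "C a = A a" "C (d - sh) = B d"
proof -
  note c = assms[unfolded joins_def]
  show "a < d - sh" "regnb C a (d - sh)" "simple_on C a (d - sh)"
    by (rule c[THEN conjunct1] c[THEN conjunct2, THEN conjunct1] c[THEN conjunct2, THEN conjunct2, THEN conjunct1])+
  note c = c[THEN conjunct2, THEN conjunct2, THEN conjunct2]
  show *: "\<exists>l>a. \<forall>t\<le>l. C t = A t" "\<exists>m<d - sh. \<forall>t\<ge>m. C t = B (t + sh)"
    by (rule c[THEN conjunct1] c[THEN conjunct2, THEN conjunct1])+
  note c = c[THEN conjunct2, THEN conjunct2]
  show "C ` {a..d - sh} \<subseteq> A ` {a..b} \<union> B ` {c..d} \<union> N"
    "homotopic_paths M (piece a (d - sh) C) (piece a b A +++ piece c d B)"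
    by (rule c[THEN conjunct1] c[THEN conjunct2])+
  show "C a = A a" using *(1) by force
  obtain m where m: "m < d - sh" "\<forall>t\<ge>m. C t = B (t + sh)" using *(2) by (elim exE conjE)
  have "C (d - sh) = B (d - sh + sh)" using m(2)[rule_format, of "d - sh"] m(1) by simp
  then show "C (d - sh) = B d" by simp
qed

text \<open>At a cusp the two arcs are graphs over their common tangent line; cutting both at the same
  height and inserting the connecting segment produces two corners that are not cusps.\<close>

lemma join_cusp:
  assumes j: "joinable A a b B c d" and N: "openin (top_of_set M) N" "A b \<in> N"
    and k: "k \<in> \<A>" "A b \<in> cdom k" and "vd (coord k \<circ> A) b \<noteq> 0"
    and "\<kappa> > 0" "vd (coord k \<circ> B) c = - \<kappa> *\<^sub>R vd (coord k \<circ> A) b"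
  obtains C sh where "joins A a b B c d N C sh"
proof -
  have ab: "a < b" "c < d" and A: "regnb A a b" and B: "regnb B c d" and AB: "A b = B c"
    and iA: "inj_on A {a..b}" and iB: "inj_on B {c..d}"
    and int: "\<And>s t. a \<le> s \<Longrightarrow> s \<le> b \<Longrightarrow> c \<le> t \<Longrightarrow> t \<le> d \<Longrightarrow> A s = B t \<Longrightarrow> (s = b \<and> t = c) \<or> (s = a \<and> t = d)"
    using j unfolding joinable_def by blast+
  define v where "v = vd (coord k \<circ> A) b"
  have vv: "v \<bullet> v > 0" using assms(6) by (simp add: v_def)
  have e1: "v \<bullet> vd (coord k \<circ> A) b > 0" using vv by (simp add: v_def)
  have e2: "(- v) \<bullet> vd (coord k \<circ> B) c > 0" unfolding assms(8) v_def[symmetric] using vv assms(7) by simp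
  obtain r \<rho> V where r: "r > 0" "r < b - a" "r < d - c" "0 < \<rho>" "\<rho> \<le> r"
    and cA: "\<And>t. \<bar>t - b\<bar> < r \<Longrightarrow> A t \<in> cdom k" and sA: "smooth_on (coord k \<circ> A) {b-r<..<b+r}"
    and dA: "\<And>t. \<bar>t - b\<bar> < r \<Longrightarrow> v \<bullet> vd (coord k \<circ> A) t > 0"
    and mA: "\<And>s t. b - r < s \<Longrightarrow> s < t \<Longrightarrow> t < b + r \<Longrightarrow> v \<bullet> coord k (A s) < v \<bullet> coord k (A t)"
    and cB: "\<And>t. \<bar>t - c\<bar> < r \<Longrightarrow> B t \<in> cdom k" and sB: "smooth_on (coord k \<circ> B) {c-r<..<c+r}"
    and dB: "\<And>t. \<bar>t - c\<bar> < r \<Longrightarrow> (- v) \<bullet> vd (coord k \<circ> B) t > 0"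
    and mB: "\<And>s t. c - r < s \<Longrightarrow> s < t \<Longrightarrow> t < c + r \<Longrightarrow> (- v) \<bullet> coord k (B s) < (- v) \<bullet> coord k (B t)"
    and V: "open V" "convex V" "V \<subseteq> img k" "disc (point k ` V)" "point k ` V \<subseteq> N"
    "point k ` V \<inter> (A ` {a..b-r} \<union> B ` {c+r..d}) = {}"
    and VA: "\<And>t. \<bar>t - b\<bar> < \<rho> \<Longrightarrow> coord k (A t) \<in> V" and VB: "\<And>t. \<bar>t - c\<bar> < \<rho> \<Longrightarrow> coord k (B t) \<in> V"
    by (rule corner_nbhd[OF j N k e1 e2]) blast
  define XA where "XA = (\<lambda>t. v \<bullet> (coord k \<circ> A) t)"
  define XB where "XB = (\<lambda>t. v \<bullet> (coord k \<circ> B) t)"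
  have incA: "XA s < XA t" if "b - r < s" "s < t" "t < b + r" for s t using mA[OF that] by (simp add: XA_def)
  have decB: "XB t < XB s" if "c - r < s" "s < t" "t < c + r" for s t using mB[OF that] by (simp add: XB_def)
  have XAB: "XA b = XB c" by (simp add: XA_def XB_def AB)
  have contA: "continuous_on {b - \<rho>/2..b} XA" unfolding XA_def
    by (intro continuous_intros continuous_on_subset[OF smooth_on_continuous[OF sA]]) (use r in auto)
  have contB: "continuous_on {c..c + \<rho>/2} XB" unfolding XB_def
    by (intro continuous_intros continuous_on_subset[OF smooth_on_continuous[OF sB]]) (use r in auto)
  \<comment> \<open>A height, measured by \<open>v\<close>, strictly below the corner and attained
    by both arcs while they are still in \<open>V\<close>; the intermediate value theorem yields the
    parameters \<alpha> and \<beta>.\<close>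
  define X0 where "X0 = max (XA (b - \<rho>/2)) (XB (c + \<rho>/2))"
  have X0: "XA (b - \<rho>/2) \<le> X0" "XB (c + \<rho>/2) \<le> X0" "X0 < XA b" "X0 < XB c"
    using incA[of "b - \<rho>/2" b] decB[of c "c + \<rho>/2"] r XAB by (auto simp: X0_def)
  obtain \<alpha> where \<alpha>: "b - \<rho>/2 \<le> \<alpha>" "\<alpha> \<le> b" "XA \<alpha> = X0"
    using IVT'[OF X0(1) less_imp_le[OF X0(3)] _ contA] r(4) by auto
  obtain \<beta> where \<beta>: "c \<le> \<beta>" "\<beta> \<le> c + \<rho>/2" "XB \<beta> = X0"
    using IVT2'[OF X0(2) less_imp_le[OF X0(4)] _ contB] r(4) by auto
  have \<alpha>b: "\<alpha> < b" "c < \<beta>" "a < \<alpha>" "\<beta> < d" "b - r < \<alpha>" "\<beta> < c + r" "\<bar>\<alpha> - b\<bar> < r" "\<bar>\<alpha> - b\<bar> < \<rho>" "\<bar>\<beta> - c\<bar> < r" "\<bar>\<beta> - c\<bar> < \<rho>"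
  proof -
    show "\<alpha> < b" using \<alpha>(2,3) X0(3) by (cases "\<alpha> = b") auto
    show "c < \<beta>" using \<beta>(1,3) X0(4) by (cases "\<beta> = c") auto
  qed (use \<alpha> \<beta> r in auto)
  define y0 where "y0 = coord k (A \<alpha>)"
  define y1 where "y1 = coord k (B \<beta>)"
  define n where "n = y1 - y0"
  have yV: "y0 \<in> V" "y1 \<in> V" using VA VB \<alpha>b by (auto simp: y0_def y1_def)
  have py: "point k y0 = A \<alpha>" "point k y1 = B \<beta>"
    unfolding y0_def y1_def by (intro point_coord[OF k(1)] cA cB \<alpha>b)+
  have AB\<alpha>: "A \<alpha> \<noteq> B t" if "c \<le> t" "t \<le> d" for t
    using int[of \<alpha> t] that \<alpha>b by auto
  have "y0 \<noteq> y1" using py AB\<alpha>[of \<beta>] \<alpha>b by auto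
  then have n: "n \<noteq> 0" "v \<bullet> n = 0"
    using \<alpha>(3) \<beta>(3) by (auto simp: n_def y0_def y1_def XA_def XB_def inner_diff_right)
  define D where "D = (\<lambda>t. point k (y0 + t *\<^sub>R (y1 - y0)))"
  note sg = segment_arc[OF k(1) V(1-3) yV \<open>y0 \<noteq> y1\<close>, folded D_def]
  have rD: "regnb D 0 1" using sg(1) unfolding regnb_def by blast
  have D01: "D 0 = A \<alpha>" "D 1 = B \<beta>" using py by (simp_all add: D_def)
  have oI: "open {t. y0 + t *\<^sub>R n \<in> V}"
  proof -
    have "open ((\<lambda>t. y0 + t *\<^sub>R n) -` V)" by (intro open_vimage V continuous_intros)
    then show ?thesis by (simp add: vimage_def)
  qed
  have Din: "y0 + t *\<^sub>R n \<in> V" if "t \<in> {0..1}" for t using sg(6)[OF that] by (simp add: n_def)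
  have Dc: "coord k (D t) = y0 + t *\<^sub>R n" if "y0 + t *\<^sub>R n \<in> V" for t
    using that V(3) coord_point[OF k(1)] by (auto simp: D_def n_def)
  have DX: "v \<bullet> coord k (D t) = X0" if "t \<in> {0..1}" for t
    using Dc[OF Din[OF that]] n(2) \<alpha>(3) by (simp add: inner_add_right y0_def XA_def)
  have DV: "D t \<in> point k ` V" if "t \<in> {0..1}" for t using sg(3) that by blast
  \<comment> \<open>The segment runs at constant height \<open>X0\<close>, while \<open>A\<close> is
    strictly monotone in height near the corner and avoids \<open>V\<close> before that; so
    \<open>A\<close> can touch the segment only at \<alpha>. The same holds for \<open>B\<close> at
    \<beta>.\<close>
  have AD: "s = \<alpha>" if st: "a \<le> s" "s \<le> b" "t \<in> {0..1}" "A s = D t" for s t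
  proof -
    have "A s \<notin> A ` {a..b-r}" using DV[OF st(3)] st(4) V(6) by auto
    then have s: "b - r < s" using st(1) by force
    have "XA s = XA \<alpha>" using DX[OF st(3)] st(4) \<alpha>(3) by (simp add: XA_def)
    then show ?thesis using incA[of s \<alpha>] incA[of \<alpha> s] s st(2) \<alpha>b r by (cases s \<alpha> rule: linorder_cases) auto
  qed
  have BD: "s = \<beta>" if st: "c \<le> s" "s \<le> d" "t \<in> {0..1}" "B s = D t" for s t
  proof -
    have "B s \<notin> B ` {c+r..d}" using DV[OF st(3)] st(4) V(6) by auto
    then have s: "s < c + r" using st(2) by force
    have "XB s = XB \<beta>" using DX[OF st(3)] st(4) \<beta>(3) by (simp add: XB_def)
    then show ?thesis using decB[of s \<beta>] decB[of \<beta> s] s st(1) \<alpha>b r by (cases s \<beta> rule: linorder_cases) auto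
  qed
  have iD: "inj_on D {0..1}" by (rule sg(2))
  have j1: "joinable A a \<alpha> D 0 1"
    unfolding joinable_def
  proof (intro conjI allI impI)
    show "regnb A a \<alpha>" by (rule regnb_sub[OF A]) (use \<alpha>b in auto)
    show "inj_on A {a..\<alpha>}" by (rule inj_on_subset[OF iA]) (use \<alpha>b in auto)
    fix s t assume st: "a \<le> s" "s \<le> \<alpha>" "0 \<le> t" "t \<le> (1::real)" "A s = D t"
    have s: "s = \<alpha>" by (rule AD[OF st(1) _ _ st(5)]) (use st \<alpha>b in auto)
    have "t = 0" by (rule inj_onD[OF iD]) (use st s D01 in auto)
    then show "s = \<alpha> \<and> t = 0 \<or> s = a \<and> t = 1" using s by simp
  qed (use \<alpha>b rD iD D01 in auto)
  \<comment> \<open>The remainder of \<open>B\<close> is removed from the admissible neighbourhood,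
    so that rounding the first corner cannot create an intersection with the arc that is attached
    next.\<close>
  define N1 where "N1 = N \<inter> (M \<inter> - (B ` {\<beta>..d}))"
  have cBd: "compact (B ` {\<beta>..d})" by (rule regnb_facts(3)[OF regnb_sub[OF B]]) (use \<alpha>b in auto)
  have oN1: "openin (top_of_set M) N1" unfolding N1_def
    by (intro openin_Int N(1) openin_open_Int open_Compl compact_imp_closed cBd)
  have "A \<alpha> \<in> point k ` V" using py(1) yV(1) by (metis imageI)
  then have AN: "A \<alpha> \<in> N" using V(5) by blast
  have "B \<beta> \<in> point k ` V" using py(2) yV(2) by (metis imageI)
  then have BN: "B \<beta> \<in> N" using V(5) by blast
  have AN1: "A \<alpha> \<in> N1"
    unfolding N1_def
  proof (intro IntI AN ComplI)
    show "A \<alpha> \<in> M" by (rule subsetD[OF openin_imp_subset[OF N(1)] AN])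
    assume "A \<alpha> \<in> B ` {\<beta>..d}"
    then obtain t where "A \<alpha> = B t" "t \<in> {\<beta>..d}" by (rule imageE)
    then show False using AB\<alpha>[of t] \<alpha>b by auto
  qed
  have dD: "((coord k \<circ> D) has_vector_derivative n) (at t)" if "t \<in> {0..1}" for t
  proof (rule has_vector_derivative_transform_within_open[OF _ oI])
    show "((\<lambda>t. y0 + t *\<^sub>R n) has_vector_derivative n) (at t)" by (auto intro!: derivative_eq_intros)
  qed (use Din[OF that] Dc in auto)
  obtain f1 where f1: "f1 \<bullet> vd (coord k \<circ> A) \<alpha> > 0" "f1 \<bullet> n > 0"
    by (rule tilted_functional[OF dA[OF \<alpha>b(7)] n(2,1)])
  have f1': "f1 \<bullet> vd (coord k \<circ> D) 0 > 0" using vector_derivative_at[OF dD[of 0]] f1(2) by simp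
  obtain C1 sh1 where J1: "joins A a \<alpha> D 0 1 N1 C1 sh1"
    by (rule join_noncusp[OF j1 oN1 AN1 k(1) cA[OF \<alpha>b(7)] f1(1) f1'])
  note J1' = joinsD[OF J1]
  define E1 where "E1 = 1 - sh1"
  have C1a: "C1 a = A a" and C1E: "C1 E1 = B \<beta>" using J1'(8,9) D01 by (simp_all add: E1_def)
  have AaB: "A a \<noteq> B \<beta>" using int[of a \<beta>] ab \<alpha>b by auto
  have iC1: "inj_on C1 {a..E1}" unfolding E1_def
    by (rule simple_on_inj[OF J1'(3)]) (use C1a C1E AaB in \<open>simp add: E1_def\<close>)
  have j2: "joinable C1 a E1 B \<beta> d"
    unfolding joinable_def
  proof (intro conjI allI impI)
    show "regnb B \<beta> d" by (rule regnb_sub[OF B]) (use \<alpha>b in auto)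
    show "inj_on B {\<beta>..d}" by (rule inj_on_subset[OF iB]) (use \<alpha>b in auto)
    show "a < E1" "regnb C1 a E1" using J1'(1,2) by (simp_all add: E1_def)
    fix s t assume st: "a \<le> s" "s \<le> E1" "\<beta> \<le> t" "t \<le> d" "C1 s = B t"
    have "C1 s \<in> C1 ` {a..1 - sh1}" by (rule imageI) (use st in \<open>simp add: E1_def\<close>)
    then consider (1) "C1 s \<in> A ` {a..\<alpha>}" | (2) "C1 s \<in> D ` {0..1}" | (3) "C1 s \<in> N1" using J1'(6) by blast
    then show "s = E1 \<and> t = \<beta> \<or> s = a \<and> t = d"
    proof cases
      case 1
      then obtain s' where s': "C1 s = A s'" "s' \<in> {a..\<alpha>}" by (rule imageE)
      have "s' = a \<and> t = d" using int[of s' t] s' st \<alpha>b by auto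
      moreover from this have "s = a" by (intro inj_onD[OF iC1]) (use s' C1a st J1'(1) in \<open>auto simp: E1_def\<close>)
      ultimately show ?thesis by simp
    next
      case 2
      then obtain u where u: "C1 s = D u" "u \<in> {0..1}" by (rule imageE)
      have t: "t = \<beta>" by (rule BD[of t u]) (use u st \<alpha>b in auto)
      have "s = E1" by (rule inj_onD[OF iC1]) (use t C1E st J1'(1) in \<open>auto simp: E1_def\<close>)
      then show ?thesis using t by simp
    next
      case 3
      then show ?thesis using st by (auto simp: N1_def)
    qed
  qed (use iC1 C1E \<alpha>b in auto)
  obtain m where m: "m < 1 - sh1" "\<forall>t\<ge>m. C1 t = D (t + sh1)" using J1'(5) by blast
  \<comment> \<open>Near its end the rounded arc is the shifted segment \<open>D\<close>, so it
    still arrives at the second corner with velocity \<open>n\<close>.\<close>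
  have dC1: "vd (coord k \<circ> C1) E1 = n"
  proof (rule vector_derivative_at, rule has_vector_derivative_transform_within_open)
    have "((\<lambda>t. t + sh1) has_vector_derivative 1) (at E1)" by (auto intro!: derivative_eq_intros)
    moreover have "((coord k \<circ> D) has_vector_derivative n) (at (E1 + sh1))"
      using dD[of 1] by (simp add: E1_def)
    ultimately show "((\<lambda>t. (coord k \<circ> D) (t + sh1)) has_vector_derivative n) (at E1)"
      using vector_diff_chain_at by (fastforce simp: o_def)
    show "open {m<..}" "E1 \<in> {m<..}" using m(1) by (auto simp: E1_def)
    show "(coord k \<circ> D) (t + sh1) = (coord k \<circ> C1) t" if "t \<in> {m<..}" for t using m(2) that by simp
  qed
  obtain f2 where f2: "f2 \<bullet> vd (coord k \<circ> B) \<beta> > 0" "f2 \<bullet> n > 0"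
    by (rule tilted_functional[OF dB[OF \<alpha>b(9)] _ n(1)]) (use n(2) in simp)
  have f2': "f2 \<bullet> vd (coord k \<circ> C1) E1 > 0" using f2(2) dC1 by simp
  have C1N: "C1 E1 \<in> N" "C1 E1 \<in> cdom k" using C1E BN cB[OF \<alpha>b(9)] by auto
  obtain C sh where J2: "joins C1 a E1 B \<beta> d N C sh"
    by (rule join_noncusp[OF j2 N(1) C1N(1) k(1) C1N(2) f2' f2(1)])
  note J2' = joinsD[OF J2]
  have "joins A a b B c d N C sh"
    unfolding joins_def
  proof (intro conjI)
    show "a < d - sh" "regnb C a (d - sh)" "simple_on C a (d - sh)" "\<exists>m<d - sh. \<forall>t\<ge>m. C t = B (t + sh)"
      by (rule J2')+
    obtain l1 where l1: "l1 > a" "\<forall>t\<le>l1. C1 t = A t" using J1'(4) by blast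
    obtain l2 where l2: "l2 > a" "\<forall>t\<le>l2. C t = C1 t" using J2'(4) by blast
    show "\<exists>l>a. \<forall>t\<le>l. C t = A t" using l1 l2 by (intro exI[of _ "min l1 l2"]) simp
    have i1: "A ` {a..\<alpha>} \<subseteq> A ` {a..b}" using \<alpha>b by (intro image_mono) auto
    have i2: "B ` {\<beta>..d} \<subseteq> B ` {c..d}" using \<alpha>b by (intro image_mono) auto
    have i3: "D ` {0..1} \<subseteq> N" using DV V(5) by blast
    have i4: "N1 \<subseteq> N" by (simp add: N1_def)
    show "C ` {a..d - sh} \<subseteq> A ` {a..b} \<union> B ` {c..d} \<union> N"
    proof
      fix z assume "z \<in> C ` {a..d - sh}"
      then consider "z \<in> C1 ` {a..1 - sh1}" | "z \<in> B ` {\<beta>..d}" | "z \<in> N"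
        using J2'(6) by (auto simp: E1_def)
      then show "z \<in> A ` {a..b} \<union> B ` {c..d} \<union> N"
        by cases (use J1'(6) i1 i2 i3 i4 in blast)+
    qed
    have pA1: "pth M (A a) (A \<alpha>) (piece a \<alpha> A)" and pA2: "pth M (A \<alpha>) (A b) (piece \<alpha> b A)"
      using regnb_facts(4)[OF A] \<alpha>b ab by auto
    have pB1: "pth M (A b) (B \<beta>) (piece c \<beta> B)" and pB2: "pth M (B \<beta>) (B d) (piece \<beta> d B)"
      using regnb_facts(4)[OF B] \<alpha>b ab AB by auto
    have pD: "pth M (A \<alpha>) (B \<beta>) (piece 0 1 D)" using regnb_facts(4)[OF rD, of 0 1] D01 by simp
    have pC1: "pth M (A a) (B \<beta>) (piece a E1 C1)"
      using regnb_facts(4)[OF J1'(2), of a "1 - sh1"] J1'(1) C1a C1E by (simp add: E1_def)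
    have hD: "homotopic_paths M (piece 0 1 D) (piece \<alpha> b A +++ piece c \<beta> B)"
    proof (rule disc_homotopic[OF V(4)])
      show "pth (point k ` V) (A \<alpha>) (B \<beta>) (piece 0 1 D)"
        using pth_piece[OF regnb_facts(1)[OF rD] sg(3), of 0 1] D01 by (simp add: closed_segment_eq_real_ivl)
      have "pth (point k ` V) (A \<alpha>) (A b) (piece \<alpha> b A)"
      proof (rule pth_piece[OF continuous_on_subset[OF regnb_facts(1)[OF A]]])
        show "closed_segment \<alpha> b \<subseteq> {\<alpha>..b}" using \<alpha>b by (simp add: closed_segment_eq_real_ivl)
        show "A ` {\<alpha>..b} \<subseteq> point k ` V"
        proof (rule image_subsetI)
          fix t assume t: "t \<in> {\<alpha>..b}"
          then have "\<bar>t - b\<bar> < \<rho>" "\<bar>t - b\<bar> < r" using \<alpha>(1) r by auto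
          then have "coord k (A t) \<in> V" "A t \<in> cdom k" using VA cA by auto
          then show "A t \<in> point k ` V" using point_coord[OF k(1)] by (metis imageI)
        qed
      qed (use \<alpha>b in auto)
      moreover have "pth (point k ` V) (A b) (B \<beta>) (piece c \<beta> B)"
        unfolding AB
      proof (rule pth_piece[OF continuous_on_subset[OF regnb_facts(1)[OF B]]])
        show "closed_segment c \<beta> \<subseteq> {c..\<beta>}" using \<alpha>b by (simp add: closed_segment_eq_real_ivl)
        show "B ` {c..\<beta>} \<subseteq> point k ` V"
        proof (rule image_subsetI)
          fix t assume t: "t \<in> {c..\<beta>}"
          then have "\<bar>t - c\<bar> < \<rho>" "\<bar>t - c\<bar> < r" using \<beta>(2) r by auto
          then have "coord k (B t) \<in> V" "B t \<in> cdom k" using VB cB by auto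
          then show "B t \<in> point k ` V" using point_coord[OF k(1)] by (metis imageI)
        qed
      qed (use \<alpha>b in auto)
      ultimately show "pth (point k ` V) (A \<alpha>) (B \<beta>) (piece \<alpha> b A +++ piece c \<beta> B)" by (rule pth_join)
    qed
    have "homotopic_paths M (piece a (d - sh) C) (piece a E1 C1 +++ piece \<beta> d B)" by (rule J2'(7))
    also have "homotopic_paths M \<dots> ((piece a \<alpha> A +++ piece 0 1 D) +++ piece \<beta> d B)"
      by (rule hp_joinL[OF pC1 pB2]) (use J1'(7) in \<open>simp add: E1_def\<close>)
    also have "homotopic_paths M \<dots> ((piece a \<alpha> A +++ (piece \<alpha> b A +++ piece c \<beta> B)) +++ piece \<beta> d B)"
      by (rule hp_joinL[OF pth_join[OF pA1 pD] pB2 hp_joinR[OF pA1 pD hD]])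
    also have "homotopic_paths M \<dots> (piece a \<alpha> A +++ ((piece \<alpha> b A +++ piece c \<beta> B) +++ piece \<beta> d B))"
      by (rule hp_sym[OF hp_assoc[OF pA1 pth_join[OF pA2 pB1] pB2]])
    also have "homotopic_paths M \<dots> ((piece a \<alpha> A +++ piece \<alpha> b A) +++ (piece c \<beta> B +++ piece \<beta> d B))"
      by (rule hp_regroup[OF pA1 pA2 pB1 pB2])
    also have "homotopic_paths M \<dots> (piece a b A +++ piece c d B)"
    proof (rule hp_join[OF pth_join[OF pA1 pA2] pth_join[OF pB1 pB2]])
      show "homotopic_paths M (piece a \<alpha> A +++ piece \<alpha> b A) (piece a b A)"
        by (rule regnb_facts(5)[OF A]) (use \<alpha>b ab in auto)
      show "homotopic_paths M (piece c \<beta> B +++ piece \<beta> d B) (piece c d B)"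
        by (rule regnb_facts(5)[OF B]) (use \<alpha>b ab in auto)
    qed
    finally show "homotopic_paths M (piece a (d - sh) C) (piece a b A +++ piece c d B)" .
  qed
  then show ?thesis by (rule that)
qed

text \<open>Regularity excludes zero velocities at the corner, so either some functional is positive
  on both velocities or they are opposite.\<close>

lemma join_arcs:
  assumes j: "joinable A a b B c d" and N: "openin (top_of_set M) N" "A b \<in> N"
  obtains C sh where "joins A a b B c d N C sh"
proof -
  have ab: "a < b" "c < d" and A: "regnb A a b" and B: "regnb B c d" and AB: "A b = B c"
    using j unfolding joinable_def by blast+
  have "A b \<in> M" using N openin_imp_subset by blast
  then obtain k where k: "k \<in> \<A>" "A b \<in> cdom k" using ex_chart by blast
  have nz: "vd (coord k \<circ> F) x \<noteq> 0" if F: "regnb F u w" "u \<le> x" "x \<le> w" "F x = A b" for F u w x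
  proof -
    obtain \<eta> where \<eta>: "\<eta> > 0" "reg F {u-\<eta><..<w+\<eta>}" using F(1) by (auto simp: regnb_def)
    show ?thesis by (rule reg_chart(2)[OF \<eta>(2) k(1)]) (use F \<eta>(1) k(2) in auto)
  qed
  have v: "vd (coord k \<circ> A) b \<noteq> 0" by (rule nz[OF A]) (use ab in auto)
  have w: "vd (coord k \<circ> B) c \<noteq> 0" by (rule nz[OF B]) (use ab AB in auto)
  show ?thesis
  proof (cases "\<exists>e. e \<bullet> vd (coord k \<circ> A) b > 0 \<and> e \<bullet> vd (coord k \<circ> B) c > 0")
    case True
    then obtain e where e: "e \<bullet> vd (coord k \<circ> A) b > 0" "e \<bullet> vd (coord k \<circ> B) c > 0" by blast
    show ?thesis by (rule join_noncusp[OF j N k e]) (rule that)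
  next
    case False
    obtain \<kappa> where \<kappa>: "\<kappa> > 0" "vd (coord k \<circ> B) c = - \<kappa> *\<^sub>R vd (coord k \<circ> A) b"
      by (rule opposite_directions[OF v w False])
    show ?thesis by (rule join_cusp[OF j N k v \<kappa>]) (rule that)
  qed
qed

subsection \<open>Smooth simple closed curves\<close>

lemma chain_nth:
  "chain p es q \<Longrightarrow> i < length es \<Longrightarrow>
    (i = 0 \<longrightarrow> src (es!i) = p) \<and> (i + 1 < length es \<longrightarrow> tgt (es!i) = src (es!(i+1))) \<and>
    (i + 1 = length es \<longrightarrow> tgt (es!i) = q)"
proof (induction es arbitrary: p i)
  case (Cons e es)
  show ?case
  proof (cases i)
    case 0
    then show ?thesis using Cons.prems by (cases es) auto
  next
    case (Suc i')
    have c: "chain (tgt e) es q" "i' < length es" using Cons.prems Suc by auto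
    have eq: "(e # es)!i = es!i'" "(e # es)!(i+1) = es!(i'+1)" "length (e # es) = length es + 1" "i = i' + 1"
      by (simp_all add: Suc)
    show ?thesis using Cons.IH[OF c] unfolding eq(1,2,3) unfolding eq(4) by simp
  qed
qed simp

text \<open>Induction on the edges already absorbed. The invariant that makes the next join possible
  is that the smooth arc meets the remaining edges only where the polygon did: the next edge at the
  end of the arc, and the last edge at the base point.\<close>

lemma polygon_arc:
  assumes n: "ncl p es" and k3: "length es \<ge> 3" and nd: "\<And>A a b. (A,a,b) \<in> set es \<Longrightarrow> a < b"
    and int: "\<And>i j z. i < j \<Longrightarrow> j < length es \<Longrightarrow> z \<in> im (es!i) \<Longrightarrow> z \<in> im (es!j) \<Longrightarrow>
       (j = i + 1 \<and> z = tgt (es!i)) \<or> (i = 0 \<and> j = length es - 1 \<and> z = p)"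
    and "i + 2 \<le> length es"
  shows "\<exists>C a b. a < b \<and> regnb C a b \<and> inj_on C {a..b} \<and> C a = p \<and> C b = tgt (es!i) \<and>
     homotopic_paths M (piece a b C) (cpath p (take (i + 1) es)) \<and>
     (\<forall>j. i + 1 \<le> j \<longrightarrow> j < length es \<longrightarrow> C ` {a..b} \<inter> im (es!j) \<subseteq>
        (if j = i + 1 then {C b} else {}) \<union> (if j = length es - 1 then {p} else {}))"
  using assms(5)
proof (induction i)
  have ch: "chain p es p" using n by (simp add: ncl_def)
  have ed: "a < b \<and> regnb A a b \<and> inj_on A {a..b} \<and> compact (A ` {a..b}) \<and> A ` {a..b} \<subseteq> M \<and> edge (A,a,b)"
    if "i < length es" "es!i = (A,a,b)" for i A a b
  proof -
    have "(A,a,b) \<in> set es" using that nth_mem by metis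
    then have "a < b" and e: "edge (A,a,b)" using nd chain_edges[OF ch] by auto
    then show ?thesis using edge_facts[OF e] by (simp add: edge.simps regnb_def)
  qed
  {
    case 0
    obtain A a b where e: "es!0 = (A,a,b)" by (rule prod_cases3)
    have l: "0 < length es" by (rule less_le_trans[OF _ k3]) simp
    note E = ed[OF l e]
    have src: "A a = p" using chain_nth[OF ch l] e by simp
    have "take (0 + 1) es = [(A,a,b)]" using l e by (cases es) auto
    then have "cpath p (take (0 + 1) es) = piece a b A +++ (\<lambda>_. A b)" by simp
    moreover have "homotopic_paths M (piece a b A) (piece a b A +++ (\<lambda>_. A b))"
      by (rule hp_sym[OF hp_const_right[OF regnb_facts(4)]]) (use E in auto)
    moreover have "\<forall>j. 0 + 1 \<le> j \<longrightarrow> j < length es \<longrightarrow> A ` {a..b} \<inter> im (es!j) \<subseteq>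
        (if j = 0 + 1 then {A b} else {}) \<union> (if j = length es - 1 then {p} else {})"
    proof (intro allI impI subsetI)
      fix j z assume j: "0 + 1 \<le> j" "j < length es" and z: "z \<in> A ` {a..b} \<inter> im (es!j)"
      then have z0: "z \<in> im (es!0)" using e by simp
      from int[OF _ j(2) z0] z j(1)
      show "z \<in> (if j = 0 + 1 then {A b} else {}) \<union> (if j = length es - 1 then {p} else {})" using e by auto
    qed
    ultimately show ?case using E src e by (intro exI[of _ A] exI[of _ a] exI[of _ b]) auto
  next
    case (Suc i)
    let ?m = "i + 1"
    have m: "?m < length es" "?m + 1 < length es" "i < length es" "i + 1 < length es" using Suc.prems by auto
    obtain C a b where C: "a < b" "regnb C a b" "inj_on C {a..b}" "C a = p" "C b = tgt (es!i)"
      "homotopic_paths M (piece a b C) (cpath p (take ?m es))"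
      and Cint: "\<And>j. ?m \<le> j \<Longrightarrow> j < length es \<Longrightarrow> C ` {a..b} \<inter> im (es!j) \<subseteq>
        (if j = ?m then {C b} else {}) \<union> (if j = length es - 1 then {p} else {})"
      using Suc.IH Suc.prems by auto
    obtain B c d where e: "es!?m = (B,c,d)" by (rule prod_cases3)
    note E = ed[OF m(1) e]
    have CB: "C b = B c" using chain_nth[OF ch m(3)] C(5) m(4) e by simp
    have "?m \<noteq> length es - 1" using m(2) by linarith
    then have Cm: "C ` {a..b} \<inter> B ` {c..d} \<subseteq> {C b}" using Cint[OF order_refl m(1)] e by simp
    have jn: "joinable C a b B c d"
      unfolding joinable_def
    proof (intro conjI allI impI)
      fix s t assume st: "a \<le> s" "s \<le> b" "c \<le> t" "t \<le> d" "C s = B t"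
      have "C s \<in> C ` {a..b}" by (rule imageI) (use st in simp)
      moreover have "C s \<in> B ` {c..d}" unfolding st(5) by (rule imageI) (use st in simp)
      ultimately have z: "C s = C b" using Cm by blast
      have "s = b" by (rule inj_onD[OF C(3) z]) (use st C(1) in auto)
      moreover have "t = c" by (rule inj_onD[of B "{c..d}"]) (use st E z CB in auto)
      ultimately show "s = b \<and> t = c \<or> s = a \<and> t = d" by simp
    qed (use C E CB in auto)
    \<comment> \<open>Rounding is confined to the complement of the edges still to come, which
      preserves the invariant. The corner is not on them, for edge \<open>?m\<close> meets later
      edges only at its own end \<open>B d\<close>.\<close>
    define L where "L = (\<Union>j\<in>{?m<..<length es}. im (es!j))"
    have cim: "compact (im (es!j))" if "j < length es" for j
    proof -
      obtain F u w where f: "es!j = (F,u,w)" by (rule prod_cases3)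
      then show ?thesis using ed[OF that f] by simp
    qed
    have "compact L" unfolding L_def by (rule compact_UN) (use cim in auto)
    then have oN: "openin (top_of_set M) (M \<inter> - L)" by (intro openin_open_Int open_Compl compact_imp_closed)
    have "C b \<notin> L"
    proof
      assume "C b \<in> L"
      then obtain j where j: "?m < j" "j < length es" "C b \<in> im (es!j)" by (auto simp: L_def)
      have "C b \<in> im (es!?m)" using CB e E by auto
      from int[OF j(1,2) this j(3)] have "C b = B d" using e by auto
      then have "c = d" using CB E by (intro inj_onD[of B "{c..d}"]) auto
      then show False using E by simp
    qed
    then have CN: "C b \<in> M \<inter> - L" using regnb_facts(2)[OF C(2)] C(1) by auto
    obtain C' sh where J: "joins C a b B c d (M \<inter> - L) C' sh" by (rule join_arcs[OF jn oN CN])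
    note J' = joinsD[OF J]
    have endpt: "C' a = p" "C' (d - sh) = B d" using J'(8,9) C(4) by auto
    \<comment> \<open>The last edge has not been reached, so the arc does not close up yet and
      \<open>simple_on\<close> strengthens to injectivity.\<close>
    have pB: "p \<noteq> B d"
    proof
      assume eq: "p = B d"
      obtain A0 a0 b0 where e0: "es!0 = (A0,a0,b0)" by (rule prod_cases3)
      have l: "0 < length es" by (rule less_le_trans[OF _ k3]) simp
      note E0 = ed[OF l e0]
      have src: "A0 a0 = p" using chain_nth[OF ch l] e0 by simp
      have p0: "p \<in> im (es!0)" using src e0 E0 by (auto intro: image_eqI[of _ _ a0])
      have pm: "p \<in> im (es!?m)" using eq e E by auto
      have "p = A0 b0" using int[OF _ m(1) p0 pm] m(2) e0 by auto
      then have "a0 = b0" using src E0 by (intro inj_onD[of A0 "{a0..b0}"]) auto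
      then show False using E0 by simp
    qed
    have iC': "inj_on C' {a..d - sh}" by (rule simple_on_inj[OF J'(3)]) (use endpt pB in auto)
    have tk: "take (Suc i + 1) es = take ?m es @ [es!?m]" using m(1) by (simp add: take_Suc_conv_app_nth)
    have chm: "chain p (take ?m es) (C b) \<and> chain (C b) (es!?m # drop (Suc ?m) es) p"
    proof -
      have "chain p (take ?m es @ es!?m # drop (Suc ?m) es) p" using ch id_take_nth_drop[OF m(1)] by metis
      then obtain q where q: "chain p (take ?m es) q" "chain q (es!?m # drop (Suc ?m) es) p" using chain_append by blast
      have "q = B c" using q(2) e by simp
      then show ?thesis using q CB by simp
    qed
    have chB: "chain (C b) [es!?m] (B d)"
      using E e CB by (auto intro: regnb_facts(2)[THEN subsetD] imageI)
    have hom: "homotopic_paths M (piece a (d - sh) C') (cpath p (take (Suc i + 1) es))"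
    proof -
      have pC: "pth M (C a) (C b) (piece a b C)" by (rule regnb_facts(4)[OF C(2)]) (use C(1) in auto)
      have pBp: "pth M (C b) (B d) (piece c d B)" unfolding CB by (rule regnb_facts(4)) (use E in auto)
      have hB: "homotopic_paths M (piece c d B) (cpath (C b) [es!?m])"
        using hp_sym[OF hp_const_right[OF pBp]] e by simp
      have "homotopic_paths M (piece a (d - sh) C') (piece a b C +++ piece c d B)" by (rule J'(7))
      also have "homotopic_paths M \<dots> (cpath p (take ?m es) +++ cpath (C b) [es!?m])"
        by (rule hp_join[OF pC pBp C(6) hB])
      also have "homotopic_paths M \<dots> (cpath p (take ?m es @ [es!?m]))"
        by (rule hp_sym[OF cpath_append[OF chm[THEN conjunct1] chB]])
      finally show ?thesis unfolding tk .
    qed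
    have "\<forall>j. Suc i + 1 \<le> j \<longrightarrow> j < length es \<longrightarrow> C' ` {a..d - sh} \<inter> im (es!j) \<subseteq>
        (if j = Suc i + 1 then {C' (d - sh)} else {}) \<union> (if j = length es - 1 then {p} else {})"
    proof (intro allI impI subsetI)
      fix j z assume j: "Suc i + 1 \<le> j" "j < length es" and z: "z \<in> C' ` {a..d - sh} \<inter> im (es!j)"
      then consider "z \<in> C ` {a..b}" | "z \<in> B ` {c..d}" | "z \<in> M \<inter> - L" using J'(6) by blast
      then show "z \<in> (if j = Suc i + 1 then {C' (d - sh)} else {}) \<union> (if j = length es - 1 then {p} else {})"
      proof cases
        case 1
        then have "z \<in> (if j = ?m then {C b} else {}) \<union> (if j = length es - 1 then {p} else {})"
          using z j by (intro subsetD[OF Cint[of j]]) auto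
        then show ?thesis using j(1) by (auto split: if_splits)
      next
        case 2
        then have "z \<in> im (es!?m)" using e by simp
        from int[OF _ j(2) this] z j(1) show ?thesis using e endpt by auto
      next
        case 3
        then show ?thesis using j z by (auto simp: L_def)
      qed
    qed
    then show ?case using J'(1,2) iC' endpt hom e
      by (intro exI[of _ C'] exI[of _ a] exI[of _ "d - sh"]) simp
  }
qed

text \<open>Absorbing the last edge gives a simple closed curve that is smooth except possibly at
  \<open>p\<close>. Cut at an interior parameter, its second half is joined to its first half, which
  rounds the corner at \<open>p\<close> by the same construction. Near its ends the join coincides
  with the curve being cut, so its periodic extension is smooth.\<close>

theorem simple_closed_curve:
  assumes "pth M p0 p0 f" "\<not> homotopic_paths M f (\<lambda>_. p0)"
  obtains \<gamma> where "reg \<gamma> UNIV" "\<And>t. \<gamma> (t + 1) = \<gamma> t" "inj_on \<gamma> {0..<1}" "\<not> contractible_loop M \<gamma>"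
proof -
  obtain p es where n: "ncl p es" and k3: "length es \<ge> 3" and nd: "\<And>A a b. (A,a,b) \<in> set es \<Longrightarrow> a < b"
    and int: "\<And>i j z. i < j \<Longrightarrow> j < length es \<Longrightarrow> z \<in> im (es!i) \<Longrightarrow> z \<in> im (es!j) \<Longrightarrow>
       (j = i + 1 \<and> z = tgt (es!i)) \<or> (i = 0 \<and> j = length es - 1 \<and> z = p)"
    by (rule simple_polygon[OF assms]) blast
  have ch: "chain p es p" using n by (simp add: ncl_def)
  define i where "i = length es - 2"
  have i: "i + 2 \<le> length es" "i + 1 = length es - 1" "i + 1 < length es" "i < length es" using k3 by (auto simp: i_def)
  obtain C a b where C: "a < b" "regnb C a b" "inj_on C {a..b}" "C a = p" "C b = tgt (es!i)"
      "homotopic_paths M (piece a b C) (cpath p (take (i + 1) es))"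
      "C ` {a..b} \<inter> im (es!(i+1)) \<subseteq> {C b, p}"
  proof -
    have "\<exists>C a b. a < b \<and> regnb C a b \<and> inj_on C {a..b} \<and> C a = p \<and> C b = tgt (es!i) \<and>
     homotopic_paths M (piece a b C) (cpath p (take (i + 1) es)) \<and>
     (\<forall>j. i + 1 \<le> j \<longrightarrow> j < length es \<longrightarrow> C ` {a..b} \<inter> im (es!j) \<subseteq>
        (if j = i + 1 then {C b} else {}) \<union> (if j = length es - 1 then {p} else {}))"
      by (rule polygon_arc[OF n k3 _ _ i(1)]) (rule nd, assumption, rule int, assumption+)
    then obtain C a b where C: "a < b" "regnb C a b" "inj_on C {a..b}" "C a = p" "C b = tgt (es!i)"
      "homotopic_paths M (piece a b C) (cpath p (take (i + 1) es))"
      and J: "\<forall>j. i + 1 \<le> j \<longrightarrow> j < length es \<longrightarrow> C ` {a..b} \<inter> im (es!j) \<subseteq>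
        (if j = i + 1 then {C b} else {}) \<union> (if j = length es - 1 then {p} else {})"
      by (elim exE conjE) (rule that)
    have "C ` {a..b} \<inter> im (es!(i+1)) \<subseteq> {C b, p}"
      using J[rule_format, OF order_refl i(3)] by (auto split: if_splits)
    then show ?thesis by (rule that[OF C(1-6)])
  qed
  obtain B c d where e: "es!(i+1) = (B,c,d)" by (rule prod_cases3)
  have "(B,c,d) \<in> set es" using e i(3) nth_mem by metis
  then have cd: "c < d" and edB: "edge (B,c,d)" using nd chain_edges[OF ch] by auto
  then have B: "regnb B c d" "inj_on B {c..d}" by (auto simp: edge.simps regnb_def)
  have CB: "C b = B c" using chain_nth[OF ch i(4)] C(5) i(3) e by simp
  have Bp: "B d = p" using chain_nth[OF ch i(3)] i(2) e k3 by simp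
  have jn: "joinable C a b B c d"
    unfolding joinable_def
  proof (intro conjI allI impI)
    fix s t assume st: "a \<le> s" "s \<le> b" "c \<le> t" "t \<le> d" "C s = B t"
    have "C s \<in> C ` {a..b}" by (rule imageI) (use st in simp)
    moreover have "C s \<in> im (es!(i+1))" unfolding st(5) e im.simps by (rule imageI) (use st in simp)
    ultimately consider "C s = C b" | "C s = p" using C(7) by blast
    then show "s = b \<and> t = c \<or> s = a \<and> t = d"
    proof cases
      case 1
      have "s = b" by (rule inj_onD[OF C(3) 1]) (use st C(1) in auto)
      moreover have "t = c" by (rule inj_onD[OF B(2)]) (use st 1 CB cd in auto)
      ultimately show ?thesis by simp
    next
      case 2
      have "s = a" by (rule inj_onD[OF C(3)]) (use st 2 C(1,4) in auto)
      moreover have "t = d" by (rule inj_onD[OF B(2)]) (use st 2 Bp cd in auto)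
      ultimately show ?thesis by simp
    qed
  qed (use C B CB cd in auto)
  have CM: "C b \<in> M" using regnb_facts(2)[OF C(2)] C(1) by auto
  have MM: "openin (top_of_set M) M" using openin_subtopology_self by auto
  obtain C' sh where J: "joins C a b B c d M C' sh" by (rule join_arcs[OF jn MM CM])
  note J' = joinsD[OF J]
  define E where "E = d - sh"
  have C': "a < E" "regnb C' a E" "simple_on C' a E" "C' a = p" "C' E = p"
    using J'(1-3,8,9) C(4) Bp by (simp_all add: E_def)
  have homC': "homotopic_paths M (piece a E C') (cpath p es)"
  proof -
    have pC: "pth M (C a) (C b) (piece a b C)" by (rule regnb_facts(4)[OF C(2)]) (use C(1) in auto)
    have pBp: "pth M (C b) (B d) (piece c d B)" unfolding CB by (rule regnb_facts(4)[OF B(1)]) (use cd in auto)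
    have hB: "homotopic_paths M (piece c d B) (cpath (C b) [es!(i+1)])"
      using hp_sym[OF hp_const_right[OF pBp]] e by simp
    have es: "take (i+1) es @ [es!(i+1)] = es"
    proof -
      have "take (Suc (i+1)) es = take (i+1) es @ [es!(i+1)]" by (rule take_Suc_conv_app_nth[OF i(3)])
      moreover have "Suc (i+1) = length es" using i(2,3) by linarith
      ultimately show ?thesis by simp
    qed
    then have "chain p (take (i+1) es @ [es!(i+1)]) p" using ch by simp
    then obtain q where q: "chain p (take (i+1) es) q" "chain q [es!(i+1)] p" using chain_append by blast
    have "q = C b" using q(2) e CB by simp
    have "homotopic_paths M (piece a E C') (piece a b C +++ piece c d B)" unfolding E_def by (rule J'(7))
    also have "homotopic_paths M \<dots> (cpath p (take (i+1) es) +++ cpath (C b) [es!(i+1)])"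
      by (rule hp_join[OF pC pBp C(6) hB])
    also have "homotopic_paths M \<dots> (cpath p (take (i+1) es @ [es!(i+1)]))"
      by (rule hp_sym[OF cpath_append]) (use q \<open>q = C b\<close> in auto)
    finally show ?thesis unfolding es .
  qed
  \<comment> \<open>The midpoint stands for any interior parameter: the curve is smooth there, so
    cutting creates no new corner.\<close>
  define \<mu> where "\<mu> = (a + E) / 2"
  have \<mu>: "a < \<mu>" "\<mu> < E" using C'(1) by (auto simp: \<mu>_def)
  have smp: "s = a \<and> t = E" if "a \<le> s" "s < t" "t \<le> E" "C' s = C' t" for s t
    using C'(3) that unfolding simple_on_def by blast
  have j2: "joinable C' \<mu> E C' a \<mu>"
    unfolding joinable_def
  proof (intro conjI allI impI)
    show "regnb C' \<mu> E" "regnb C' a \<mu>" by (rule regnb_sub[OF C'(2)]; use \<mu> in simp)+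
    show "inj_on C' {\<mu>..E}"
    proof (rule linorder_inj_onI)
      fix x y assume "x < y" "x \<in> {\<mu>..E}" "y \<in> {\<mu>..E}"
      then show "C' x \<noteq> C' y" using smp[of x y] \<mu> by auto
    qed auto
    show "inj_on C' {a..\<mu>}"
    proof (rule linorder_inj_onI)
      fix x y assume "x < y" "x \<in> {a..\<mu>}" "y \<in> {a..\<mu>}"
      then show "C' x \<noteq> C' y" using smp[of x y] \<mu> by auto
    qed auto
    fix s t assume st: "\<mu> \<le> s" "s \<le> E" "a \<le> t" "t \<le> \<mu>" "C' s = C' t"
    show "s = E \<and> t = a \<or> s = \<mu> \<and> t = \<mu>"
    proof (cases "t = s")
      case True
      then have "s = \<mu>" using st by linarith
      then show ?thesis using True by simp
    next
      case False
      then have "t < s" using st by linarith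
      then have "t = a \<and> s = E" by (intro smp) (use st in auto)
      then show ?thesis by simp
    qed
  qed (use C' \<mu> in auto)
  have "C' E \<in> M" using regnb_facts(2)[OF C'(2)] C'(1) by auto
  then obtain G sg where G: "joins C' \<mu> E C' a \<mu> M G sg" using join_arcs[OF j2 MM] by blast
  note G' = joinsD[OF G]
  define F where "F = \<mu> - sg"
  define T where "T = F - \<mu>"
  have T: "T > 0" using G'(1) by (simp add: T_def F_def)
  obtain l where l: "l > \<mu>" "\<forall>t\<le>l. G t = C' t" using G'(4) by blast
  obtain m where m: "m < F" "\<forall>t\<ge>m. G t = C' (t + sg)" using G'(5) by (auto simp: F_def)
  have GF: "G F = G \<mu>" using l(2)[rule_format, of \<mu>] m(2)[rule_format, of F] l(1) m(1) by (simp add: F_def)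
  obtain \<eta> where \<eta>: "\<eta> > 0" "reg G {\<mu>-\<eta><..<F+\<eta>}" using G'(2) by (auto simp: regnb_def F_def)
  define \<gamma> where "\<gamma> t = G (\<mu> + T * frac t)" for t
  have per: "\<gamma> (t + 1) = \<gamma> t" for t by (simp add: \<gamma>_def frac_def)
  have \<gamma>01: "\<gamma> t = G (\<mu> + T * (t - of_int n))" if "of_int n \<le> t" "t < of_int n + 1" for t and n :: int
  proof -
    have "\<lfloor>t\<rfloor> = n" using that by (simp add: floor_unique)
    then show ?thesis by (simp add: \<gamma>_def frac_def)
  qed
  have regg: "reg \<gamma> UNIV"
  proof (rule reg_local)
    fix t0 :: real assume "t0 \<in> UNIV"
    define n where "n = \<lfloor>t0\<rfloor>"
    show "\<exists>J. t0 \<in> J \<and> J \<subseteq> UNIV \<and> reg \<gamma> J"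
    proof (cases "t0 = of_int n")
      case False
      then have t0: "t0 \<in> {of_int n<..<of_int n + 1}" unfolding n_def by (auto simp: less_le) linarith+
      have "reg \<gamma> {of_int n<..<of_int n + 1}"
      proof (rule reg_affine[OF \<eta>(2), of T _ _ "\<mu> - T * of_int n"])
        show "\<gamma> t = G (T * t + (\<mu> - T * of_int n))" if "t \<in> {of_int n<..<of_int n + 1}" for t
          using \<gamma>01[of n t] that by (simp add: algebra_simps)
        show "T * t + (\<mu> - T * of_int n) \<in> {\<mu>-\<eta><..<F+\<eta>}" if t: "t \<in> {of_int n<..<of_int n + 1}" for t
        proof -
          have "0 < T * (t - of_int n)" "T * (t - of_int n) < T * 1"
            using T t by (auto intro!: mult_pos_pos mult_strict_left_mono)
          moreover have "T * t + (\<mu> - T * of_int n) = \<mu> + T * (t - of_int n)" by (simp add: algebra_simps)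
          ultimately show ?thesis using \<eta>(1) by (simp add: T_def)
        qed
      qed (use T in auto)
      then show ?thesis using t0 by blast
    next
      case True
      define q where "q = min (min (1/2) (\<eta> / T)) (min ((l - \<mu>) / T) ((F - m) / T))"
      have q: "q > 0" "q \<le> 1/2" "T * q \<le> \<eta>" "T * q \<le> l - \<mu>" "T * q \<le> F - m"
      proof -
        show "q > 0" using T \<eta>(1) l(1) m(1) by (simp add: q_def)
        show "q \<le> 1/2" unfolding q_def by (rule order_trans[OF min.cobounded1 min.cobounded1])
        have "q \<le> \<eta> / T" unfolding q_def by (rule order_trans[OF min.cobounded1 min.cobounded2])
        moreover have "q \<le> (l - \<mu>) / T" unfolding q_def by (rule order_trans[OF min.cobounded2 min.cobounded1])
        moreover have "q \<le> (F - m) / T" unfolding q_def by (rule order_trans[OF min.cobounded2 min.cobounded2])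
        ultimately show "T * q \<le> \<eta>" "T * q \<le> l - \<mu>" "T * q \<le> F - m" using T by (simp_all add: pos_le_divide_eq mult.commute)
      qed
      have eq: "\<gamma> t = G (T * t + (\<mu> - T * of_int n))" if t: "t \<in> {of_int n - q<..<of_int n + q}" for t
      proof (cases "of_int n \<le> t")
        case True
        then show ?thesis using \<gamma>01[of n t] t q(2) by (simp add: algebra_simps)
      next
        case False
        have 1: "\<gamma> t = G (\<mu> + T * (t - of_int (n - 1)))" by (rule \<gamma>01) (use False t q(2) in auto)
        have 2: "\<mu> + T * (t - of_int (n - 1)) = F + T * (t - of_int n)" by (simp add: T_def algebra_simps)
        have "T * (of_int n - t) < T * q" by (rule mult_strict_left_mono[OF _ T]) (use t in auto)
        then have 3: "- (T * q) < T * (t - of_int n)" by (simp add: algebra_simps)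
        have 4: "T * (t - of_int n) \<le> 0" using False T by (simp add: mult_le_0_iff)
        \<comment> \<open>Since \<open>F + sg = \<mu>\<close>, the last stretch of \<open>G\<close>
          before \<open>F\<close> is \<open>C'\<close> before \<mu>, which in turn is
          \<open>G\<close> continued to the left of \<mu>. So the periodic curve is given by one
          formula on both sides of an integer.\<close>
        have "G (F + T * (t - of_int n)) = C' (\<mu> + T * (t - of_int n))"
          using m(2)[rule_format, of "F + T * (t - of_int n)"] 3 q(5) by (simp add: F_def)
        also have "\<dots> = G (\<mu> + T * (t - of_int n))" using l(2)[rule_format, of "\<mu> + T * (t - of_int n)"] 4 l(1) by simp
        finally have "\<gamma> t = G (\<mu> + T * (t - of_int n))" using 1 unfolding 2 by simp
        moreover have "\<mu> + T * (t - of_int n) = T * t + (\<mu> - T * of_int n)" by (simp add: algebra_simps)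
        ultimately show ?thesis by simp
      qed
      have "reg \<gamma> {of_int n - q<..<of_int n + q}"
      proof (rule reg_affine[OF \<eta>(2), of T _ _ "\<mu> - T * of_int n"])
        show "T * t + (\<mu> - T * of_int n) \<in> {\<mu>-\<eta><..<F+\<eta>}" if t: "t \<in> {of_int n - q<..<of_int n + q}" for t
        proof -
          have "T * (of_int n - t) < T * q" "T * (t - of_int n) < T * q"
            by (rule mult_strict_left_mono[OF _ T]; use t in simp)+
          then show ?thesis using q(3) T unfolding T_def by (auto simp: algebra_simps)
        qed
      qed (use T eq in auto)
      then show ?thesis using True q(1) by (intro exI[of _ "{of_int n - q<..<of_int n + q}"]) simp
    qed
  qed
  have smpG: "simple_on G \<mu> F" using G'(3) by (simp add: F_def)
  have inj: "inj_on \<gamma> {0..<1}"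
  proof (rule linorder_inj_onI)
    fix s t :: real assume st: "s < t" "s \<in> {0..<1}" "t \<in> {0..<1}"
    have g: "\<gamma> s = G (\<mu> + T * s)" "\<gamma> t = G (\<mu> + T * t)" using \<gamma>01[of 0 s] \<gamma>01[of 0 t] st by auto
    have "T * s < T * t" "T * t < T * 1" "0 \<le> T * s" using st T by (auto intro!: mult_strict_left_mono)
    then have "\<mu> \<le> \<mu> + T * s" "\<mu> + T * s < \<mu> + T * t" "\<mu> + T * t < F" by (simp_all add: T_def)
    then show "\<gamma> s \<noteq> \<gamma> t"
      using smpG unfolding simple_on_def g by (metis less_imp_le less_irrefl)
  qed auto
  have "\<not> contractible_loop M \<gamma>"
  proof
    assume "contractible_loop M \<gamma>"
    then obtain q where "homotopic_loops M \<gamma> (\<lambda>t. q)" by (auto simp: contractible_loop_def)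
    then have 1: "homotopic_paths M \<gamma> (\<lambda>_. pathstart \<gamma>)" by (rule null_homotopic_loop_based)
    have st: "pathstart \<gamma> = G \<mu>" using \<gamma>01[of 0 0] by (simp add: pathstart_def)
    have pG: "pth M (G \<mu>) (G F) (piece \<mu> F G)"
      using regnb_facts(4)[OF G'(2), of \<mu> "\<mu> - sg"] G'(1) by (simp add: F_def)
    have "homotopic_paths M (piece \<mu> F G) \<gamma>"
    proof (rule homotopic_paths_eq)
      fix t :: real assume t: "t \<in> {0..1}"
      have "piece \<mu> F G t = G (\<mu> + T * t)" by (simp add: piece_def linepath_def T_def algebra_simps)
      moreover have "\<gamma> t = G (\<mu> + T * t)"
      proof (cases "t = 1")
        case True
        then show ?thesis using GF \<gamma>01[of 1 1] by (simp add: T_def)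
      next
        case False
        then show ?thesis using \<gamma>01[of 0 t] t by simp
      qed
      ultimately show "piece \<mu> F G t = \<gamma> t" by simp
    qed (use pG in \<open>auto simp: pth_def\<close>)
    then have 2: "homotopic_paths M (piece \<mu> F G) (\<lambda>_. G \<mu>)" using 1 st hp_trans by metis
    have p1: "pth M (C' \<mu>) p (piece \<mu> E C')" and p2: "pth M p (C' \<mu>) (piece a \<mu> C')"
      using regnb_facts(4)[OF C'(2), of \<mu> E] regnb_facts(4)[OF C'(2), of a \<mu>] \<mu> C'(4,5) by auto
    have "G \<mu> = C' \<mu>" using l by simp
    then have "homotopic_paths M (piece \<mu> E C' +++ piece a \<mu> C') (\<lambda>_. C' \<mu>)"
      using 2 hp_trans[OF hp_sym[OF G'(7)]] by (simp add: F_def)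
    \<comment> \<open>Returns from the base point \<open>C' \<mu>\<close> of the rounded curve to
      \<open>p\<close>, where the polygon is based.\<close>
    then have "homotopic_paths M (piece a \<mu> C' +++ piece \<mu> E C') (\<lambda>_. p)"
      by (rule null_homotopic_swap[OF p1 p2])
    moreover have "homotopic_paths M (piece a \<mu> C' +++ piece \<mu> E C') (piece a E C')"
      by (rule regnb_facts(5)[OF C'(2)]) (use \<mu> in auto)
    ultimately have "homotopic_paths M (cpath p es) (\<lambda>_. p)" using homC' hp_trans hp_sym by metis
    then show False using n by (simp add: ncl_def)
  qed
  with regg per inj show ?thesis by (rule that)
qed

end

section \<open>Riemannian metrics in coordinates\<close>

lemma bounded_bilinear_matrix_vector:
  "bounded_bilinear (\<lambda>(A::real^2^2) (x::real^2). A *v x)"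
proof -
  have "bilinear (\<lambda>(A::real^2^2) (x::real^2). A *v x)"
    unfolding bilinear_def
    by (intro conjI allI linearI)
       (simp_all add: matrix_vector_mult_add_rdistrib scaleR_matrix_vector_assoc matrix_vector_right_distrib
         matrix_vector_mult_scaleR)
  then show ?thesis by (simp add: bilinear_conv_bounded_bilinear)
qed

lemmas smooth_on_matrix_vector = smooth_on_bilinear[OF bounded_bilinear_matrix_vector]

lemma has_derivative_trilinear:
  fixes f h :: "'a::real_normed_vector \<Rightarrow> real^2" and A :: "'a \<Rightarrow> real^2^2"
  assumes "(f has_derivative f') (at y within S)" "(A has_derivative A') (at y within S)" "(h has_derivative h') (at y within S)"
  shows "((\<lambda>y. f y \<bullet> (A y *v h y)) has_derivative
    (\<lambda>a. f' a \<bullet> (A y *v h y) + f y \<bullet> (A' a *v h y) + f y \<bullet> (A y *v h' a))) (at y within S)"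
proof -
  have "((\<lambda>y. A y *v h y) has_derivative (\<lambda>a. A y *v h' a + A' a *v h y)) (at y within S)"
    using bounded_bilinear.FDERIV[OF bounded_bilinear_matrix_vector assms(2,3)] .
  from has_derivative_inner[OF assms(1) this] show ?thesis
    by (rule has_derivative_eq_rhs) (simp add: fun_eq_iff inner_add_right algebra_simps)
qed

lemma Df_Df_linear:
  fixes f :: "'a::euclidean_space \<Rightarrow> 'b::euclidean_space"
  assumes f: "smooth_on f S" and S: "open S" and y: "y \<in> S"
  shows "Df (\<lambda>z. Df f z v) y a = (\<Sum>b\<in>Basis. (v \<bullet> b) *\<^sub>R Df (\<lambda>z. Df f z b) y a)"
proof -
  have "((\<lambda>z. \<Sum>b\<in>Basis. (v \<bullet> b) *\<^sub>R Df f z b) has_derivative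
      (\<lambda>a. \<Sum>b\<in>Basis. (v \<bullet> b) *\<^sub>R Df (\<lambda>z. Df f z b) y a)) (at y)"
    by (intro has_derivative_sum has_derivative_scaleR_right smooth_on_has_derivative[OF smooth_on_Df[OF f S] S y])
  then have "((\<lambda>z. Df f z v) has_derivative (\<lambda>a. \<Sum>b\<in>Basis. (v \<bullet> b) *\<^sub>R Df (\<lambda>z. Df f z b) y a)) (at y)"
  proof (rule has_derivative_transform_within_open[OF _ S y])
    show "(\<Sum>b\<in>Basis. (v \<bullet> b) *\<^sub>R Df f z b) = Df f z v" if "z \<in> S" for z
      by (rule linear_eq_sum_Basis[OF has_derivative_linear[OF smooth_on_has_derivative[OF f S that]], symmetric])
  qed
  from Df_eqI[OF this] show ?thesis by simp
qed

lemma Df_along_curve: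
  fixes f :: "'a::euclidean_space \<Rightarrow> 'b::euclidean_space"
  assumes f: "smooth_on f S" and S: "open S" and I: "open I" "t \<in> I" "c ` I \<subseteq> S"
    and c: "(c has_vector_derivative c') (at t)" and v: "(v has_vector_derivative v') (at t)"
  shows "((\<lambda>s. Df f (c s) (v s)) has_vector_derivative Df (\<lambda>y. Df f y (v t)) (c t) c' + Df f (c t) v') (at t)"
proof -
  have ct: "c t \<in> S" using I by blast
  have d: "((\<lambda>s. Df f (c s) b) has_vector_derivative Df (\<lambda>y. Df f y b) (c t) c') (at t)" for b
    by (rule has_vector_derivative_compose_Df[OF _ c]) (rule smooth_on_has_derivative[OF smooth_on_Df[OF f S] S ct])
  have vb: "((\<lambda>s. v s \<bullet> b) has_real_derivative v' \<bullet> b) (at t)" for b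
    unfolding has_real_derivative_iff_has_vector_derivative
    by (rule bounded_linear.has_vector_derivative[OF bounded_linear_inner_left v])
  have "((\<lambda>s. \<Sum>b\<in>Basis. (v s \<bullet> b) *\<^sub>R Df f (c s) b) has_vector_derivative
      (\<Sum>b\<in>Basis. (v t \<bullet> b) *\<^sub>R Df (\<lambda>y. Df f y b) (c t) c' + (v' \<bullet> b) *\<^sub>R Df f (c t) b)) (at t)"
    by (intro has_vector_derivative_sum has_vector_derivative_scaleR vb d)
  then have "((\<lambda>s. Df f (c s) (v s)) has_vector_derivative
      (\<Sum>b\<in>Basis. (v t \<bullet> b) *\<^sub>R Df (\<lambda>y. Df f y b) (c t) c' + (v' \<bullet> b) *\<^sub>R Df f (c t) b)) (at t)"
  proof (rule has_vector_derivative_transform_within_open[OF _ I(1,2)])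
    show "(\<Sum>b\<in>Basis. (v s \<bullet> b) *\<^sub>R Df f (c s) b) = Df f (c s) (v s)" if "s \<in> I" for s
      by (rule linear_eq_sum_Basis[OF has_derivative_linear[OF smooth_on_has_derivative[OF f S]], symmetric])
         (use that I(3) in blast)
  qed
  moreover have "(\<Sum>b\<in>Basis. (v t \<bullet> b) *\<^sub>R Df (\<lambda>y. Df f y b) (c t) c') = Df (\<lambda>y. Df f y (v t)) (c t) c'"
    by (rule Df_Df_linear[OF f S ct, symmetric])
  moreover have "(\<Sum>b\<in>Basis. (v' \<bullet> b) *\<^sub>R Df f (c t) b) = Df f (c t) v'"
    by (rule linear_eq_sum_Basis[OF has_derivative_linear[OF smooth_on_has_derivative[OF f S ct]], symmetric])
  ultimately show ?thesis by (simp only: sum.distrib)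
qed

text \<open>The derivatives possible at \<open>t\<close> and at \<open>t + r\<close> are the same,
  so the choice operator in \<open>vector_derivative\<close> picks the same one, also where the
  function is not differentiable.\<close>

lemma vd_shift:
  fixes f :: "real \<Rightarrow> 'b::real_normed_vector"
  assumes "\<And>t. f (t + r) = f t"
  shows "vd f (t + r) = vd f t"
proof -
  have "(f has_vector_derivative D) (at (t + r)) \<longleftrightarrow> (f has_vector_derivative D) (at t)" for D
  proof
    assume f: "(f has_vector_derivative D) (at (t + r))"
    have "((\<lambda>s. s + r) has_vector_derivative 1) (at t)" by (auto intro!: derivative_eq_intros)
    from vector_diff_chain_at[OF this f] show "(f has_vector_derivative D) (at t)" by (simp add: o_def assms)
  next
    assume "(f has_vector_derivative D) (at t)"
    then have f: "(f has_vector_derivative D) (at (t + r - r))" by simp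
    have "((\<lambda>s. s - r) has_vector_derivative 1) (at (t + r))" by (auto intro!: derivative_eq_intros)
    from vector_diff_chain_at[OF this f] have "((\<lambda>s. f (s - r)) has_vector_derivative D) (at (t + r))"
      by (simp add: o_def)
    moreover have "f (s - r) = f s" for s using assms[of "s - r"] by simp
    ultimately show "(f has_vector_derivative D) (at (t + r))" by simp
  qed
  then show ?thesis unfolding vector_derivative_def by simp
qed

locale riemann_surface = surface M \<A>
  for M :: "'a::t2_space set" and \<A> +
  fixes \<sigma> :: "'a metric_field"
  assumes riem: "riemannian_metric \<A> \<sigma>"
begin

abbreviation gram :: "'a chart \<Rightarrow> real^2 \<Rightarrow> real^2^2" where
  "gram c \<equiv> \<sigma> c \<circ> point c"

lemma smooth_gram: "c \<in> \<A> \<Longrightarrow> smooth_on (gram c) (img c)"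
  using riem unfolding riemannian_metric_def by blast

lemma gram_sym: "c \<in> \<A> \<Longrightarrow> p \<in> cdom c \<Longrightarrow> v \<bullet> (\<sigma> c p *v w) = w \<bullet> (\<sigma> c p *v v)"
proof -
  assume "c \<in> \<A>" "p \<in> cdom c"
  then have "transpose (\<sigma> c p) = \<sigma> c p" using riem unfolding riemannian_metric_def by blast
  then have "v \<bullet> (\<sigma> c p *v w) = v \<bullet> (w v* \<sigma> c p)" by (metis transpose_matrix_vector)
  also have "\<dots> = w \<bullet> (\<sigma> c p *v v)" using dot_lmul_matrix[of w "\<sigma> c p" v] by (simp add: inner_commute)
  finally show ?thesis .
qed

lemma gram_pos: "c \<in> \<A> \<Longrightarrow> p \<in> cdom c \<Longrightarrow> v \<noteq> 0 \<Longrightarrow> v \<bullet> (\<sigma> c p *v v) > 0"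
  using riem unfolding riemannian_metric_def by blast

lemma gram_transform:
  assumes "c \<in> \<A>" "d \<in> \<A>" "p \<in> cdom c" "p \<in> cdom d"
  shows "v \<bullet> (\<sigma> c p *v w) =
    Df (transition c d) (coord c p) v \<bullet> (\<sigma> d p *v Df (transition c d) (coord c p) w)"
proof -
  let ?J = "jacobian (transition c d) (at (coord c p))"
  have "\<sigma> c p = transpose ?J ** \<sigma> d p ** ?J"
    using riem assms unfolding riemannian_metric_def Let_def by blast
  then have "v \<bullet> (\<sigma> c p *v w) = v \<bullet> (transpose ?J *v (\<sigma> d p *v (?J *v w)))"
    by (simp only: matrix_vector_mul_assoc[symmetric])
  also have "\<dots> = (?J *v v) \<bullet> (\<sigma> d p *v (?J *v w))"
    using dot_lmul_matrix[of "\<sigma> d p *v (?J *v w)" ?J v] by (simp add: inner_commute)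
  finally have eq: "v \<bullet> (\<sigma> c p *v w) = (?J *v v) \<bullet> (\<sigma> d p *v (?J *v w))" .
  have "?J *v u = Df (transition c d) (coord c p) u" for u
    unfolding jacobian_def
    by (rule matrix_works) (simp add: linear_matrix_vector_mul_eq
        has_derivative_linear[OF transition_has_derivative[OF assms]])
  then show ?thesis by (simp only: eq)
qed

text \<open>\<open>EL\<close> is the Euler-Lagrange covector of the energy along a curve: it vanishes exactly on
  geodesics and, unlike the Christoffel symbols, is tensorial.\<close>

definition EL :: "(real \<Rightarrow> 'a) \<Rightarrow> 'a chart \<Rightarrow> real \<Rightarrow> real^2 \<Rightarrow> real" where
  "EL \<gamma> c t a = (let x = coord c \<circ> \<gamma>; x' = vd x t in
     a \<bullet> (\<sigma> c (\<gamma> t) *v vd (vd x) t) + a \<bullet> (Df (gram c) (x t) x' *v x') - (1/2) * (x' \<bullet> (Df (gram c) (x t) a *v x')))"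

text \<open>The velocity with its index lowered by \<sigma>, evaluated at \<open>a\<close>; on the
  velocity itself it is the squared speed \<open>nrm2\<close>.\<close>

definition flatv :: "(real \<Rightarrow> 'a) \<Rightarrow> 'a chart \<Rightarrow> real \<Rightarrow> real^2 \<Rightarrow> real" where
  "flatv \<gamma> c t a = a \<bullet> (\<sigma> c (\<gamma> t) *v vd (coord c \<circ> \<gamma>) t)"

abbreviation nrm2 :: "(real \<Rightarrow> 'a) \<Rightarrow> 'a chart \<Rightarrow> real \<Rightarrow> real" where
  "nrm2 \<gamma> c t \<equiv> flatv \<gamma> c t (vd (coord c \<circ> \<gamma>) t)"

text \<open>Obtained by differentiating the transformation law with \<open>v\<close> and
  \<open>w\<close> held fixed in the chart \<open>c\<close>; the second derivatives of the
  transition map enter because the images of both vectors vary with the point.\<close>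

lemma gram_transform_derivative:
  assumes c: "c \<in> \<A>" "d \<in> \<A>" and p: "p \<in> cdom c" "p \<in> cdom d"
  defines "T \<equiv> transition c d" and "x \<equiv> coord c p"
  shows "v \<bullet> (Df (gram c) x a *v w) =
      Df (\<lambda>y. Df T y v) x a \<bullet> (\<sigma> d p *v Df T x w) +
      Df T x v \<bullet> (Df (gram d) (coord d p) (Df T x a) *v Df T x w) +
      Df T x v \<bullet> (\<sigma> d p *v Df (\<lambda>y. Df T y w) x a)"
proof -
  let ?O = "coord c ` (cdom c \<inter> cdom d)"
  have sT: "smooth_on T ?O" and oO: "open ?O" and xO: "x \<in> ?O"
    using smooth_transition[OF c] open_overlap[OF c] p by (auto simp: T_def x_def)
  have Tx: "T x = coord d p" unfolding T_def x_def by (rule transition_coord[OF c(1) p(1)])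
  have f: "((\<lambda>y. Df T y u) has_derivative Df (\<lambda>y. Df T y u) x) (at x)" for u
    by (rule smooth_on_has_derivative[OF smooth_on_Df[OF sT oO] oO xO])
  have dT: "(T has_derivative Df T x) (at x)" by (rule smooth_on_has_derivative[OF sT oO xO])
  have "(gram d has_derivative Df (gram d) (coord d p)) (at (T x))"
    unfolding Tx by (rule smooth_on_has_derivative[OF smooth_gram[OF c(2)] open_img[OF c(2)]]) (use p in blast)
  from has_derivative_compose[OF dT this]
  have M: "((\<lambda>y. gram d (T y)) has_derivative (\<lambda>a. Df (gram d) (coord d p) (Df T x a))) (at x)" .
  have "((\<lambda>y. Df T y v \<bullet> (gram d (T y) *v Df T y w)) has_derivative
    (\<lambda>a. Df (\<lambda>y. Df T y v) x a \<bullet> (gram d (T x) *v Df T x w) +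
      Df T x v \<bullet> (Df (gram d) (coord d p) (Df T x a) *v Df T x w) +
      Df T x v \<bullet> (gram d (T x) *v Df (\<lambda>y. Df T y w) x a))) (at x)"
    by (rule has_derivative_trilinear[OF f M f])
  then have 1: "((\<lambda>y. v \<bullet> (gram c y *v w)) has_derivative
    (\<lambda>a. Df (\<lambda>y. Df T y v) x a \<bullet> (gram d (T x) *v Df T x w) +
      Df T x v \<bullet> (Df (gram d) (coord d p) (Df T x a) *v Df T x w) +
      Df T x v \<bullet> (gram d (T x) *v Df (\<lambda>y. Df T y w) x a))) (at x)"
  proof (rule has_derivative_transform_within_open[OF _ oO xO])
    fix y assume "y \<in> ?O"
    then obtain q where q: "q \<in> cdom c" "q \<in> cdom d" "y = coord c q" by blast
    have "point c y = q" "point d (T y) = q"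
      using q point_coord[OF c(1)] point_coord[OF c(2)] transition_coord[OF c(1)] by (simp_all add: T_def)
    then show "Df T y v \<bullet> (gram d (T y) *v Df T y w) = v \<bullet> (gram c y *v w)"
      using gram_transform[OF c q(1,2), of v w] q(3) by (simp add: T_def)
  qed
  have "(gram c has_derivative Df (gram c) x) (at x)"
    by (rule smooth_on_has_derivative[OF smooth_gram[OF c(1)] open_img[OF c(1)]]) (use p in \<open>auto simp: x_def\<close>)
  from has_derivative_trilinear[OF has_derivative_const this has_derivative_const, of v w]
  have 2: "((\<lambda>y. v \<bullet> (gram c y *v w)) has_derivative (\<lambda>a. v \<bullet> (Df (gram c) x a *v w))) (at x)" by simp
  have "gram d (T x) = \<sigma> d p" unfolding Tx using point_coord[OF c(2) p(2)] by simp
  then show ?thesis using fun_cong[OF has_derivative_unique[OF 2 1], of a] by simp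
qed

context
  fixes \<gamma> assumes reg\<gamma>: "reg \<gamma> UNIV"
begin

lemma curve_smooth:
  assumes "c \<in> \<A>"
  shows "open {t. \<gamma> t \<in> cdom c}" "smooth_on (coord c \<circ> \<gamma>) {t. \<gamma> t \<in> cdom c}"
    "\<gamma> t \<in> cdom c \<Longrightarrow> vd (coord c \<circ> \<gamma>) t \<noteq> 0"
    "\<gamma> t \<in> cdom c \<Longrightarrow> ((coord c \<circ> \<gamma>) has_vector_derivative vd (coord c \<circ> \<gamma>) t) (at t)"
    "\<gamma> t \<in> cdom c \<Longrightarrow> (vd (coord c \<circ> \<gamma>) has_vector_derivative vd (vd (coord c \<circ> \<gamma>)) t) (at t)"
proof -
  show o: "open {t. \<gamma> t \<in> cdom c}" using reg_open_cdom[OF reg\<gamma> assms] by simp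
  show s: "smooth_on (coord c \<circ> \<gamma>) {t. \<gamma> t \<in> cdom c}" using reg_chart(1)[OF reg\<gamma> assms] by simp
  show "\<gamma> t \<in> cdom c \<Longrightarrow> vd (coord c \<circ> \<gamma>) t \<noteq> 0" using reg_chart(2)[OF reg\<gamma> assms] by simp
  show "\<gamma> t \<in> cdom c \<Longrightarrow> ((coord c \<circ> \<gamma>) has_vector_derivative vd (coord c \<circ> \<gamma>) t) (at t)"
    using smooth_on_vd(1)[OF s o] by simp
  show "\<gamma> t \<in> cdom c \<Longrightarrow> (vd (coord c \<circ> \<gamma>) has_vector_derivative vd (vd (coord c \<circ> \<gamma>)) t) (at t)"
    using smooth_on_vd(1)[OF smooth_on_vector_derivative[OF s o] o] by simp
qed

lemma curve_transition:
  assumes c: "c \<in> \<A>" "d \<in> \<A>" and p: "\<gamma> t \<in> cdom c" "\<gamma> t \<in> cdom d"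
  defines "T \<equiv> transition c d" and "x \<equiv> coord c \<circ> \<gamma>"
  shows "vd (coord d \<circ> \<gamma>) t = Df T (x t) (vd x t)"
    "vd (vd (coord d \<circ> \<gamma>)) t = Df (\<lambda>y. Df T y (vd x t)) (x t) (vd x t) + Df T (x t) (vd (vd x) t)"
proof -
  let ?I = "{t. \<gamma> t \<in> cdom c} \<inter> {t. \<gamma> t \<in> cdom d}"
  have oI: "open ?I" "t \<in> ?I" using curve_smooth(1)[OF c(1)] curve_smooth(1)[OF c(2)] p by auto
  have 1: "vd (coord d \<circ> \<gamma>) s = Df T (x s) (vd x s)" if "s \<in> ?I" for s
  proof (rule vector_derivative_at)
    have "continuous_on UNIV \<gamma>" "\<gamma> ` UNIV \<subseteq> M" using reg_continuous[OF reg\<gamma>] reg_sub[OF reg\<gamma>] by auto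
    from coord_curve_derivative[OF c _ _ this UNIV_I, of s "vd x s"]
    show "((coord d \<circ> \<gamma>) has_vector_derivative Df T (x s) (vd x s)) (at s)"
      using that curve_smooth(4)[OF c(1), of s] by (simp add: x_def T_def)
  qed
  show "vd (coord d \<circ> \<gamma>) t = Df T (x t) (vd x t)" by (rule 1[OF oI(2)])
  have "((\<lambda>s. Df T (x s) (vd x s)) has_vector_derivative
      Df (\<lambda>y. Df T y (vd x t)) (x t) (vd x t) + Df T (x t) (vd (vd x) t)) (at t)"
    unfolding T_def
    by (rule Df_along_curve[OF smooth_transition[OF c] open_overlap[OF c] oI])
       (use curve_smooth(4,5)[OF c(1) p(1)] in \<open>auto simp: x_def o_def\<close>)
  then have "(vd (coord d \<circ> \<gamma>) has_vector_derivative
      Df (\<lambda>y. Df T y (vd x t)) (x t) (vd x t) + Df T (x t) (vd (vd x) t)) (at t)"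
    by (rule has_vector_derivative_transform_within_open[OF _ oI]) (rule 1[symmetric])
  then show "vd (vd (coord d \<circ> \<gamma>)) t = Df (\<lambda>y. Df T y (vd x t)) (x t) (vd x t) + Df T (x t) (vd (vd x) t)"
    by (rule vector_derivative_at)
qed

lemma flatv_transform:
  assumes c: "c \<in> \<A>" "d \<in> \<A>" and p: "\<gamma> t \<in> cdom c" "\<gamma> t \<in> cdom d"
  shows "flatv \<gamma> c t a = flatv \<gamma> d t (Df (transition c d) (coord c (\<gamma> t)) a)"
  unfolding flatv_def using gram_transform[OF c p] curve_transition(1)[OF c p] by simp

lemma nrm2_transform:
  assumes c: "c \<in> \<A>" "d \<in> \<A>" and p: "\<gamma> t \<in> cdom c" "\<gamma> t \<in> cdom d"
  shows "nrm2 \<gamma> c t = nrm2 \<gamma> d t"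
  using flatv_transform[OF c p] curve_transition(1)[OF c p] by simp

lemma nrm2_pos: "c \<in> \<A> \<Longrightarrow> \<gamma> t \<in> cdom c \<Longrightarrow> nrm2 \<gamma> c t > 0"
  unfolding flatv_def using gram_pos curve_smooth(3) by simp

text \<open>Second derivatives of the transition map enter through the acceleration and through the
  derivatives of the Gram matrix. By symmetry of the second derivatives and of the metric, the terms
  in which they are applied to \<open>a\<close> cancel between the last two summands of
  \<open>EL\<close>; what remains is exactly the correction of the acceleration.\<close>

lemma EL_transform:
  assumes c: "c \<in> \<A>" "d \<in> \<A>" and p: "\<gamma> t \<in> cdom c" "\<gamma> t \<in> cdom d"
  shows "EL \<gamma> c t a = EL \<gamma> d t (Df (transition c d) (coord c (\<gamma> t)) a)"
proof -
  let ?T = "transition c d"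
  define x where "x = coord c (\<gamma> t)"
  define v where "v = vd (coord c \<circ> \<gamma>) t"
  define w where "w = vd (vd (coord c \<circ> \<gamma>)) t"
  define S where "S = \<sigma> d (\<gamma> t)"
  define J where "J = Df ?T x"
  define D2 where "D2 u b = Df (\<lambda>y. Df ?T y u) x b" for u b
  define G where "G = Df (gram d) (coord d (\<gamma> t))"
  have sym: "D2 u b = D2 b u" for u b
    unfolding D2_def
    by (rule Df_symmetric[OF smooth_transition[OF c] open_overlap[OF c]]) (use p in \<open>auto simp: x_def\<close>)
  have S: "u \<bullet> (S *v b) = b \<bullet> (S *v u)" for u b unfolding S_def by (rule gram_sym[OF c(2) p(2)])
  have v': "vd (coord d \<circ> \<gamma>) t = J v" and w': "vd (vd (coord d \<circ> \<gamma>)) t = D2 v v + J w"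
    using curve_transition[OF c p] by (simp_all add: J_def v_def w_def x_def D2_def)
  have G: "u \<bullet> (Df (gram c) x b *v z) = D2 u b \<bullet> (S *v J z) + J u \<bullet> (G (J b) *v J z) + J u \<bullet> (S *v D2 z b)" for u b z
    using gram_transform_derivative[OF c p, of u b z] by (simp add: D2_def S_def J_def G_def x_def)
  have 1: "a \<bullet> (\<sigma> c (\<gamma> t) *v w) = J a \<bullet> (S *v J w)"
    using gram_transform[OF c p, of a w] by (simp add: J_def S_def x_def)
  have "EL \<gamma> c t a = a \<bullet> (\<sigma> c (\<gamma> t) *v w) + a \<bullet> (Df (gram c) x v *v v) - (1/2) * (v \<bullet> (Df (gram c) x a *v v))"
    by (simp add: EL_def x_def v_def w_def Let_def)
  also have "\<dots> = J a \<bullet> (S *v J w) + J a \<bullet> (S *v D2 v v) + J a \<bullet> (G (J v) *v J v) - (1/2) * (J v \<bullet> (G (J a) *v J v))"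
    unfolding 1 G using S[of "D2 v a" "J v"] sym[of a v] S[of "J v" "D2 v a"] by (simp add: field_simps)
  also have "\<dots> = EL \<gamma> d t (J a)"
    by (simp add: EL_def v' w' Let_def S_def G_def matrix_vector_right_distrib inner_add_right)
  finally show ?thesis by (simp add: J_def x_def)
qed

text \<open>The slope that \<open>u\<close> must have along the curve, and the condition on the differential of \<open>u\<close> that
  makes the curve a geodesic of \<open>exp (2 u) \<sigma>\<close>.\<close>

definition slope :: "'a chart \<Rightarrow> real \<Rightarrow> real" where
  "slope c t = - EL \<gamma> c t (vd (coord c \<circ> \<gamma>) t) / nrm2 \<gamma> c t"

definition jet_in :: "('a \<Rightarrow> real) \<Rightarrow> 'a chart \<Rightarrow> real \<Rightarrow> bool" where
  "jet_in u c t \<longleftrightarrow> (u \<circ> point c) differentiable (at (coord c (\<gamma> t))) \<and>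
     (\<forall>a. nrm2 \<gamma> c t * Df (u \<circ> point c) (coord c (\<gamma> t)) a = EL \<gamma> c t a + 2 * slope c t * flatv \<gamma> c t a)"

definition jet :: "('a \<Rightarrow> real) \<Rightarrow> real \<Rightarrow> bool" where
  "jet u t \<longleftrightarrow> (\<forall>c\<in>\<A>. \<gamma> t \<in> cdom c \<longrightarrow> jet_in u c t)"

lemma slope_transform:
  assumes c: "c \<in> \<A>" "d \<in> \<A>" and p: "\<gamma> t \<in> cdom c" "\<gamma> t \<in> cdom d"
  shows "slope c t = slope d t"
  unfolding slope_def nrm2_transform[OF assms] using EL_transform[OF assms] curve_transition(1)[OF assms] by simp

text \<open>All ingredients of the condition are tensorial or invariant, so one chart decides it for
  all.\<close>

lemma jetI:
  assumes c: "c \<in> \<A>" "\<gamma> t \<in> cdom c" and j: "jet_in u c t"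
  shows "jet u t"
  unfolding jet_def
proof (intro ballI impI)
  fix d assume d: "d \<in> \<A>" "\<gamma> t \<in> cdom d"
  let ?T = "transition d c" and ?x = "coord d (\<gamma> t)"
  have Tx: "?T ?x = coord c (\<gamma> t)" by (rule transition_coord[OF d])
  have "((u \<circ> point c) has_derivative Df (u \<circ> point c) (coord c (\<gamma> t))) (at (?T ?x))"
    using j unfolding jet_in_def Tx frechet_derivative_works by blast
  from has_derivative_compose[OF transition_has_derivative[OF d(1) c(1) d(2) c(2)] this]
  have "((\<lambda>y. (u \<circ> point c) (?T y)) has_derivative (\<lambda>a. Df (u \<circ> point c) (coord c (\<gamma> t)) (Df ?T ?x a))) (at ?x)" .
  then have h: "((u \<circ> point d) has_derivative (\<lambda>a. Df (u \<circ> point c) (coord c (\<gamma> t)) (Df ?T ?x a))) (at ?x)"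
    by (rule has_derivative_transform_within_open[OF _ open_overlap[OF d(1) c(1)]])
       (use c d in \<open>auto simp: transition_coord[OF d(1)] point_coord[OF c(1)] point_coord[OF d(1)]\<close>)
  show "jet_in u d t"
    unfolding jet_in_def
  proof (intro conjI allI)
    show "(u \<circ> point d) differentiable (at ?x)" using h differentiableI by blast
    fix a
    have N: "nrm2 \<gamma> d t = nrm2 \<gamma> c t" by (rule nrm2_transform[OF d(1) c(1) d(2) c(2)])
    show "nrm2 \<gamma> d t * Df (u \<circ> point d) ?x a = EL \<gamma> d t a + 2 * slope d t * flatv \<gamma> d t a"
      unfolding N Df_eqI[OF h] EL_transform[OF d(1) c(1) d(2) c(2)]
        flatv_transform[OF d(1) c(1) d(2) c(2), of a] slope_transform[OF d(1) c(1) d(2) c(2)]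
      using j unfolding jet_in_def by blast
  qed
qed

lemma jet_cong:
  assumes W: "openin (top_of_set M) W" "\<gamma> t \<in> W" and eq: "\<And>q. q \<in> W \<Longrightarrow> u q = w q" and j: "jet u t"
  shows "jet w t"
  unfolding jet_def
proof (intro ballI impI)
  fix c assume c: "c \<in> \<A>" "\<gamma> t \<in> cdom c"
  let ?x = "coord c (\<gamma> t)"
  have ju: "jet_in u c t" using j c unfolding jet_def by blast
  have h: "((w \<circ> point c) has_derivative Df (u \<circ> point c) ?x) (at ?x)"
  proof (rule has_derivative_transform_within_open[OF _ open_coord_image[OF c(1) W(1)]])
    show "((u \<circ> point c) has_derivative Df (u \<circ> point c) ?x) (at ?x)"
      using ju unfolding jet_in_def frechet_derivative_works by blast
    show "?x \<in> coord c ` (cdom c \<inter> W)" using c W by blast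
    show "(u \<circ> point c) y = (w \<circ> point c) y" if "y \<in> coord c ` (cdom c \<inter> W)" for y
      using that eq point_coord[OF c(1)] by auto
  qed
  show "jet_in w c t"
    using ju unfolding jet_in_def Df_eqI[OF h] using h differentiableI by blast
qed

lemma jet_add_const:
  assumes "jet u t" shows "jet (\<lambda>p. u p + k) t"
  unfolding jet_def
proof (intro ballI impI)
  fix c assume c: "c \<in> \<A>" "\<gamma> t \<in> cdom c"
  let ?x = "coord c (\<gamma> t)"
  have ju: "jet_in u c t" using assms c unfolding jet_def by blast
  have "((u \<circ> point c) has_derivative Df (u \<circ> point c) ?x) (at ?x)"
    using ju unfolding jet_in_def frechet_derivative_works by blast
  from has_derivative_add[OF this has_derivative_const[of k]]
  have h: "(((\<lambda>p. u p + k) \<circ> point c) has_derivative Df (u \<circ> point c) ?x) (at ?x)" by (simp add: o_def)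
  show "jet_in (\<lambda>p. u p + k) c t"
    using ju unfolding jet_in_def Df_eqI[OF h] using h differentiableI by blast
qed

text \<open>Where two functions agree, the differential of a blend is the blend of the differentials.\<close>

lemma jet_blend:
  assumes u: "jet u t" and w: "jet w t" and eq: "u (\<gamma> t) = w (\<gamma> t)" and b: "smooth_function \<A> \<beta>"
  shows "jet (\<lambda>p. u p - \<beta> p * u p + \<beta> p * w p) t"
  unfolding jet_def
proof (intro ballI impI)
  fix c assume c: "c \<in> \<A>" "\<gamma> t \<in> cdom c"
  let ?x = "coord c (\<gamma> t)"
  have ju: "jet_in u c t" "jet_in w c t" using u w c unfolding jet_def by blast+
  have hu: "((u \<circ> point c) has_derivative Df (u \<circ> point c) ?x) (at ?x)"
    and hw: "((w \<circ> point c) has_derivative Df (w \<circ> point c) ?x) (at ?x)"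
    using ju unfolding jet_in_def frechet_derivative_works by blast+
  have hb: "((\<beta> \<circ> point c) has_derivative Df (\<beta> \<circ> point c) ?x) (at ?x)"
    by (rule smooth_on_has_derivative[OF smooth_function_chart[OF b c(1)] open_img[OF c(1)]]) (use c in blast)
  have px: "point c ?x = \<gamma> t" by (rule point_coord[OF c])
  have "((\<lambda>y. (u \<circ> point c) y - (\<beta> \<circ> point c) y * (u \<circ> point c) y + (\<beta> \<circ> point c) y * (w \<circ> point c) y) has_derivative
     (\<lambda>a. Df (u \<circ> point c) ?x a - ((\<beta> \<circ> point c) ?x * Df (u \<circ> point c) ?x a + Df (\<beta> \<circ> point c) ?x a * (u \<circ> point c) ?x)
        + ((\<beta> \<circ> point c) ?x * Df (w \<circ> point c) ?x a + Df (\<beta> \<circ> point c) ?x a * (w \<circ> point c) ?x))) (at ?x)"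
    by (intro has_derivative_add has_derivative_diff has_derivative_mult hu hw hb)
  moreover have "(\<lambda>a. Df (u \<circ> point c) ?x a - ((\<beta> \<circ> point c) ?x * Df (u \<circ> point c) ?x a + Df (\<beta> \<circ> point c) ?x a * (u \<circ> point c) ?x)
        + ((\<beta> \<circ> point c) ?x * Df (w \<circ> point c) ?x a + Df (\<beta> \<circ> point c) ?x a * (w \<circ> point c) ?x))
     = (\<lambda>a. (1 - \<beta> (\<gamma> t)) * Df (u \<circ> point c) ?x a + \<beta> (\<gamma> t) * Df (w \<circ> point c) ?x a)"
    by (rule ext) (simp add: px eq algebra_simps)
  ultimately have h: "(((\<lambda>p. u p - \<beta> p * u p + \<beta> p * w p) \<circ> point c) has_derivative
     (\<lambda>a. (1 - \<beta> (\<gamma> t)) * Df (u \<circ> point c) ?x a + \<beta> (\<gamma> t) * Df (w \<circ> point c) ?x a)) (at ?x)"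
    by (simp add: o_def)
  show "jet_in (\<lambda>p. u p - \<beta> p * u p + \<beta> p * w p) c t"
    unfolding jet_in_def Df_eqI[OF h]
  proof (intro conjI allI)
    show "((\<lambda>p. u p - \<beta> p * u p + \<beta> p * w p) \<circ> point c) differentiable (at ?x)" using h differentiableI by blast
    fix a
    have 1: "nrm2 \<gamma> c t * Df (u \<circ> point c) ?x a = EL \<gamma> c t a + 2 * slope c t * flatv \<gamma> c t a"
      and 2: "nrm2 \<gamma> c t * Df (w \<circ> point c) ?x a = EL \<gamma> c t a + 2 * slope c t * flatv \<gamma> c t a"
      using ju unfolding jet_in_def by blast+
    have "nrm2 \<gamma> c t * ((1 - \<beta> (\<gamma> t)) * Df (u \<circ> point c) ?x a + \<beta> (\<gamma> t) * Df (w \<circ> point c) ?x a)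
      = (1 - \<beta> (\<gamma> t)) * (nrm2 \<gamma> c t * Df (u \<circ> point c) ?x a) + \<beta> (\<gamma> t) * (nrm2 \<gamma> c t * Df (w \<circ> point c) ?x a)"
      by (simp add: algebra_simps)
    then show "nrm2 \<gamma> c t * ((1 - \<beta> (\<gamma> t)) * Df (u \<circ> point c) ?x a + \<beta> (\<gamma> t) * Df (w \<circ> point c) ?x a)
      = EL \<gamma> c t a + 2 * slope c t * flatv \<gamma> c t a"
      unfolding 1 2 by (simp add: algebra_simps)
  qed
qed

text \<open>In a chart where \<open>e \<bullet> x(t)\<close> is a parameter along the curve with inverse \<open>\<theta>\<close>, the function
  \<open>f(\<theta>) + w(\<theta>) \<bullet> (y - x(\<theta>))\<close>, \<open>\<theta> = \<theta>(e \<bullet> y)\<close>, has value \<open>f\<close> and gradient \<open>w\<close> along the curve, provided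
  that \<open>f' = w \<bullet> x'\<close>.\<close>

lemma local_jet:
  assumes c: "c \<in> \<A>" "\<gamma> t0 \<in> cdom c"
  obtains U V \<eta> where "\<eta> > 0" "open V" "V \<subseteq> img c" "coord c (\<gamma> t0) \<in> V" "smooth_on (U \<circ> point c) V"
    "\<And>t. \<bar>t - t0\<bar> < \<eta> \<Longrightarrow> \<gamma> t \<in> cdom c \<and> U (\<gamma> t) = - (1/2) * ln (nrm2 \<gamma> c t) \<and> jet U t"
proof -
  define x where "x = coord c \<circ> \<gamma>"
  let ?I0 = "{t. \<gamma> t \<in> cdom c}"
  have oI0: "open ?I0" and sx: "smooth_on x ?I0" using curve_smooth(1,2)[OF c(1)] by (simp_all add: x_def)
  have sx': "smooth_on (vd x) ?I0" by (rule smooth_on_vector_derivative[OF sx oI0])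
  have sx'': "smooth_on (vd (vd x)) ?I0" by (rule smooth_on_vector_derivative[OF sx' oI0])
  have xI: "x ` ?I0 \<subseteq> img c" by (auto simp: x_def)
  have sG: "smooth_on (\<lambda>t. gram c (x t)) ?I0"
    by (rule smooth_on_compose[OF sx smooth_gram[OF c(1)] oI0 open_img[OF c(1)] xI])
  have Gx: "gram c (x t) = \<sigma> c (\<gamma> t)" if "t \<in> ?I0" for t using that point_coord[OF c(1)] by (simp add: x_def)
  have sDG: "smooth_on (\<lambda>t. Df (gram c) (x t) (v t)) ?I0" if "smooth_on v ?I0" for v
    by (rule smooth_on_Df2[OF smooth_gram[OF c(1)] open_img[OF c(1)] sx that oI0 xI])
  define N where "N t = vd x t \<bullet> (gram c (x t) *v vd x t)" for t
  define L where "L t a = a \<bullet> (gram c (x t) *v vd (vd x) t) + a \<bullet> (Df (gram c) (x t) (vd x t) *v vd x t)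
     - (1/2) * (vd x t \<bullet> (Df (gram c) (x t) a *v vd x t))" for t a
  define s where "s t = - L t (vd x t) / N t" for t
  \<comment> \<open>The coordinate gradient that realises the jet condition: its components are the
    prescribed differential evaluated on the basis vectors.\<close>
  define w where "w t = (\<Sum>b\<in>Basis. ((L t b + 2 * s t * (b \<bullet> (gram c (x t) *v vd x t))) / N t) *\<^sub>R b)" for t
  define f where "f t = - (1/2) * ln (N t)" for t
  have NN: "N t = nrm2 \<gamma> c t" and LE: "L t a = EL \<gamma> c t a" and ss: "s t = slope c t"
    and fl: "a \<bullet> (gram c (x t) *v vd x t) = flatv \<gamma> c t a" if "t \<in> ?I0" for t a
    using that Gx[OF that] by (simp_all add: N_def L_def EL_def s_def slope_def flatv_def Let_def x_def)
  have Npos: "N t > 0" if "t \<in> ?I0" for t using NN[OF that] nrm2_pos[OF c(1)] that by simp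
  have sN: "smooth_on N ?I0" unfolding N_def
    by (intro smooth_on_inner smooth_on_matrix_vector sx' sG oI0)
  have sLc: "smooth_on (\<lambda>t. L t (v t)) ?I0" if "smooth_on v ?I0" for v unfolding L_def
    by (intro smooth_on_diff smooth_on_add smooth_on_mult smooth_on_const smooth_on_inner smooth_on_matrix_vector
        sx' sx'' sG sDG that oI0)
  have Nne: "N t \<noteq> 0" if "t \<in> ?I0" for t using Npos[OF that] by simp
  have sc: "smooth_on (\<lambda>t. b) ?I0" for b :: "real^2" by (rule smooth_on_const[OF oI0])
  have sb: "smooth_on (\<lambda>t. b \<bullet> (gram c (x t) *v vd x t)) ?I0" for b
    by (intro smooth_on_inner smooth_on_matrix_vector sx' sG oI0 sc)
  have sss: "smooth_on s ?I0" unfolding s_def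
    by (intro smooth_on_divide smooth_on_minus sLc[OF sx'] sN oI0 Nne)
  have sw: "smooth_on w ?I0" unfolding w_def
    by (intro smooth_on_sum smooth_on_scaleR smooth_on_divide smooth_on_add smooth_on_mult
        smooth_on_const sLc[OF sc] sss sb sN oI0 Nne)
  have sf: "smooth_on f ?I0" unfolding f_def
    by (intro smooth_on_mult smooth_on_const smooth_on_compose[OF sN smooth_on_ln] oI0) (use Npos in auto)
  have Llin: "L t a = (\<Sum>b\<in>Basis. (a \<bullet> b) * L t b)" if t: "t \<in> ?I0" for t a
  proof -
    have "x t \<in> img c" using xI t by blast
    from has_derivative_linear[OF smooth_on_has_derivative[OF smooth_gram[OF c(1)] open_img[OF c(1)] this]]
    have lin: "linear (Df (gram c) (x t))" .
    have "linear (L t)"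
      unfolding L_def
      by (rule linearI)
         (simp_all add: linear_add[OF lin] linear_scale[OF lin] inner_add_left inner_add_right algebra_simps
           matrix_vector_mult_add_rdistrib scaleR_matrix_vector_assoc[symmetric])
    from linear_eq_sum_Basis[OF this, of a] show ?thesis by simp
  qed
  have wa: "w t \<bullet> a = (L t a + 2 * s t * (a \<bullet> (gram c (x t) *v vd x t))) / N t" if t: "t \<in> ?I0" for t a
  proof -
    let ?z = "gram c (x t) *v vd x t"
    have za: "a \<bullet> ?z = (\<Sum>b\<in>Basis. (a \<bullet> b) * (b \<bullet> ?z))"
      by (subst euclidean_inner) (simp add: inner_commute)
    have "w t \<bullet> a = (\<Sum>b\<in>Basis. ((L t b + 2 * s t * (b \<bullet> ?z)) / N t) * (b \<bullet> a))"
      by (simp add: w_def inner_sum_left)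
    also have "\<dots> = (\<Sum>b\<in>Basis. (a \<bullet> b) * L t b + 2 * s t * ((a \<bullet> b) * (b \<bullet> ?z))) / N t"
      unfolding sum_divide_distrib by (intro sum.cong refl) (simp add: inner_commute field_simps)
    also have "\<dots> = (L t a + 2 * s t * (a \<bullet> ?z)) / N t"
      unfolding Llin[OF t, of a] za by (simp only: sum.distrib sum_distrib_left)
    finally show ?thesis .
  qed
  have w_slope: "w t \<bullet> vd x t = s t" if t: "t \<in> ?I0" for t
  proof -
    have "w t \<bullet> vd x t = (L t (vd x t) + 2 * s t * N t) / N t" unfolding wa[OF t] by (simp only: N_def)
    then show ?thesis using Nne[OF t] by (simp add: s_def field_simps)
  qed
  \<comment> \<open>By symmetry of the metric the derivative of the squared speed is
    \<open>2 * L t (vd x t)\<close>. Thus the slope prescribed by \<open>s\<close> is the one forced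
    by the prescribed values \<open>f\<close>, and value and gradient are compatible.\<close>
  have df: "vd f t = s t" if t: "t \<in> ?I0" for t
  proof -
    have hx': "(vd x has_derivative (\<lambda>h. h *\<^sub>R vd (vd x) t)) (at t)"
      using smooth_on_vd(1)[OF sx' oI0 t] by (simp add: has_vector_derivative_def)
    have hx: "(x has_vector_derivative vd x t) (at t)" by (rule smooth_on_vd(1)[OF sx oI0 t])
    have "(gram c has_derivative Df (gram c) (x t)) (at (x t))"
      by (rule smooth_on_has_derivative[OF smooth_gram[OF c(1)] open_img[OF c(1)]]) (use xI t in blast)
    from has_vector_derivative_compose_Df[OF this hx]
    have hG: "((\<lambda>t. gram c (x t)) has_derivative (\<lambda>h. h *\<^sub>R Df (gram c) (x t) (vd x t))) (at t)"
      by (simp add: has_vector_derivative_def)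
    have sym: "vd (vd x) t \<bullet> (gram c (x t) *v vd x t) = vd x t \<bullet> (gram c (x t) *v vd (vd x) t)"
      unfolding Gx[OF t] by (rule gram_sym[OF c(1)]) (use t in simp)
    have "(N has_derivative (\<lambda>h. (h *\<^sub>R vd (vd x) t) \<bullet> (gram c (x t) *v vd x t)
        + vd x t \<bullet> ((h *\<^sub>R Df (gram c) (x t) (vd x t)) *v vd x t) + vd x t \<bullet> (gram c (x t) *v (h *\<^sub>R vd (vd x) t)))) (at t)"
      unfolding N_def by (rule has_derivative_trilinear[OF hx' hG hx'])
    moreover have "(\<lambda>h. (h *\<^sub>R vd (vd x) t) \<bullet> (gram c (x t) *v vd x t)
        + vd x t \<bullet> ((h *\<^sub>R Df (gram c) (x t) (vd x t)) *v vd x t) + vd x t \<bullet> (gram c (x t) *v (h *\<^sub>R vd (vd x) t)))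
      = (\<lambda>h. (2 * L t (vd x t)) * h)"
      using sym by (auto simp: fun_eq_iff L_def scaleR_matrix_vector_assoc[symmetric] matrix_vector_mult_scaleR algebra_simps)
    ultimately have "(N has_real_derivative 2 * L t (vd x t)) (at t)"
      by (simp add: has_field_derivative_def)
    from DERIV_chain2[OF DERIV_ln_divide[OF Npos[OF t]] this]
    have ln: "((\<lambda>t. ln (N t)) has_real_derivative 2 * L t (vd x t) / N t) (at t)" by simp
    have "(f has_real_derivative - (1/2) * (2 * L t (vd x t) / N t)) (at t)"
      unfolding f_def by (intro DERIV_cmult ln)
    then have "(f has_vector_derivative s t) (at t)"
      by (simp add: s_def has_real_derivative_iff_has_vector_derivative)
    then show ?thesis by (rule vector_derivative_at)
  qed
  \<comment> \<open>Projection to the direction of the velocity at \<open>t0\<close> is strictly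
    monotone along the curve nearby and so provides the smooth parameter \<theta>.\<close>
  define e where "e = vd x t0"
  have "e \<noteq> 0" using curve_smooth(3)[OF c] by (simp add: e_def x_def)
  have t0: "t0 \<in> ?I0" using c(2) by simp
  have "continuous_on ?I0 (\<lambda>t. e \<bullet> vd x t)" by (intro continuous_intros smooth_on_continuous[OF sx'])
  then have "open (?I0 \<inter> (\<lambda>t. e \<bullet> vd x t) -` {0<..})" by (rule continuous_open_preimage[OF _ oI0]) simp
  moreover have "t0 \<in> ?I0 \<inter> (\<lambda>t. e \<bullet> vd x t) -` {0<..}" using t0 \<open>e \<noteq> 0\<close> by (simp add: e_def)
  ultimately obtain \<eta> where \<eta>: "\<eta> > 0" "ball t0 \<eta> \<subseteq> ?I0 \<inter> (\<lambda>t. e \<bullet> vd x t) -` {0<..}" by (rule openE)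
  let ?J = "{t0-\<eta><..<t0+\<eta>}"
  have I: "?J \<subseteq> ?I0" "\<And>t. t \<in> ?J \<Longrightarrow> e \<bullet> vd x t > 0"
  proof -
    have "?J = ball t0 \<eta>" by (auto simp: dist_real_def)
    then show "?J \<subseteq> ?I0" "\<And>t. t \<in> ?J \<Longrightarrow> e \<bullet> vd x t > 0" using \<eta>(2) by blast+
  qed
  define X where "X t = e \<bullet> x t" for t
  have sX: "smooth_on X ?J" unfolding X_def
    by (intro smooth_on_inner smooth_on_const smooth_on_subset[OF sx I(1)]) auto
  have vX: "vd X t = e \<bullet> vd x t" if "t \<in> ?J" for t
  proof (rule vector_derivative_at)
    show "(X has_vector_derivative e \<bullet> vd x t) (at t)" unfolding X_def
      by (rule bounded_linear.has_vector_derivative[OF bounded_linear_inner_right smooth_on_vd(1)[OF sx oI0]])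
         (use that I(1) in blast)
  qed
  have Xpos: "vd X t > 0" if "t \<in> ?J" for t using vX[OF that] I(2)[OF that] by simp
  have ne: "t0 - \<eta> < t0 + \<eta>" using \<eta>(1) by simp
  obtain \<theta> where \<theta>: "open (X ` ?J)" "smooth_on \<theta> (X ` ?J)" "\<And>t. t \<in> ?J \<Longrightarrow> \<theta> (X t) = t"
    by (rule smooth_on_inverse_function[OF sX Xpos ne], assumption) (rule that; assumption)
  define V where "V = img c \<inter> (\<lambda>y. e \<bullet> y) -` (X ` ?J)"
  have oV: "open V" unfolding V_def by (intro open_Int open_img[OF c(1)] open_vimage \<theta>(1) continuous_intros)
  define q where "q y = \<theta> (e \<bullet> y)" for y
  have sq: "smooth_on q V" unfolding q_def
    by (rule smooth_on_compose[OF smooth_on_inner[OF smooth_on_const smooth_on_ident] \<theta>(2) oV \<theta>(1)])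
       (use oV in \<open>auto simp: V_def\<close>)
  have qI: "q ` V \<subseteq> ?J" unfolding q_def V_def using \<theta>(3) by auto
  then have qI0: "q ` V \<subseteq> ?I0" using I(1) by blast
  define Y where "Y y = f (q y) + w (q y) \<bullet> (y - x (q y))" for y
  have sY: "smooth_on Y V" unfolding Y_def
    by (intro smooth_on_add smooth_on_inner smooth_on_diff smooth_on_ident oV
        smooth_on_compose[OF sq sf oV oI0 qI0] smooth_on_compose[OF sq sw oV oI0 qI0] smooth_on_compose[OF sq sx oV oI0 qI0])
  define U where "U = (\<lambda>p. Y (coord c p))"
  have sU: "smooth_on (U \<circ> point c) V"
    by (rule smooth_on_cong[OF sY oV]) (use coord_point[OF c(1)] in \<open>auto simp: U_def V_def\<close>)
  have xV: "x t \<in> V" "q (x t) = t" if "t \<in> ?J" for t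
  proof -
    have "x t \<in> img c" using that xI I(1) by blast
    then show "x t \<in> V" "q (x t) = t" using that \<theta>(3)[OF that] by (auto simp: V_def q_def X_def)
  qed
  have main: "\<gamma> t \<in> cdom c \<and> U (\<gamma> t) = - (1/2) * ln (nrm2 \<gamma> c t) \<and> jet U t" if "\<bar>t - t0\<bar> < \<eta>" for t
  proof -
    have t: "t \<in> ?J" using that by auto
    then have tI0: "t \<in> ?I0" using I(1) by blast
    then have tc: "\<gamma> t \<in> cdom c" by simp
    have val: "U (\<gamma> t) = - (1/2) * ln (nrm2 \<gamma> c t)"
      using xV(2)[OF t] NN[OF tI0] by (simp add: U_def Y_def f_def x_def)
    have hq: "(q has_derivative Df q (x t)) (at (x t))" by (rule smooth_on_has_derivative[OF sq oV xV(1)[OF t]])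
    have comp: "((\<lambda>y. h (q y)) has_derivative (\<lambda>a. Df q (x t) a *\<^sub>R vd h t)) (at (x t))"
      if "smooth_on h ?I0" for h :: "real \<Rightarrow> 'b::real_normed_vector"
    proof -
      have "(h has_derivative (\<lambda>r. r *\<^sub>R vd h t)) (at (q (x t)))"
        using smooth_on_vd(1)[OF that oI0 tI0] xV(2)[OF t] by (simp add: has_vector_derivative_def)
      from has_derivative_compose[OF hq this] show ?thesis .
    qed
    have "(Y has_derivative (\<lambda>a. Df q (x t) a *\<^sub>R vd f t + (w (q (x t)) \<bullet> (a - Df q (x t) a *\<^sub>R vd x t)
        + (Df q (x t) a *\<^sub>R vd w t) \<bullet> (x t - x (q (x t)))))) (at (x t))"
      unfolding Y_def
      by (intro has_derivative_add has_derivative_inner has_derivative_diff has_derivative_ident comp sf sw sx)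
    \<comment> \<open>On the curve \<open>q (x t) = t\<close>: the last product vanishes, and the
      terms with the derivative of \<open>q\<close> cancel because
      \<open>f' = w \<bullet> x'\<close>.\<close>
    moreover have "(\<lambda>a. Df q (x t) a *\<^sub>R vd f t + (w (q (x t)) \<bullet> (a - Df q (x t) a *\<^sub>R vd x t)
        + (Df q (x t) a *\<^sub>R vd w t) \<bullet> (x t - x (q (x t))))) = (\<lambda>a. w t \<bullet> a)"
      using xV(2)[OF t] df[OF tI0] w_slope[OF tI0] by (simp add: fun_eq_iff inner_diff_right)
    ultimately have hY: "(Y has_derivative (\<lambda>a. w t \<bullet> a)) (at (x t))" by simp
    have hU: "((U \<circ> point c) has_derivative (\<lambda>a. w t \<bullet> a)) (at (coord c (\<gamma> t)))"
      by (rule has_derivative_transform_within_open[OF _ oV, of Y])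
         (use hY xV(1)[OF t] coord_point[OF c(1)] in \<open>auto simp: U_def V_def x_def\<close>)
    have "jet_in U c t"
      unfolding jet_in_def Df_eqI[OF hU]
    proof (intro conjI allI)
      show "(U \<circ> point c) differentiable (at (coord c (\<gamma> t)))" using hU differentiableI by blast
      fix a
      have "N t * (w t \<bullet> a) = L t a + 2 * s t * (a \<bullet> (gram c (x t) *v vd x t))"
        unfolding wa[OF tI0] using Nne[OF tI0] by simp
      then show "nrm2 \<gamma> c t * (w t \<bullet> a) = EL \<gamma> c t a + 2 * slope c t * flatv \<gamma> c t a"
        by (simp only: NN[OF tI0] LE[OF tI0] ss[OF tI0] fl[OF tI0])
    qed
    then show ?thesis using jetI[OF c(1) tc] val tc by blast
  qed
  show ?thesis
  proof (rule that[OF \<eta>(1) oV _ _ sU main])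
    show "V \<subseteq> img c" by (simp add: V_def)
    show "coord c (\<gamma> t0) \<in> V" using xV(1)[of t0] \<eta>(1) by (simp add: x_def)
  qed
qed

end

end

section \<open>Conformal metrics with a prescribed geodesic\<close>

context riemann_surface
begin

definition conf :: "('a \<Rightarrow> real) \<Rightarrow> 'a metric_field" where
  "conf u = (\<lambda>c p. exp (2 * u p) *\<^sub>R \<sigma> c p)"

lemma conf_riemannian:
  assumes u: "smooth_function \<A> u" shows "riemannian_metric \<A> (conf u)"
  unfolding riemannian_metric_def
proof (intro conjI ballI allI impI)
  fix c assume c: "c \<in> \<A>"
  have s1: "smooth_on (\<lambda>y. 2 * (u \<circ> point c) y) (img c)"
    by (intro smooth_on_mult smooth_on_const smooth_function_chart[OF u c] open_img[OF c])
  have "smooth_on (\<lambda>y. exp (2 * (u \<circ> point c) y)) (img c)"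
    by (rule smooth_on_compose[OF s1 smooth_on_exp open_img[OF c]]) auto
  from smooth_on_scaleR[OF this smooth_gram[OF c] open_img[OF c]]
  show "smooth_on (conf u c \<circ> point c) (img c)" by (simp add: conf_def o_def)
  fix p assume p: "p \<in> cdom c"
  have "transpose (\<sigma> c p) = \<sigma> c p" using riem c p unfolding riemannian_metric_def by blast
  then show "transpose (conf u c p) = conf u c p" by (simp add: conf_def transpose_scalar)
  show "0 < v \<bullet> (conf u c p *v v)" if "v \<noteq> 0" for v
    using gram_pos[OF c p that] by (simp add: conf_def scaleR_matrix_vector_assoc[symmetric])
next
  fix c d p assume c: "c \<in> \<A>" "d \<in> \<A>" and p: "p \<in> cdom c \<inter> cdom d"
  let ?J = "jacobian (transition c d) (at (coord c p))"
  have "\<sigma> c p = transpose ?J ** \<sigma> d p ** ?J"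
    using riem c p unfolding riemannian_metric_def Let_def by blast
  then have "conf u c p = transpose ?J ** conf u d p ** ?J"
    by (simp add: conf_def matrix_scalar_ac scalar_matrix_assoc)
  then show "let J = ?J in conf u c p = transpose J ** conf u d p ** J" by (simp add: Let_def)
qed

lemma conf_conformal: "smooth_function \<A> u \<Longrightarrow> conformally_equivalent \<A> (conf u) \<sigma>"
  unfolding conformally_equivalent_def conf_def by blast

context
  fixes \<gamma> assumes reg\<gamma>: "reg \<gamma> UNIV"
begin

text \<open>For \<open>exp (2 u) \<sigma>\<close> the Euler-Lagrange covector is
  \<open>exp (2 u)\<close> times
  \<open>EL a + 2 du(\<gamma>') <a,\<gamma>'> - |\<gamma>'|^2 du(a)\<close>. The jet condition,
  tested on the velocity, gives \<open>du(\<gamma>') = slope\<close>, and then says that this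
  covector is 0. Applying the inverse Gram matrix yields the equation with Christoffel
  symbols.\<close>

lemma geodesic_conf:
  assumes u: "smooth_function \<A> u" and j: "\<And>t. jet \<gamma> u t"
  shows "geodesic M \<A> (conf u) \<gamma>"
  unfolding geodesic_def Let_def
proof (intro conjI ballI allI impI)
  show "continuous_on UNIV \<gamma>" "range \<gamma> \<subseteq> M" using reg_continuous[OF reg\<gamma>] reg_sub[OF reg\<gamma>] by auto
  fix c t assume c: "c \<in> \<A>" "\<gamma> t \<in> cdom c"
  note cs = curve_smooth[OF reg\<gamma> c(1)]
  show "((coord c \<circ> \<gamma>) has_vector_derivative vd (coord c \<circ> \<gamma>) t) (at t)" by (rule cs(4)[OF c(2)])
  define x where "x = coord c (\<gamma> t)"
  define v where "v = vd (coord c \<circ> \<gamma>) t"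
  define a where "a = vd (vd (coord c \<circ> \<gamma>)) t"
  define ut where "ut = u \<circ> point c"
  define H where "H = conf u c \<circ> point c"
  define ex where "ex = exp (2 * u (\<gamma> t))"
  have xi: "x \<in> img c" using c(2) by (simp add: x_def)
  have px: "point c x = \<gamma> t" unfolding x_def by (rule point_coord[OF c])
  have dG: "(gram c has_derivative Df (gram c) x) (at x)"
    by (rule smooth_on_has_derivative[OF smooth_gram[OF c(1)] open_img[OF c(1)] xi])
  have du: "(ut has_derivative Df ut x) (at x)" unfolding ut_def
    by (rule smooth_on_has_derivative[OF smooth_function_chart[OF u c(1)] open_img[OF c(1)] xi])
  define DH where "DH b = ex *\<^sub>R Df (gram c) x b + (ex * (2 * Df ut x b)) *\<^sub>R \<sigma> c (\<gamma> t)" for b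
  have dH: "(H has_derivative DH) (at x)"
  proof -
    have "((\<lambda>y. exp (2 * ut y)) has_derivative (\<lambda>b. exp (2 * ut x) * (2 * Df ut x b))) (at x)"
      by (rule has_derivative_exp[OF has_derivative_mult_right[OF du], THEN has_derivative_eq_rhs]) (simp add: mult.commute)
    from has_derivative_scaleR[OF this dG]
    have "((\<lambda>y. exp (2 * ut y) *\<^sub>R gram c y) has_derivative
       (\<lambda>b. exp (2 * ut x) *\<^sub>R Df (gram c) x b + (exp (2 * ut x) * (2 * Df ut x b)) *\<^sub>R gram c x)) (at x)" .
    moreover have "H = (\<lambda>y. exp (2 * ut y) *\<^sub>R gram c y)" by (auto simp: H_def conf_def ut_def)
    moreover have "(\<lambda>b. exp (2 * ut x) *\<^sub>R Df (gram c) x b + (exp (2 * ut x) * (2 * Df ut x b)) *\<^sub>R gram c x) = DH"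
      by (auto simp: DH_def ex_def ut_def px)
    ultimately show ?thesis by simp
  qed
  have Hx: "H x = ex *\<^sub>R \<sigma> c (\<gamma> t)" by (simp add: H_def conf_def ex_def px)
  have ju: "nrm2 \<gamma> c t * Df ut x b = EL \<gamma> c t b + 2 * slope \<gamma> c t * flatv \<gamma> c t b" for b
    using j[of t] c unfolding jet_def[OF reg\<gamma>] jet_in_def[OF reg\<gamma>] ut_def x_def by blast
  have Np: "nrm2 \<gamma> c t > 0" by (rule nrm2_pos[OF reg\<gamma> c])
  have duv: "Df ut x v = slope \<gamma> c t"
  proof -
    have "EL \<gamma> c t v = - slope \<gamma> c t * nrm2 \<gamma> c t" using Np by (simp add: slope_def[OF reg\<gamma>] v_def)
    then have "nrm2 \<gamma> c t * Df ut x v = nrm2 \<gamma> c t * slope \<gamma> c t" using ju[of v] by (simp add: v_def)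
    then show ?thesis using Np by simp
  qed
  have ELx: "EL \<gamma> c t b = b \<bullet> (\<sigma> c (\<gamma> t) *v a) + b \<bullet> (Df (gram c) x v *v v) - (1/2) * (v \<bullet> (Df (gram c) x b *v v))" for b
    by (simp add: EL_def Let_def x_def v_def a_def)
  have E0: "b \<bullet> (H x *v a) + b \<bullet> (DH v *v v) - (1/2) * (v \<bullet> (DH b *v v)) = 0" for b
  proof -
    have "b \<bullet> (H x *v a) + b \<bullet> (DH v *v v) - (1/2) * (v \<bullet> (DH b *v v))
      = ex * (EL \<gamma> c t b + 2 * Df ut x v * (b \<bullet> (\<sigma> c (\<gamma> t) *v v)) - Df ut x b * (v \<bullet> (\<sigma> c (\<gamma> t) *v v)))"
      unfolding ELx Hx DH_def
      by (simp add: matrix_vector_mult_add_rdistrib scaleR_matrix_vector_assoc[symmetric] inner_add_right algebra_simps)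
    also have "\<dots> = 0" using ju[of b] unfolding duv by (simp add: flatv_def v_def mult.commute)
    finally show ?thesis .
  qed
  define P where "P i k l = DH (axis i 1) $ k $ l" for i k l :: 2
  have par: "partial i (\<lambda>y. H y $ k $ l) x = P i k l" for i k l :: 2
  proof -
    have "((\<lambda>y. H y $ k $ l) has_derivative (\<lambda>b. DH b $ k $ l)) (at x)"
      by (intro bounded_linear.has_derivative[OF bounded_linear_vec_nth] dH)
    from Df_eqI[OF this] show ?thesis by (simp add: partial_def P_def)
  qed
  have Psym: "P i k l = P i l k" for i k l
  proof -
    have h: "((\<lambda>y. H y $ k $ l) has_derivative (\<lambda>b. DH b $ k $ l)) (at x)" for k l
      by (intro bounded_linear.has_derivative[OF bounded_linear_vec_nth] dH)
    have "((\<lambda>y. H y $ l $ k) has_derivative (\<lambda>b. DH b $ k $ l)) (at x)"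
    proof (rule has_derivative_transform_within_open[OF h open_img[OF c(1)] xi])
      fix y assume y: "y \<in> img c"
      have "transpose (\<sigma> c (point c y)) = \<sigma> c (point c y)"
        using riem c(1) point_in[OF c(1) y] unfolding riemannian_metric_def by blast
      from arg_cong[OF this, of "\<lambda>A. A $ l $ k"]
      have "\<sigma> c (point c y) $ k $ l = \<sigma> c (point c y) $ l $ k" by (simp add: transpose_def)
      then show "H y $ k $ l = H y $ l $ k" by (simp add: H_def conf_def)
    qed
    from fun_cong[OF has_derivative_unique[OF this h], of "axis i 1"] show ?thesis unfolding P_def .
  qed
  have lin: "linear DH" using has_derivative_linear[OF dH] .
  have v12: "v = v$1 *\<^sub>R axis 1 1 + v$2 *\<^sub>R axis 2 1" by (simp add: vec_eq_iff forall_2 axis_def)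
  have DHv: "DH v $ k $ l = v$1 * P 1 k l + v$2 * P 2 k l" for k l
    by (subst v12) (simp add: linear_add[OF lin] linear_scale[OF lin] P_def)
  \<comment> \<open>The part of the covector that is quadratic in the velocity, so that
    \<open>H x *v a = - S\<close> is the geodesic equation with lowered index.\<close>
  define S where "S l = (DH v *v v) $ l - (1/2) * (v \<bullet> (DH (axis l 1) *v v))" for l :: 2
  have HS: "(H x *v a) $ l = - S l" for l
    using E0[of "axis l 1"] by (simp add: S_def inner_axis' )
  have inv: "matrix_inv (H x) ** H x = mat 1"
  proof -
    have "y = 0" if "H x *v y = 0" for y
    proof (rule ccontr)
      assume "y \<noteq> 0"
      then have "y \<bullet> (\<sigma> c (\<gamma> t) *v y) > 0" by (rule gram_pos[OF c])
      then have "y \<bullet> (H x *v y) > 0" unfolding Hx by (simp add: scaleR_matrix_vector_assoc[symmetric] ex_def)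
      then show False using that by simp
    qed
    then have "\<exists>B. B ** H x = mat 1" using matrix_left_invertible_ker[of "H x"] by blast
    then have "invertible (H x)" using invertible_left_inverse by blast
    then show ?thesis unfolding invertible_def matrix_inv_def by (rule someI2_ex) simp
  qed
  have ainv: "a = matrix_inv (H x) *v (H x *v a)" by (simp add: matrix_vector_mul_assoc inv)
  have ak: "a $ k = - (\<Sum>l\<in>UNIV. matrix_inv (H x) $ k $ l * S l)" for k
  proof -
    have "a $ k = (matrix_inv (H x) *v (H x *v a)) $ k" by (rule arg_cong[OF ainv])
    also have "\<dots> = (\<Sum>l\<in>UNIV. matrix_inv (H x) $ k $ l * (H x *v a) $ l)"
      by (simp only: matrix_vector_mult_def[of "matrix_inv (H x)"] vec_lambda_beta)
    also have "\<dots> = - (\<Sum>l\<in>UNIV. matrix_inv (H x) $ k $ l * S l)"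
      by (simp only: HS mult_minus_right sum_negf)
    finally show ?thesis .
  qed
  have "(\<chi> k. - (\<Sum>i\<in>UNIV. \<Sum>j\<in>UNIV. christoffel H k i j x * v $ i * v $ j)) = a"
  proof (rule vec_eq_iff[THEN iffD2], rule allI)
    fix k :: 2
    define m where "m = matrix_inv (H x) $ k"
    have S1: "S 1 = (v$1 * P 1 1 1 + v$2 * P 2 1 1) * v$1 + (v$1 * P 1 1 2 + v$2 * P 2 1 2) * v$2
        - (1/2) * (v$1 * (P 1 1 1 * v$1 + P 1 1 2 * v$2) + v$2 * (P 1 2 1 * v$1 + P 1 2 2 * v$2))"
      by (simp add: S_def matrix_vector_mult_def sum_2 DHv inner_vec_def P_def)
    have S2: "S 2 = (v$1 * P 1 2 1 + v$2 * P 2 2 1) * v$1 + (v$1 * P 1 2 2 + v$2 * P 2 2 2) * v$2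
        - (1/2) * (v$1 * (P 2 1 1 * v$1 + P 2 1 2 * v$2) + v$2 * (P 2 2 1 * v$1 + P 2 2 2 * v$2))"
      by (simp add: S_def matrix_vector_mult_def sum_2 DHv inner_vec_def P_def)
    \<comment> \<open>Contraction with the symmetric \<open>v $ i * v $ j\<close> merges the first
      two derivative terms of the Christoffel symbols into the single first term of
      \<open>S\<close>.\<close>
    have "(\<Sum>i\<in>UNIV. \<Sum>j\<in>UNIV. christoffel H k i j x * v $ i * v $ j) = m $ 1 * S 1 + m $ 2 * S 2"
      unfolding christoffel_def par sum_2 S1 S2 m_def[symmetric] Psym[of _ 2 1]
      by (simp add: field_simps)
    then show "(\<chi> k. - (\<Sum>i\<in>UNIV. \<Sum>j\<in>UNIV. christoffel H k i j x * v $ i * v $ j)) $ k = a $ k"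
      unfolding ak by (simp add: sum_2 m_def)
  qed
  then show "(vd (coord c \<circ> \<gamma>) has_vector_derivative
      (\<chi> k. - (\<Sum>i\<in>UNIV. \<Sum>j\<in>UNIV. christoffel (conf u c \<circ> point c) k i j ((coord c \<circ> \<gamma>) t) *
         vd (coord c \<circ> \<gamma>) t $ i * vd (coord c \<circ> \<gamma>) t $ j))) (at t)"
    using cs(5)[OF c(2)] by (simp add: H_def[symmetric] x_def[symmetric] v_def[symmetric] a_def[symmetric])
qed

text \<open>On the curve \<open>exp u\<close> is \<open>exp (- K)\<close> divided by the speed for
  \<sigma>, so the new speed is constant and the period is 1.\<close>

lemma curve_length_conf:
  assumes "\<And>t c. c \<in> \<A> \<Longrightarrow> \<gamma> t \<in> cdom c \<Longrightarrow> u (\<gamma> t) = - (1/2) * ln (nrm2 \<gamma> c t) - K"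
  shows "curve_length \<A> (conf u) \<gamma> = exp (- K)"
proof -
  have sp: "speed \<A> (conf u) \<gamma> t = exp (- K)" for t
    unfolding speed_def Let_def
  proof (rule the_equality)
    have *: "sqrt (vd (coord c \<circ> \<gamma>) t \<bullet> (conf u c (\<gamma> t) *v vd (coord c \<circ> \<gamma>) t)) = exp (- K)"
      if c: "c \<in> \<A>" "\<gamma> t \<in> cdom c" for c
    proof -
      have N: "nrm2 \<gamma> c t > 0" by (rule nrm2_pos[OF reg\<gamma> c])
      have "vd (coord c \<circ> \<gamma>) t \<bullet> (conf u c (\<gamma> t) *v vd (coord c \<circ> \<gamma>) t) = exp (2 * u (\<gamma> t)) * nrm2 \<gamma> c t"
        by (simp add: conf_def flatv_def scaleR_matrix_vector_assoc[symmetric])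
      also have "\<dots> = exp (- ln (nrm2 \<gamma> c t) - 2 * K) * nrm2 \<gamma> c t"
        unfolding assms[OF c] by (simp add: algebra_simps)
      also have "\<dots> = (exp (- K))\<^sup>2"
      proof -
        have "exp (- ln (nrm2 \<gamma> c t) - 2 * K) = exp (- K) * exp (- K) * exp (- ln (nrm2 \<gamma> c t))"
          unfolding exp_add[symmetric] by simp
        moreover have "exp (- ln (nrm2 \<gamma> c t)) * nrm2 \<gamma> c t = 1" using N by (simp add: exp_minus)
        ultimately show ?thesis by (simp add: power2_eq_square mult.assoc)
      qed
      finally show ?thesis by simp
    qed
    show "\<forall>c\<in>\<A>. \<gamma> t \<in> cdom c \<longrightarrow> exp (- K) = sqrt (vd (coord c \<circ> \<gamma>) t \<bullet> (conf u c (\<gamma> t) *v vd (coord c \<circ> \<gamma>) t))"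
      using * by simp
    fix s assume s: "\<forall>c\<in>\<A>. \<gamma> t \<in> cdom c \<longrightarrow> s = sqrt (vd (coord c \<circ> \<gamma>) t \<bullet> (conf u c (\<gamma> t) *v vd (coord c \<circ> \<gamma>) t))"
    have "\<gamma> t \<in> M" using reg_sub[OF reg\<gamma>] by blast
    then obtain c where c: "c \<in> \<A>" "\<gamma> t \<in> cdom c" using ex_chart by blast
    from s[rule_format, OF c] show "s = exp (- K)" unfolding *[OF c] .
  qed
  show ?thesis unfolding curve_length_def sp by simp
qed

end

section \<open>Prescribing the conformal factor along a simple closed curve\<close>

context
  fixes \<gamma> assumes reg\<gamma>: "reg \<gamma> UNIV" and per: "\<And>t. \<gamma> (t + 1) = \<gamma> t" and inj\<gamma>: "inj_on \<gamma> {0..<1}"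
begin

lemma per_int: "\<gamma> (t + of_int n) = \<gamma> t"
proof (induction n rule: int_induct[of _ 0])
  case (step1 i)
  have "\<gamma> (t + of_int (i + 1)) = \<gamma> (t + of_int i + 1)" by (simp add: add.assoc)
  then show ?case using per step1 by simp
next
  case (step2 i)
  have "\<gamma> (t + of_int (i - 1) + 1) = \<gamma> (t + of_int i)" by simp
  then show ?case using per[of "t + of_int (i - 1)"] step2 by simp
qed simp

lemma per_inj:
  assumes "\<gamma> s = \<gamma> t" obtains n :: int where "s = t + of_int n"
proof -
  have *: "\<gamma> (frac z) = \<gamma> z" for z using per_int[of z "- \<lfloor>z\<rfloor>"] by (simp add: frac_def)
  have "frac s = frac t"
    by (rule inj_onD[OF inj\<gamma>]) (use * assms frac_lt_1 frac_ge_0 in auto)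
  then have "s = t + of_int (\<lfloor>s\<rfloor> - \<lfloor>t\<rfloor>)" by (simp add: frac_def algebra_simps)
  then show ?thesis by (rule that)
qed

lemma jet_shift: "jet \<gamma> u (t + of_int n) \<longleftrightarrow> jet \<gamma> u t"
  and nrm2_shift: "nrm2 \<gamma> c (t + of_int n) = nrm2 \<gamma> c t"
proof -
  have x: "(coord c \<circ> \<gamma>) (s + of_int n) = (coord c \<circ> \<gamma>) s" for s c by (simp add: per_int)
  have v: "vd (coord c \<circ> \<gamma>) (s + of_int n) = vd (coord c \<circ> \<gamma>) s" for s c by (rule vd_shift[where f="coord c \<circ> \<gamma>" and r="of_int n", OF x])
  have a: "vd (vd (coord c \<circ> \<gamma>)) (s + of_int n) = vd (vd (coord c \<circ> \<gamma>)) s" for s c by (rule vd_shift[where f="vd (coord c \<circ> \<gamma>)" and r="of_int n", OF v])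
  show "jet \<gamma> u (t + of_int n) \<longleftrightarrow> jet \<gamma> u t"
    unfolding jet_def[OF reg\<gamma>] jet_in_def[OF reg\<gamma>] slope_def[OF reg\<gamma>] EL_def flatv_def Let_def v a per_int o_apply ..
  show "nrm2 \<gamma> c (t + of_int n) = nrm2 \<gamma> c t" unfolding flatv_def v per_int ..
qed

text \<open>Minus the logarithm of the speed, read in some chart around the point;
  \<open>nrm2_transform\<close> makes the value independent of the chart chosen.\<close>

definition lspeed :: "real \<Rightarrow> real" where
  "lspeed t = - (1/2) * ln (nrm2 \<gamma> (SOME c. c \<in> \<A> \<and> \<gamma> t \<in> cdom c) t)"

lemma lspeed: "c \<in> \<A> \<Longrightarrow> \<gamma> t \<in> cdom c \<Longrightarrow> lspeed t = - (1/2) * ln (nrm2 \<gamma> c t)"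
proof -
  assume c: "c \<in> \<A>" "\<gamma> t \<in> cdom c"
  let ?d = "SOME c. c \<in> \<A> \<and> \<gamma> t \<in> cdom c"
  have d: "?d \<in> \<A> \<and> \<gamma> t \<in> cdom ?d" using c by (intro someI[of "\<lambda>c. c \<in> \<A> \<and> \<gamma> t \<in> cdom c"]) simp
  have "nrm2 \<gamma> ?d t = nrm2 \<gamma> c t" by (rule nrm2_transform[OF reg\<gamma>]) (use c d in auto)
  then show ?thesis by (simp add: lspeed_def)
qed

text \<open>\<open>local_jet\<close> controls parameters near \<open>t0\<close>, whereas patching
  needs a statement about all points of the curve in a neighbourhood of \<open>\<gamma> t0\<close>.
  As the curve is simple, the compact image \<open>C0\<close> of the other parameters misses this
  point, and shrinking \<open>V\<close> excludes it.\<close>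

lemma local_jet_image:
  obtains c U V where "c \<in> \<A>" "\<gamma> t0 \<in> cdom c" "open V" "V \<subseteq> img c" "coord c (\<gamma> t0) \<in> V"
    "smooth_on (U \<circ> point c) V" "\<And>t. \<gamma> t \<in> point c ` V \<Longrightarrow> U (\<gamma> t) = lspeed t \<and> jet \<gamma> U t"
proof -
  have cont: "continuous_on S \<gamma>" for S using reg_continuous[OF reg\<gamma>] continuous_on_subset by blast
  have gM: "\<gamma> t \<in> M" for t using reg_sub[OF reg\<gamma>] by blast
  obtain c where c: "c \<in> \<A>" "\<gamma> t0 \<in> cdom c" using ex_chart[OF gM] by blast
  obtain U V \<eta> where \<eta>: "\<eta> > 0" and V: "open V" "V \<subseteq> img c" "coord c (\<gamma> t0) \<in> V" "smooth_on (U \<circ> point c) V"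
    and J: "\<And>t. \<bar>t - t0\<bar> < \<eta> \<Longrightarrow> \<gamma> t \<in> cdom c \<and> U (\<gamma> t) = - (1/2) * ln (nrm2 \<gamma> c t) \<and> jet \<gamma> U t"
    by (rule local_jet[OF reg\<gamma> c]) blast
  define h where "h = min \<eta> (1/2)"
  have h: "h > 0" "h \<le> \<eta>" "h \<le> 1/2" using \<eta> by (auto simp: h_def)
  define C0 where "C0 = \<gamma> ` {t0 + h..t0 + 1 - h}"
  have cC: "compact C0" unfolding C0_def by (rule compact_continuous_image[OF cont]) simp
  have nC: "\<gamma> t0 \<notin> C0"
  proof
    assume "\<gamma> t0 \<in> C0"
    then obtain s where s: "\<gamma> t0 = \<gamma> s" "s \<in> {t0 + h..t0 + 1 - h}" unfolding C0_def by (rule imageE)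
    obtain n :: int where n: "t0 = s + of_int n" by (rule per_inj[OF s(1)])
    have n01: "(0::real) < of_int (- n)" "of_int (- n) < (1::real)" using n s(2) h(1) by auto
    have "0 < - n" using n01(1) unfolding of_int_0_less_iff .
    moreover have "- n < 1" using n01(2) unfolding of_int_less_1_iff .
    ultimately show False by linarith
  qed
  define W where "W = coord c ` (cdom c \<inter> (M \<inter> - C0))"
  have oW: "open W" unfolding W_def
    by (intro open_coord_image[OF c(1)] openin_open_Int open_Compl compact_imp_closed cC)
  show ?thesis
  proof (rule that[OF c, of "V \<inter> W" U])
    show "open (V \<inter> W)" using V(1) oW by blast
    show "V \<inter> W \<subseteq> img c" using V(2) by blast
    show "coord c (\<gamma> t0) \<in> V \<inter> W" using V(3) nC gM c(2) unfolding W_def by blast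
    show "smooth_on (U \<circ> point c) (V \<inter> W)" by (rule smooth_on_subset[OF V(4)]) blast
    fix t assume t: "\<gamma> t \<in> point c ` (V \<inter> W)"
    then obtain y where y: "\<gamma> t = point c y" "y \<in> W" by blast
    then have tC: "\<gamma> t \<notin> C0" unfolding W_def using point_coord[OF c(1)] by auto
    \<comment> \<open>Moves \<open>t\<close> by an integer into the period starting at
      \<open>t0 - h\<close>. Avoiding \<open>C0\<close> then leaves only parameters within
      \<open>h\<close> of \<open>t0\<close>, the left end being excluded by periodicity.\<close>
    define n where "n = \<lfloor>t - t0 + h\<rfloor>"
    define s where "s = t - of_int n"
    have s: "t0 - h \<le> s" "s < t0 - h + 1" unfolding s_def n_def by linarith+
    have ts: "t = s + of_int n" by (simp add: s_def)
    have gs: "\<gamma> s = \<gamma> t" unfolding ts per_int ..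
    have "s \<notin> {t0 + h..t0 + 1 - h}" using tC gs unfolding C0_def by (metis imageI)
    moreover have "s \<noteq> t0 - h"
    proof
      assume "s = t0 - h"
      then have "t0 + 1 - h = s + 1" by simp
      then have "\<gamma> t = \<gamma> (t0 + 1 - h)" by (simp only: per gs)
      then show False using tC h unfolding C0_def by auto
    qed
    ultimately have "\<bar>s - t0\<bar> < \<eta>" using s h(1,2) by auto
    from J[OF this] have "\<gamma> s \<in> cdom c" "U (\<gamma> s) = - (1/2) * ln (nrm2 \<gamma> c s)" "jet \<gamma> U s" by blast+
    then show "U (\<gamma> t) = lspeed t \<and> jet \<gamma> U t"
      using lspeed[OF c(1), of t] nrm2_shift[of c s n] jet_shift[of U s n] gs unfolding ts[symmetric] by simp
  qed
qed

text \<open>The constant \<open>ln 2\<close> is overwritten disc by disc along a finite cover of the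
  curve: in each disc \<open>u\<close> is blended with a local solution lowered by \<open>K\<close>.
  Convex combinations keep the bound \<open>ln 2\<close>, and \<open>jet_blend\<close> keeps the
  jet, because on the curve both functions have the value \<open>lspeed t - K\<close>.\<close>

lemma global_jet:
  assumes V0: "openin (top_of_set M) V0" "range \<gamma> \<subseteq> V0"
  obtains u K where "K \<ge> K0" "smooth_function \<A> u" "\<And>p. u p \<le> ln 2" "\<And>p. p \<notin> V0 \<Longrightarrow> u p = ln 2"
    "\<And>t. u (\<gamma> t) = lspeed t - K" "\<And>t. jet \<gamma> u t"
proof -
  have ex: "\<exists>c U V r b. c \<in> \<A> \<and> open V \<and> V \<subseteq> img c \<and> smooth_on (U \<circ> point c) V \<and>
      (\<forall>t. \<gamma> t \<in> point c ` V \<longrightarrow> U (\<gamma> t) = lspeed t \<and> jet \<gamma> U t) \<and> r > 0 \<and> \<gamma> t0 \<in> cdom c \<and>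
      cball (coord c (\<gamma> t0)) r \<subseteq> V \<and> point c ` cball (coord c (\<gamma> t0)) r \<subseteq> V0 \<and>
      (\<forall>p\<in>point c ` cball (coord c (\<gamma> t0)) r. U p \<le> b)" for t0
  proof -
    obtain c U V where c: "c \<in> \<A>" "\<gamma> t0 \<in> cdom c" "open V" "V \<subseteq> img c" "coord c (\<gamma> t0) \<in> V"
      "smooth_on (U \<circ> point c) V" "\<And>t. \<gamma> t \<in> point c ` V \<Longrightarrow> U (\<gamma> t) = lspeed t \<and> jet \<gamma> U t"
      by (rule local_jet_image[of t0]) blast
    let ?O = "V \<inter> coord c ` (cdom c \<inter> V0)"
    have "open ?O" using c(3) open_coord_image[OF c(1) V0(1)] by blast
    moreover have "coord c (\<gamma> t0) \<in> ?O" using c(2,5) V0(2) by blast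
    ultimately obtain r where r: "r > 0" "cball (coord c (\<gamma> t0)) r \<subseteq> ?O" by (meson open_contains_cball)
    have "compact ((U \<circ> point c) ` cball (coord c (\<gamma> t0)) r)"
      by (intro compact_continuous_image continuous_on_subset[OF smooth_on_continuous[OF c(6)]]) (use r in auto)
    then have "bounded ((U \<circ> point c) ` cball (coord c (\<gamma> t0)) r)" by (rule compact_imp_bounded)
    then obtain b where b: "\<forall>z\<in>(U \<circ> point c) ` cball (coord c (\<gamma> t0)) r. norm z \<le> b" unfolding bounded_iff by blast
    have "U p \<le> b" if p: "p \<in> point c ` cball (coord c (\<gamma> t0)) r" for p
    proof -
      have "U p \<in> (U \<circ> point c) ` cball (coord c (\<gamma> t0)) r" using p by auto
      then have "norm (U p) \<le> b" using b by blast
      then show ?thesis by simp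
    qed
    moreover have "point c ` cball (coord c (\<gamma> t0)) r \<subseteq> V0"
    proof
      fix p assume "p \<in> point c ` cball (coord c (\<gamma> t0)) r"
      then obtain y where "p = point c y" "y \<in> coord c ` (cdom c \<inter> V0)" using r(2) by blast
      then show "p \<in> V0" using point_coord[OF c(1)] by auto
    qed
    moreover have "cball (coord c (\<gamma> t0)) r \<subseteq> V" using r(2) by blast
    ultimately show ?thesis using c r(1) by blast
  qed
  obtain c U V r b where D: "\<And>t0. c t0 \<in> \<A> \<and> open (V t0) \<and> V t0 \<subseteq> img (c t0) \<and> smooth_on (U t0 \<circ> point (c t0)) (V t0) \<and>
      (\<forall>t. \<gamma> t \<in> point (c t0) ` V t0 \<longrightarrow> U t0 (\<gamma> t) = lspeed t \<and> jet \<gamma> (U t0) t) \<and> r t0 > (0::real) \<and> \<gamma> t0 \<in> cdom (c t0) \<and>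
      cball (coord (c t0) (\<gamma> t0)) (r t0) \<subseteq> V t0 \<and> point (c t0) ` cball (coord (c t0) (\<gamma> t0)) (r t0) \<subseteq> V0 \<and>
      (\<forall>p\<in>point (c t0) ` cball (coord (c t0) (\<gamma> t0)) (r t0). U t0 p \<le> b t0)"
    using ex by metis
  define Q where "Q t = point (c t) ` cball (coord (c t) (\<gamma> t)) (r t)" for t
  define B where "B t = point (c t) ` ball (coord (c t) (\<gamma> t)) (r t / 2)" for t
  have cA: "c t \<in> \<A>" and oV: "open (V t)" and Vi: "V t \<subseteq> img (c t)" and sU: "smooth_on (U t \<circ> point (c t)) (V t)"
    and rp: "r t > 0" and gc: "\<gamma> t \<in> cdom (c t)" and cbV: "cball (coord (c t) (\<gamma> t)) (r t) \<subseteq> V t" and QV: "Q t \<subseteq> V0"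
    and Ub: "\<And>p. p \<in> Q t \<Longrightarrow> U t p \<le> b t" and J: "\<And>s. \<gamma> s \<in> point (c t) ` V t \<Longrightarrow> U t (\<gamma> s) = lspeed s \<and> jet \<gamma> (U t) s" for t
    using D[of t] unfolding Q_def by blast+
  have cbi: "cball (coord (c t) (\<gamma> t)) (r t) \<subseteq> img (c t)" for t using cbV Vi by blast
  have bi: "ball (coord (c t) (\<gamma> t)) (r t / 2) \<subseteq> cball (coord (c t) (\<gamma> t)) (r t)" for t using rp[of t] by auto
  have oB: "openin (top_of_set M) (B t)" for t unfolding B_def
    by (rule openin_point_image[OF cA open_ball]) (use bi cbi in blast)
  have gB: "\<gamma> t \<in> B t" for t
  proof -
    have "point (c t) (coord (c t) (\<gamma> t)) \<in> B t" unfolding B_def by (rule imageI) (use rp in simp)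
    then show ?thesis using point_coord[OF cA gc] by simp
  qed
  have BQ: "B t \<subseteq> Q t" for t unfolding B_def Q_def using bi by (rule image_mono)
  have QpV: "Q t \<subseteq> point (c t) ` V t" for t unfolding Q_def using cbV by (rule image_mono)
  have cQ: "compact (Q t)" for t unfolding Q_def by (rule compact_point_image[OF cA compact_cball cbi])
  have "\<exists>O'. open O' \<and> B t = M \<inter> O'" for t using oB[of t] by (auto simp: openin_open)
  then obtain O' where O': "\<And>t. open (O' t)" "\<And>t. B t = M \<inter> O' t" by metis
  have "compact (\<gamma> ` {0..1})"
    by (rule compact_continuous_image[OF continuous_on_subset[OF reg_continuous[OF reg\<gamma>]]]) auto
  moreover have "\<gamma> ` {0..1} \<subseteq> (\<Union>t\<in>{0..1}. O' t)" using gB O'(2) by blast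
  ultimately obtain F where F: "F \<subseteq> {0..1}" "finite F" "\<gamma> ` {0..1} \<subseteq> (\<Union>t\<in>F. O' t)"
    using O'(1) by (elim compactE_image) auto
  have cover: "\<exists>s\<in>F. \<gamma> t \<in> B s" for t
  proof -
    have "\<gamma> t = \<gamma> (frac t)" using per_int[of t "- \<lfloor>t\<rfloor>"] by (simp add: frac_def)
    moreover have "frac t \<in> {0..1}" using frac_ge_0[of t] frac_lt_1[of t] by simp
    ultimately have "\<gamma> t \<in> (\<Union>t\<in>F. O' t)" using F(3) by (metis imageI subsetD)
    moreover have "\<gamma> t \<in> M" using reg_sub[OF reg\<gamma>] by blast
    ultimately show ?thesis using O'(2) by blast
  qed
  \<comment> \<open>Lowers every local solution to at most 0 on its disc, and subtracting a constant
    does not disturb the jets. \<open>K0\<close> lets the curve be made as short as desired.\<close>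
  define K where "K = max K0 (Max (insert 0 (b ` F)))"
  have K: "K \<ge> K0" "\<And>t. t \<in> F \<Longrightarrow> b t \<le> K"
  proof -
    show "K \<ge> K0" by (simp add: K_def)
    show "b t \<le> K" if "t \<in> F" for t
    proof -
      have "b t \<le> Max (insert 0 (b ` F))" by (rule Max_ge) (use F(2) that in auto)
      then show ?thesis by (simp add: K_def)
    qed
  qed
  have "\<exists>u. smooth_function \<A> u \<and> (\<forall>p. u p \<le> ln 2) \<and> (\<forall>p. p \<notin> V0 \<longrightarrow> u p = ln 2) \<and>
      (\<forall>t. (\<exists>s\<in>F'. \<gamma> t \<in> B s) \<longrightarrow> u (\<gamma> t) = lspeed t - K \<and> jet \<gamma> u t)" if "finite F'" "F' \<subseteq> F" for F'
    using that
  proof (induction F' rule: finite_induct)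
    case empty
    show ?case by (intro exI[of _ "\<lambda>p. ln 2"]) (simp add: smooth_function_const)
  next
    case (insert s F')
    then obtain u where u: "smooth_function \<A> u" "\<And>p. u p \<le> ln 2" "\<And>p. p \<notin> V0 \<Longrightarrow> u p = ln 2"
      "\<And>t. \<exists>s\<in>F'. \<gamma> t \<in> B s \<Longrightarrow> u (\<gamma> t) = lspeed t - K \<and> jet \<gamma> u t" by auto
    have sF: "s \<in> F" using insert.prems by simp
    obtain \<beta> where \<beta>: "\<And>p. 0 \<le> \<beta> p" "\<And>p. \<beta> p \<le> (1::real)"
      "\<And>p. p \<in> cdom (c s) \<Longrightarrow> dist (coord (c s) (\<gamma> s)) (coord (c s) p) \<le> r s / 2 \<Longrightarrow> \<beta> p = 1"
      "\<And>p. p \<notin> point (c s) ` cball (coord (c s) (\<gamma> s)) (r s) \<Longrightarrow> \<beta> p = 0" "smooth_function \<A> \<beta>"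
      "\<And>U'. (\<And>y. y \<in> cball (coord (c s) (\<gamma> s)) (r s) \<Longrightarrow> \<exists>V. open V \<and> y \<in> V \<and> V \<subseteq> img (c s) \<and> smooth_on (U' \<circ> point (c s)) V) \<Longrightarrow>
         smooth_function \<A> (\<lambda>p. \<beta> p * U' p)"
      by (rule smooth_bump[OF cA rp cbi, of s]) blast
    have \<beta>Q: "\<beta> p = 0" if "p \<notin> Q s" for p using \<beta>(4) that by (simp add: Q_def)
    have \<beta>B: "\<beta> p = 1" if pB: "p \<in> B s" for p
    proof -
      obtain y where y: "p = point (c s) y" "y \<in> ball (coord (c s) (\<gamma> s)) (r s / 2)" using pB unfolding B_def by blast
      then have "y \<in> img (c s)" using bi cbi by blast
      then show ?thesis using \<beta>(3)[of p] y point_in[OF cA] coord_point[OF cA] by auto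
    qed
    define W where "W p = U s p + (- K)" for p
    define u' where "u' p = u p - \<beta> p * u p + \<beta> p * W p" for p
    have sW: "smooth_on (W \<circ> point (c s)) (V s)"
      using smooth_on_add[OF sU[of s] smooth_on_const[OF oV, of "- K"] oV] by (simp add: W_def o_def)
    have "smooth_function \<A> (\<lambda>p. \<beta> p * W p)"
    proof (rule \<beta>(6))
      fix y assume "y \<in> cball (coord (c s) (\<gamma> s)) (r s)"
      then have "y \<in> V s" using cbV by blast
      then show "\<exists>V. open V \<and> y \<in> V \<and> V \<subseteq> img (c s) \<and> smooth_on (W \<circ> point (c s)) V" using oV Vi sW by blast
    qed
    then have s': "smooth_function \<A> u'"
      unfolding u'_def
      by (rule smooth_function_add[OF smooth_function_diff[OF u(1) smooth_function_mult[OF \<beta>(5) u(1)]]])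
    have W0: "W p \<le> ln 2" if "p \<in> Q s" for p
    proof -
      have "U s p \<le> K" using Ub[OF that] K(2)[OF sF] by linarith
      moreover have "0 < ln (2::real)" by simp
      ultimately show ?thesis unfolding W_def by linarith
    qed
    have le: "u' p \<le> ln 2" for p
    proof (cases "p \<in> Q s")
      case True
      have "u' p = (1 - \<beta> p) * u p + \<beta> p * W p" by (simp add: u'_def algebra_simps)
      also have "\<dots> \<le> (1 - \<beta> p) * ln 2 + \<beta> p * ln 2"
        by (intro add_mono mult_left_mono u(2) W0[OF True]) (use \<beta>(1,2) in auto)
      finally show ?thesis by (simp add: algebra_simps)
    next
      case False
      then show ?thesis using u(2) \<beta>Q by (simp add: u'_def)
    qed
    have off: "u' p = ln 2" if "p \<notin> V0" for p
      using u(3)[OF that] \<beta>Q[of p] QV[of s] that by (auto simp: u'_def)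
    have jW: "W (\<gamma> t) = lspeed t - K \<and> jet \<gamma> W t" if "\<gamma> t \<in> point (c s) ` V s" for t
      using J[OF that] jet_add_const[OF reg\<gamma>, of "U s" t "- K"] by (simp add: W_def[abs_def])
    \<comment> \<open>On \<open>B s\<close> the blend equals \<open>W\<close>. A point of an earlier
      disc outside \<open>B s\<close> either lies in the domain of the local solution, where both
      functions have the right jet, or off the support of the bump, where nothing changes.\<close>
    have main: "u' (\<gamma> t) = lspeed t - K \<and> jet \<gamma> u' t" if ex: "\<exists>z\<in>insert s F'. \<gamma> t \<in> B z" for t
    proof (cases "\<gamma> t \<in> B s")
      case True
      have eq: "W p = u' p" if "p \<in> B s" for p using \<beta>B[OF that] by (simp add: u'_def)
      have "\<gamma> t \<in> point (c s) ` V s" using True BQ QpV by blast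
      then have W: "W (\<gamma> t) = lspeed t - K" "jet \<gamma> W t" using jW by auto
      from jet_cong[OF reg\<gamma> oB True eq W(2)] have "jet \<gamma> u' t" .
      then show ?thesis using W(1) eq[OF True] by simp
    next
      case False
      then have ut: "u (\<gamma> t) = lspeed t - K \<and> jet \<gamma> u t" using u(4) ex by blast
      show ?thesis
      proof (cases "\<gamma> t \<in> point (c s) ` V s")
        case True
        have W: "W (\<gamma> t) = lspeed t - K" "jet \<gamma> W t" using jW[OF True] by auto
        have "jet \<gamma> (\<lambda>p. u p - \<beta> p * u p + \<beta> p * W p) t"
          by (rule jet_blend[OF reg\<gamma> _ W(2) _ \<beta>(5)]) (use ut W(1) in auto)
        then show ?thesis using ut W(1) by (simp add: u'_def[abs_def])
      next
        case False
        have o: "openin (top_of_set M) (M \<inter> - Q s)" by (intro openin_open_Int open_Compl compact_imp_closed cQ)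
        have eq: "u p = u' p" if "p \<in> M \<inter> - Q s" for p using \<beta>Q[of p] that by (simp add: u'_def)
        have gt: "\<gamma> t \<in> M \<inter> - Q s" using False QpV reg_sub[OF reg\<gamma>] by blast
        from jet_cong[OF reg\<gamma> o gt eq conjunct2[OF ut]] have "jet \<gamma> u' t" .
        then show ?thesis using ut eq[OF gt] by simp
      qed
    qed
    show ?case using s' le off main by blast
  qed
  from this[OF F(2) order_refl] obtain u where u: "smooth_function \<A> u" "\<And>p. u p \<le> ln 2" "\<And>p. p \<notin> V0 \<Longrightarrow> u p = ln 2"
      "\<And>t. \<exists>s\<in>F. \<gamma> t \<in> B s \<Longrightarrow> u (\<gamma> t) = lspeed t - K \<and> jet \<gamma> u t" by blast
  show ?thesis by (rule that[OF K(1) u(1-3)]) (use u(4) cover in auto)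
qed

end

end

section \<open>Area\<close>

text \<open>The predicate inside the definite description of \<open>area_measure\<close>, named so
  that existence and uniqueness can be treated separately.\<close>

definition area_on :: "'a::topological_space set \<Rightarrow> 'a chart set \<Rightarrow> 'a metric_field \<Rightarrow> 'a measure \<Rightarrow> bool" where
  "area_on M \<A> g \<mu> \<longleftrightarrow> sets \<mu> = sets (restrict_space borel M) \<and>
     (\<forall>c\<in>\<A>. \<forall>B\<in>sets \<mu>. B \<subseteq> cdom c \<longrightarrow>
        emeasure \<mu> B = (\<integral>\<^sup>+x\<in>coord c ` B. ennreal (sqrt (det (g c (point c x)))) \<partial>lborel))"

lemma area_measure_The: "area_measure M \<A> g = (THE \<mu>. area_on M \<A> g \<mu>)"
  unfolding area_measure_def area_on_def ..

context surface
begin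

lemma borel_M: "M \<in> sets borel"
  by (rule borel_closed[OF compact_imp_closed[OF compact_M]])

lemma finite_chart_cover: obtains F where "finite F" "F \<subseteq> \<A>" "M = (\<Union>c\<in>F. cdom c)"
proof -
  define ch where "ch p = (SOME c. c \<in> \<A> \<and> p \<in> cdom c)" for p
  have ch: "ch p \<in> \<A> \<and> p \<in> cdom (ch p)" if "p \<in> M" for p
    unfolding ch_def by (rule someI_ex) (use ex_chart[OF that] in blast)
  obtain F where F: "finite F" "F \<subseteq> M" "M = (\<Union>p\<in>F. cdom (ch p))"
    by (rule finite_subcover_M[of "\<lambda>p. cdom (ch p)"]) (use ch openin_cdom in auto)
  show ?thesis
  proof (rule that[of "ch ` F"])
    show "ch ` F \<subseteq> \<A>" using ch F(2) by auto
    show "M = (\<Union>c\<in>ch ` F. cdom c)" using F(3) by simp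
  qed (use F(1) in simp)
qed

lemma borel_cdom: "c \<in> \<A> \<Longrightarrow> cdom c \<in> sets borel"
proof -
  assume "c \<in> \<A>"
  from openin_cdom[OF this] obtain T where "open T" "cdom c = M \<inter> T" by (auto simp: openin_open)
  then show ?thesis using borel_M by auto
qed

lemma borel_coord_image:
  assumes "c \<in> \<A>" "B \<subseteq> cdom c" "B \<in> sets borel"
  shows "coord c ` B \<in> sets borel"
proof -
  have m: "point c \<in> borel_measurable (restrict_space borel (img c))"
    by (rule borel_measurable_continuous_on_restrict[OF cont_point[OF assms(1)]])
  have "point c -` B \<inter> space (restrict_space borel (img c)) \<in> sets (restrict_space borel (img c))"
    by (rule measurable_sets[OF m assms(3)])
  then have "point c -` B \<inter> img c \<in> sets borel"
    using open_img[OF assms(1)] by (simp add: space_restrict_space sets_restrict_space_iff)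
  moreover have "point c -` B \<inter> img c = coord c ` B"
  proof (rule Set.set_eqI)
    fix y
    show "y \<in> point c -` B \<inter> img c \<longleftrightarrow> y \<in> coord c ` B"
    proof
      assume "y \<in> point c -` B \<inter> img c"
      then show "y \<in> coord c ` B" using coord_point[OF assms(1), of y] by (intro image_eqI[of _ _ "point c y"]) auto
    next
      assume "y \<in> coord c ` B"
      then obtain p where "y = coord c p" "p \<in> B" by (rule imageE)
      then show "y \<in> point c -` B \<inter> img c" using point_coord[OF assms(1), of p] assms(2) by auto
    qed
  qed
  ultimately show ?thesis by simp
qed

lemma area_on_sets: "area_on M \<A> g \<mu> \<Longrightarrow> B \<in> sets \<mu> \<longleftrightarrow> B \<subseteq> M \<and> B \<in> sets borel"
  using borel_M by (simp add: area_on_def sets_restrict_space_iff)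

lemma area_on_space: "area_on M \<A> g \<mu> \<Longrightarrow> space \<mu> = M"
proof -
  assume "area_on M \<A> g \<mu>"
  then have "sets \<mu> = sets (restrict_space borel M)" by (simp add: area_on_def)
  from sets_eq_imp_space_eq[OF this] show ?thesis by (simp add: space_restrict_space)
qed

lemma area_on_chart:
  "area_on M \<A> g \<mu> \<Longrightarrow> c \<in> \<A> \<Longrightarrow> B \<in> sets \<mu> \<Longrightarrow> B \<subseteq> cdom c \<Longrightarrow>
    emeasure \<mu> B = (\<integral>\<^sup>+x\<in>coord c ` B. ennreal (sqrt (det (g c (point c x)))) \<partial>lborel)"
  unfolding area_on_def by simp

text \<open>A Borel set is cut along finitely many chart domains, and on each piece the measure is a
  coordinate integral.\<close>

lemma area_on_unique:
  assumes \<mu>: "area_on M \<A> g \<mu>" and \<nu>: "area_on M \<A> g \<nu>"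
  shows "\<mu> = \<nu>"
proof (rule measure_eqI)
  show st: "sets \<mu> = sets \<nu>" using \<mu> \<nu> by (simp add: area_on_def)
  have chart: "emeasure \<mu> B = emeasure \<nu> B" if "c \<in> \<A>" "B \<in> sets \<mu>" "B \<subseteq> cdom c" for c B
    using area_on_chart[OF \<mu> that] area_on_chart[OF \<nu> that(1) _ that(3)] that(2) st by simp
  fix A assume A: "A \<in> sets \<mu>"
  obtain F where F: "finite F" "F \<subseteq> \<A>" "M = (\<Union>c\<in>F. cdom c)" by (rule finite_chart_cover)
  have "emeasure \<mu> B = emeasure \<nu> B" if "B \<in> sets \<mu>" "B \<subseteq> (\<Union>c\<in>F. cdom c)" for B
    using F(1,2) that
  proof (induction F arbitrary: B rule: finite_induct)
    case empty then show ?case by simp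
  next
    case (insert c F)
    have c: "c \<in> \<A>" using insert.prems(1) by simp
    have s1: "B \<inter> cdom c \<in> sets \<mu>"
      using insert.prems(2) borel_cdom[OF c] unfolding area_on_sets[OF \<mu>] by auto
    have s2: "B - cdom c \<in> sets \<mu>"
      using insert.prems(2) borel_cdom[OF c] unfolding area_on_sets[OF \<mu>] by auto
    have sp: "emeasure \<kappa> B = emeasure \<kappa> (B \<inter> cdom c) + emeasure \<kappa> (B - cdom c)" if "sets \<kappa> = sets \<mu>" for \<kappa>
    proof -
      have "emeasure \<kappa> (B \<inter> cdom c) + emeasure \<kappa> (B - cdom c) = emeasure \<kappa> ((B \<inter> cdom c) \<union> (B - cdom c))"
        by (rule plus_emeasure) (use s1 s2 that in auto)
      also have "(B \<inter> cdom c) \<union> (B - cdom c) = B" by auto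
      finally show ?thesis by simp
    qed
    have "emeasure \<mu> (B - cdom c) = emeasure \<nu> (B - cdom c)"
      by (rule insert.IH) (use insert.prems s2 in auto)
    moreover have "emeasure \<mu> (B \<inter> cdom c) = emeasure \<nu> (B \<inter> cdom c)" by (rule chart[OF c s1]) simp
    ultimately show ?case using sp[of \<mu>] sp[of \<nu>] st by simp
  qed
  then show "emeasure \<mu> A = emeasure \<nu> A" using A F(3) unfolding area_on_sets[OF \<mu>] by simp
qed

lemma area_measure_eq: "area_on M \<A> g \<mu> \<Longrightarrow> area_measure M \<A> g = \<mu>"
  unfolding area_measure_The using area_on_unique by (intro the_equality) auto

end

section \<open>Area under a conformal change\<close>

context riemann_surface
begin

lemma continuous_gram: "c \<in> \<A> \<Longrightarrow> continuous_on (img c) (gram c)"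
  by (rule smooth_on_continuous[OF smooth_gram])

lemma measurable_area:
  assumes "area_on M \<A> g \<mu>" "smooth_function \<A> u"
  shows "u \<in> borel_measurable \<mu>"
proof -
  have "u \<in> borel_measurable (restrict_space borel M)"
    by (rule borel_measurable_continuous_on_restrict[OF smooth_function_continuous[OF assms(2)]])
  moreover have "sets \<mu> = sets (restrict_space borel M)" using assms(1) by (simp add: area_on_def)
  ultimately show ?thesis by (simp cong: measurable_cong_sets)
qed

text \<open>In dimension two \<open>det (exp (2 u) G) = exp (4 u) det G\<close>, so the area density
  is multiplied by \<open>exp (2 u)\<close>.\<close>

lemma area_on_conf:
  assumes \<mu>: "area_on M \<A> \<sigma> \<mu>" and u: "smooth_function \<A> u"
  shows "area_on M \<A> (conf u) (density \<mu> (\<lambda>p. ennreal (exp (2 * u p))))"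
  unfolding area_on_def
proof (intro conjI ballI impI)
  let ?f = "\<lambda>p. ennreal (exp (2 * u p))"
  have st: "sets \<mu> = sets (restrict_space borel M)" using \<mu> by (simp add: area_on_def)
  then show "sets (density \<mu> ?f) = sets (restrict_space borel M)" by simp
  note um[measurable] = measurable_area[OF \<mu> u]
  fix c B assume c: "c \<in> \<A>" and B0: "B \<in> sets (density \<mu> ?f)" and Bc: "B \<subseteq> cdom c"
  have B[measurable]: "B \<in> sets \<mu>" using B0 by simp
  have cd[measurable]: "cdom c \<in> sets \<mu>" using borel_cdom[OF c] cdom_sub[OF c] area_on_sets[OF \<mu>] by simp
  obtain p0 where p0: "p0 \<in> M" using M_ne by auto
  define s where "s x = indicator (img c) x *\<^sub>R sqrt (det (gram c x))" for x
  have cg: "continuous_on (img c) (\<lambda>x. \<sigma> c (point c x))" using continuous_gram[OF c] by (simp add: o_def)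
  have s[measurable]: "s \<in> borel_measurable borel"
    unfolding s_def det_2
    by (rule borel_measurable_continuous_on_indicator)
       (use open_img[OF c] in \<open>auto intro!: continuous_intros cg\<close>)
  \<comment> \<open>\<open>point c\<close> made total by an arbitrary value off
    \<open>img c\<close>, where the density \<open>s\<close> vanishes. The restriction of \<mu> to
    the chart can then be written as an image measure.\<close>
  define pt where "pt x = (if x \<in> img c then point c x else p0)" for x
  have ptM: "pt x \<in> M" for x using point_in[OF c] cdom_sub[OF c] p0 by (auto simp: pt_def)
  have pt[measurable]: "pt \<in> measurable lborel (restrict_space borel M)"
  proof (rule measurable_restrict_space2)
    have "pt \<in> borel_measurable borel"
      unfolding pt_def
      by (subst measurable_If_restrict_space_iff)
         (use open_img[OF c] borel_measurable_continuous_on_restrict[OF cont_point[OF c]] in auto)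
    then show "pt \<in> borel_measurable lborel" by simp
  qed (use ptM in auto)
  have mem: "x \<in> coord c ` A \<longleftrightarrow> pt x \<in> A" if "x \<in> img c" "A \<subseteq> cdom c" for x A
  proof
    assume "x \<in> coord c ` A"
    then obtain p where p: "x = coord c p" "p \<in> A" by (rule imageE)
    then show "pt x \<in> A" using that point_coord[OF c, of p] by (auto simp: pt_def)
  next
    assume "pt x \<in> A"
    then show "x \<in> coord c ` A" using that(1) coord_point[OF c, of x] by (intro image_eqI[of _ _ "pt x"]) (auto simp: pt_def)
  qed
  have out: "x \<notin> coord c ` A" if "x \<notin> img c" "A \<subseteq> cdom c" for x A using that by blast
  define \<nu> where "\<nu> = distr (density lborel (\<lambda>x. ennreal (s x))) (restrict_space borel M) pt"
  have ptd: "pt \<in> measurable (density lborel (\<lambda>x. ennreal (s x))) (restrict_space borel M)" using pt by simp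
  \<comment> \<open>The defining property of \<mu> on the chart as an equality of measures, so that
    integrals of functions, and not only measures of sets, can be pulled back to
    coordinates.\<close>
  have eqm: "density \<mu> (indicator (cdom c)) = \<nu>"
  proof (rule measure_eqI)
    show "sets (density \<mu> (indicator (cdom c))) = sets \<nu>" using st by (simp add: \<nu>_def)
    fix A assume "A \<in> sets (density \<mu> (indicator (cdom c)))"
    then have A[measurable]: "A \<in> sets \<mu>" by simp
    then have A'[measurable]: "A \<in> sets (restrict_space borel M)" using st by simp
    have ptA: "pt -` A \<in> sets borel" using measurable_sets[OF pt A'] by simp
    have "emeasure (density \<mu> (indicator (cdom c))) A = (\<integral>\<^sup>+p. indicator (cdom c) p * indicator A p \<partial>\<mu>)"
      by (rule emeasure_density) simp_all
    also have "\<dots> = (\<integral>\<^sup>+p. indicator (cdom c \<inter> A) p \<partial>\<mu>)" by (simp only: indicator_inter_arith)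
    also have "\<dots> = emeasure \<mu> (cdom c \<inter> A)" by (rule nn_integral_indicator) simp
    also have "\<dots> = (\<integral>\<^sup>+x\<in>coord c ` (cdom c \<inter> A). ennreal (sqrt (det (gram c x))) \<partial>lborel)"
      using area_on_chart[OF \<mu> c, of "cdom c \<inter> A"] by simp
    also have "\<dots> = (\<integral>\<^sup>+x. ennreal (s x) * indicator (pt -` A \<inter> space lborel) x \<partial>lborel)"
    proof (rule nn_integral_cong)
      fix x :: "real^2"
      show "ennreal (sqrt (det (gram c x))) * indicator (coord c ` (cdom c \<inter> A)) x
        = ennreal (s x) * indicator (pt -` A \<inter> space lborel) x"
      proof (cases "x \<in> img c")
        case True
        then have "x \<in> coord c ` (cdom c \<inter> A) \<longleftrightarrow> pt x \<in> A"
          using mem[OF True, of "cdom c \<inter> A"] point_in[OF c True] by (simp add: pt_def)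
        then show ?thesis using True by (simp add: s_def indicator_def)
      next
        case False
        then show ?thesis using out[OF False, of "cdom c \<inter> A"] by (simp add: s_def)
      qed
    qed
    also have "\<dots> = emeasure (density lborel (\<lambda>x. ennreal (s x))) (pt -` A \<inter> space lborel)"
      by (rule emeasure_density[symmetric]) (simp_all add: ptA)
    also have "\<dots> = emeasure \<nu> A" unfolding \<nu>_def by (subst emeasure_distr[OF ptd A']) simp
    finally show "emeasure (density \<mu> (indicator (cdom c))) A = emeasure \<nu> A" .
  qed
  have fB: "(\<lambda>p. ?f p * indicator B p) \<in> borel_measurable \<mu>" by simp
  then have fB': "(\<lambda>p. ?f p * indicator B p) \<in> borel_measurable (restrict_space borel M)"
    using st by (simp cong: measurable_cong_sets)
  have "emeasure (density \<mu> ?f) B = (\<integral>\<^sup>+p. ?f p * indicator B p \<partial>\<mu>)" by (rule emeasure_density) simp_all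
  also have "\<dots> = (\<integral>\<^sup>+p. indicator (cdom c) p * (?f p * indicator B p) \<partial>\<mu>)"
    using Bc by (intro nn_integral_cong) (auto simp: indicator_def)
  also have "\<dots> = (\<integral>\<^sup>+p. ?f p * indicator B p \<partial>density \<mu> (indicator (cdom c)))"
    by (rule nn_integral_density[symmetric]) (use fB in simp_all)
  also have "\<dots> = (\<integral>\<^sup>+p. ?f p * indicator B p \<partial>\<nu>)" unfolding eqm ..
  also have "\<dots> = (\<integral>\<^sup>+x. ?f (pt x) * indicator B (pt x) \<partial>density lborel (\<lambda>x. ennreal (s x)))"
    unfolding \<nu>_def by (rule nn_integral_distr[OF ptd]) (use fB' in simp)
  also have "\<dots> = (\<integral>\<^sup>+x. ennreal (s x) * (?f (pt x) * indicator B (pt x)) \<partial>lborel)"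
    by (rule nn_integral_density) (use measurable_compose[OF pt fB'] in simp_all)
  also have "\<dots> = (\<integral>\<^sup>+x\<in>coord c ` B. ennreal (sqrt (det (conf u c (point c x)))) \<partial>lborel)"
  proof (rule nn_integral_cong)
    fix x :: "real^2"
    show "ennreal (s x) * (?f (pt x) * indicator B (pt x)) =
      ennreal (sqrt (det (conf u c (point c x)))) * indicator (coord c ` B) x"
    proof (cases "x \<in> img c")
      case True
      let ?e = "exp (2 * u (point c x))"
      have "det (conf u c (point c x)) = ?e\<^sup>2 * det (\<sigma> c (point c x))"
        by (simp add: conf_def det_2 algebra_simps power2_eq_square)
      then have "sqrt (det (conf u c (point c x))) = sqrt (det (\<sigma> c (point c x))) * ?e"
        by (simp add: real_sqrt_mult)
      then have "ennreal (sqrt (det (conf u c (point c x)))) = ennreal (s x) * ?f (pt x)"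
        using True by (simp add: ennreal_mult'' s_def pt_def)
      moreover have "indicator B (pt x) = (indicator (coord c ` B) x :: ennreal)"
        using mem[OF True Bc] by (simp add: indicator_def)
      ultimately show ?thesis by (simp add: mult.assoc)
    next
      case False
      then show ?thesis using out[OF False Bc] by (simp add: s_def)
    qed
  qed
  finally show "emeasure (density \<mu> ?f) B = (\<integral>\<^sup>+x\<in>coord c ` B. ennreal (sqrt (det (conf u c (point c x)))) \<partial>lborel)" .
qed

text \<open>The factor with exponent \<open>- u\<close> leads from \<open>conf u\<close> back to
  \<sigma>, so either both metrics have an area measure or neither has.\<close>

lemma area_on_conf_reverse:
  assumes \<nu>: "area_on M \<A> (conf u) \<nu>" and u: "smooth_function \<A> u"
  shows "\<exists>\<mu>. area_on M \<A> \<sigma> \<mu>"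
proof -
  interpret c: riemann_surface M \<A> "conf u"
    by unfold_locales (rule conf_riemannian[OF u])
  have "smooth_function \<A> (\<lambda>p. 0 - u p)" by (rule smooth_function_diff[OF smooth_function_const u])
  from c.area_on_conf[OF \<nu> this] have "area_on M \<A> (c.conf (\<lambda>p. 0 - u p)) (density \<nu> (\<lambda>p. ennreal (exp (2 * (0 - u p)))))" .
  moreover have "c.conf (\<lambda>p. 0 - u p) = \<sigma>"
    unfolding c.conf_def unfolding conf_def by (simp add: mult_exp_exp)
  ultimately show ?thesis by auto
qed

lemma total_area_conf:
  assumes "area_on M \<A> \<sigma> \<mu>" "smooth_function \<A> u"
  shows "total_area M \<A> (conf u) = enn2real (\<integral>\<^sup>+p. ennreal (exp (2 * u p)) \<partial>\<mu>)"
proof -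
  note [measurable] = measurable_area[OF assms]
  have "emeasure (density \<mu> (\<lambda>p. ennreal (exp (2 * u p)))) M = (\<integral>\<^sup>+p. ennreal (exp (2 * u p)) * indicator M p \<partial>\<mu>)"
    by (rule emeasure_density) (use area_on_sets[OF assms(1)] borel_M in simp_all)
  also have "\<dots> = (\<integral>\<^sup>+p. ennreal (exp (2 * u p)) \<partial>\<mu>)"
    by (rule nn_integral_cong) (use area_on_space[OF assms(1)] in simp)
  finally show ?thesis unfolding total_area_def area_measure_eq[OF area_on_conf[OF assms]] measure_def by simp
qed

text \<open>The coordinate images of \<open>M - C\<close> are open in the plane and are exhausted
  there; finitely many charts are then united. This supplies compact sets that avoid the curve and
  carry almost all of the area.\<close>

lemma compact_exhaustion:
  assumes C: "compact C" "C \<subseteq> M"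
  obtains E where "\<And>n::nat. compact (E n)" "\<And>n. E n \<subseteq> M - C" "incseq E" "(\<Union>n. E n) = M - C"
proof -
  obtain F where F: "finite F" "F \<subseteq> \<A>" "M = (\<Union>c\<in>F. cdom c)" by (rule finite_chart_cover)
  let ?W = "\<lambda>c. coord c ` (cdom c \<inter> (M - C))"
  have oM: "openin (top_of_set M) (M - C)"
    using compact_imp_closed[OF C(1)] by (auto simp: openin_open intro!: exI[of _ "- C"])
  have "\<exists>K. (\<forall>n. compact (K n) \<and> K n \<subseteq> ?W c \<and> K n \<subseteq> K (Suc n)) \<and> (\<Union>n. K n) = ?W c" if c: "c \<in> \<A>" for c
  proof -
    obtain K where "\<And>n. compact (K n)" "\<And>n. K n \<subseteq> ?W c" "\<And>n. K n \<subseteq> interior (K (Suc n))" "\<Union>(range K) = ?W c"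
      by (rule open_Union_compact_subsets[OF open_coord_image[OF c oM]]) (rule that; assumption)
    moreover have "K n \<subseteq> K (Suc n)" for n using \<open>K n \<subseteq> interior (K (Suc n))\<close> interior_subset by (rule subset_trans)
    ultimately show ?thesis by (intro exI[of _ K]) simp
  qed
  then obtain K where K: "\<And>c. c \<in> \<A> \<Longrightarrow> (\<forall>n. compact (K c n) \<and> K c n \<subseteq> ?W c \<and> K c n \<subseteq> K c (Suc n)) \<and> (\<Union>n. K c n) = ?W c"
    by metis
  have Kimg: "K c n \<subseteq> img c" if "c \<in> \<A>" for c n using K[OF that] by blast
  define E where "E n = (\<Union>c\<in>F. point c ` K c n)" for n
  have pW: "point c y \<in> M - C" if "c \<in> \<A>" "y \<in> ?W c" for c y
    using that(2) point_coord[OF that(1)] by auto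
  show ?thesis
  proof
    show "compact (E n)" for n
      unfolding E_def
    proof (rule compact_UN[OF F(1)])
      fix c assume "c \<in> F"
      then have c: "c \<in> \<A>" using F(2) by blast
      have "compact (K c n)" using K[OF c] by simp
      then show "compact (point c ` K c n)" by (rule compact_point_image[OF c _ Kimg[OF c]])
    qed
    show "E n \<subseteq> M - C" for n
    proof
      fix p assume "p \<in> E n"
      then obtain c y where "c \<in> F" "y \<in> K c n" "p = point c y" unfolding E_def by blast
      then show "p \<in> M - C" using pW[of c y] K[of c] F(2) by blast
    qed
    show "incseq E"
    proof (rule incseq_SucI)
      fix n
      show "E n \<subseteq> E (Suc n)" unfolding E_def
        by (intro UN_mono image_mono subset_refl) (use K F(2) in blast)
    qed
    show "(\<Union>n. E n) = M - C"
    proof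
      show "(\<Union>n. E n) \<subseteq> M - C" using \<open>\<And>n. E n \<subseteq> M - C\<close> by blast
      show "M - C \<subseteq> (\<Union>n. E n)"
      proof
        fix p assume p: "p \<in> M - C"
        then obtain c where c: "c \<in> F" "p \<in> cdom c" using F(3) by blast
        then have "coord c p \<in> ?W c" using p by blast
        then obtain n where n: "coord c p \<in> K c n" using K[of c] c(1) F(2) by blast
        have pc: "point c (coord c p) = p" by (rule point_coord) (use c F(2) in auto)
        from imageI[OF n, of "point c"] have "p \<in> point c ` K c n" unfolding pc .
        then have "p \<in> E n" unfolding E_def by (rule UN_I[OF c(1)])
        then show "p \<in> (\<Union>n. E n)" by blast
      qed
    qed
  qed
qed

context
  fixes \<gamma> assumes reg\<gamma>: "reg \<gamma> UNIV" and per: "\<And>t. \<gamma> (t + 1) = \<gamma> t" and inj\<gamma>: "inj_on \<gamma> {0..<1}"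
begin

lemma range_compact: "compact (range \<gamma>)" "range \<gamma> \<subseteq> M"
proof -
  have "range \<gamma> = \<gamma> ` {0..1}"
  proof
    show "range \<gamma> \<subseteq> \<gamma> ` {0..1}"
    proof
      fix p assume "p \<in> range \<gamma>"
      then obtain t where "p = \<gamma> t" by blast
      also have "\<dots> = \<gamma> (frac t + of_int \<lfloor>t\<rfloor>)" by (simp add: frac_def)
      also have "\<dots> = \<gamma> (frac t)" by (rule per_int[OF reg\<gamma> per inj\<gamma>])
      finally show "p \<in> \<gamma> ` {0..1}" using frac_lt_1[of t] by (intro image_eqI[of _ _ "frac t"]) auto
    qed
  qed auto
  moreover have "compact (\<gamma> ` {0..1})"
    by (rule compact_continuous_image[OF continuous_on_subset[OF reg_continuous[OF reg\<gamma>]]]) auto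
  ultimately show "compact (range \<gamma>)" by simp
  show "range \<gamma> \<subseteq> M" by (rule reg_sub[OF reg\<gamma>])
qed

text \<open>In a chart the curve is the differentiable image of an open subset of the line in the
  plane, hence negligible.\<close>

lemma range_null:
  assumes \<mu>: "area_on M \<A> \<sigma> \<mu>"
  shows "range \<gamma> \<in> null_sets \<mu>"
proof -
  obtain F where F: "finite F" "F \<subseteq> \<A>" "M = (\<Union>c\<in>F. cdom c)" by (rule finite_chart_cover)
  have bC: "range \<gamma> \<in> sets borel" by (rule borel_closed[OF compact_imp_closed[OF range_compact(1)]])
  have "range \<gamma> \<inter> cdom c \<in> null_sets \<mu>" if c: "c \<in> \<A>" for c
  proof -
    let ?B = "range \<gamma> \<inter> cdom c"
    have bB: "?B \<in> sets borel" using bC borel_cdom[OF c] by simp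
    have B: "?B \<in> sets \<mu>" using bB range_compact(2) unfolding area_on_sets[OF \<mu>] by auto
    have "coord c ` ?B = (coord c \<circ> \<gamma>) ` {t. \<gamma> t \<in> cdom c}" by auto
    moreover have "negligible ((coord c \<circ> \<gamma>) ` {t. \<gamma> t \<in> cdom c})"
    proof (rule negligible_differentiable_image_lowdim)
      have "Ck_on (Suc 0) (coord c \<circ> \<gamma>) {t. \<gamma> t \<in> cdom c}"
        using curve_smooth(2)[OF reg\<gamma> c] unfolding smooth_on_def by blast
      then show "(coord c \<circ> \<gamma>) differentiable_on {t. \<gamma> t \<in> cdom c}" by simp
    qed simp
    ultimately have "coord c ` ?B \<in> null_sets lebesgue" by (simp add: negligible_iff_null_sets)
    moreover have "coord c ` ?B \<in> sets lborel" using borel_coord_image[OF c _ bB] by simp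
    ultimately have "coord c ` ?B \<in> null_sets lborel" by (simp add: null_sets_completion_iff)
    then have "emeasure \<mu> ?B = 0"
      using area_on_chart[OF \<mu> c B] by (simp add: nn_integral_null_set)
    then show ?thesis using B by (simp add: null_sets_def)
  qed
  then have "(\<Union>c\<in>F. range \<gamma> \<inter> cdom c) \<in> null_sets \<mu>"
    using F(1,2) by (intro null_sets_UN' countable_finite) auto
  moreover have "(\<Union>c\<in>F. range \<gamma> \<inter> cdom c) = range \<gamma>" using F(3) range_compact(2) by auto
  ultimately show ?thesis by simp
qed

text \<open>Off a small neighbourhood of the curve \<open>u\<close> is \<open>ln 2\<close>, which multiplies the area by 4; hence the
  constant that restores the area is negative.\<close>

lemma area_preserving_jet:
  assumes \<epsilon>: "\<epsilon> > 0"
  obtains u K where "smooth_function \<A> u" "\<And>p. u p \<le> ln 2" "\<And>t. u (\<gamma> t) = lspeed \<gamma> t - K" "\<And>t. jet \<gamma> u t"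
    "exp (- K) \<le> \<epsilon>" "total_area M \<A> (conf u) = total_area M \<A> \<sigma>"
proof -
  have eK: "exp (- K) \<le> \<epsilon>" if "K \<ge> - ln \<epsilon>" for K
  proof -
    have "exp (- K) \<le> exp (ln \<epsilon>)" using that by simp
    then show ?thesis using \<epsilon> by simp
  qed
  show ?thesis
  proof (cases "\<exists>\<mu>. area_on M \<A> \<sigma> \<mu>")
    \<comment> \<open>Without an area measure for \<sigma> there is none for \<open>conf u\<close>;
      both definite descriptions are then those of the same empty predicate, and the total areas
      agree.\<close>
    case False
    obtain u K where u: "K \<ge> - ln \<epsilon>" "smooth_function \<A> u" "\<And>p. u p \<le> ln 2" "\<And>p. p \<notin> M \<Longrightarrow> u p = ln 2"
      "\<And>t. u (\<gamma> t) = lspeed \<gamma> t - K" "\<And>t. jet \<gamma> u t"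
      by (rule global_jet[OF reg\<gamma> per inj\<gamma> _ range_compact(2), of "- ln \<epsilon>"]) auto
    have "\<not> area_on M \<A> (conf u) \<nu>" for \<nu> using area_on_conf_reverse[OF _ u(2)] False by blast
    then have "area_measure M \<A> (conf u) = area_measure M \<A> \<sigma>"
      unfolding area_measure_The using False by (intro arg_cong[of _ _ The]) auto
    then have "total_area M \<A> (conf u) = total_area M \<A> \<sigma>" by (simp add: total_area_def)
    from that[OF u(2,3,5,6) eK[OF u(1)] this] show ?thesis .
  next
    case True
    then obtain \<mu> where \<mu>: "area_on M \<A> \<sigma> \<mu>" by blast
    have sp: "space \<mu> = M" by (rule area_on_space[OF \<mu>])
    have tot: "total_area M \<A> \<sigma> = enn2real (emeasure \<mu> M)"
      unfolding total_area_def area_measure_eq[OF \<mu>] measure_def ..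
    let ?I = "\<lambda>u. \<integral>\<^sup>+p. ennreal (exp (2 * u p)) \<partial>\<mu>"
    have le4: "ennreal (exp (2 * a)) \<le> 4" if "a \<le> ln 2" for a :: real
    proof -
      have "exp (2 * a) \<le> exp (2 * ln 2)" using that by simp
      also have "\<dots> = exp (ln 2 + ln 2)" by simp
      also have "\<dots> = (4::real)" unfolding exp_add by simp
      finally have "ennreal (exp (2 * a)) \<le> ennreal 4" by (rule ennreal_leI)
      then show ?thesis by simp
    qed
    have up: "?I u \<le> 4 * emeasure \<mu> M" if "\<And>p. u p \<le> ln 2" for u
    proof -
      have "?I u \<le> (\<integral>\<^sup>+p. 4 \<partial>\<mu>)" by (rule nn_integral_mono) (rule le4[OF that])
      then show ?thesis by (simp add: sp)
    qed
    show ?thesis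
    \<comment> \<open>In the exceptional cases \<open>total_area\<close> is 0 by convention of
      \<open>enn2real\<close>, and it suffices that the new measure of \<open>M\<close> remains zero
      or infinite. For the latter, \<open>u\<close> is bounded below on the compact
      \<open>M\<close>.\<close>
    proof (cases "emeasure \<mu> M = 0 \<or> emeasure \<mu> M = \<infinity>")
      case True
      obtain u K where u: "K \<ge> - ln \<epsilon>" "smooth_function \<A> u" "\<And>p. u p \<le> ln 2" "\<And>p. p \<notin> M \<Longrightarrow> u p = ln 2"
        "\<And>t. u (\<gamma> t) = lspeed \<gamma> t - K" "\<And>t. jet \<gamma> u t"
        by (rule global_jet[OF reg\<gamma> per inj\<gamma> _ range_compact(2), of "- ln \<epsilon>"]) auto
      have "?I u = emeasure \<mu> M"
      proof (cases "emeasure \<mu> M = 0")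
        case True
        then show ?thesis using up[OF u(3)] by simp
      next
        case False
        then have inf: "emeasure \<mu> M = \<infinity>" using \<open>_ \<or> _\<close> by simp
        have "compact (u ` M)" by (rule compact_continuous_image[OF smooth_function_continuous[OF u(2)] compact_M])
        then obtain b where b: "\<And>p. p \<in> M \<Longrightarrow> b \<le> u p"
          using compact_attains_inf[of "u ` M"] M_ne by (metis imageE image_eqI image_is_empty)
        have "ennreal (exp (2 * b)) * emeasure \<mu> M = (\<integral>\<^sup>+p. ennreal (exp (2 * b)) \<partial>\<mu>)" by (simp add: sp)
        also have "\<dots> \<le> ?I u"
          by (rule nn_integral_mono) (use b sp in \<open>auto intro!: ennreal_leI\<close>)
        finally show ?thesis using inf by (simp add: ennreal_mult_top top_unique)
      qed
      then have "total_area M \<A> (conf u) = total_area M \<A> \<sigma>" unfolding total_area_conf[OF \<mu> u(2)] tot by simp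
      from that[OF u(2,3,5,6) eK[OF u(1)] this] show ?thesis .
    next
      case False
      define A where "A = enn2real (emeasure \<mu> M)"
      have A: "emeasure \<mu> M = ennreal A" "A > 0"
        using False by (auto simp: A_def enn2real_positive_iff top.not_eq_extremum less_top zero_less_iff_neq_zero)
      obtain E where E: "\<And>n::nat. compact (E n)" "\<And>n. E n \<subseteq> M - range \<gamma>" "incseq E" "(\<Union>n. E n) = M - range \<gamma>"
        by (rule compact_exhaustion[OF range_compact]) blast
      have Es: "E n \<in> sets \<mu>" for n
        using E(2)[of n] borel_closed[OF compact_imp_closed[OF E(1)]] unfolding area_on_sets[OF \<mu>] by blast
      have "M \<in> sets \<mu>" using borel_M unfolding area_on_sets[OF \<mu>] by simp
      then have "emeasure \<mu> (M - range \<gamma>) = emeasure \<mu> M"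
        by (rule emeasure_Diff_null_set[OF range_null[OF \<mu>]])
      then have "(SUP n. emeasure \<mu> (E n)) = ennreal A"
        using SUP_emeasure_incseq[of E \<mu>] Es E(3,4) A(1) by auto
      moreover have "ennreal (A / 4) < ennreal A" using A(2) by (simp add: ennreal_less_iff)
      \<comment> \<open>A compact set off the curve with more than a quarter of the area. On it the
        area is multiplied by \<open>exp (2 * ln 2) = 4\<close>, so the new total cannot fall below
        \<open>A\<close>.\<close>
      ultimately obtain n where n: "ennreal (A / 4) < emeasure \<mu> (E n)" by (metis less_SUP_iff)
      define V where "V = M - E n"
      have V: "openin (top_of_set M) V" "range \<gamma> \<subseteq> V"
        using compact_imp_closed[OF E(1)[of n]] E(2)[of n] range_compact(2)
        by (auto simp: V_def openin_open intro!: exI[of _ "- E n"])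
      obtain u K where u: "K \<ge> - ln \<epsilon>" "smooth_function \<A> u" "\<And>p. u p \<le> ln 2" "\<And>p. p \<notin> V \<Longrightarrow> u p = ln 2"
        "\<And>t. u (\<gamma> t) = lspeed \<gamma> t - K" "\<And>t. jet \<gamma> u t"
        by (rule global_jet[OF reg\<gamma> per inj\<gamma> V, of "- ln \<epsilon>"]) auto
      define a where "a = enn2real (?I u)"
      have "4 * emeasure \<mu> M < \<infinity>" unfolding A(1) by (simp add: ennreal_mult_less_top)
      with up[OF u(3)] have "?I u < \<infinity>" by (rule order_le_less_trans)
      then have Iu: "?I u = ennreal a" by (simp add: a_def)
      have ln4: "exp (2 * ln 2) = (4::real)"
      proof -
        have "exp (2 * ln 2) = exp (ln 2 + ln (2::real))" by simp
        then show ?thesis unfolding exp_add by simp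
      qed
      have "ennreal A = 4 * ennreal (A / 4)" using A(2) by (simp add: ennreal_mult'[symmetric] flip: ennreal_numeral)
      also have "\<dots> \<le> 4 * emeasure \<mu> (E n)" using n by (intro mult_left_mono) auto
      also have "\<dots> = (\<integral>\<^sup>+p. 4 * indicator (E n) p \<partial>\<mu>)" by (rule nn_integral_cmult_indicator[OF Es, symmetric])
      also have "\<dots> \<le> ?I u"
      proof (rule nn_integral_mono)
        fix p
        show "4 * indicator (E n) p \<le> ennreal (exp (2 * u p))"
        proof (cases "p \<in> E n")
          case True
          then have "u p = ln 2" by (intro u(4)) (simp add: V_def)
          then show ?thesis using True ln4 by simp
        qed simp
      qed
      finally have "A \<le> a" unfolding Iu using A(2)
        by (metis a_def enn2real_nonneg ennreal_le_iff)
      then have a: "a > 0" using A(2) by linarith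
      \<comment> \<open>Adding \<open>k\<close> to \<open>u\<close> multiplies the area by
        \<open>exp (2 * k)\<close>. As \<open>A \<le> a\<close>, the constant is not positive, so
        both the bound \<open>ln 2\<close> and the shortness of the curve survive.\<close>
      define k where "k = ln (A / a) / 2"
      have k: "exp (2 * k) = A / a" "k \<le> 0"
        using A(2) a \<open>A \<le> a\<close> by (auto simp: k_def divide_le_0_iff)
      let ?w = "\<lambda>p. u p + k"
      have w: "smooth_function \<A> ?w" by (rule smooth_function_add[OF u(2) smooth_function_const])
      note [measurable] = measurable_area[OF \<mu> u(2)]
      have "?I ?w = (\<integral>\<^sup>+p. ennreal (A / a) * ennreal (exp (2 * u p)) \<partial>\<mu>)"
      proof (rule nn_integral_cong)
        fix p
        have eq: "exp (2 * (u p + k)) = A / a * exp (2 * u p)" unfolding k(1)[symmetric] exp_add[symmetric] by (simp add: algebra_simps)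
        show "ennreal (exp (2 * (u p + k))) = ennreal (A / a) * ennreal (exp (2 * u p))"
          unfolding eq by (rule ennreal_mult'') simp
      qed
      also have "\<dots> = ennreal (A / a) * ennreal a" unfolding Iu[symmetric] by (rule nn_integral_cmult) simp
      also have "\<dots> = ennreal A" using A(2) a by (simp add: ennreal_mult''[symmetric])
      finally have area: "total_area M \<A> (conf ?w) = total_area M \<A> \<sigma>" unfolding total_area_conf[OF \<mu> w] tot A(1) by simp
      show ?thesis
      proof (rule that[OF w])
        show "u p + k \<le> ln 2" for p using u(3)[of p] k(2) by linarith
        show "u (\<gamma> t) + k = lspeed \<gamma> t - (K - k)" for t using u(5)[of t] by simp
        show "jet \<gamma> ?w t" for t by (rule jet_add_const[OF reg\<gamma> u(6)])
        show "exp (- (K - k)) \<le> \<epsilon>" by (rule eK) (use u(1) k(2) in linarith)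
      qed (rule area)
    qed
  qed
qed

end

end

section \<open>Lengths and diameter\<close>

lemma integral_mono_off_finite:
  fixes f g :: "real \<Rightarrow> real"
  assumes "f integrable_on S" "g integrable_on S" "finite T" "\<And>t. t \<in> S - T \<Longrightarrow> f t \<le> g t"
  shows "integral S f \<le> integral S g"
proof -
  define f' g' where "f' t = (if t \<in> T then 0 else f t)" and "g' t = (if t \<in> T then 0 else g t)" for t
  have "(f' has_integral integral S f) S"
    by (rule has_integral_spike_finite[OF assms(3) _ integrable_integral[OF assms(1)]]) (simp add: f'_def)
  moreover have "(g' has_integral integral S g) S"
    by (rule has_integral_spike_finite[OF assms(3) _ integrable_integral[OF assms(2)]]) (simp add: g'_def)
  ultimately show ?thesis
    by (rule has_integral_le) (use assms(4) in \<open>auto simp: f'_def g'_def\<close>)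
qed

context surface
begin

lemma C1_curve_affine:
  assumes g: "C1_curve_on \<A> \<gamma> (k * a + m) (k * b + m)" and k: "k > 0"
    and eq: "\<And>t. t \<in> {a..b} \<Longrightarrow> \<delta> t = \<gamma> (k * t + m)"
  shows "C1_curve_on \<A> \<delta> a b"
  unfolding C1_curve_on_def
proof
  fix c assume "c \<in> \<A>"
  then obtain D where D: "continuous_on {t\<in>{k * a + m..k * b + m}. \<gamma> t \<in> cdom c} D"
    "\<And>t. t \<in> {k * a + m..k * b + m} \<Longrightarrow> \<gamma> t \<in> cdom c \<Longrightarrow>
      ((coord c \<circ> \<gamma>) has_vector_derivative D t) (at t within {k * a + m..k * b + m})"
    using g unfolding C1_curve_on_def by blast
  let ?h = "\<lambda>t. k * t + m"
  have h: "?h t \<in> {k * a + m..k * b + m}" if "t \<in> {a..b}" for t using that k by auto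
  have him: "?h ` {a..b} \<subseteq> {k * a + m..k * b + m}" using h by blast
  show "\<exists>D. continuous_on {t \<in> {a..b}. \<delta> t \<in> cdom c} D \<and>
      (\<forall>t\<in>{a..b}. \<delta> t \<in> cdom c \<longrightarrow> ((coord c \<circ> \<delta>) has_vector_derivative D t) (at t within {a..b}))"
  proof (intro exI[of _ "\<lambda>t. k *\<^sub>R D (?h t)"] conjI ballI impI)
    have "continuous_on {t \<in> {a..b}. \<delta> t \<in> cdom c} (D \<circ> ?h)"
    proof (rule continuous_on_compose)
      show "continuous_on (?h ` {t \<in> {a..b}. \<delta> t \<in> cdom c}) D"
        by (rule continuous_on_subset[OF D(1)]) (use h eq in auto)
    qed (intro continuous_intros)
    then show "continuous_on {t \<in> {a..b}. \<delta> t \<in> cdom c} (\<lambda>t. k *\<^sub>R D (?h t))"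
      by (intro continuous_intros) (simp add: o_def)
    fix t assume t: "t \<in> {a..b}" "\<delta> t \<in> cdom c"
    have "((coord c \<circ> \<gamma>) has_vector_derivative D (?h t)) (at (?h t) within {k * a + m..k * b + m})"
      by (rule D(2)) (use h[OF t(1)] eq[OF t(1)] t(2) in auto)
    then have gD: "((coord c \<circ> \<gamma>) has_vector_derivative D (?h t)) (at (?h t) within ?h ` {a..b})"
      by (rule has_vector_derivative_within_subset[OF _ him])
    have hD: "(?h has_vector_derivative k) (at t within {a..b})"
      unfolding has_real_derivative_iff_has_vector_derivative[symmetric] by (auto intro!: derivative_eq_intros)
    from vector_diff_chain_within[OF hD gD]
    have "((coord c \<circ> \<gamma> \<circ> ?h) has_vector_derivative k *\<^sub>R D (?h t)) (at t within {a..b})" .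
    then show "((coord c \<circ> \<delta>) has_vector_derivative k *\<^sub>R D (?h t)) (at t within {a..b})"
      by (rule has_vector_derivative_transform[OF t(1), rotated]) (use eq in simp)
  qed
qed

lemma piecewise_C1_join:
  assumes 1: "piecewise_C1_curve M \<A> \<gamma>1" and 2: "piecewise_C1_curve M \<A> \<gamma>2" and e: "pathfinish \<gamma>1 = pathstart \<gamma>2"
  shows "piecewise_C1_curve M \<A> (\<gamma>1 +++ \<gamma>2)"
  unfolding piecewise_C1_curve_def
proof (intro conjI)
  show "path (\<gamma>1 +++ \<gamma>2)" using 1 2 e by (simp add: piecewise_C1_curve_def)
  show "path_image (\<gamma>1 +++ \<gamma>2) \<subseteq> M" using 1 2 e by (simp add: piecewise_C1_curve_def path_image_join)
  obtain T1 where T1: "finite T1" "\<And>a b. 0 \<le> a \<Longrightarrow> a < b \<Longrightarrow> b \<le> 1 \<Longrightarrow> {a<..<b} \<inter> T1 = {} \<Longrightarrow> C1_curve_on \<A> \<gamma>1 a b"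
    using 1 unfolding piecewise_C1_curve_def by auto
  obtain T2 where T2: "finite T2" "\<And>a b. 0 \<le> a \<Longrightarrow> a < b \<Longrightarrow> b \<le> 1 \<Longrightarrow> {a<..<b} \<inter> T2 = {} \<Longrightarrow> C1_curve_on \<A> \<gamma>2 a b"
    using 2 unfolding piecewise_C1_curve_def by auto
  let ?T = "insert (1/2) ((\<lambda>t. t / 2) ` T1 \<union> (\<lambda>t. (t + 1) / 2) ` T2)"
  show "\<exists>T. finite T \<and> (\<forall>a b. 0 \<le> a \<and> a < b \<and> b \<le> 1 \<and> {a<..<b} \<inter> T = {} \<longrightarrow> C1_curve_on \<A> (\<gamma>1 +++ \<gamma>2) a b)"
  proof (intro exI[of _ ?T] conjI allI impI)
    show "finite ?T" using T1(1) T2(1) by simp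
    fix a b :: real assume "0 \<le> a \<and> a < b \<and> b \<le> 1 \<and> {a<..<b} \<inter> ?T = {}"
    then have ab: "0 \<le> a" "a < b" "b \<le> 1" and dis: "{a<..<b} \<inter> ?T = {}" by blast+
    have no: "t \<notin> ?T" if "a < t" "t < b" for t
    proof -
      have "t \<in> {a<..<b}" using that by simp
      then show ?thesis using dis by blast
    qed
    show "C1_curve_on \<A> (\<gamma>1 +++ \<gamma>2) a b"
    proof (cases "b \<le> 1/2")
      case True
      have "C1_curve_on \<A> \<gamma>1 (2 * a + 0) (2 * b + 0)"
      proof (rule T1(2))
        show "{2 * a + 0<..<2 * b + 0} \<inter> T1 = {}"
        proof (rule equals0I)
          fix t assume t: "t \<in> {2 * a + 0<..<2 * b + 0} \<inter> T1"
          then have "t / 2 \<in> ?T" by blast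
          then show False using no[of "t / 2"] t by simp
        qed
      qed (use ab True in auto)
      then show ?thesis by (rule C1_curve_affine) (use True in \<open>auto simp: joinpaths_def\<close>)
    next
      case False
      then have a: "a \<ge> 1/2" using no[of "1/2"] by force
      have "C1_curve_on \<A> \<gamma>2 (2 * a + (-1)) (2 * b + (-1))"
      proof (rule T2(2))
        show "{2 * a + (-1)<..<2 * b + (-1)} \<inter> T2 = {}"
        proof (rule equals0I)
          fix t assume t: "t \<in> {2 * a + (-1)<..<2 * b + (-1)} \<inter> T2"
          then have "(t + 1) / 2 \<in> ?T" by blast
          then show False using no[of "(t + 1) / 2"] t by simp
        qed
      qed (use ab a in auto)
      then show ?thesis
      proof (rule C1_curve_affine)
        fix t assume "t \<in> {a..b}"
        then have "t \<ge> 1/2" using a by simp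
        show "(\<gamma>1 +++ \<gamma>2) t = \<gamma>2 (2 * t + -1)"
        proof (cases "t = 1/2")
          case True
          then have h: "2 * t = 1" "2 * t + -1 = 0" by auto
          show ?thesis unfolding joinpaths_def h using e True by (simp add: pathfinish_def pathstart_def)
        qed (use \<open>t \<ge> 1/2\<close> in \<open>simp add: joinpaths_def\<close>)
      qed simp
    qed
  qed
qed

lemma piecewise_C1_derivative:
  assumes "piecewise_C1_curve M \<A> \<gamma>"
  obtains T where "finite T" "\<And>t c. t \<in> {0..1} - T \<Longrightarrow> c \<in> \<A> \<Longrightarrow> \<gamma> t \<in> cdom c \<Longrightarrow>
    \<exists>v. ((coord c \<circ> \<gamma>) has_vector_derivative v) (at t)" "0 \<in> T" "1 \<in> T"
proof -
  obtain T where T: "finite T" "\<And>a b. 0 \<le> a \<Longrightarrow> a < b \<Longrightarrow> b \<le> 1 \<Longrightarrow> {a<..<b} \<inter> T = {} \<Longrightarrow> C1_curve_on \<A> \<gamma> a b"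
    using assms unfolding piecewise_C1_curve_def by auto
  show ?thesis
  proof (rule that[of "T \<union> {0,1}"])
    fix t c assume t: "t \<in> {0..1} - (T \<union> {0,1})" and c: "c \<in> \<A>" "\<gamma> t \<in> cdom c"
    have "open ({0<..<1} - T)" using T(1) by (intro open_Diff finite_imp_closed) auto
    moreover have "t \<in> {0<..<1} - T" using t by auto
    ultimately obtain r where r: "r > 0" "ball t r \<subseteq> {0<..<1} - T" by (rule openE)
    define a b where "a = t - r / 2" and "b = t + r / 2"
    have sub: "{a..b} \<subseteq> {0<..<1} - T" using r by (intro order_trans[OF _ r(2)]) (auto simp: a_def b_def dist_real_def abs_if)
    have ab: "a < t" "t < b" using r(1) by (auto simp: a_def b_def)
    have "a \<in> {a..b}" "b \<in> {a..b}" using ab by auto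
    then have mem: "a \<in> {0<..<1} - T" "b \<in> {0<..<1} - T" using sub by blast+
    have "{a<..<b} \<subseteq> {a..b}" by auto
    then have "{a<..<b} \<inter> T = {}" using sub by blast
    then have "C1_curve_on \<A> \<gamma> a b" using mem ab by (intro T(2)) auto
    then obtain D where "\<And>t. t \<in> {a..b} \<Longrightarrow> \<gamma> t \<in> cdom c \<Longrightarrow> ((coord c \<circ> \<gamma>) has_vector_derivative D t) (at t within {a..b})"
      using c(1) unfolding C1_curve_on_def by blast
    from this[of t] have "((coord c \<circ> \<gamma>) has_vector_derivative D t) (at t within {a..b})" using ab c(2) by auto
    then have "((coord c \<circ> \<gamma>) has_vector_derivative D t) (at t)" using ab by (simp add: at_within_Icc_at)
    then show "\<exists>v. ((coord c \<circ> \<gamma>) has_vector_derivative v) (at t)" by blast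
  qed (use T(1) in auto)
qed

lemma piecewise_C1_facts:
  assumes "piecewise_C1_curve M \<A> \<gamma>"
  shows "continuous_on {0..1} \<gamma>" "\<gamma> ` {0..1} \<subseteq> M"
  using assms by (auto simp: piecewise_C1_curve_def path_def path_image_def)

end

section \<open>Speed and length of piecewise C1 curves\<close>

context riemann_surface
begin

lemma speed_eq:
  assumes I: "open I" "t \<in> I" "continuous_on I \<gamma>" "\<gamma> ` I \<subseteq> M" and c: "c \<in> \<A>" "\<gamma> t \<in> cdom c"
    and v: "((coord c \<circ> \<gamma>) has_vector_derivative v) (at t)"
  shows "speed \<A> \<sigma> \<gamma> t = sqrt (v \<bullet> (\<sigma> c (\<gamma> t) *v v))"
  unfolding speed_def Let_def
proof (rule the_equality)
  have eq: "v \<bullet> (\<sigma> c (\<gamma> t) *v v) = vd (coord d \<circ> \<gamma>) t \<bullet> (\<sigma> d (\<gamma> t) *v vd (coord d \<circ> \<gamma>) t)"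
    if d: "d \<in> \<A>" "\<gamma> t \<in> cdom d" for d
  proof -
    have "((coord d \<circ> \<gamma>) has_vector_derivative Df (transition c d) (coord c (\<gamma> t)) v) (at t within I)"
      by (rule coord_curve_derivative[OF c(1) d(1) c(2) d(2) I(3,4,2)])
         (rule has_vector_derivative_at_within[OF v])
    then have "vd (coord d \<circ> \<gamma>) t = Df (transition c d) (coord c (\<gamma> t)) v"
      unfolding at_within_open[OF I(2,1)] by (rule vector_derivative_at)
    then show ?thesis using gram_transform[OF c(1) d(1) c(2) d(2), of v v] by simp
  qed
  then show "\<forall>d\<in>\<A>. \<gamma> t \<in> cdom d \<longrightarrow> sqrt (v \<bullet> (\<sigma> c (\<gamma> t) *v v)) =
      sqrt (vd (coord d \<circ> \<gamma>) t \<bullet> (\<sigma> d (\<gamma> t) *v vd (coord d \<circ> \<gamma>) t))" by simp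
  fix s assume "\<forall>d\<in>\<A>. \<gamma> t \<in> cdom d \<longrightarrow> s = sqrt (vd (coord d \<circ> \<gamma>) t \<bullet> (\<sigma> d (\<gamma> t) *v vd (coord d \<circ> \<gamma>) t))"
  then show "s = sqrt (v \<bullet> (\<sigma> c (\<gamma> t) *v v))" using eq[OF c] c by simp
qed

lemma speed_nonneg:
  assumes I: "open I" "t \<in> I" "continuous_on I \<gamma>" "\<gamma> ` I \<subseteq> M" and c: "c \<in> \<A>" "\<gamma> t \<in> cdom c"
    and v: "((coord c \<circ> \<gamma>) has_vector_derivative v) (at t)"
  shows "speed \<A> \<sigma> \<gamma> t \<ge> 0"
proof -
  have "v \<bullet> (\<sigma> c (\<gamma> t) *v v) \<ge> 0" using gram_pos[OF c, of v] by (cases "v = 0") auto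
  then show ?thesis unfolding speed_eq[OF assms] by simp
qed

lemma speed_conf:
  assumes I: "open I" "t \<in> I" "continuous_on I \<gamma>" "\<gamma> ` I \<subseteq> M" and c: "c \<in> \<A>" "\<gamma> t \<in> cdom c"
    and v: "((coord c \<circ> \<gamma>) has_vector_derivative v) (at t)" and u: "smooth_function \<A> u"
  shows "speed \<A> (conf u) \<gamma> t = exp (u (\<gamma> t)) * speed \<A> \<sigma> \<gamma> t"
proof -
  interpret c: riemann_surface M \<A> "conf u" by unfold_locales (rule conf_riemannian[OF u])
  have "v \<bullet> (conf u c (\<gamma> t) *v v) = (exp (u (\<gamma> t)))\<^sup>2 * (v \<bullet> (\<sigma> c (\<gamma> t) *v v))"
    by (simp add: conf_def scaleR_matrix_vector_assoc[symmetric] power2_eq_square mult_exp_exp)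
  then show ?thesis unfolding speed_eq[OF I c v] c.speed_eq[OF I c v] by (simp add: real_sqrt_mult)
qed

text \<open>The speed is built from two-sided derivatives. \<open>S\<close> is built from
  derivatives within the interval instead; it is continuous up to the ends and agrees with the speed
  in the interior.\<close>

lemma speed_integrable_piece:
  assumes C: "C1_curve_on \<A> \<gamma> a b" and ct: "continuous_on {a..b} \<gamma>" "\<gamma> ` {a..b} \<subseteq> M" and ab: "a < b"
  shows "speed \<A> \<sigma> \<gamma> integrable_on {a..b}"
proof -
  define V where "V c t = vector_derivative (coord c \<circ> \<gamma>) (at t within {a..b})" for c t
  define ch where "ch t = (SOME c. c \<in> \<A> \<and> \<gamma> t \<in> cdom c)" for t
  define S where "S t = sqrt (V (ch t) t \<bullet> (\<sigma> (ch t) (\<gamma> t) *v V (ch t) t))" for t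
  have ch: "ch t \<in> \<A>" "\<gamma> t \<in> cdom (ch t)" if "t \<in> {a..b}" for t
  proof -
    have "\<gamma> t \<in> M" using ct(2) that by blast
    from ex_chart[OF this] have "\<exists>c. c \<in> \<A> \<and> \<gamma> t \<in> cdom c" by blast
    then have "ch t \<in> \<A> \<and> \<gamma> t \<in> cdom (ch t)" unfolding ch_def by (rule someI_ex)
    then show "ch t \<in> \<A>" "\<gamma> t \<in> cdom (ch t)" by auto
  qed
  have V: "((coord c \<circ> \<gamma>) has_vector_derivative V c t) (at t within {a..b})"
    if c: "c \<in> \<A>" and t: "t \<in> {a..b}" and tc: "\<gamma> t \<in> cdom c" for c t
  proof -
    obtain D where "\<forall>t\<in>{a..b}. \<gamma> t \<in> cdom c \<longrightarrow> ((coord c \<circ> \<gamma>) has_vector_derivative D t) (at t within {a..b})"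
      using C c unfolding C1_curve_on_def by blast
    then have D: "((coord c \<circ> \<gamma>) has_vector_derivative D t) (at t within {a..b})" using t tc by blast
    have "V c t = D t" unfolding V_def by (rule vector_derivative_within_closed_interval[OF ab t D])
    then show ?thesis using D by simp
  qed
  have S: "S t = sqrt (V c t \<bullet> (\<sigma> c (\<gamma> t) *v V c t))" if "c \<in> \<A>" "t \<in> {a..b}" "\<gamma> t \<in> cdom c" for c t
  proof -
    note d = ch[OF that(2)]
    have "((coord (ch t) \<circ> \<gamma>) has_vector_derivative Df (transition c (ch t)) (coord c (\<gamma> t)) (V c t)) (at t within {a..b})"
      by (rule coord_curve_derivative[OF that(1) d(1) that(3) d(2) ct that(2) V[OF that]])
    from vector_derivative_within_closed_interval[OF ab that(2) this]
    have "V (ch t) t = Df (transition c (ch t)) (coord c (\<gamma> t)) (V c t)" unfolding V_def[of "ch t"] .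
    then show ?thesis using gram_transform[OF that(1) d(1) that(3) d(2), of "V c t" "V c t"] by (simp add: S_def)
  qed
  have "continuous_on {a..b} S"
    unfolding continuous_on_eq_continuous_within
  proof
    fix t assume t: "t \<in> {a..b}"
    define c where "c = ch t"
    have c: "c \<in> \<A>" "\<gamma> t \<in> cdom c" using ch[OF t] by (simp_all add: c_def)
    let ?W = "{t\<in>{a..b}. \<gamma> t \<in> cdom c}"
    obtain O' where O': "open O'" "cdom c = M \<inter> O'" using openin_cdom[OF c(1)] by (auto simp: openin_open)
    have W: "?W = {a..b} \<inter> \<gamma> -` O'" using O'(2) ct(2) by auto
    have oW: "openin (top_of_set {a..b}) ?W" unfolding W by (rule continuous_openin_preimage_gen[OF ct(1) O'(1)])
    obtain D where D: "continuous_on ?W D" "\<And>t. t \<in> {a..b} \<Longrightarrow> \<gamma> t \<in> cdom c \<Longrightarrow>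
      ((coord c \<circ> \<gamma>) has_vector_derivative D t) (at t within {a..b})"
      using C c(1) unfolding C1_curve_on_def by blast
    have VD: "V c s = D s" if "s \<in> ?W" for s
    proof -
      have s: "s \<in> {a..b}" "\<gamma> s \<in> cdom c" using that by auto
      show ?thesis unfolding V_def by (rule vector_derivative_within_closed_interval[OF ab s(1) D(2)[OF s]])
    qed
    have cc: "continuous_on ?W (coord c \<circ> \<gamma>)"
      by (rule continuous_on_compose[OF continuous_on_subset[OF ct(1)] continuous_on_subset[OF cont_coord[OF c(1)]]]) auto
    have "continuous_on ?W (gram c \<circ> (coord c \<circ> \<gamma>))"
      by (rule continuous_on_compose[OF cc continuous_on_subset[OF continuous_gram[OF c(1)]]]) auto
    then have G: "continuous_on ?W (\<lambda>s. \<sigma> c (\<gamma> s))"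
      by (rule continuous_on_eq) (use point_coord[OF c(1)] in auto)
    have "continuous_on ?W (\<lambda>s. sqrt (D s \<bullet> (\<sigma> c (\<gamma> s) *v D s)))"
      by (intro continuous_intros bounded_bilinear.continuous_on[OF bounded_bilinear_matrix_vector] D(1) G)
    then have "continuous_on ?W S"
      by (rule continuous_on_eq) (use S[OF c(1)] VD in auto)
    then have "continuous (at t within ?W) S"
      unfolding continuous_on_eq_continuous_within using t c(2) by blast
    moreover obtain U where U: "open U" "?W = {a..b} \<inter> U" using oW unfolding openin_open by blast
    have "at t within ?W = at t within {a..b}"
      by (rule at_within_nhd[of t U]) (use U t c(2) in blast)+
    ultimately show "continuous (at t within {a..b}) S" by simp
  qed
  then have "S integrable_on {a..b}" by (rule integrable_continuous_real)
  then show ?thesis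
  proof (rule integrable_spike_finite[of "{a,b}", rotated 2])
    fix t assume "t \<in> {a..b} - {a, b}"
    then have t: "t \<in> {a<..<b}" by auto
    then have t': "t \<in> {a..b}" by auto
    show "speed \<A> \<sigma> \<gamma> t = S t"
      unfolding S_def
    proof (rule speed_eq[OF _ t])
      show "continuous_on {a<..<b} \<gamma>" by (rule continuous_on_subset[OF ct(1)]) auto
      show "\<gamma> ` {a<..<b} \<subseteq> M" using ct(2) by auto
      show "((coord (ch t) \<circ> \<gamma>) has_vector_derivative V (ch t) t) (at t)"
        using V[OF ch(1)[OF t'] t' ch(2)[OF t']] t by (simp add: at_within_Icc_at)
    qed (use ch[OF t'] in auto)
  qed simp
qed

text \<open>Around each parameter \<open>x\<close> there is no other break point, so a short
  interval containing \<open>x\<close> splits there into two pieces of class C1.\<close>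

lemma speed_integrable:
  assumes p: "piecewise_C1_curve M \<A> \<gamma>"
  shows "speed \<A> \<sigma> \<gamma> integrable_on {0..1}"
proof -
  note pf = piecewise_C1_facts[OF p]
  obtain T where T: "finite T" "\<And>a b. 0 \<le> a \<Longrightarrow> a < b \<Longrightarrow> b \<le> 1 \<Longrightarrow> {a<..<b} \<inter> T = {} \<Longrightarrow> C1_curve_on \<A> \<gamma> a b"
    using p unfolding piecewise_C1_curve_def by auto
  have int: "speed \<A> \<sigma> \<gamma> integrable_on {a..b}" if "0 \<le> a" "a \<le> b" "b \<le> 1" "{a<..<b} \<inter> T = {}" for a b
  proof (cases "a = b")
    case True
    then show ?thesis using integrable_on_refl[of _ a] by simp
  next
    case False
    then have ab: "a < b" using that by simp
    have sub: "{a..b} \<subseteq> {0..1}" using that by auto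
    show ?thesis
      by (rule speed_integrable_piece[OF T(2)[OF that(1) ab that(3,4)] continuous_on_subset[OF pf(1) sub] _ ab])
         (use pf(2) sub in blast)
  qed
  have "speed \<A> \<sigma> \<gamma> integrable_on cbox 0 1"
  proof (rule integrable_on_little_subintervals, intro ballI)
    fix x :: real assume "x \<in> cbox 0 1"
    have "open (- (T - {x}))" using T(1) by (intro open_Compl finite_imp_closed) simp
    moreover have "x \<in> - (T - {x})" by simp
    ultimately obtain d where d: "d > 0" "ball x d \<subseteq> - (T - {x})" by (rule openE)
    show "\<exists>d>0. \<forall>u v. x \<in> cbox u v \<and> cbox u v \<subseteq> ball x d \<and> cbox u v \<subseteq> cbox 0 1 \<longrightarrow> speed \<A> \<sigma> \<gamma> integrable_on cbox u v"
    proof (intro exI[of _ d] conjI allI impI d(1))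
      fix u v :: real assume uv: "x \<in> cbox u v \<and> cbox u v \<subseteq> ball x d \<and> cbox u v \<subseteq> cbox 0 1"
      then have ux: "u \<le> x" "x \<le> v" by auto
      then have "u \<in> cbox u v" "v \<in> cbox u v" by auto
      then have "u \<in> cbox 0 1" "v \<in> cbox 0 1" using uv by blast+
      with ux have o: "u \<le> x" "x \<le> v" "0 \<le> u" "v \<le> 1" by auto
      have no: "t \<notin> T" if "t \<in> {u..v}" "t \<noteq> x" for t
      proof -
        have "t \<in> ball x d" using uv that(1) unfolding cbox_interval by blast
        then show ?thesis using d(2) that(2) by blast
      qed
      have "speed \<A> \<sigma> \<gamma> integrable_on {u..x}" by (rule int) (use o no in auto)
      moreover have "speed \<A> \<sigma> \<gamma> integrable_on {x..v}" by (rule int) (use o no in auto)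
      ultimately show "speed \<A> \<sigma> \<gamma> integrable_on cbox u v"
        unfolding cbox_interval by (rule Henstock_Kurzweil_Integration.integrable_combine[OF o(1,2)])
    qed
  qed
  then show ?thesis by (simp add: cbox_interval)
qed

text \<open>The common exceptional set \<open>T\<close> holds the parameters without a two-sided
  derivative. The last property is the rescaling rule under affine changes of parameter, used for
  concatenation.\<close>

lemma piecewise_C1_speed:
  assumes p: "piecewise_C1_curve M \<A> \<gamma>"
  obtains T where "finite T"
    "\<And>t. t \<in> {0..1} - T \<Longrightarrow> speed \<A> \<sigma> \<gamma> t \<ge> 0"
    "\<And>t u. t \<in> {0..1} - T \<Longrightarrow> smooth_function \<A> u \<Longrightarrow> speed \<A> (conf u) \<gamma> t = exp (u (\<gamma> t)) * speed \<A> \<sigma> \<gamma> t"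
    "\<And>t k \<delta> J m. t \<in> J \<Longrightarrow> open J \<Longrightarrow> k > 0 \<Longrightarrow> k * t + m \<in> {0..1} - T \<Longrightarrow> (\<forall>s\<in>J. \<delta> s = \<gamma> (k * s + m)) \<Longrightarrow>
       speed \<A> \<sigma> \<delta> t = k * speed \<A> \<sigma> \<gamma> (k * t + m)"
proof -
  note pf = piecewise_C1_facts[OF p]
  let ?I = "{0<..<1::real}"
  have I: "open ?I" "continuous_on ?I \<gamma>" "\<gamma> ` ?I \<subseteq> M"
    using pf(2) by (auto intro: continuous_on_subset[OF pf(1)])
  obtain T where T: "finite T" "0 \<in> T" "1 \<in> T" "\<And>t c. t \<in> {0..1} - T \<Longrightarrow> c \<in> \<A> \<Longrightarrow> \<gamma> t \<in> cdom c \<Longrightarrow>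
    \<exists>v. ((coord c \<circ> \<gamma>) has_vector_derivative v) (at t)"
    by (rule piecewise_C1_derivative[OF p]) (rule that; assumption)
  have tI: "t \<in> ?I" if "t \<in> {0..1} - T" for t
    using that T(2,3) by (cases "t = 0 \<or> t = 1") auto
  have cv: "\<exists>c v. c \<in> \<A> \<and> \<gamma> t \<in> cdom c \<and> ((coord c \<circ> \<gamma>) has_vector_derivative v) (at t)"
    if t: "t \<in> {0..1} - T" for t
  proof -
    have "\<gamma> t \<in> M" using pf(2) t by blast
    then obtain c where "c \<in> \<A>" "\<gamma> t \<in> cdom c" using ex_chart by blast
    with T(4)[OF t this] show ?thesis by blast
  qed
  show ?thesis
  proof (rule that[OF T(1)])
    fix t assume t: "t \<in> {0..1} - T"
    obtain c v where c: "c \<in> \<A>" "\<gamma> t \<in> cdom c" "((coord c \<circ> \<gamma>) has_vector_derivative v) (at t)" using cv[OF t] by blast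
    show "speed \<A> \<sigma> \<gamma> t \<ge> 0" by (rule speed_nonneg[OF I(1) tI[OF t] I(2,3) c])
    show "speed \<A> (conf u) \<gamma> t = exp (u (\<gamma> t)) * speed \<A> \<sigma> \<gamma> t" if "smooth_function \<A> u" for u
      by (rule speed_conf[OF I(1) tI[OF t] I(2,3) c that])
  next
    fix t k m :: real and \<delta> J
    assume J: "t \<in> J" "open J" and k: "k > 0" and h: "k * t + m \<in> {0..1} - T" and eq0: "\<forall>s\<in>J. \<delta> s = \<gamma> (k * s + m)"
    have eq: "\<delta> s = \<gamma> (k * s + m)" if "s \<in> J" for s using eq0 that by blast
    obtain c v where c: "c \<in> \<A>" "\<gamma> (k * t + m) \<in> cdom c" "((coord c \<circ> \<gamma>) has_vector_derivative v) (at (k * t + m))"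
      using cv[OF h] by blast
    let ?h = "\<lambda>s. k * s + m"
    let ?J = "J \<inter> ?h -` ?I"
    have oJ: "open ?J" by (intro open_Int J(2) open_vimage continuous_intros)
    have tJ: "t \<in> ?J" using J(1) tI[OF h] by simp
    have "continuous_on ?J (\<gamma> \<circ> ?h)"
      by (rule continuous_on_compose) (auto intro!: continuous_intros continuous_on_subset[OF I(2)])
    then have cJ: "continuous_on ?J \<delta>" by (rule continuous_on_eq) (use eq in simp)
    have sJ: "\<delta> ` ?J \<subseteq> M" using eq I(3) by auto
    have "(?h has_vector_derivative k) (at t)"
      unfolding has_real_derivative_iff_has_vector_derivative[symmetric] by (auto intro!: derivative_eq_intros)
    from vector_diff_chain_at[OF this c(3)]
    have "((coord c \<circ> \<gamma> \<circ> ?h) has_vector_derivative k *\<^sub>R v) (at t)" .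
    then have "((coord c \<circ> \<delta>) has_vector_derivative k *\<^sub>R v) (at t)"
      by (rule has_vector_derivative_transform_within_open[OF _ J(2,1)]) (use eq in simp)
    moreover have "\<delta> t \<in> cdom c" using eq[OF J(1)] c(2) by simp
    ultimately have "speed \<A> \<sigma> \<delta> t = sqrt ((k *\<^sub>R v) \<bullet> (\<sigma> c (\<delta> t) *v (k *\<^sub>R v)))"
      by (intro speed_eq[OF oJ tJ cJ sJ c(1)])
    also have "\<dots> = sqrt (k\<^sup>2 * (v \<bullet> (\<sigma> c (\<gamma> (k * t + m)) *v v)))"
      using eq[OF J(1)] by (simp add: matrix_vector_mult_scaleR power2_eq_square)
    also have "\<dots> = k * speed \<A> \<sigma> \<gamma> (k * t + m)"
      using k unfolding speed_eq[OF I(1) tI[OF h] I(2,3) c] by (simp add: real_sqrt_mult)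
    finally show "speed \<A> \<sigma> \<delta> t = k * speed \<A> \<sigma> \<gamma> (k * t + m)" .
  qed
qed

lemma curve_length_nonneg:
  assumes "piecewise_C1_curve M \<A> \<gamma>"
  shows "curve_length \<A> \<sigma> \<gamma> \<ge> 0"
proof -
  obtain T where T: "finite T" "\<And>t. t \<in> {0..1} - T \<Longrightarrow> speed \<A> \<sigma> \<gamma> t \<ge> 0"
    by (rule piecewise_C1_speed[OF assms]) (rule that; assumption)
  have "integral {0..1} (\<lambda>_::real. 0::real) \<le> integral {0..1} (speed \<A> \<sigma> \<gamma>)"
    by (rule integral_mono_off_finite[OF integrable_0 speed_integrable[OF assms] T])
  then show ?thesis by (simp add: curve_length_def)
qed

lemma curve_length_conf_le:
  assumes p: "piecewise_C1_curve M \<A> \<gamma>" and u: "smooth_function \<A> u" "\<And>q. u q \<le> ln 2"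
  shows "curve_length \<A> (conf u) \<gamma> \<le> 2 * curve_length \<A> \<sigma> \<gamma>"
proof -
  interpret c: riemann_surface M \<A> "conf u" by unfold_locales (rule conf_riemannian[OF u(1)])
  obtain T where T: "finite T" "\<And>t. t \<in> {0..1} - T \<Longrightarrow> speed \<A> \<sigma> \<gamma> t \<ge> 0"
    "\<And>t u. t \<in> {0..1} - T \<Longrightarrow> smooth_function \<A> u \<Longrightarrow> speed \<A> (conf u) \<gamma> t = exp (u (\<gamma> t)) * speed \<A> \<sigma> \<gamma> t"
    by (rule piecewise_C1_speed[OF p]) (rule that; assumption)
  have "integral {0..1} (speed \<A> (conf u) \<gamma>) \<le> integral {0..1} (\<lambda>t. 2 * speed \<A> \<sigma> \<gamma> t)"
  proof (rule integral_mono_off_finite[OF c.speed_integrable[OF p] _ T(1)])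
    show "(\<lambda>t. 2 * speed \<A> \<sigma> \<gamma> t) integrable_on {0..1}"
      using integrable_cmul[OF speed_integrable[OF p], of 2] by simp
    fix t assume t: "t \<in> {0..1} - T"
    have "exp (u (\<gamma> t)) \<le> exp (ln 2)" unfolding exp_le_cancel_iff by (rule u(2))
    also have "exp (ln 2) = (2::real)" by simp
    finally have "exp (u (\<gamma> t)) \<le> 2" .
    then have "exp (u (\<gamma> t)) * speed \<A> \<sigma> \<gamma> t \<le> 2 * speed \<A> \<sigma> \<gamma> t"
      by (intro mult_right_mono T(2)[OF t]) simp
    then show "speed \<A> (conf u) \<gamma> t \<le> 2 * speed \<A> \<sigma> \<gamma> t" unfolding T(3)[OF t u(1)] .
  qed
  then show ?thesis by (simp add: curve_length_def)
qed

lemma curve_length_join: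
  assumes 1: "piecewise_C1_curve M \<A> \<gamma>1" and 2: "piecewise_C1_curve M \<A> \<gamma>2"
  shows "curve_length \<A> \<sigma> (\<gamma>1 +++ \<gamma>2) = curve_length \<A> \<sigma> \<gamma>1 + curve_length \<A> \<sigma> \<gamma>2"
proof -
  have h1: "(speed \<A> \<sigma> \<gamma>1 has_integral curve_length \<A> \<sigma> \<gamma>1) {0..1}"
    and h2: "(speed \<A> \<sigma> \<gamma>2 has_integral curve_length \<A> \<sigma> \<gamma>2) {0..1}"
    using speed_integrable[OF 1] speed_integrable[OF 2] by (simp_all add: curve_length_def integrable_integral)
  have i1: "((\<lambda>x. 2 * speed \<A> \<sigma> \<gamma>1 (2 * x + 0)) has_integral curve_length \<A> \<sigma> \<gamma>1) {0..1/2}"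
    and i2: "((\<lambda>x. 2 * speed \<A> \<sigma> \<gamma>2 (2 * x + -1)) has_integral curve_length \<A> \<sigma> \<gamma>2) {1/2..1}"
    using has_integral_affinity01[OF h1, where m=2 and c=0, THEN has_integral_cmul[where c=2]]
      has_integral_affinity01[OF h2, where m=2 and c="-1", THEN has_integral_cmul[where c=2]]
    by (simp_all only: image_affinity_atLeastAtMost_div_diff, simp_all)
  obtain T1 where T1: "finite T1" "\<And>t k \<delta> J m. t \<in> J \<Longrightarrow> open J \<Longrightarrow> k > 0 \<Longrightarrow> k * t + m \<in> {0..1} - T1 \<Longrightarrow>
      (\<forall>s\<in>J. \<delta> s = \<gamma>1 (k * s + m)) \<Longrightarrow> speed \<A> \<sigma> \<delta> t = k * speed \<A> \<sigma> \<gamma>1 (k * t + m)"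
    by (rule piecewise_C1_speed[OF 1]) (rule that; assumption)
  obtain T2 where T2: "finite T2" "\<And>t k \<delta> J m. t \<in> J \<Longrightarrow> open J \<Longrightarrow> k > 0 \<Longrightarrow> k * t + m \<in> {0..1} - T2 \<Longrightarrow>
      (\<forall>s\<in>J. \<delta> s = \<gamma>2 (k * s + m)) \<Longrightarrow> speed \<A> \<sigma> \<delta> t = k * speed \<A> \<sigma> \<gamma>2 (k * t + m)"
    by (rule piecewise_C1_speed[OF 2]) (rule that; assumption)
  have "(speed \<A> \<sigma> (\<gamma>1 +++ \<gamma>2) has_integral curve_length \<A> \<sigma> \<gamma>1) {0..1/2}"
  proof (rule has_integral_spike_finite[OF _ _ i1])
    show "finite (insert (1/2) ((\<lambda>t. t / 2) ` T1))" using T1(1) by simp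
    fix t assume t: "t \<in> {0..1/2} - insert (1/2) ((\<lambda>t. t / 2) ` T1)"
    have "2 * t + 0 \<notin> T1"
    proof
      assume "2 * t + 0 \<in> T1"
      then have "(2 * t + 0) / 2 \<in> (\<lambda>t. t / 2) ` T1" by (rule imageI)
      then show False using t by simp
    qed
    then show "speed \<A> \<sigma> (\<gamma>1 +++ \<gamma>2) t = 2 * speed \<A> \<sigma> \<gamma>1 (2 * t + 0)"
      by (intro T1(2)[of t "{..<1/2}"]) (use t in \<open>auto simp: joinpaths_def\<close>)
  qed
  moreover have "(speed \<A> \<sigma> (\<gamma>1 +++ \<gamma>2) has_integral curve_length \<A> \<sigma> \<gamma>2) {1/2..1}"
  proof (rule has_integral_spike_finite[OF _ _ i2])
    show "finite (insert (1/2) ((\<lambda>t. (t + 1) / 2) ` T2))" using T2(1) by simp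
    fix t assume t: "t \<in> {1/2..1} - insert (1/2) ((\<lambda>t. (t + 1) / 2) ` T2)"
    have "2 * t + -1 \<notin> T2"
    proof
      assume "2 * t + -1 \<in> T2"
      then have "(2 * t + -1 + 1) / 2 \<in> (\<lambda>t. (t + 1) / 2) ` T2" by (rule imageI)
      then show False using t by simp
    qed
    then show "speed \<A> \<sigma> (\<gamma>1 +++ \<gamma>2) t = 2 * speed \<A> \<sigma> \<gamma>2 (2 * t + -1)"
      by (intro T2(2)[of t "{1/2<..}"]) (use t in \<open>auto simp: joinpaths_def\<close>)
  qed
  ultimately have "(speed \<A> \<sigma> (\<gamma>1 +++ \<gamma>2) has_integral (curve_length \<A> \<sigma> \<gamma>1 + curve_length \<A> \<sigma> \<gamma>2)) {0..1}"
    by (intro has_integral_combine[of 0 "1/2" 1]) auto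
  then show ?thesis unfolding curve_length_def[of _ _ "\<gamma>1 +++ \<gamma>2"] by (rule integral_unique)
qed

text \<open>\<open>Inf\<close> and \<open>Sup\<close> of reals are meaningful only for nonempty
  bounded sets. Uniform links show that distances are infima of nonempty sets of lengths and that
  the diameter is the supremum of a bounded set.\<close>

definition linked :: "real \<Rightarrow> 'a \<Rightarrow> 'a \<Rightarrow> bool" where
  "linked B p q \<longleftrightarrow> (\<exists>\<gamma>. piecewise_C1_curve M \<A> \<gamma> \<and> pathstart \<gamma> = p \<and> pathfinish \<gamma> = q \<and> curve_length \<A> \<sigma> \<gamma> \<le> B)"

lemma linked_trans: "linked B p q \<Longrightarrow> linked C q r \<Longrightarrow> linked (B + C) p r"
proof -
  assume "linked B p q" "linked C q r"
  then obtain f g where f: "piecewise_C1_curve M \<A> f" "pathstart f = p" "pathfinish f = q" "curve_length \<A> \<sigma> f \<le> B"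
    and g: "piecewise_C1_curve M \<A> g" "pathstart g = q" "pathfinish g = r" "curve_length \<A> \<sigma> g \<le> C"
    unfolding linked_def by blast
  show ?thesis unfolding linked_def
    by (intro exI[of _ "f +++ g"] conjI piecewise_C1_join f(1) g(1))
       (use f g curve_length_join[OF f(1) g(1)] in simp_all)
qed

lemma linked_mono: "linked B p q \<Longrightarrow> B \<le> C \<Longrightarrow> linked C p q"
proof -
  assume "linked B p q" and BC: "B \<le> C"
  then obtain \<gamma> where \<gamma>: "piecewise_C1_curve M \<A> \<gamma>" "pathstart \<gamma> = p" "pathfinish \<gamma> = q" "curve_length \<A> \<sigma> \<gamma> \<le> B"
    unfolding linked_def by blast
  have "curve_length \<A> \<sigma> \<gamma> \<le> C" using \<gamma>(4) BC by linarith
  with \<gamma>(1-3) show ?thesis unfolding linked_def by blast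
qed

text \<open>Segments straight in coordinates do it: their speed is bounded by the maximum of a
  continuous function on the compact set of points of the ball and velocities of norm at most
  \<open>2 * r\<close>.\<close>

lemma segment_linked:
  assumes c: "c \<in> \<A>" and r: "cball z r \<subseteq> img c"
  shows "\<exists>B. \<forall>x\<in>cball z r. \<forall>y\<in>cball z r. linked B (point c x) (point c y)"
proof -
  let ?K = "cball z r \<times> cball (0::real^2) (2 * r)"
  let ?F = "\<lambda>(x, v). sqrt (v \<bullet> (gram c x *v v))"
  have "continuous_on ?K (\<lambda>p. gram c (fst p))"
    by (rule continuous_on_compose2[OF continuous_gram[OF c] continuous_on_fst[OF continuous_on_id]]) (use r in auto)
  then have "continuous_on ?K ?F"
    unfolding case_prod_beta
    by (intro continuous_intros bounded_bilinear.continuous_on[OF bounded_bilinear_matrix_vector])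
  then have "compact (?F ` ?K)" by (rule compact_continuous_image) (intro compact_Times compact_cball)
  from compact_imp_bounded[OF this] obtain B where B0: "\<forall>y\<in>?F ` ?K. \<bar>y\<bar> \<le> B" unfolding bounded_real by blast
  have B: "sqrt (v \<bullet> (gram c x *v v)) \<le> B" if "x \<in> cball z r" "v \<in> cball 0 (2 * r)" for x v
  proof -
    have "?F (x, v) \<in> ?F ` ?K" by (rule imageI) (use that in blast)
    from bspec[OF B0 this] show ?thesis by simp
  qed
  have "linked B (point c x) (point c y)" if x: "x \<in> cball z r" and y: "y \<in> cball z r" for x y
  proof -
    define \<gamma> where "\<gamma> t = point c (linepath x y t)" for t
    have lin: "linepath x y t \<in> cball z r" if "t \<in> {0..1}" for t
      by (rule subsetD[OF closed_segment_subset[OF x y convex_cball] linepath_in_path[OF that]])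
    then have img: "linepath x y t \<in> img c" if "t \<in> {0..1}" for t using that r by blast
    have ct: "continuous_on {0..1} \<gamma>"
      unfolding \<gamma>_def by (rule continuous_on_compose2[OF cont_point[OF c] continuous_on_linepath]) (use img in auto)
    have gc: "\<gamma> t \<in> cdom c" if "t \<in> {0..1}" for t unfolding \<gamma>_def by (rule point_in[OF c img[OF that]])
    then have gM: "\<gamma> ` {0..1} \<subseteq> M" using cdom_sub[OF c] by blast
    have co: "coord c (\<gamma> t) = linepath x y t" if "t \<in> {0..1}" for t
      unfolding \<gamma>_def by (rule coord_point[OF c img[OF that]])
    have lv: "(linepath x y has_vector_derivative (y - x)) (at t within S)" for t S
      by (rule has_vector_derivative_linepath_within)
    have der: "((coord c \<circ> \<gamma>) has_vector_derivative (y - x)) (at t within {a..b})"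
      if "0 \<le> a" "b \<le> 1" "t \<in> {a..b}" for t a b
      by (rule has_vector_derivative_transform[OF that(3) _ lv]) (use co that in auto)
    have C1: "C1_curve_on \<A> \<gamma> a b" if ab: "0 \<le> a" "b \<le> 1" for a b
      unfolding C1_curve_on_def
    proof
      fix d assume d: "d \<in> \<A>"
      let ?W = "{t \<in> {a..b}. \<gamma> t \<in> cdom d}"
      have sub: "{a..b} \<subseteq> {0..1}" using ab by auto
      show "\<exists>D. continuous_on ?W D \<and> (\<forall>t\<in>{a..b}. \<gamma> t \<in> cdom d \<longrightarrow>
          ((coord d \<circ> \<gamma>) has_vector_derivative D t) (at t within {a..b}))"
      proof (intro exI[of _ "\<lambda>t. Df (transition c d) (linepath x y t) (y - x)"] conjI ballI impI)
        have W: "linepath x y t \<in> coord c ` (cdom c \<inter> cdom d)" if "t \<in> ?W" for t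
        proof -
          have t: "t \<in> {0..1}" using that sub by blast
          show ?thesis by (rule image_eqI[of _ _ "\<gamma> t"]) (use co[OF t] gc[OF t] that in auto)
        qed
        show "continuous_on ?W (\<lambda>t. Df (transition c d) (linepath x y t) (y - x))"
          by (rule continuous_on_compose2[OF smooth_on_continuous[OF smooth_on_Df[OF smooth_transition[OF c d] open_overlap[OF c d]]]
                continuous_on_linepath]) (use W in blast)
        fix t assume t: "t \<in> {a..b}" "\<gamma> t \<in> cdom d"
        then have t01: "t \<in> {0..1}" using sub by blast
        have "((coord d \<circ> \<gamma>) has_vector_derivative Df (transition c d) (coord c (\<gamma> t)) (y - x)) (at t within {a..b})"
          by (rule coord_curve_derivative[OF c d gc[OF t01] t(2) continuous_on_subset[OF ct sub] _ t(1) der[OF ab t(1)]])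
             (use gM sub in blast)
        then show "((coord d \<circ> \<gamma>) has_vector_derivative Df (transition c d) (linepath x y t) (y - x)) (at t within {a..b})"
          unfolding co[OF t01] .
      qed
    qed
    have p: "piecewise_C1_curve M \<A> \<gamma>"
      unfolding piecewise_C1_curve_def path_def path_image_def
      using ct gM C1 by (intro conjI exI[of _ "{}"]) auto
    have "integral {0..1} (speed \<A> \<sigma> \<gamma>) \<le> integral {0..1} (\<lambda>_::real. B)"
    proof (rule integral_mono_off_finite[OF speed_integrable[OF p], where T="{0,1}"])
      fix t assume "t \<in> {0..1::real} - {0, 1}"
      then have t: "t \<in> {0<..<1}" "t \<in> {0..1}" by auto
      have "speed \<A> \<sigma> \<gamma> t = sqrt ((y - x) \<bullet> (\<sigma> c (\<gamma> t) *v (y - x)))"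
      proof (rule speed_eq[where \<gamma>=\<gamma> and t=t and I="{0<..<1}" and c=c])
        show "c \<in> \<A>" by (rule c)
        show "\<gamma> t \<in> cdom c" by (rule gc[OF t(2)])
        show "t \<in> {0<..<1}" by (rule t(1))
        show "continuous_on {0<..<1} \<gamma>" by (rule continuous_on_subset[OF ct]) auto
        show "\<gamma> ` {0<..<1} \<subseteq> M" using gM by auto
        show "((coord c \<circ> \<gamma>) has_vector_derivative (y - x)) (at t)"
          using der[of 0 1 t] t by (simp add: at_within_Icc_at)
      qed simp
      also have "\<sigma> c (\<gamma> t) = gram c (linepath x y t)" by (simp add: \<gamma>_def)
      also have "sqrt ((y - x) \<bullet> (gram c (linepath x y t) *v (y - x))) \<le> B"
      proof (rule B[OF lin[OF t(2)]])
        have "dist y x \<le> dist y z + dist z x" by (rule dist_triangle)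
        then show "y - x \<in> cball 0 (2 * r)" using x y by (simp add: dist_norm norm_minus_commute)
      qed
      finally show "speed \<A> \<sigma> \<gamma> t \<le> B" .
    qed auto
    then have "curve_length \<A> \<sigma> \<gamma> \<le> B" by (simp add: curve_length_def)
    moreover have "pathstart \<gamma> = point c x" "pathfinish \<gamma> = point c y"
      by (simp_all add: \<gamma>_def pathstart_def pathfinish_def linepath_def)
    ultimately show ?thesis unfolding linked_def using p by blast
  qed
  then show ?thesis by blast
qed

lemma locally_linked:
  assumes "p \<in> M"
  shows "\<exists>U B. openin (top_of_set M) U \<and> p \<in> U \<and> (\<forall>x\<in>U. \<forall>y\<in>U. linked B x y)"
proof -
  have oM: "openin (top_of_set M) M" unfolding openin_open by (intro exI[of _ UNIV]) simp
  obtain c r where c: "c \<in> \<A>" "p \<in> cdom c" "r > 0" "cball (coord c p) r \<subseteq> img c"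
    by (rule disc_nbhd[OF assms oM]) (rule that; assumption)
  obtain B where B: "\<And>x y. x \<in> cball (coord c p) r \<Longrightarrow> y \<in> cball (coord c p) r \<Longrightarrow> linked B (point c x) (point c y)"
    using segment_linked[OF c(1,4)] by blast
  let ?U = "point c ` ball (coord c p) r"
  have "openin (top_of_set M) ?U"
    by (rule openin_point_image[OF c(1)]) (use c(4) ball_subset_cball in auto)
  moreover have "p \<in> ?U" using point_coord[OF c(1,2)] c(3) by (intro image_eqI[of _ _ "coord c p"]) auto
  moreover have "linked B x y" if x: "x \<in> ?U" and y: "y \<in> ?U" for x y
  proof -
    obtain x' y' where "x = point c x'" "x' \<in> ball (coord c p) r" "y = point c y'" "y' \<in> ball (coord c p) r"
      using x y by blast
    then show ?thesis using B[of x' y'] by simp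
  qed
  ultimately show ?thesis by blast
qed

text \<open>Connectedness links every point to \<open>p0\<close>, and a finite subcover makes the
  bound uniform. Links are carried in both directions, which replaces the reversal of
  curves.\<close>

theorem uniformly_linked: "\<exists>B. \<forall>p\<in>M. \<forall>q\<in>M. linked B p q"
proof -
  obtain p0 where p0: "p0 \<in> M" using M_ne by auto
  let ?P = "\<lambda>q. \<exists>B. linked B p0 q \<and> linked B q p0"
  have ext: "linked (B + C) p0 y \<and> linked (B + C) y p0"
    if "linked B p0 x \<and> linked B x p0" "linked C x y" "linked C y x" for B C x y
    using linked_trans[of B p0 x C y] linked_trans[of C y x B p0] that by (simp add: add.commute)
  have P: "?P q" if q: "q \<in> M" for q
  proof (rule connected_induction_simple[OF connected_M p0 q, of ?P])
    show "?P p0" using locally_linked[OF p0] by blast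
    fix a assume a: "a \<in> M"
    obtain U B where U: "openin (top_of_set M) U" "a \<in> U" "\<And>x y. x \<in> U \<Longrightarrow> y \<in> U \<Longrightarrow> linked B x y"
      using locally_linked[OF a] by blast
    have "?P y" if "x \<in> U" "y \<in> U" "?P x" for x y
      using that(3) ext[OF _ U(3)[OF that(1,2)] U(3)[OF that(2,1)]] by blast
    then show "\<exists>T. openin (top_of_set M) T \<and> a \<in> T \<and> (\<forall>x\<in>T. \<forall>y\<in>T. ?P x \<longrightarrow> ?P y)"
      using U(1,2) by blast
  qed
  have "\<exists>U C. openin (top_of_set M) U \<and> q \<in> U \<and> (\<forall>x\<in>U. linked C p0 x \<and> linked C x p0)" if q: "q \<in> M" for q
  proof -
    obtain U B where U: "openin (top_of_set M) U" "q \<in> U" "\<And>x y. x \<in> U \<Longrightarrow> y \<in> U \<Longrightarrow> linked B x y"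
      using locally_linked[OF q] by blast
    obtain B' where "linked B' p0 q \<and> linked B' q p0" using P[OF q] by blast
    from ext[OF this U(3)[OF U(2)] U(3)[OF _ U(2)]] U(1,2) show ?thesis by blast
  qed
  then obtain U C where UC0: "\<And>q. q \<in> M \<Longrightarrow> openin (top_of_set M) (U q) \<and> q \<in> U q \<and>
      (\<forall>x\<in>U q. linked (C q) p0 x \<and> linked (C q) x p0)"
    by metis
  have UC: "q \<in> M \<Longrightarrow> openin (top_of_set M) (U q) \<and> q \<in> U q"
    "q \<in> M \<Longrightarrow> x \<in> U q \<Longrightarrow> linked (C q) p0 x \<and> linked (C q) x p0" for q x
    using UC0[of q] by blast+
  obtain F where F: "finite F" "F \<subseteq> M" "M = (\<Union>q\<in>F. U q)" by (rule finite_subcover_M[OF UC(1)])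
  define B where "B = Max (insert 0 (C ` F))"
  have B: "linked B p0 x \<and> linked B x p0" if x: "x \<in> M" for x
  proof -
    obtain q where q: "q \<in> F" "x \<in> U q" using x F(3) by blast
    have "C q \<le> B" unfolding B_def using F(1) q(1) by (intro Max_ge) auto
    then show ?thesis using UC(2)[OF _ q(2)] q(1) F(2) linked_mono by blast
  qed
  have "linked (B + B) p q" if "p \<in> M" "q \<in> M" for p q
    using linked_trans B[OF that(1)] B[OF that(2)] by blast
  then show ?thesis by blast
qed

section \<open>Comparison of distance, diameter and systole\<close>

lemma path_in_M: "x \<in> M \<Longrightarrow> y \<in> M \<Longrightarrow> \<exists>f. pth M x y f"
  using uniformly_linked unfolding linked_def piecewise_C1_curve_def pth_def by blast

text \<open>A length at most doubled for every curve passes to the infimum; the link guarantees that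
  there are curves at all, and nonnegative lengths bound the sets below.\<close>

lemma dist_bounds:
  assumes p: "p \<in> M" and q: "q \<in> M" and B: "linked B p q"
  shows "riemannian_dist M \<A> \<sigma> p q \<le> B"
    and "smooth_function \<A> u \<Longrightarrow> (\<And>q. u q \<le> ln 2) \<Longrightarrow>
      riemannian_dist M \<A> (conf u) p q \<le> 2 * riemannian_dist M \<A> \<sigma> p q"
proof -
  let ?L = "\<lambda>g. {curve_length \<A> g \<gamma> | \<gamma>. piecewise_C1_curve M \<A> \<gamma> \<and> pathstart \<gamma> = p \<and> pathfinish \<gamma> = q}"
  have bdd: "bdd_below (?L \<sigma>)" using curve_length_nonneg by (intro bdd_belowI[of _ 0]) auto
  obtain \<gamma> where \<gamma>: "piecewise_C1_curve M \<A> \<gamma>" "pathstart \<gamma> = p" "pathfinish \<gamma> = q" "curve_length \<A> \<sigma> \<gamma> \<le> B"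
    using B unfolding linked_def by blast
  have "riemannian_dist M \<A> \<sigma> p q \<le> curve_length \<A> \<sigma> \<gamma>"
    unfolding riemannian_dist_def by (rule cInf_lower[OF _ bdd]) (use \<gamma> in blast)
  then show "riemannian_dist M \<A> \<sigma> p q \<le> B" using \<gamma>(4) by simp
  assume u: "smooth_function \<A> u" "\<And>q. u q \<le> ln 2"
  interpret c: riemann_surface M \<A> "conf u" by unfold_locales (rule conf_riemannian[OF u(1)])
  have bddc: "bdd_below (?L (conf u))" using c.curve_length_nonneg by (intro bdd_belowI[of _ 0]) auto
  have "riemannian_dist M \<A> (conf u) p q / 2 \<le> riemannian_dist M \<A> \<sigma> p q"
    unfolding riemannian_dist_def[of _ _ \<sigma>]
  proof (rule cInf_greatest)
    show "?L \<sigma> \<noteq> {}" using \<gamma> by blast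
    fix l assume "l \<in> ?L \<sigma>"
    then obtain \<delta> where d: "l = curve_length \<A> \<sigma> \<delta>" "piecewise_C1_curve M \<A> \<delta>" "pathstart \<delta> = p" "pathfinish \<delta> = q" by blast
    have "riemannian_dist M \<A> (conf u) p q \<le> curve_length \<A> (conf u) \<delta>"
      unfolding riemannian_dist_def by (rule cInf_lower[OF _ bddc]) (use d in blast)
    also have "\<dots> \<le> 2 * l" unfolding d(1) by (rule curve_length_conf_le[OF d(2) u])
    finally show "riemannian_dist M \<A> (conf u) p q / 2 \<le> l" by simp
  qed
  then show "riemannian_dist M \<A> (conf u) p q \<le> 2 * riemannian_dist M \<A> \<sigma> p q" by simp
qed

lemma diam_conf_le:
  assumes u: "smooth_function \<A> u" "\<And>q. u q \<le> ln 2"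
  shows "diam M \<A> (conf u) \<le> 2 * diam M \<A> \<sigma>"
proof -
  obtain B where B: "\<And>p q. p \<in> M \<Longrightarrow> q \<in> M \<Longrightarrow> linked B p q" using uniformly_linked by blast
  have bdd: "bdd_above {riemannian_dist M \<A> \<sigma> p q | p q. p \<in> M \<and> q \<in> M}"
    by (rule bdd_aboveI[of _ B]) (use dist_bounds(1)[OF _ _ B] in blast)
  show ?thesis
    unfolding diam_def[of _ _ "conf u"]
  proof (rule cSup_least)
    show "{riemannian_dist M \<A> (conf u) p q | p q. p \<in> M \<and> q \<in> M} \<noteq> {}" using M_ne by blast
    fix d assume "d \<in> {riemannian_dist M \<A> (conf u) p q | p q. p \<in> M \<and> q \<in> M}"
    then obtain p q where pq: "p \<in> M" "q \<in> M" "d = riemannian_dist M \<A> (conf u) p q" by blast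
    have "d \<le> 2 * riemannian_dist M \<A> \<sigma> p q" unfolding pq(3) by (rule dist_bounds(2)[OF pq(1,2) B[OF pq(1,2)] u])
    also have "riemannian_dist M \<A> \<sigma> p q \<le> diam M \<A> \<sigma>"
      unfolding diam_def by (rule cSup_upper[OF _ bdd]) (use pq in blast)
    finally show "d \<le> 2 * diam M \<A> \<sigma>" by simp
  qed
qed

lemma systole_le:
  assumes "closed_geodesic M \<A> \<sigma> \<gamma>" "\<not> contractible_loop M \<gamma>"
  shows "systole M \<A> \<sigma> \<le> curve_length \<A> \<sigma> \<gamma>"
  unfolding systole_def
proof (rule cInf_lower)
  have "0 \<le> curve_length \<A> \<sigma> \<delta>" if "closed_geodesic M \<A> \<sigma> \<delta>" for \<delta>
  proof -
    have g: "continuous_on UNIV \<delta>" "range \<delta> \<subseteq> M"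
      "\<And>c t. c \<in> \<A> \<Longrightarrow> \<delta> t \<in> cdom c \<Longrightarrow> ((coord c \<circ> \<delta>) has_vector_derivative vd (coord c \<circ> \<delta>) t) (at t)"
      using that unfolding closed_geodesic_def geodesic_def Let_def by auto
    have "speed \<A> \<sigma> \<delta> t \<ge> 0" for t
    proof -
      have "\<delta> t \<in> M" using g(2) by blast
      then obtain c where c: "c \<in> \<A>" "\<delta> t \<in> cdom c" using ex_chart by blast
      show ?thesis by (rule speed_nonneg[OF open_UNIV UNIV_I g(1,2) c g(3)[OF c]])
    qed
    \<comment> \<open>A nonintegrable speed has integral 0 by convention, so the lower bound holds
      without an integrability proof along geodesics.\<close>
    then show ?thesis unfolding curve_length_def
      by (cases "speed \<A> \<sigma> \<delta> integrable_on {0..1}") (auto intro!: integral_nonneg simp: not_integrable_integral)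
  qed
  then show "bdd_below {curve_length \<A> \<sigma> \<gamma> |\<gamma>. closed_geodesic M \<A> \<sigma> \<gamma> \<and> \<not> contractible_loop M \<gamma>}"
    by (intro bdd_belowI[of _ 0]) auto
qed (use assms in blast)

end

theorem lemma4p1:
  fixes M :: "'a::t2_space set" and \<A> :: "'a chart set" and n :: nat
    and \<sigma> :: "'a metric_field" and A \<epsilon> :: real
  assumes "smooth_closed_surface M \<A>"
    and "has_genus M \<A> n" and "n \<ge> 2"
    and "hyperbolic_metric \<A> \<sigma>"
    and "total_area M \<A> \<sigma> = A"
    and "\<epsilon> > 0"
  shows "\<exists>g. riemannian_metric \<A> g \<and> total_area M \<A> g = A \<and>
           conformally_equivalent \<A> g \<sigma> \<and>
           systole M \<A> g \<le> \<epsilon> \<and> diam M \<A> g \<le> 2 * diam M \<A> \<sigma>"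
proof -
  interpret riemann_surface M \<A> \<sigma>
    by unfold_locales (use assms(1,4) in \<open>auto simp: hyperbolic_metric_def\<close>)
  have iso: "homology_group 1 (top_of_set M) \<cong> free_Abelian_group {..<2 * n}"
    using assms(2) by (simp add: has_genus_def)
  have "2 * n > 0" using assms(3) by simp
  then obtain p f where f: "pth M p p f" "\<not> homotopic_paths M f (\<lambda>_. p)"
    by (rule free_first_homology_noncontractible[OF iso _ path_in_M M_ne])
  obtain \<gamma> where \<gamma>: "reg \<gamma> UNIV" "\<And>t. \<gamma> (t + 1) = \<gamma> t" "inj_on \<gamma> {0..<1}" "\<not> contractible_loop M \<gamma>"
    by (rule simple_closed_curve[OF f]) (rule that; assumption)
  obtain u K where u: "smooth_function \<A> u" "\<And>p. u p \<le> ln 2" "\<And>t. u (\<gamma> t) = lspeed \<gamma> t - K" "\<And>t. jet \<gamma> u t"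
    "exp (- K) \<le> \<epsilon>" "total_area M \<A> (conf u) = total_area M \<A> \<sigma>"
    by (rule area_preserving_jet[OF \<gamma>(1-3) assms(6)]) (rule that; assumption)
  interpret c: riemann_surface M \<A> "conf u" by unfold_locales (rule conf_riemannian[OF u(1)])
  have "closed_geodesic M \<A> (conf u) \<gamma>"
    unfolding closed_geodesic_def using geodesic_conf[OF \<gamma>(1) u(1,4)] \<gamma>(2) by blast
  then have "systole M \<A> (conf u) \<le> curve_length \<A> (conf u) \<gamma>" by (rule c.systole_le[OF _ \<gamma>(4)])
  also have "\<dots> = exp (- K)"
    by (rule curve_length_conf[OF \<gamma>(1)]) (use u(3) lspeed[OF \<gamma>(1-3)] in simp)
  also have "\<dots> \<le> \<epsilon>" by (rule u(5))
  finally show ?thesis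
    using conf_riemannian[OF u(1)] u(6) assms(5) conf_conformal[OF u(1)] diam_conf_le[OF u(1,2)] by blast
qed

end
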